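(* Let $V$ be a two-sided quaternionic Banach space and let $T$ be the quaternionic infinitesimal generator of a strongly continuous group $(\mathcal{Z}_T(t))_{t\in\mathbb{R}}$ of bounded right linear operators on $V$. Let $f\in\mathbf{V}(T)$ and suppose that $f$ is right slice regular at infinity. Then the operator $f(T)$ defined using the quaternionic Laplace-Stieltjes transform equals the operator $f[T]$ obtained from the $S$-functional calculus, i.e. $f(T)=f[T]$.
   Context: Quaternions: $\mathbb{H}$ denotes the skew field of quaternions with units $e_1,e_2,e_3$; $\mathrm{Re}(s)$, $\overline{s}$, $|s|$ are the real part, conjugate and modulus. $\mathbb{S}=\{I\in\mathbb{H}: \mathrm{Re}(I)=0,\ |I|=1\}$, and for $I\in\mathbb{S}$, $\mathbb{C}_I=\mathbb{R}+I\mathbb{R}$. For $x=x_0+Ix_1$, $[x]=\{x_0+Jx_1: J\in\mathbb{S}\}$. Operators: a two-sided quaternionic Banach space $V$ is a two-sided $\mathbb{H}$-vector space that is complete for a norm with $\|av\|=|a|\|v\|=\|va\|$ ($a\in\mathbb{H}$, $v\in V$). $T$ is right linear if $T(ua+v)=T(u)a+T(v)$. $\mathcal{B}(V)$ is the set of bounded right linear operators on $V$; for $a\in\mathbb{H}$, $(aT)v=a(Tv)$; $\mathcal{I}$ is the identity. Group: a strongly continuous group is a family $(\mathcal{Z}(t))_{t\in\mathbb{R}}\subset\mathcal{B}(V)$ with $\mathcal{Z}(0)=\mathcal{I}$, $\mathcal{Z}(t_1+t_2)=\mathcal{Z}(t_1)\mathcal{Z}(t_2)$ and $t\mapsto\mathcal{Z}(t)v$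 continuous for every $v\in V$. Its infinitesimal generator is $Tv=\lim_{h\to0^+}\frac1h(\mathcal{Z}(h)v-v)$ with domain $\mathcal{D}(T)$ the set of $v$ for which the limit exists; one writes $\mathcal{Z}_T(t)$ for $\mathcal{Z}(t)$. $T$ is closed and densely defined. $S$-spectrum: for a closed densely defined right linear $T$, let $\mathcal{R}_s(T)=T^2-2\mathrm{Re}(s)T+|s|^2\mathcal{I}:\mathcal{D}(T^2)\to V$. $\rho_S(T)$ is the set of $s\in\mathbb{H}$ such that $\mathcal{R}_s(T)$ is injective with dense range and $\mathcal{R}_s(T)^{-1}\in\mathcal{B}(V)$; $\sigma_S(T)=\mathbb{H}\setminus\rho_S(T)$. For $s\in\rho_S(T)$, $S_R^{-1}(s,T)=-(T-\overline{s}\mathcal{I})(T^2-2\mathrm{Re}(s)T+|s|^2\mathcal{I})^{-1}$. Standing constants: fix $M>0$, $\omega\ge0$ with $\|\mathcal{Z}_T(t)\|\le Me^{\omega|t|}$ for all $t\in\mathbb{R}$ and such that $\sigma_S(T)\subset\{s:-\omega<\mathrm{Re}(s)<\omega\}$. Measures: a quaternionic measure on the Borel sets $\mathbf{B}(\mathbb{R})$ is a countably additive $\mu:\mathbf{B}(\mathbb{R})\to\mathbb{H}$; $|\mu|(A)=\sup\sum_i|\mu(A_i)|$ over countable measurable partitions of $A$ is its total variation (a finite positive measure), and $d\mu=h\,d|\mu|$ with $|h|=1$. Write $\int d\mu(t)\,F(t):=\int h(t)F(t)\,d|\mu|(t)$ (Bochner integral). $\mathbf{S}(T)$ is the set of quaternionic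 measures $\mu$ on $\mathbf{B}(\mathbb{R})$ with $\int_{\mathbb{R}}d|\mu|(t)\,e^{(\omega+\varepsilon)|t|}<\infty$ for some $\varepsilon=\varepsilon(\mu)>0$. Its quaternionic bilateral (right) Laplace-Stieltjes transform is $\mathcal{L}(\mu)(s)=\int_{\mathbb{R}}d\mu(t)\,e^{-st}$, $-(\omega+\varepsilon)<\mathrm{Re}(s)<\omega+\varepsilon$. $\mathbf{V}(T)=\{\mathcal{L}(\mu):\mu\in\mathbf{S}(T)\}$. For $f=\mathcal{L}(\mu)\in\mathbf{V}(T)$, $\mu\in\mathbf{S}(T)$, define $f(T)v=\int_{\mathbb{R}}d\mu(t)\,\mathcal{Z}_T(-t)v$, $v\in V$. Slice regularity: a real differentiable $f:U\to\mathbb{H}$, $U\subset\mathbb{H}$ open, is right slice regular if for every $I\in\mathbb{S}$, $\frac12\left(\frac{\partial}{\partial x_0}f_I(x)+\frac{\partial}{\partial x_1}f_I(x)I\right)=0$ for all $x=x_0+Ix_1\in U\cap\mathbb{C}_I$, where $f_I=f|_{U\cap\mathbb{C}_I}$. $f$ is right slice regular at infinity if it is right slice regular on $\{s:|s|>r\}$ for some $r>0$ and $f(\infty):=\lim_{s\to\infty}f(s)$ exists in $\mathbb{H}$. $S$-functional calculus: an axially symmetric slice domain is a domain $U\subset\mathbb{H}$ with $U\cap\mathbb{R}\ne\emptyset$, $U\cap\mathbb{C}_I$ a domain in $\mathbb{C}_I$ for all $I\in\mathbb{S}$, and $[x]\subset U$ for all $x\in U$. For $A\in\mathcal{B}(V)$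 and $h$ right slice regular on an open set containing $\overline{U}$, where $U\supset\sigma_S(A)$ is a (bounded) axially symmetric slice domain such that each $\partial(U\cap\mathbb{C}_I)$ is a finite union of continuously differentiable Jordan curves, set $h[A]=\frac1{2\pi}\int_{\partial(U\cap\mathbb{C}_I)}h(s)\,ds_I\,S_R^{-1}(s,A)$ with $ds_I=-ds\,I$ (independent of $U$ and $I\in\mathbb{S}$). For the unbounded operator $T$, choose $\alpha\in\rho_S(T)\cap\mathbb{R}$, set $A=(T-\alpha\mathcal{I})^{-1}$ and $\Phi_\alpha(s)=(s-\alpha)^{-1}$, $\Phi_\alpha(\alpha)=\infty$, $\Phi_\alpha(\infty)=0$; then $f[T]:=(f\circ\Phi_\alpha^{-1})[A]$, which is independent of $\alpha$. *)

theory Defs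
  imports "HOL-Complex_Analysis.Complex_Analysis"
begin

section \<open>Quaternions\<close>

datatype quat = Quat (qRe: real) (qIm1: real) (qIm2: real) (qIm3: real)

lemma quat_eq_iff:
  "x = y \<longleftrightarrow> qRe x = qRe y \<and> qIm1 x = qIm1 y \<and> qIm2 x = qIm2 y \<and> qIm3 x = qIm3 y"
  by (cases x; cases y) auto

instantiation quat :: ab_group_add
begin

definition zero_quat where "0 = Quat 0 0 0 0"
definition plus_quat where
  "x + y = Quat (qRe x + qRe y) (qIm1 x + qIm1 y) (qIm2 x + qIm2 y) (qIm3 x + qIm3 y)"
definition uminus_quat where "- x = Quat (- qRe x) (- qIm1 x) (- qIm2 x) (- qIm3 x)"
definition minus_quat where
  "x - y = Quat (qRe x - qRe y) (qIm1 x - qIm1 y) (qIm2 x - qIm2 y) (qIm3 x - qIm3 y)"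

instance
  by standard (simp_all add: quat_eq_iff zero_quat_def plus_quat_def uminus_quat_def minus_quat_def)

end

definition qcnj :: "quat \<Rightarrow> quat" where
  "qcnj x = Quat (qRe x) (- qIm1 x) (- qIm2 x) (- qIm3 x)"

instantiation quat :: real_vector
begin

definition scaleR_quat where
  "r *\<^sub>R x = Quat (r * qRe x) (r * qIm1 x) (r * qIm2 x) (r * qIm3 x)"

instance
  by standard (simp_all add: quat_eq_iff plus_quat_def scaleR_quat_def algebra_simps)

end

instantiation quat :: ring_1
begin

definition one_quat where "1 = Quat 1 0 0 0"

definition times_quat where
  "x * y = Quat
     (qRe x * qRe y - qIm1 x * qIm1 y - qIm2 x * qIm2 y - qIm3 x * qIm3 y)
     (qRe x * qIm1 y + qIm1 x * qRe y + qIm2 x * qIm3 y - qIm3 x * qIm2 y)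
     (qRe x * qIm2 y - qIm1 x * qIm3 y + qIm2 x * qRe y + qIm3 x * qIm1 y)
     (qRe x * qIm3 y + qIm1 x * qIm2 y - qIm2 x * qIm1 y + qIm3 x * qRe y)"

instance
  by standard
    (simp_all add: quat_eq_iff zero_quat_def one_quat_def plus_quat_def times_quat_def algebra_simps)

end

instantiation quat :: real_inner
begin

definition inner_quat where
  "inner x y = qRe x * qRe y + qIm1 x * qIm1 y + qIm2 x * qIm2 y + qIm3 x * qIm3 y"
definition norm_quat where "norm (x :: quat) = sqrt (inner x x)"
definition sgn_quat where "sgn x = x /\<^sub>R norm (x :: quat)"
definition dist_quat where "dist x y = norm (x - y :: quat)"
definition uniformity_quat where
  "(uniformity :: (quat \<times> quat) filter) = (INF e\<in>{0<..}. principal {(x, y). dist x y < e})"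
definition open_quat where
  "open (U :: quat set) \<longleftrightarrow> (\<forall>x\<in>U. eventually (\<lambda>(x', y). x' = x \<longrightarrow> y \<in> U) uniformity)"

instance
proof
  fix x y z :: quat and r :: real
  show "inner x y = inner y x"
    by (simp add: inner_quat_def mult.commute)
  show "inner (x + y) z = inner x z + inner y z"
    by (simp add: inner_quat_def plus_quat_def algebra_simps)
  show "inner (r *\<^sub>R x) y = r * inner x y"
    by (simp add: inner_quat_def scaleR_quat_def algebra_simps)
  show "0 \<le> inner x x"
    by (simp add: inner_quat_def)
  show "inner x x = 0 \<longleftrightarrow> x = 0"
    by (simp add: inner_quat_def quat_eq_iff zero_quat_def add_nonneg_eq_0_iff)
qed (simp_all add: norm_quat_def sgn_quat_def dist_quat_def uniformity_quat_def open_quat_def)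

end

instantiation quat :: division_ring
begin

definition inverse_quat where "inverse x = qcnj x /\<^sub>R (norm x)\<^sup>2"
definition divide_quat where "x div (y :: quat) = x * inverse y"

instance
proof
  fix x :: quat
  have sq: "(norm x)\<^sup>2 = qRe x * qRe x + qIm1 x * qIm1 x + qIm2 x * qIm2 x + qIm3 x * qIm3 x"
    using power2_norm_eq_inner[of x] by (simp add: inner_quat_def)
  have l: "qcnj x * x = (norm x)\<^sup>2 *\<^sub>R 1" and r: "x * qcnj x = (norm x)\<^sup>2 *\<^sub>R 1"
    by (simp_all add: sq quat_eq_iff qcnj_def times_quat_def one_quat_def scaleR_quat_def
        algebra_simps)
  have sl: "(a *\<^sub>R x) * y = a *\<^sub>R (x * y)" "x * (a *\<^sub>R y) = a *\<^sub>R (x * y)" for a and x y :: quat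
    by (simp_all add: quat_eq_iff times_quat_def scaleR_quat_def algebra_simps)
  show "inverse x * x = 1" and "x * inverse x = 1" if "x \<noteq> 0"
    using that l r by (simp_all add: inverse_quat_def sl)
  show "inverse 0 = (0 :: quat)"
    by (simp add: inverse_quat_def)
  show "x div y = x * inverse y" for y
    by (simp add: divide_quat_def)
qed

end

instance quat :: real_normed_div_algebra
proof
  fix x y :: quat and r :: real
  show "r *\<^sub>R x * y = r *\<^sub>R (x * y)" "x * r *\<^sub>R y = r *\<^sub>R (x * y)"
    by (simp_all add: quat_eq_iff times_quat_def scaleR_quat_def algebra_simps)
  have "inner (x * y) (x * y) = inner x x * inner y y"
    unfolding inner_quat_def times_quat_def quat.sel by algebra
  then show "norm (x * y) = norm x * norm y"
    by (simp add: norm_quat_def real_sqrt_mult)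
qed

instantiation quat :: euclidean_space
begin

definition Basis_quat where "Basis = {Quat 1 0 0 0, Quat 0 1 0 0, Quat 0 0 1 0, Quat 0 0 0 1}"

instance
proof
  fix u v x :: quat
  show "Basis \<noteq> ({} :: quat set)" and "finite (Basis :: quat set)"
    by (simp_all add: Basis_quat_def)
  show "inner u v = (if u = v then 1 else 0)" if "u \<in> Basis" "v \<in> Basis"
    using that unfolding Basis_quat_def by (elim insertE emptyE) (simp_all add: inner_quat_def)
  show "(\<forall>u\<in>Basis. inner x u = 0) \<longleftrightarrow> x = 0"
    unfolding Basis_quat_def by (simp add: inner_quat_def zero_quat_def) (cases x; auto)
qed

end

definition imag_sphere :: "quat set" where
  "imag_sphere = {I. qRe I = 0 \<and> norm I = 1}"

text \<open>The map \<open>x\<^sub>0 + \<i> x\<^sub>1 \<mapsto> x\<^sub>0 + I x\<^sub>1\<close> identifies the complex plane with \<open>\<complex>\<^sub>I\<close>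
  (isometrically, and compatibly with the orientation that \<open>I\<close> gives to \<open>\<complex>\<^sub>I\<close>).
  Subsets of \<open>\<complex>\<^sub>I\<close> and curves in \<open>\<complex>\<^sub>I\<close> are handled through it.\<close>

definition in_slice :: "quat \<Rightarrow> complex \<Rightarrow> quat" where
  "in_slice I z = of_real (Re z) + I * of_real (Im z)"

definition slice :: "quat \<Rightarrow> quat set \<Rightarrow> complex set" where
  "slice I U = {z. in_slice I z \<in> U}"

section \<open>Slice regular functions\<close>

definition right_slice_regular_on :: "(quat \<Rightarrow> quat) \<Rightarrow> quat set \<Rightarrow> bool" where
  "right_slice_regular_on f U \<longleftrightarrow> open U \<and> (\<forall>x\<in>U. f differentiable (at x)) \<and>
     (\<forall>I\<in>imag_sphere. \<forall>x0 x1 :: real. of_real x0 + I * of_real x1 \<in> U \<longrightarrow>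
        (1/2) *\<^sub>R (vector_derivative (\<lambda>t. f (of_real t + I * of_real x1)) (at x0)
               + vector_derivative (\<lambda>t. f (of_real x0 + I * of_real t)) (at x1) * I) = 0)"

definition right_slice_regular_at_infinity :: "(quat \<Rightarrow> quat) \<Rightarrow> bool" where
  "right_slice_regular_at_infinity f \<longleftrightarrow>
     (\<exists>r>0. right_slice_regular_on f {s. norm s > r}) \<and> (\<exists>l. (f \<longlongrightarrow> l) at_infinity)"

section \<open>Two-sided quaternionic Banach spaces and operators\<close>

text \<open>The real scalar multiplication of the class \<^class>\<open>banach\<close> is the common restriction of the two
  quaternionic ones to the reals.\<close>

class quaternionic_banach = banach +
  fixes lscale :: "quat \<Rightarrow> 'a \<Rightarrow> 'a"  (infixr "*\<^sub>l" 75)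
    and rscale :: "'a \<Rightarrow> quat \<Rightarrow> 'a"  (infixl "*\<^sub>r" 75)
  assumes lscale_add_left: "(a + b) *\<^sub>l v = a *\<^sub>l v + b *\<^sub>l v"
    and lscale_add_right: "a *\<^sub>l (v + w) = a *\<^sub>l v + a *\<^sub>l w"
    and lscale_mult: "(a * b) *\<^sub>l v = a *\<^sub>l (b *\<^sub>l v)"
    and rscale_add_left: "(v + w) *\<^sub>r a = v *\<^sub>r a + w *\<^sub>r a"
    and rscale_add_right: "v *\<^sub>r (a + b) = v *\<^sub>r a + v *\<^sub>r b"
    and rscale_mult: "v *\<^sub>r (a * b) = (v *\<^sub>r a) *\<^sub>r b"
    and lscale_rscale: "a *\<^sub>l (v *\<^sub>r b) = (a *\<^sub>l v) *\<^sub>r b"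
    and lscale_of_real: "of_real r *\<^sub>l v = r *\<^sub>R v"
    and rscale_of_real: "v *\<^sub>r of_real r = r *\<^sub>R v"
    and norm_lscale: "norm (a *\<^sub>l v) = norm a * norm v"
    and norm_rscale: "norm (v *\<^sub>r a) = norm v * norm a"

instantiation quat :: quaternionic_banach
begin

definition lscale_quat where "(a :: quat) *\<^sub>l (v :: quat) = a * v"
definition rscale_quat where "(v :: quat) *\<^sub>r (a :: quat) = v * a"

instance
  by standard
    (simp_all add: lscale_quat_def rscale_quat_def distrib_left distrib_right mult.assoc norm_mult
      of_real_def)

end

text \<open>Bounded right linear operators, as a subset of the bounded real linear ones with their
  operator norm.\<close>

definition right_linear_ops :: "('v::quaternionic_banach \<Rightarrow>\<^sub>L 'v) set" where
  "right_linear_ops = {B :: 'v \<Rightarrow>\<^sub>L 'v. \<forall>v a. B (v *\<^sub>r a) = B v *\<^sub>r a}"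

definition op_lscale :: "quat \<Rightarrow> ('v::quaternionic_banach \<Rightarrow>\<^sub>L 'v) \<Rightarrow> ('v \<Rightarrow>\<^sub>L 'v)" where
  "op_lscale a B = Blinfun (\<lambda>v. a *\<^sub>l B v)"

text \<open>An unbounded operator is given by its domain \<open>D\<close> and a function \<open>T\<close> whose values outside
  \<open>D\<close> are irrelevant; a bounded operator has domain \<^term>\<open>UNIV\<close>.\<close>

definition is_bounded_inverse ::
    "'v::quaternionic_banach set \<Rightarrow> ('v \<Rightarrow> 'v) \<Rightarrow> ('v \<Rightarrow>\<^sub>L 'v) \<Rightarrow> bool" where
  "is_bounded_inverse D R B \<longleftrightarrow> B \<in> right_linear_ops \<and>
     (\<forall>v\<in>D. B (R v) = v) \<and> (\<forall>w. B w \<in> D \<and> R (B w) = w)"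

definition bounded_inverse ::
    "'v::quaternionic_banach set \<Rightarrow> ('v \<Rightarrow> 'v) \<Rightarrow> ('v \<Rightarrow>\<^sub>L 'v)" where
  "bounded_inverse D R = (THE B. is_bounded_inverse D R B)"

subsection \<open>The S-spectrum and the right S-resolvent operator\<close>

definition dom_sq :: "'v set \<Rightarrow> ('v \<Rightarrow> 'v) \<Rightarrow> 'v set" where
  "dom_sq D T = {v \<in> D. T v \<in> D}"

definition R_op :: "quat \<Rightarrow> ('v::quaternionic_banach \<Rightarrow> 'v) \<Rightarrow> 'v \<Rightarrow> 'v" where
  "R_op s T v = T (T v) - (2 * qRe s) *\<^sub>R T v + (norm s)\<^sup>2 *\<^sub>R v"

definition S_resolvent_set :: "'v::quaternionic_banach set \<Rightarrow> ('v \<Rightarrow> 'v) \<Rightarrow> quat set" where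
  "S_resolvent_set D T = {s.
     inj_on (R_op s T) (dom_sq D T) \<and>
     closure (R_op s T ` dom_sq D T) = UNIV \<and>
     (\<exists>B. is_bounded_inverse (dom_sq D T) (R_op s T) B)}"

definition S_spectrum :: "'v::quaternionic_banach set \<Rightarrow> ('v \<Rightarrow> 'v) \<Rightarrow> quat set" where
  "S_spectrum D T = - S_resolvent_set D T"

definition right_S_resolvent ::
    "quat \<Rightarrow> 'v::quaternionic_banach set \<Rightarrow> ('v \<Rightarrow> 'v) \<Rightarrow> ('v \<Rightarrow>\<^sub>L 'v)" where
  "right_S_resolvent s D T = Blinfun (\<lambda>v.
     let w = bounded_inverse (dom_sq D T) (R_op s T) v in - (T w - qcnj s *\<^sub>l w))"

subsection \<open>The S-functional calculus\<close>

text \<open>The boundary of \<open>G\<close> is a finite union of continuously differentiable Jordan curves.  The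
  winding number conditions say that the curves carry the positive orientation relative to \<open>G\<close>.\<close>

definition is_oriented_boundary :: "(real \<Rightarrow> complex) list \<Rightarrow> complex set \<Rightarrow> bool" where
  "is_oriented_boundary \<gamma>s G \<longleftrightarrow>
     (\<forall>\<gamma>\<in>set \<gamma>s. \<gamma> C1_differentiable_on {0..1} \<and> simple_path \<gamma> \<and> pathfinish \<gamma> = pathstart \<gamma>) \<and>
     (\<Union>\<gamma>\<in>set \<gamma>s. path_image \<gamma>) = frontier G \<and>
     (\<forall>z\<in>G. (\<Sum>\<gamma>\<leftarrow>\<gamma>s. winding_number \<gamma> z) = 1) \<and>
     (\<forall>z. z \<notin> closure G \<longrightarrow> (\<Sum>\<gamma>\<leftarrow>\<gamma>s. winding_number \<gamma> z) = 0)"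

definition axially_symmetric_slice_domain :: "quat set \<Rightarrow> bool" where
  "axially_symmetric_slice_domain U \<longleftrightarrow>
     open U \<and> connected U \<and> U \<noteq> {} \<and>
     (\<exists>x::real. of_real x \<in> U) \<and>
     (\<forall>I\<in>imag_sphere. open (slice I U) \<and> connected (slice I U) \<and> slice I U \<noteq> {}) \<and>
     (\<forall>I\<in>imag_sphere. \<forall>x0 x1 :: real. of_real x0 + I * of_real x1 \<in> U \<longrightarrow>
        (\<forall>J\<in>imag_sphere. of_real x0 + J * of_real x1 \<in> U))"

definition S_calculus_domain ::
    "(quat \<Rightarrow> quat) \<Rightarrow> ('v::quaternionic_banach \<Rightarrow>\<^sub>L 'v) \<Rightarrow> quat set \<Rightarrow> bool" where
  "S_calculus_domain h A U \<longleftrightarrow>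
     axially_symmetric_slice_domain U \<and> bounded U \<and> S_spectrum UNIV (blinfun_apply A) \<subseteq> U \<and>
     (\<forall>I\<in>imag_sphere. \<exists>\<gamma>s. is_oriented_boundary \<gamma>s (slice I U)) \<and>
     (\<exists>W. closure U \<subseteq> W \<and> right_slice_regular_on h W)"

text \<open>Here \<open>s = p t\<close> runs through the curve in \<open>\<complex>\<^sub>I\<close> and \<open>ds\<^sub>I = - ds I\<close> with \<open>ds = p' t dt\<close>.\<close>

definition S_cauchy_integral ::
    "(quat \<Rightarrow> quat) \<Rightarrow> ('v::quaternionic_banach \<Rightarrow>\<^sub>L 'v) \<Rightarrow> quat \<Rightarrow> (real \<Rightarrow> complex) list \<Rightarrow> ('v \<Rightarrow>\<^sub>L 'v)"
  where
  "S_cauchy_integral h A I \<gamma>s =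
     (1 / (2 * pi)) *\<^sub>R (\<Sum>\<gamma>\<leftarrow>\<gamma>s. let p = in_slice I \<circ> \<gamma> in
        integral {0..1} (\<lambda>t.
          op_lscale (h (p t) * (- vector_derivative p (at t within {0..1}) * I))
            (right_S_resolvent (p t) UNIV (blinfun_apply A))))"

text \<open>The value is independent of the choice of \<open>U\<close>, \<open>I\<close> and of the parametrization.\<close>

definition S_calculus ::
    "(quat \<Rightarrow> quat) \<Rightarrow> ('v::quaternionic_banach \<Rightarrow>\<^sub>L 'v) \<Rightarrow> ('v \<Rightarrow>\<^sub>L 'v)" where
  "S_calculus h A =
     (let (U, I, \<gamma>s) = (SOME (U, I, \<gamma>s). S_calculus_domain h A U \<and> I \<in> imag_sphere \<and>
                                          is_oriented_boundary \<gamma>s (slice I U))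
      in S_cauchy_integral h A I \<gamma>s)"

text \<open>For an unbounded operator \<open>(D, T)\<close> and a real \<open>\<alpha>\<close> in its S-resolvent set.  As
  \<open>\<Phi>\<^sub>\<alpha>(s) = (s - \<alpha>)\<^sup>-\<^sup>1\<close>, the composition of \<open>f\<close> with the inverse of \<open>\<Phi>\<^sub>\<alpha>\<close> is \<open>f(s\<^sup>-\<^sup>1 + \<alpha>)\<close>
  for \<open>s \<noteq> 0\<close> and \<open>f(\<infinity>)\<close> for \<open>s = 0\<close>.\<close>

definition S_calculus_unbounded ::
    "real \<Rightarrow> (quat \<Rightarrow> quat) \<Rightarrow> 'v::quaternionic_banach set \<Rightarrow> ('v \<Rightarrow> 'v) \<Rightarrow> ('v \<Rightarrow>\<^sub>L 'v)" where
  "S_calculus_unbounded \<alpha> f D T =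
     S_calculus (\<lambda>s. if s = 0 then Lim at_infinity f else f (inverse s + of_real \<alpha>))
       (bounded_inverse D (\<lambda>v. T v - \<alpha> *\<^sub>R v))"

subsection \<open>Strongly continuous groups\<close>

definition strongly_continuous_group :: "(real \<Rightarrow> 'v::quaternionic_banach \<Rightarrow>\<^sub>L 'v) \<Rightarrow> bool" where
  "strongly_continuous_group Z \<longleftrightarrow>
     (\<forall>t. Z t \<in> right_linear_ops) \<and> Z 0 = id_blinfun \<and>
     (\<forall>t1 t2. Z (t1 + t2) = Z t1 o\<^sub>L Z t2) \<and>
     (\<forall>v. continuous_on UNIV (\<lambda>t. Z t v))"

definition generator_domain :: "(real \<Rightarrow> 'v::quaternionic_banach \<Rightarrow>\<^sub>L 'v) \<Rightarrow> 'v set" where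
  "generator_domain Z = {v. \<exists>l. ((\<lambda>h. (1 / h) *\<^sub>R (Z h v - v)) \<longlongrightarrow> l) (at_right 0)}"

definition generator :: "(real \<Rightarrow> 'v::quaternionic_banach \<Rightarrow>\<^sub>L 'v) \<Rightarrow> 'v \<Rightarrow> 'v" where
  "generator Z v = Lim (at_right 0) (\<lambda>h. (1 / h) *\<^sub>R (Z h v - v))"

section \<open>Quaternionic measures and the Laplace-Stieltjes transform\<close>

definition quaternionic_measure :: "(real set \<Rightarrow> quat) \<Rightarrow> bool" where
  "quaternionic_measure \<mu> \<longleftrightarrow>
     (\<forall>A :: nat \<Rightarrow> real set. range A \<subseteq> sets borel \<longrightarrow> disjoint_family A \<longrightarrow>
        (\<lambda>i. \<mu> (A i)) sums \<mu> (\<Union>i. A i))"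

definition total_variation :: "(real set \<Rightarrow> quat) \<Rightarrow> real measure" where
  "total_variation \<mu> = measure_of UNIV (sets borel) (\<lambda>B.
     SUP A \<in> {A :: nat \<Rightarrow> real set. range A \<subseteq> sets borel \<and> disjoint_family A \<and> (\<Union>i. A i) = B}.
       (\<Sum>i. ennreal (norm (\<mu> (A i)))))"

text \<open>A function \<open>h\<close> with \<open>|h| = 1\<close> and \<open>d\<mu> = h d|\<mu>|\<close>; it is unique up to \<open>|\<mu>|\<close>-null sets.\<close>

definition polar_density :: "(real set \<Rightarrow> quat) \<Rightarrow> real \<Rightarrow> quat" where
  "polar_density \<mu> = (SOME h. h \<in> borel_measurable borel \<and> (\<forall>t. norm (h t) = 1) \<and>
     (\<forall>A\<in>sets borel. \<mu> A = (LINT t:A|total_variation \<mu>. h t)))"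

text \<open>The library defines the Bochner integral for second countable target spaces only; this is the
  same definition for arbitrary Banach spaces.\<close>

definition has_bochner_int :: "'a measure \<Rightarrow> ('a \<Rightarrow> 'b::banach) \<Rightarrow> 'b \<Rightarrow> bool" where
  "has_bochner_int M F x \<longleftrightarrow> F \<in> borel_measurable M \<and>
     (\<exists>\<sigma>. (\<forall>i. Bochner_Integration.simple_bochner_integrable M (\<sigma> i)) \<and>
          (\<lambda>i. \<integral>\<^sup>+ y. ennreal (norm (F y - \<sigma> i y)) \<partial>M) \<longlonglongrightarrow> 0 \<and>
          (\<lambda>i. Bochner_Integration.simple_bochner_integral M (\<sigma> i)) \<longlonglongrightarrow> x)"

definition quat_integral :: "(real set \<Rightarrow> quat) \<Rightarrow> (real \<Rightarrow> 'v::quaternionic_banach) \<Rightarrow> 'v" where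
  "quat_integral \<mu> F = (THE x. has_bochner_int (total_variation \<mu>) (\<lambda>t. polar_density \<mu> t *\<^sub>l F t) x)"

definition exp_integrable :: "real \<Rightarrow> (real set \<Rightarrow> quat) \<Rightarrow> bool" where
  "exp_integrable c \<mu> \<longleftrightarrow> (\<integral>\<^sup>+ t. ennreal (exp (c * \<bar>t\<bar>)) \<partial>total_variation \<mu>) < \<infinity>"

text \<open>The class \<open>S(T)\<close>, which depends on \<open>T\<close> through \<open>\<omega>\<close> only.\<close>

definition S_measures :: "real \<Rightarrow> (real set \<Rightarrow> quat) set" where
  "S_measures \<omega> = {\<mu>. quaternionic_measure \<mu> \<and> (\<exists>\<epsilon>>0. exp_integrable (\<omega> + \<epsilon>) \<mu>)}"

definition laplace_stieltjes :: "(real set \<Rightarrow> quat) \<Rightarrow> quat \<Rightarrow> quat" where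
  "laplace_stieltjes \<mu> s = quat_integral \<mu> (\<lambda>t. exp (- s * of_real t))"

text \<open>\<open>f = L(\<mu>)\<close> means equality on a strip on which \<open>L(\<mu>)\<close> is defined.  The function \<open>f\<close> may be
  defined on a larger set, as is needed for speaking of its behaviour at infinity.\<close>

definition is_laplace_stieltjes :: "real \<Rightarrow> (real set \<Rightarrow> quat) \<Rightarrow> (quat \<Rightarrow> quat) \<Rightarrow> bool" where
  "is_laplace_stieltjes \<omega> \<mu> f \<longleftrightarrow>
     (\<exists>\<epsilon>>0. exp_integrable (\<omega> + \<epsilon>) \<mu> \<and>
        (\<forall>s. \<bar>qRe s\<bar> < \<omega> + \<epsilon> \<longrightarrow> f s = laplace_stieltjes \<mu> s))"

definition group_calculus ::
    "(real set \<Rightarrow> quat) \<Rightarrow> (real \<Rightarrow> 'v::quaternionic_banach \<Rightarrow>\<^sub>L 'v) \<Rightarrow> 'v \<Rightarrow> 'v" where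
  "group_calculus \<mu> Z v = quat_integral \<mu> (\<lambda>t. Z (- t) v)"

end

theory Submission imports Defs begin

text \<open>Fix a slice \<open>\<complex>\<^sub>I\<close> and a unit \<open>J\<close> anticommuting with \<open>I\<close>. By the Hahn-Banach theorem it suffices to
  compare real functionals \<open>\<phi>\<close> of both sides, and splitting \<open>h = F\<^sub>1 + J F\<^sub>2\<close> with \<open>F\<^sub>1, F\<^sub>2\<close> holomorphic
  on \<open>\<complex>\<^sub>I\<close> turns the \<open>S\<close>-functional calculus into scalar contour integrals \<open>\<integral> F r\<close>, where \<open>r\<close> is
  the complexified \<open>\<phi>\<close> applied to the \<open>S\<close>-resolvent of \<open>A = (T - \<alpha>)\<^sup>-\<^sup>1\<close>. Cauchy's theorem for cycles
  replaces the given contours by three circles with real centres. Their images under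
  \<open>\<zeta> \<mapsto> \<zeta>\<^sup>-\<^sup>1 + \<alpha>\<close> lie in \<open>\<bar>Re z\<bar> > \<omega>\<close>, where \<open>r\<close> is a Laplace transform of \<open>H t = l (Z t v)\<close>, except
  that for \<open>\<bar>\<alpha>\<bar> \<le> \<omega>\<close> one of them is a small circle around \<open>\<alpha>\<close> and contributes \<open>2 \<pi> \<i> f(\<alpha>) H(0)\<close>.
  The sum of the three integrals is a functional of \<open>H\<close> alone, and it is continuous under limits
  dominated by \<open>e\<^bsup>\<omega>|t|\<^esup>\<close>. For \<open>H t = e\<^bsup>iyt\<^esup>\<close> Cauchy's integral formula gives \<open>2 \<pi> \<i> f(iy)\<close>, that is
  \<open>2 \<pi> \<i> \<integral> d\<mu>(t) H(-t)\<close>. As trigonometric polynomials are dense in this sense, the same holds for every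
  continuous \<open>H\<close> of growth \<open>e\<^bsup>\<omega>|t|\<^esup>\<close>.\<close>

section \<open>Quaternionic measures\<close>

text \<open>The curves of the calculus run partly through the region where \<open>f\<close> is known
  only from its regularity at infinity and not from \<open>\<mu>\<close>. The integral formula for
  \<open>f\<close> can therefore not be inserted under the contour integral and interchanged with
  it. Instead both sides are treated as functionals of the orbit and compared on exponentials, where
  Cauchy's formula asks only for values of \<open>f\<close> on the imaginary axis, and these lie in
  the strip. The definitions add obstacles of their own. \<open>S_calculus\<close> takes its contour
  by \<open>SOME\<close>, so one contour must be exhibited and any other compared with it.
  \<open>polar_density\<close> and \<open>quat_integral\<close> are selected by \<open>SOME\<close>
  and \<open>THE\<close>, so the polar decomposition and the existence of the integral have to be
  proved, for a target that may be non-separable. The resolvent set bounds only the inverse of the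
  quadratic operator, not its product with \<open>T\<close>. Finally, regularity includes real
  differentiability in all four directions, so at the point that corresponds to infinity a slicewise
  argument has to be upgraded to a full derivative.\<close>

definition variation :: "(real set \<Rightarrow> quat) \<Rightarrow> real set \<Rightarrow> ennreal" where
  "variation \<mu> B = (SUP A \<in> {A :: nat \<Rightarrow> real set. range A \<subseteq> sets borel \<and> disjoint_family A \<and> (\<Union>i. A i) = B}.
     (\<Sum>i. ennreal (norm (\<mu> (A i)))))"

lemma variation_upper:
  assumes "range A \<subseteq> sets borel" "disjoint_family A" "(\<Union>i. A i) = B"
  shows "(\<Sum>i. ennreal (norm (\<mu> (A i)))) \<le> variation \<mu> B"
  unfolding variation_def using assms by (intro SUP_upper) auto

lemma variation_least:
  assumes "\<And>A. range A \<subseteq> sets borel \<Longrightarrow> disjoint_family A \<Longrightarrow> (\<Union>i. A i) = B \<Longrightarrow>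
    (\<Sum>i. ennreal (norm (\<mu> (A i)))) \<le> c"
  shows "variation \<mu> B \<le> c"
  unfolding variation_def using assms by (intro SUP_least) auto

lemma quaternionic_measure_sums:
  assumes "quaternionic_measure \<mu>" "range A \<subseteq> sets borel" "disjoint_family A"
  shows "(\<lambda>i. \<mu> (A i)) sums \<mu> (\<Union>i. A i)"
  using assms by (auto simp: quaternionic_measure_def)

lemma quaternionic_measure_empty:
  assumes "quaternionic_measure \<mu>"
  shows "\<mu> {} = 0"
proof -
  have "(\<lambda>i::nat. \<mu> {}) sums \<mu> {}"
    using quaternionic_measure_sums[OF assms, of "\<lambda>_. {}"] by (auto simp: disjoint_family_on_def)
  then show ?thesis using sums_summable summable_const_iff by blast
qed

lemma norm_le_variation:
  assumes \<mu>: "quaternionic_measure \<mu>" and B: "B \<in> sets borel"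
  shows "ennreal (norm (\<mu> B)) \<le> variation \<mu> B"
proof -
  let ?A = "\<lambda>i::nat. if i = 0 then B else {}"
  have "(\<Sum>i. ennreal (norm (\<mu> (?A i)))) = (\<Sum>i\<in>{0::nat}. ennreal (norm (\<mu> (?A i))))"
    by (rule suminf_finite) (auto simp: quaternionic_measure_empty[OF \<mu>])
  moreover have "(\<Sum>i. ennreal (norm (\<mu> (?A i)))) \<le> variation \<mu> B"
    by (rule variation_upper) (use B in \<open>auto simp: disjoint_family_on_def split: if_splits\<close>)
  ultimately show ?thesis by simp
qed

lemma variation_empty: "quaternionic_measure \<mu> \<Longrightarrow> variation \<mu> {} = 0"
  by (rule antisym, rule variation_least) (auto simp: quaternionic_measure_empty)

text \<open>A partition of the smaller set becomes one of the larger set by prepending the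
  difference, which only adds a term.\<close>

lemma variation_mono:
  assumes \<mu>: "quaternionic_measure \<mu>" and B: "B \<subseteq> C" "B \<in> sets borel" "C \<in> sets borel"
  shows "variation \<mu> B \<le> variation \<mu> C"
proof (rule variation_least)
  fix A :: "nat \<Rightarrow> real set"
  assume A: "range A \<subseteq> sets borel" "disjoint_family A" "(\<Union>i. A i) = B"
  define A' where "A' n = (case n of 0 \<Rightarrow> C - B | Suc i \<Rightarrow> A i)" for n
  have "(\<Sum>i. ennreal (norm (\<mu> (A i)))) \<le> (\<Sum>i. ennreal (norm (\<mu> (A' i))))"
  proof (rule suminf_le_const)
    fix n
    have "(\<Sum>i<n. ennreal (norm (\<mu> (A i)))) \<le> (\<Sum>i<Suc n. ennreal (norm (\<mu> (A' i))))"
      by (simp add: A'_def sum.lessThan_Suc_shift del: sum.lessThan_Suc)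
    also have "\<dots> \<le> (\<Sum>i. ennreal (norm (\<mu> (A' i))))" by (rule sum_le_suminf) auto
    finally show "(\<Sum>i<n. ennreal (norm (\<mu> (A i)))) \<le> (\<Sum>i. ennreal (norm (\<mu> (A' i))))" .
  qed simp
  also have "\<dots> \<le> variation \<mu> C"
  proof (rule variation_upper)
    show "range A' \<subseteq> sets borel" using A B by (auto simp: A'_def split: nat.splits)
    show "disjoint_family A'" using A(2,3)
      by (auto simp: disjoint_family_on_def A'_def split: nat.splits)
    have "(\<Union>i. A' i) = (C - B) \<union> (\<Union>i. A i)"
      unfolding A'_def by (auto split: nat.splits)
    then show "(\<Union>i. A' i) = C" using A(3) B(1) by auto
  qed
  finally show "(\<Sum>i. ennreal (norm (\<mu> (A i)))) \<le> variation \<mu> C" .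
qed

lemma suminf_ennreal_swap:
  fixes f :: "nat \<Rightarrow> nat \<Rightarrow> ennreal"
  shows "(\<Sum>i. \<Sum>j. f i j) = (\<Sum>j. \<Sum>i. f i j)"
proof -
  have "(\<Sum>i. \<Sum>j. f i j) = (\<integral>\<^sup>+ i. (\<Sum>j. f i j) \<partial>count_space UNIV)" by (simp only: nn_integral_count_space_nat)
  also have "\<dots> = (\<Sum>j. \<integral>\<^sup>+ i. f i j \<partial>count_space UNIV)" by (rule nn_integral_suminf) auto
  finally show ?thesis by (simp only: nn_integral_count_space_nat)
qed

text \<open>One inequality cuts a partition of the union along the \<open>B j\<close> and exchanges
  the two sums. The other merges nearly optimal partitions of the \<open>B j\<close> into one
  partition of the union; \<open>ennreal_le_epsilon\<close> reduces it to a finite total, and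
  finiteness is what makes nearly optimal partitions exist.\<close>

lemma variation_countably_additive:
  assumes \<mu>: "quaternionic_measure \<mu>"
  shows "countably_additive (sets borel) (variation \<mu>)"
  unfolding countably_additive_def
proof (intro allI impI)
  fix B :: "nat \<Rightarrow> real set"
  assume B: "range B \<subseteq> sets borel" "disjoint_family B" "(\<Union>i. B i) \<in> sets borel"
  have Bs: "B j \<in> sets borel" for j using B(1) by auto
  show "(\<Sum>i. variation \<mu> (B i)) = variation \<mu> (\<Union>i. B i)"
  proof (rule antisym)
    show "variation \<mu> (\<Union>i. B i) \<le> (\<Sum>i. variation \<mu> (B i))"
    proof (rule variation_least)
      fix A :: "nat \<Rightarrow> real set"
      assume A: "range A \<subseteq> sets borel" "disjoint_family A" "(\<Union>i. A i) = (\<Union>i. B i)"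
      have As: "A j \<in> sets borel" for j using A(1) by auto
      have "ennreal (norm (\<mu> (A i))) \<le> (\<Sum>j. ennreal (norm (\<mu> (A i \<inter> B j))))" for i
      proof -
        have "(\<lambda>j. \<mu> (A i \<inter> B j)) sums \<mu> (\<Union>j. A i \<inter> B j)"
          using As Bs B(2) unfolding disjoint_family_on_def
          by (intro quaternionic_measure_sums[OF \<mu>]) (auto simp: disjoint_family_on_def, blast)
        moreover have "(\<Union>j. A i \<inter> B j) = A i" using A(3) by auto
        ultimately have s: "(\<lambda>j. \<mu> (A i \<inter> B j)) sums \<mu> (A i)" by simp
        show ?thesis
        proof (cases "(\<Sum>j. ennreal (norm (\<mu> (A i \<inter> B j)))) = top")
          case False
          then have sm: "summable (\<lambda>j. norm (\<mu> (A i \<inter> B j)))"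
            by (intro summable_suminf_not_top) auto
          have "norm (\<mu> (A i)) \<le> (\<Sum>j. norm (\<mu> (A i \<inter> B j)))"
            using summable_norm[OF sm] s by (simp add: sums_iff)
          then show ?thesis using sm by (simp add: suminf_ennreal2 ennreal_leI)
        qed simp
      qed
      then have "(\<Sum>i. ennreal (norm (\<mu> (A i)))) \<le> (\<Sum>i. \<Sum>j. ennreal (norm (\<mu> (A i \<inter> B j))))"
        by (intro suminf_le) auto
      also have "\<dots> = (\<Sum>j. \<Sum>i. ennreal (norm (\<mu> (A i \<inter> B j))))" by (rule suminf_ennreal_swap)
      also have "\<dots> \<le> (\<Sum>j. variation \<mu> (B j))"
      proof (intro suminf_le variation_upper)
        show "(\<Union>i. A i \<inter> B j) = B j" for j using A(3) by auto
        show "disjoint_family (\<lambda>i. A i \<inter> B j)" for j using A(2) unfolding disjoint_family_on_def by blast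
      qed (use As Bs in auto)
      finally show "(\<Sum>i. ennreal (norm (\<mu> (A i)))) \<le> (\<Sum>j. variation \<mu> (B j))" .
    qed
    show "(\<Sum>i. variation \<mu> (B i)) \<le> variation \<mu> (\<Union>i. B i)" (is "_ \<le> ?V")
    proof (rule ennreal_le_epsilon)
      fix e :: real assume top: "?V < top" and e: "e > 0"
      \<comment> \<open>The errors e / 2^(j+1) are chosen so that they add up to e.\<close>
      have "\<exists>A. range A \<subseteq> sets borel \<and> disjoint_family A \<and> (\<Union>i. A i) = B j \<and>
          variation \<mu> (B j) \<le> (\<Sum>i. ennreal (norm (\<mu> (A i)))) + ennreal (e * (1/2) ^ Suc j)" for j
      proof -
        have "variation \<mu> (B j) \<le> ?V" using Bs B(3) by (intro variation_mono[OF \<mu>]) auto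
        then have nt: "variation \<mu> (B j) \<noteq> \<infinity>" using top by auto
        have ne: "{A :: nat \<Rightarrow> real set. range A \<subseteq> sets borel \<and> disjoint_family A \<and> (\<Union>i. A i) = B j} \<noteq> {}"
          using Bs[of j]
          by (auto intro!: exI[of _ "\<lambda>i::nat. if i = 0 then B j else {}"] simp: disjoint_family_on_def split: if_splits)
        have "0 < e * (1/2) ^ Suc j" using e by simp
        from SUP_approx_ennreal[OF this ne variation_def nt] show ?thesis by (auto intro: less_imp_le)
      qed
      then obtain A where A: "\<And>j. range (A j) \<subseteq> sets borel" "\<And>j. disjoint_family (A j)" "\<And>j. (\<Union>i. A j i) = B j"
          "\<And>j. variation \<mu> (B j) \<le> (\<Sum>i. ennreal (norm (\<mu> (A j i)))) + ennreal (e * (1/2) ^ Suc j)"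
        by metis
      \<comment> \<open>The partitions of all the \<open>B j\<close>, enumerated as a single
        sequence by pairing the indices.\<close>
      define A' where "A' n = (case prod_decode n of (j, i) \<Rightarrow> A j i)" for n
      have "(\<Sum>j. variation \<mu> (B j)) \<le> (\<Sum>j. (\<Sum>i. ennreal (norm (\<mu> (A j i)))) + ennreal (e * (1/2) ^ Suc j))"
        by (intro suminf_le A) auto
      also have "\<dots> = (\<Sum>j. \<Sum>i. ennreal (norm (\<mu> (A j i)))) + (\<Sum>j. ennreal (e * (1/2) ^ Suc j))"
        by (intro suminf_add[symmetric]) auto
      also have "(\<Sum>j. ennreal (e * (1/2) ^ Suc j)) = ennreal e"
        using sums_mult[OF power_half_series, of e] e by (intro suminf_ennreal_eq) auto
      also have "(\<Sum>j. \<Sum>i. ennreal (norm (\<mu> (A j i)))) = (\<Sum>n. ennreal (norm (\<mu> (A' n))))"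
      proof -
        have "(\<Sum>n. (\<lambda>(j, i). ennreal (norm (\<mu> (A j i)))) (prod_decode n)) = (\<Sum>j. \<Sum>i. ennreal (norm (\<mu> (A j i))))"
          by (rule suminf_ennreal_2dimen) simp
        moreover have "ennreal (norm (\<mu> (A' n))) = (\<lambda>(j, i). ennreal (norm (\<mu> (A j i)))) (prod_decode n)" for n
          unfolding A'_def split_def ..
        ultimately show ?thesis by (simp only:)
      qed
      also have "\<dots> \<le> ?V"
      proof (rule variation_upper)
        show "range A' \<subseteq> sets borel" using A(1) unfolding A'_def split_def by blast
        have sub: "A j i \<subseteq> B j" for j i using A(3) by blast
        have disj: "A j i \<inter> A j' i' = {}" if ne: "(j, i) \<noteq> (j', i')" for j i j' i'
        proof (cases "j = j'")
          case True
          then have "i \<noteq> i'" using ne by simp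
          then show ?thesis using True A(2)[of j] unfolding disjoint_family_on_def by blast
        next
          case False
          then have "B j \<inter> B j' = {}" using B(2) unfolding disjoint_family_on_def by blast
          then show ?thesis using sub by blast
        qed
        show "disjoint_family A'"
          unfolding disjoint_family_on_def
        proof (intro ballI impI)
          fix m n :: nat assume "m \<noteq> n"
          then have "prod_decode m \<noteq> prod_decode n" using inj_prod_decode by (simp add: inj_on_eq_iff)
          then show "A' m \<inter> A' n = {}"
            unfolding A'_def split_def using disj by (metis prod.collapse)
        qed
        have "A j i = A' (prod_encode (j, i))" for j i by (simp add: A'_def)
        then have "(\<Union>j. \<Union>i. A j i) \<subseteq> (\<Union>n. A' n)" by blast
        moreover have "(\<Union>n. A' n) \<subseteq> (\<Union>j. \<Union>i. A j i)" unfolding A'_def split_def by blast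
        ultimately have "(\<Union>n. A' n) = (\<Union>j. \<Union>i. A j i)" by (rule antisym[rotated])
        then show "(\<Union>n. A' n) = (\<Union>i. B i)" using A(3) by simp
      qed
      finally show "(\<Sum>i. variation \<mu> (B i)) \<le> ?V + ennreal e" by (simp add: add_right_mono)
    qed
  qed
qed

lemma sets_total_variation [simp, measurable_cong]: "sets (total_variation \<mu>) = sets borel"
  unfolding total_variation_def by (subst sets_measure_of) (auto simp: sets.sigma_sets_eq[of borel, simplified])

lemma space_total_variation [simp]: "space (total_variation \<mu>) = UNIV"
  unfolding total_variation_def by (simp add: space_measure_of)

text \<open>\<open>measure_of\<close> takes on the prescribed values only if they form a measure, so
  this is where countable additivity of the variation enters.\<close>

lemma emeasure_total_variation:
  assumes \<mu>: "quaternionic_measure \<mu>" and B: "B \<in> sets borel"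
  shows "emeasure (total_variation \<mu>) B = variation \<mu> B"
proof (rule emeasure_measure_of[where \<Omega> = UNIV and A = "sets borel"])
  show "total_variation \<mu> = measure_of UNIV (sets borel) (variation \<mu>)"
    unfolding total_variation_def variation_def ..
  show "positive (sets (total_variation \<mu>)) (variation \<mu>)"
    by (simp add: positive_def variation_empty[OF \<mu>])
  show "countably_additive (sets (total_variation \<mu>)) (variation \<mu>)"
    by (simp add: variation_countably_additive[OF \<mu>])
qed (use B in auto)

text \<open>The exponential weight is at least 1, so its integrability already bounds the total
  mass.\<close>

lemma finite_total_variation:
  assumes \<mu>: "quaternionic_measure \<mu>" and c: "exp_integrable c \<mu>" "c \<ge> 0"
  shows "finite_measure (total_variation \<mu>)"
proof
  have "emeasure (total_variation \<mu>) UNIV = (\<integral>\<^sup>+ t. 1 \<partial>total_variation \<mu>)" by simp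
  also have "\<dots> \<le> (\<integral>\<^sup>+ t. ennreal (exp (c * \<bar>t\<bar>)) \<partial>total_variation \<mu>)"
    using c(2) by (intro nn_integral_mono) (auto simp: ennreal_1[symmetric] simp del: ennreal_1 intro!: ennreal_leI)
  also have "\<dots> < \<infinity>" using c(1) by (simp add: exp_integrable_def)
  finally show "emeasure (total_variation \<mu>) (space (total_variation \<mu>)) \<noteq> \<infinity>" by simp
qed


text \<open>The set function \<open>inner (\<mu> A) b\<close> is signed, but it is bounded in
  modulus by the total variation, so adding the total variation gives a positive measure. The
  Radon-Nikodym density of that measure, minus 1, is the wanted function.\<close>

lemma ex_component_density:
  assumes \<mu>: "quaternionic_measure \<mu>" and fin: "finite_measure (total_variation \<mu>)" and b: "norm b = 1"
  shows "\<exists>k. k \<in> borel_measurable borel \<and> integrable (total_variation \<mu>) k \<and>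
    (\<forall>A\<in>sets borel. (LINT t:A|total_variation \<mu>. k t) = inner (\<mu> A) b)"
proof -
  define N where "N = total_variation \<mu>"
  interpret finite_measure N using fin by (simp add: N_def)
  have sN [measurable_cong, simp]: "sets N = sets borel" and spN [simp]: "space N = UNIV" by (simp_all add: N_def)
  have nn: "\<bar>inner (\<mu> A) b\<bar> \<le> measure N A" if A: "A \<in> sets borel" for A
  proof -
    have "ennreal (norm (\<mu> A)) \<le> ennreal (measure N A)"
      using norm_le_variation[OF \<mu> A] emeasure_total_variation[OF \<mu> A] emeasure_eq_measure[of A]
      by (simp add: N_def)
    then have "norm (\<mu> A) \<le> measure N A" by simp
    moreover have "\<bar>inner (\<mu> A) b\<bar> \<le> norm (\<mu> A)" using Cauchy_Schwarz_ineq2[of "\<mu> A" b] b by simp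
    ultimately show ?thesis by linarith
  qed
  define m where "m A = ennreal (inner (\<mu> A) b + measure N A)" for A
  define N' where "N' = measure_of UNIV (sets borel) m"
  have sN': "sets N' = sets borel" unfolding N'_def
    by (subst sets_measure_of) (auto simp: sets.sigma_sets_eq[of borel, simplified])
  have emN': "emeasure N' A = m A" if "A \<in> sets borel" for A
  proof (rule emeasure_measure_of[OF N'_def])
    show "positive (sets N') m" by (simp add: positive_def m_def quaternionic_measure_empty[OF \<mu>])
    show "countably_additive (sets N') m"
      unfolding countably_additive_def
    proof (intro allI impI)
      fix A :: "nat \<Rightarrow> real set" assume A: "range A \<subseteq> sets N'" "disjoint_family A"
      have "(\<lambda>i. inner (\<mu> (A i)) b + measure N (A i)) sums (inner (\<mu> (\<Union>i. A i)) b + measure N (\<Union>i. A i))"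
        using A sN' by (intro sums_add bounded_linear.sums[OF bounded_linear_inner_left]
          quaternionic_measure_sums[OF \<mu>] finite_measure_UNION) auto
      then show "(\<Sum>i. m (A i)) = m (\<Union>i. A i)"
        unfolding m_def
      proof (rule suminf_ennreal_eq[rotated])
        fix i
        have "A i \<in> sets borel" using A(1) sN' by auto
        from nn[OF this] show "0 \<le> inner (\<mu> (A i)) b + measure N (A i)" by linarith
      qed
    qed
  qed (use that sN' in auto)
  have "absolutely_continuous N N'"
    unfolding absolutely_continuous_def
  proof
    fix A assume "A \<in> null_sets N"
    then have A: "A \<in> sets borel" "measure N A = 0" by (auto simp: measure_def)
    then have "m A = 0" using nn[of A] by (simp add: m_def)
    then show "A \<in> null_sets N'" using A emN'[of A] sN' by auto
  qed
  then obtain g where g [measurable]: "g \<in> borel_measurable N" and dens: "density N g = N'"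
    using Radon_Nikodym sN' by (metis sN)
  have gint: "(\<integral>\<^sup>+ t\<in>A. g t \<partial>N) = m A" if "A \<in> sets borel" for A
    using that emN'[of A] dens emeasure_density[OF g, of A] by simp
  have "(\<integral>\<^sup>+ t. g t \<partial>N) \<noteq> \<infinity>" using gint[of UNIV] by (simp add: m_def)
  then have fing: "AE t in N. g t \<noteq> \<infinity>" by (intro nn_integral_noteq_infinite) auto
  \<comment> \<open>\<open>g\<close> is finite almost everywhere, so \<open>enn2real\<close> changes
    it only on a null set; the 1 takes off the total variation that was added in
    \<open>m\<close>.\<close>
  define k where "k t = enn2real (g t) - 1" for t
  have kN [measurable]: "k \<in> borel_measurable N" unfolding k_def by measurable
  have gi: "has_bochner_integral N (\<lambda>t. indicator A t * enn2real (g t)) (inner (\<mu> A) b + measure N A)"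
    if A [measurable]: "A \<in> sets borel" for A
  proof (rule has_bochner_integral_nn_integral)
    have "(\<integral>\<^sup>+ t. ennreal (indicator A t * enn2real (g t)) \<partial>N) = (\<integral>\<^sup>+ t\<in>A. g t \<partial>N)"
      by (rule nn_integral_cong_AE)
         (use fing in \<open>eventually_elim, auto simp: indicator_def ennreal_enn2real_if top_unique\<close>)
    then show "(\<integral>\<^sup>+ t. ennreal (indicator A t * enn2real (g t)) \<partial>N) = ennreal (inner (\<mu> A) b + measure N A)"
      using gint[OF A] by (simp add: m_def)
  qed (use nn[OF A] in auto)
  have hb: "has_bochner_integral N (\<lambda>t. indicator A t *\<^sub>R k t) (inner (\<mu> A) b)" if A: "A \<in> sets borel" for A
  proof -
    have "has_bochner_integral N (\<lambda>t. indicator A t * enn2real (g t) - indicator A t) (inner (\<mu> A) b + measure N A - measure N A)"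
      using A by (intro has_bochner_integral_diff gi has_bochner_integral_real_indicator) (auto simp: less_top[symmetric])
    then show ?thesis by (simp add: k_def algebra_simps)
  qed
  have "(LINT t:A|N. k t) = inner (\<mu> A) b" if "A \<in> sets borel" for A
    using has_bochner_integral_integral_eq[OF hb[OF that]] by (simp add: set_lebesgue_integral_def)
  moreover have "integrable N k" using integrable.intros[OF hb[of UNIV]] by simp
  ultimately show ?thesis using kN by (auto simp: N_def cong: measurable_cong_sets intro!: exI[of _ k])
qed

text \<open>The four components give a density \<open>g\<close>. Its averages are values of
  \<open>\<mu>\<close> divided by the total variation, so they lie in the unit ball, and with them
  almost all values of \<open>g\<close>. Conversely the total mass is a supremum of sums that are
  dominated by the integral of \<open>norm (g t)\<close>. Hence the norm is 1 almost everywhere, and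
  redefining \<open>g\<close> elsewhere changes no integral.\<close>

lemma ex_polar_density:
  assumes \<mu>: "quaternionic_measure \<mu>" and fin: "finite_measure (total_variation \<mu>)"
  shows "\<exists>h. h \<in> borel_measurable borel \<and> (\<forall>t. norm (h t) = 1) \<and>
     (\<forall>A\<in>sets borel. \<mu> A = (LINT t:A|total_variation \<mu>. h t))"
proof -
  define N where "N = total_variation \<mu>"
  interpret finite_measure N using fin by (simp add: N_def)
  have sN [measurable_cong, simp]: "sets N = sets borel" and spN [simp]: "space N = UNIV" by (simp_all add: N_def)
  obtain k where k: "\<And>b. b \<in> Basis \<Longrightarrow> k b \<in> borel_measurable borel"
      "\<And>b. b \<in> Basis \<Longrightarrow> integrable N (k b)"
      "\<And>b A. b \<in> Basis \<Longrightarrow> A \<in> sets borel \<Longrightarrow> (LINT t:A|N. k b t) = inner (\<mu> A) b"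
    using ex_component_density[OF \<mu> fin] unfolding N_def by (metis norm_Basis)
  define g where "g t = (\<Sum>b\<in>Basis. k b t *\<^sub>R b)" for t
  have gm [measurable]: "g \<in> borel_measurable borel" unfolding g_def using k(1) by measurable
  have gi: "integrable N g" unfolding g_def using k(2) by (intro Bochner_Integration.integrable_sum integrable_scaleR_left) auto
  have gA: "(LINT t:A|N. g t) = \<mu> A" if A: "A \<in> sets borel" for A
  proof -
    have ki: "integrable N (\<lambda>t. indicat_real A t *\<^sub>R k b t)" if "b \<in> Basis" for b
      by (rule integrable_mult_indicator) (use that k(2) A in auto)
    have "(LINT t:A|N. g t) = (LINT t|N. (\<Sum>b\<in>Basis. (indicat_real A t *\<^sub>R k b t) *\<^sub>R b))"
      unfolding g_def set_lebesgue_integral_def by (simp add: scaleR_sum_right)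
    also have "\<dots> = (\<Sum>b\<in>Basis. (LINT t|N. (indicat_real A t *\<^sub>R k b t) *\<^sub>R b))"
      by (rule Bochner_Integration.integral_sum) (use ki in auto)
    also have "\<dots> = (\<Sum>b\<in>Basis. (LINT t:A|N. k b t) *\<^sub>R b)"
      unfolding set_lebesgue_integral_def using ki by (intro sum.cong refl integral_scaleR_left) auto
    also have "\<dots> = (\<Sum>b\<in>Basis. inner (\<mu> A) b *\<^sub>R b)" using k(3)[OF _ A] by simp
    finally show ?thesis by (simp add: euclidean_representation)
  qed
  have le1: "AE t in N. g t \<in> cball 0 1"
  proof (rule averaging_theorem[OF gi closed_cball])
    fix A assume A: "A \<in> sets N" "measure N A > 0"
    have "ennreal (norm (\<mu> A)) \<le> ennreal (measure N A)"
      using norm_le_variation[OF \<mu>, of A] emeasure_total_variation[OF \<mu>, of A] emeasure_eq_measure[of A] A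
      by (simp add: N_def)
    then have "norm (\<mu> A) \<le> measure N A" by simp
    then show "(1 / measure N A) *\<^sub>R (LINT t:A|N. g t) \<in> cball 0 1"
      using A gA[of A] by (simp add: field_simps)
  qed
  have "emeasure N UNIV \<le> (\<integral>\<^sup>+ t. ennreal (norm (g t)) \<partial>N)"
  proof -
    have "variation \<mu> UNIV \<le> (\<integral>\<^sup>+ t. ennreal (norm (g t)) \<partial>N)"
    proof (rule variation_least)
      fix A :: "nat \<Rightarrow> real set"
      assume A: "range A \<subseteq> sets borel" "disjoint_family A" "(\<Union>i. A i) = UNIV"
      have "ennreal (norm (\<mu> (A i))) \<le> (\<integral>\<^sup>+ t\<in>A i. ennreal (norm (g t)) \<partial>N)" for i
      proof -
        have Ai [measurable]: "A i \<in> sets borel" using A by auto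
        have "norm (\<mu> (A i)) = norm (LINT t|N. indicator (A i) t *\<^sub>R g t)"
          using gA[OF Ai] by (simp add: set_lebesgue_integral_def)
        also have "ennreal \<dots> \<le> (\<integral>\<^sup>+ t. ennreal (norm (indicator (A i) t *\<^sub>R g t)) \<partial>N)"
          using gi integrable_mult_indicator[of "A i" N g] by (intro integral_norm_bound_ennreal) auto
        also have "\<dots> = (\<integral>\<^sup>+ t\<in>A i. ennreal (norm (g t)) \<partial>N)"
          by (intro nn_integral_cong) (auto simp: indicator_def)
        finally show ?thesis .
      qed
      then have "(\<Sum>i. ennreal (norm (\<mu> (A i)))) \<le> (\<Sum>i. \<integral>\<^sup>+ t\<in>A i. ennreal (norm (g t)) \<partial>N)"
        by (intro suminf_le) auto
      also have "\<dots> = (\<Sum>i. emeasure (density N (\<lambda>t. ennreal (norm (g t)))) (A i))"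
        using A by (intro arg_cong[where f = suminf] ext, subst emeasure_density) auto
      also have "\<dots> = emeasure (density N (\<lambda>t. ennreal (norm (g t)))) (\<Union>i. A i)"
        using A by (intro suminf_emeasure) auto
      also have "\<dots> = (\<integral>\<^sup>+ t. ennreal (norm (g t)) \<partial>N)" using A(3) by (subst emeasure_density) auto
      finally show "(\<Sum>i. ennreal (norm (\<mu> (A i)))) \<le> (\<integral>\<^sup>+ t. ennreal (norm (g t)) \<partial>N)" .
    qed
    then show ?thesis using emeasure_total_variation[OF \<mu>, of UNIV] by (simp add: N_def)
  qed
  also have "(\<integral>\<^sup>+ t. ennreal (norm (g t)) \<partial>N) = ennreal (LINT t|N. norm (g t))"
    using gi by (intro nn_integral_eq_integral) auto
  finally have ge: "measure N UNIV \<le> (LINT t|N. norm (g t))" by (simp add: emeasure_eq_measure)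
  have i1: "integrable N (\<lambda>t. 1 - norm (g t))" using gi by auto
  have nn: "AE t in N. 0 \<le> 1 - norm (g t)" using le1 by eventually_elim simp
  have "(LINT t|N. 1 - norm (g t)) = measure N UNIV - (LINT t|N. norm (g t))"
    using gi by (subst Bochner_Integration.integral_diff) auto
  then have "(LINT t|N. 1 - norm (g t)) = 0" using ge integral_nonneg_AE[OF nn] by linarith
  then have eq1: "AE t in N. norm (g t) = 1" using integral_nonneg_eq_0_iff_AE[OF i1 nn] by auto
  define h where "h t = (if norm (g t) = 1 then g t else 1)" for t
  have hm [measurable]: "h \<in> borel_measurable borel" unfolding h_def by measurable
  have "(LINT t:A|N. h t) = (LINT t:A|N. g t)" if "A \<in> sets borel" for A
    unfolding set_lebesgue_integral_def
    by (rule integral_cong_AE) (use that eq1 in \<open>auto simp: h_def\<close>)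
  moreover have "\<forall>t. norm (h t) = 1" by (simp add: h_def)
  ultimately show ?thesis using hm gA unfolding N_def by (intro exI[of _ h]) auto
qed

lemma polar_density:
  assumes "quaternionic_measure \<mu>" "finite_measure (total_variation \<mu>)"
  shows "polar_density \<mu> \<in> borel_measurable borel" "norm (polar_density \<mu> t) = 1"
  using someI_ex[OF ex_polar_density[OF assms]] unfolding polar_density_def by blast+


section \<open>Bochner integrals with values in a possibly non-separable Banach space\<close>

lemma simple_bochner_integral_bounded_general:
  fixes f :: "'a \<Rightarrow> 'b::real_normed_vector"
  assumes f: "(\<lambda>x. norm (f x - s x)) \<in> borel_measurable M" "(\<lambda>x. norm (f x - t x)) \<in> borel_measurable M"
    and s: "Bochner_Integration.simple_bochner_integrable M s" and t: "Bochner_Integration.simple_bochner_integrable M t"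
  shows "ennreal (norm (Bochner_Integration.simple_bochner_integral M s - Bochner_Integration.simple_bochner_integral M t)) \<le>
    (\<integral>\<^sup>+ x. ennreal (norm (f x - s x)) \<partial>M) + (\<integral>\<^sup>+ x. ennreal (norm (f x - t x)) \<partial>M)"
proof -
  have d: "Bochner_Integration.simple_bochner_integrable M (\<lambda>x. s x - t x)"
    using simple_bochner_integrable_compose2[OF _ s t, of "\<lambda>x y. x - y"] by simp
  have n: "Bochner_Integration.simple_bochner_integrable M (\<lambda>x. norm (s x - t x))"
    using simple_bochner_integrable_compose2[OF _ s t, of "\<lambda>x y. norm (x - y)"] by simp
  have "norm (Bochner_Integration.simple_bochner_integral M s - Bochner_Integration.simple_bochner_integral M t) \<le>
      Bochner_Integration.simple_bochner_integral M (\<lambda>x. norm (s x - t x))"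
    using simple_bochner_integral_norm_bound[OF d] simple_bochner_integral_diff[OF s t] by simp
  then have "ennreal (norm (Bochner_Integration.simple_bochner_integral M s - Bochner_Integration.simple_bochner_integral M t)) \<le>
      (\<integral>\<^sup>+ x. ennreal (norm (s x - t x)) \<partial>M)"
    using simple_bochner_integral_eq_nn_integral[OF n] by (metis ennreal_leI norm_ge_zero)
  also have "\<dots> \<le> (\<integral>\<^sup>+ x. ennreal (norm (f x - s x)) + ennreal (norm (f x - t x)) \<partial>M)"
  proof (rule nn_integral_mono)
    fix x
    have "norm (s x - t x) \<le> norm (f x - s x) + norm (f x - t x)"
      using norm_triangle_ineq4[of "f x - t x" "f x - s x"] by simp
    then show "ennreal (norm (s x - t x)) \<le> ennreal (norm (f x - s x)) + ennreal (norm (f x - t x))"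
      by (simp add: ennreal_plus[symmetric] ennreal_leI del: ennreal_plus)
  qed
  also have "\<dots> = (\<integral>\<^sup>+ x. ennreal (norm (f x - s x)) \<partial>M) + (\<integral>\<^sup>+ x. ennreal (norm (f x - t x)) \<partial>M)"
    using f by (intro nn_integral_add) auto
  finally show ?thesis .
qed

text \<open>In a non-separable space the difference of two measurable functions need not be
  measurable. Here one of them takes finitely many values, and on each of its level sets the norm is
  a continuous function of \<open>f\<close> alone.\<close>

lemma norm_diff_simple_measurable:
  fixes f :: "'a \<Rightarrow> 'b::real_normed_vector"
  assumes f: "f \<in> borel_measurable M" and s: "simple_function M s"
  shows "(\<lambda>x. norm (f x - s x)) \<in> borel_measurable M"
proof -
  have "(\<lambda>x. norm (f x - s x)) \<in> borel_measurable M"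
  proof (rule measurable_compose_countable'[where I = "s ` space M" and f = "\<lambda>y x. norm (f x - y)"])
    show "s \<in> M \<rightarrow>\<^sub>M count_space (s ` space M)"
      using s by (auto simp: simple_function_def measurable_count_space_eq2)
    show "countable (s ` space M)" using s by (auto simp: simple_function_def countable_finite)
    show "(\<lambda>x. norm (f x - y)) \<in> borel_measurable M" if "y \<in> s ` space M" for y
      by (rule measurable_compose[OF f]) (intro borel_measurable_continuous_onI continuous_intros)
  qed
  then show ?thesis .
qed

lemma simple_bochner_integrable_finite_measure:
  "finite_measure M \<Longrightarrow> simple_function M s \<Longrightarrow> Bochner_Integration.simple_bochner_integrable M s"
  by (intro simple_bochner_integrable.intros) (auto simp: finite_measure.emeasure_eq_measure)

lemma has_bochner_int_unique:
  assumes "has_bochner_int M F x" "has_bochner_int M F y"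
  shows "x = y"
proof -
  obtain s t where s: "\<And>i. Bochner_Integration.simple_bochner_integrable M (s i)" "(\<lambda>i. \<integral>\<^sup>+ y. ennreal (norm (F y - s i y)) \<partial>M) \<longlonglongrightarrow> 0"
      "(\<lambda>i. Bochner_Integration.simple_bochner_integral M (s i)) \<longlonglongrightarrow> x"
    and t: "\<And>i. Bochner_Integration.simple_bochner_integrable M (t i)" "(\<lambda>i. \<integral>\<^sup>+ y. ennreal (norm (F y - t i y)) \<partial>M) \<longlonglongrightarrow> 0"
      "(\<lambda>i. Bochner_Integration.simple_bochner_integral M (t i)) \<longlonglongrightarrow> y" and F: "F \<in> borel_measurable M"
    using assms unfolding has_bochner_int_def by blast
  have sf: "simple_function M (s i)" "simple_function M (t i)" for i
    using s(1) t(1) simple_bochner_integrable.cases by blast+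
  have "(\<lambda>i. ennreal (norm (Bochner_Integration.simple_bochner_integral M (s i) - Bochner_Integration.simple_bochner_integral M (t i)))) \<longlonglongrightarrow> 0"
  proof (rule tendsto_sandwich[OF _ _ tendsto_const])
    show "(\<lambda>i. (\<integral>\<^sup>+ y. ennreal (norm (F y - s i y)) \<partial>M) + (\<integral>\<^sup>+ y. ennreal (norm (F y - t i y)) \<partial>M)) \<longlonglongrightarrow> 0"
      using tendsto_add[OF s(2) t(2)] by simp
    show "\<forall>\<^sub>F i in sequentially. ennreal (norm (Bochner_Integration.simple_bochner_integral M (s i) - Bochner_Integration.simple_bochner_integral M (t i)))
        \<le> (\<integral>\<^sup>+ y. ennreal (norm (F y - s i y)) \<partial>M) + (\<integral>\<^sup>+ y. ennreal (norm (F y - t i y)) \<partial>M)"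
      by (intro always_eventually allI simple_bochner_integral_bounded_general s t norm_diff_simple_measurable F sf)
  qed simp
  moreover have "(\<lambda>i. ennreal (norm (Bochner_Integration.simple_bochner_integral M (s i) - Bochner_Integration.simple_bochner_integral M (t i)))) \<longlonglongrightarrow> ennreal (norm (x - y))"
    by (intro tendsto_ennrealI tendsto_norm tendsto_diff s t)
  ultimately have "ennreal (norm (x - y)) = 0" using LIMSEQ_unique by blast
  then show ?thesis by simp
qed

text \<open>The bridge to ordinary integration theory: under a bounded linear map into a separable
  space the approximating simple functions become admissible for
  \<open>has_bochner_integral\<close>.\<close>

lemma has_bochner_int_bounded_linear:
  fixes \<phi> :: "'b::banach \<Rightarrow> 'c::{banach, second_countable_topology}"
  assumes "has_bochner_int M F x" and \<phi>: "bounded_linear \<phi>"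
  shows "has_bochner_integral M (\<lambda>t. \<phi> (F t)) (\<phi> x)"
proof -
  interpret bounded_linear \<phi> by fact
  obtain s where F: "F \<in> borel_measurable M" and s: "\<And>i. Bochner_Integration.simple_bochner_integrable M (s i)"
      "(\<lambda>i. \<integral>\<^sup>+ y. ennreal (norm (F y - s i y)) \<partial>M) \<longlonglongrightarrow> 0" "(\<lambda>i. Bochner_Integration.simple_bochner_integral M (s i)) \<longlonglongrightarrow> x"
    using assms unfolding has_bochner_int_def by blast
  have sf: "simple_function M (s i)" for i using s(1) simple_bochner_integrable.cases by blast
  obtain K where K: "K > 0" "\<And>x. norm (\<phi> x) \<le> norm x * K" using pos_bounded by blast
  show ?thesis
  proof (rule has_bochner_integral.intros)
    show "(\<lambda>t. \<phi> (F t)) \<in> borel_measurable M"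
      by (rule measurable_compose[OF F]) (intro borel_measurable_continuous_onI continuous_on continuous_on_id)
    show "Bochner_Integration.simple_bochner_integrable M (\<lambda>t. \<phi> (s i t))" for i
      using simple_bochner_integrable_compose2[OF _ s(1) s(1), of "\<lambda>x y. \<phi> x"] by (simp add: zero)
    show "(\<lambda>i. Bochner_Integration.simple_bochner_integral M (\<lambda>t. \<phi> (s i t))) \<longlonglongrightarrow> \<phi> x"
      using tendsto[OF s(3)] simple_bochner_integral_linear[OF linear_axioms s(1)] by simp
    show "(\<lambda>i. \<integral>\<^sup>+ x. ennreal (norm (\<phi> (F x) - \<phi> (s i x))) \<partial>M) \<longlonglongrightarrow> 0"
    proof (rule tendsto_sandwich[OF _ _ tendsto_const])
      have "(\<integral>\<^sup>+ x. ennreal (norm (\<phi> (F x) - \<phi> (s i x))) \<partial>M) \<le> ennreal K * (\<integral>\<^sup>+ x. ennreal (norm (F x - s i x)) \<partial>M)" for i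
      proof -
        have "(\<integral>\<^sup>+ x. ennreal (norm (\<phi> (F x) - \<phi> (s i x))) \<partial>M) \<le> (\<integral>\<^sup>+ x. ennreal K * ennreal (norm (F x - s i x)) \<partial>M)"
          using K by (intro nn_integral_mono)
            (auto simp: diff[symmetric] ennreal_mult[symmetric] mult.commute intro!: ennreal_leI)
        also have "\<dots> = ennreal K * (\<integral>\<^sup>+ x. ennreal (norm (F x - s i x)) \<partial>M)"
          by (intro nn_integral_cmult) (use norm_diff_simple_measurable[OF F sf] in measurable)
        finally show ?thesis .
      qed
      then show "\<forall>\<^sub>F i in sequentially. (\<integral>\<^sup>+ x. ennreal (norm (\<phi> (F x) - \<phi> (s i x))) \<partial>M)
          \<le> ennreal K * (\<integral>\<^sup>+ x. ennreal (norm (F x - s i x)) \<partial>M)" by auto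
      show "(\<lambda>i. ennreal K * (\<integral>\<^sup>+ x. ennreal (norm (F x - s i x)) \<partial>M)) \<longlonglongrightarrow> 0"
        using ennreal_tendsto_cmult[OF _ s(2), of "ennreal K"] by simp
    qed simp
  qed
qed

text \<open>The integrand factors through a second countable metric space \<open>'c\<close>, where simple approximations
  exist; this replaces separability of the target space.\<close>

lemma ex_has_bochner_int:
  fixes \<Phi> :: "'c::{metric_space, second_countable_topology} \<Rightarrow> 'b::banach"
  assumes M: "finite_measure M" and g: "g \<in> borel_measurable M" and \<Phi>: "continuous_on UNIV \<Phi>"
    and int: "(\<integral>\<^sup>+ t. ennreal (norm (\<Phi> (g t))) \<partial>M) < \<infinity>"
  shows "\<exists>x. has_bochner_int M (\<lambda>t. \<Phi> (g t)) x"
proof -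
  interpret finite_measure M by fact
  define F where "F t = \<Phi> (g t)" for t
  have Fm [measurable]: "F \<in> borel_measurable M"
    unfolding F_def using measurable_compose[OF g borel_measurable_continuous_onI[OF \<Phi>]] by simp
  have nFm [measurable]: "(\<lambda>t. norm (F t)) \<in> borel_measurable M"
    by (rule measurable_compose[OF Fm]) (intro borel_measurable_continuous_onI continuous_intros)
  obtain s where s: "\<And>i. simple_function M (s i)" "\<And>x. x \<in> space M \<Longrightarrow> (\<lambda>i. s i x) \<longlonglongrightarrow> g x"
    using borel_measurable_implies_sequence_metric[OF g] by blast
  \<comment> \<open>The functions \<open>\<Phi> (s i t)\<close> converge pointwise but have no
    common majorant. Dropping values above \<open>2 * norm (F t) + 1\<close> keeps the functions
    simple, yields the majorant 3|F| + 1, and affects only finitely many \<open>i\<close> at each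
    \<open>t\<close>, because the limit \<open>F t\<close> lies strictly below the
    threshold.\<close>
  define \<sigma> where "\<sigma> i t = (if norm (\<Phi> (s i t)) \<le> 2 * norm (F t) + 1 then \<Phi> (s i t) else 0)" for i t
  have sPhi: "simple_function M (\<lambda>t. \<Phi> (s i t))" for i using s(1) by (rule simple_function_compose1)
  have nsm [measurable]: "(\<lambda>t. norm (\<Phi> (s i t))) \<in> borel_measurable M" for i
    using simple_function_compose1[OF s(1), of "\<lambda>x. norm (\<Phi> x)"] borel_measurable_simple_function by blast
  have s\<sigma>: "simple_function M (\<sigma> i)" for i
    unfolding \<sigma>_def by (intro simple_function_If sPhi simple_function_const) measurable
  have "F \<in> borel_measurable M" by fact
  moreover have lim: "(\<lambda>i. \<integral>\<^sup>+ t. ennreal (norm (F t - \<sigma> i t)) \<partial>M) \<longlonglongrightarrow> (\<integral>\<^sup>+ t. 0 \<partial>M)"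
  proof (rule nn_integral_dominated_convergence[where w = "\<lambda>t. 3 * ennreal (norm (F t)) + 1"])
    show "(\<lambda>t. ennreal (norm (F t - \<sigma> i t))) \<in> borel_measurable M" for i
      using norm_diff_simple_measurable[OF Fm s\<sigma>] by measurable
    have "(\<integral>\<^sup>+ t. 3 * ennreal (norm (F t)) + 1 \<partial>M) = 3 * (\<integral>\<^sup>+ t. ennreal (norm (F t)) \<partial>M) + emeasure M (space M)"
      by (subst nn_integral_add) (auto simp: nn_integral_cmult)
    also have "\<dots> < \<infinity>" using int by (auto simp: F_def ennreal_mult_less_top emeasure_eq_measure)
    finally show "(\<integral>\<^sup>+ t. 3 * ennreal (norm (F t)) + 1 \<partial>M) < \<infinity>" .
    show "AE t in M. ennreal (norm (F t - \<sigma> i t)) \<le> 3 * ennreal (norm (F t)) + 1" for i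
    proof (rule AE_I2)
      fix t
      have "norm (\<sigma> i t) \<le> 2 * norm (F t) + 1" by (simp add: \<sigma>_def)
      then have "norm (F t - \<sigma> i t) \<le> 3 * norm (F t) + 1"
        using norm_triangle_ineq4[of "F t" "\<sigma> i t"] by linarith
      then have "ennreal (norm (F t - \<sigma> i t)) \<le> ennreal (3 * norm (F t) + 1)" by (rule ennreal_leI)
      also have "\<dots> = 3 * ennreal (norm (F t)) + 1" by (simp add: ennreal_plus ennreal_mult)
      finally show "ennreal (norm (F t - \<sigma> i t)) \<le> 3 * ennreal (norm (F t)) + 1" .
    qed
    show "AE t in M. (\<lambda>i. ennreal (norm (F t - \<sigma> i t))) \<longlonglongrightarrow> 0"
    proof (rule AE_I2)
      fix t assume t: "t \<in> space M"
      have "isCont \<Phi> (g t)" using \<Phi> by (simp add: continuous_on_eq_continuous_at)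
      then have *: "(\<lambda>i. \<Phi> (s i t)) \<longlonglongrightarrow> F t" unfolding F_def using s(2)[OF t] by (rule isCont_tendsto_compose)
      have "norm (F t) < 2 * norm (F t) + 1" by (simp add: add_pos_nonneg less_add_same_cancel1 algebra_simps)
      from order_tendstoD(2)[OF tendsto_norm[OF *] this]
      have "\<forall>\<^sub>F i in sequentially. \<Phi> (s i t) = \<sigma> i t" by eventually_elim (simp add: \<sigma>_def)
      with * have "(\<lambda>i. \<sigma> i t) \<longlonglongrightarrow> F t" by (rule Lim_transform_eventually)
      then have "(\<lambda>i. norm (F t - \<sigma> i t)) \<longlonglongrightarrow> norm (F t - F t)" by (intro tendsto_intros)
      from tendsto_ennrealI[OF this] show "(\<lambda>i. ennreal (norm (F t - \<sigma> i t))) \<longlonglongrightarrow> 0" by simp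
    qed
  qed auto
  moreover have "convergent (\<lambda>i. Bochner_Integration.simple_bochner_integral M (\<sigma> i))"
  proof (rule Cauchy_convergent, rule CauchyI)
    fix e :: real assume e: "e > 0"
    have "\<forall>\<^sub>F i in sequentially. (\<integral>\<^sup>+ t. ennreal (norm (F t - \<sigma> i t)) \<partial>M) < ennreal (e / 2)"
      using lim e by (intro order_tendstoD) auto
    then obtain n where n: "\<And>i. i \<ge> n \<Longrightarrow> (\<integral>\<^sup>+ t. ennreal (norm (F t - \<sigma> i t)) \<partial>M) < ennreal (e / 2)"
      by (auto simp: eventually_sequentially)
    have "norm (Bochner_Integration.simple_bochner_integral M (\<sigma> i) - Bochner_Integration.simple_bochner_integral M (\<sigma> j)) < e" if "i \<ge> n" "j \<ge> n" for i j
    proof -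
      have "ennreal (norm (Bochner_Integration.simple_bochner_integral M (\<sigma> i) - Bochner_Integration.simple_bochner_integral M (\<sigma> j))) \<le>
          (\<integral>\<^sup>+ t. ennreal (norm (F t - \<sigma> i t)) \<partial>M) + (\<integral>\<^sup>+ t. ennreal (norm (F t - \<sigma> j t)) \<partial>M)"
        by (intro simple_bochner_integral_bounded_general norm_diff_simple_measurable Fm s\<sigma>
            simple_bochner_integrable_finite_measure M)
      also have "\<dots> < ennreal (e / 2) + ennreal (e / 2)" using n that by (intro add_strict_mono) auto
      also have "\<dots> = ennreal e" using e by (simp add: ennreal_plus[symmetric] del: ennreal_plus)
      finally show ?thesis using e by (simp add: ennreal_less_iff)
    qed
    then show "\<exists>n. \<forall>i\<ge>n. \<forall>j\<ge>n. norm (Bochner_Integration.simple_bochner_integral M (\<sigma> i) - Bochner_Integration.simple_bochner_integral M (\<sigma> j)) < e" by blast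
  qed
  ultimately show ?thesis
    using simple_bochner_integrable_finite_measure[OF M s\<sigma>]
    unfolding has_bochner_int_def F_def[symmetric] convergent_def by auto
qed

lemma bounded_bilinear_lscale: "bounded_bilinear ((*\<^sub>l) :: quat \<Rightarrow> 'v \<Rightarrow> 'v::quaternionic_banach)"
proof
  fix a b :: quat and v w :: 'v and r :: real
  have "(of_real r * a) *\<^sub>l v = r *\<^sub>R (a *\<^sub>l v)" by (simp add: lscale_mult lscale_of_real)
  then show "(r *\<^sub>R a) *\<^sub>l v = r *\<^sub>R (a *\<^sub>l v)" by (simp add: scaleR_conv_of_real)
  have "(a * of_real r) *\<^sub>l v = a *\<^sub>l (r *\<^sub>R v)" by (simp add: lscale_mult lscale_of_real)
  moreover have "a * of_real r = of_real r * a" by (simp add: of_real_def)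
  ultimately show "a *\<^sub>l (r *\<^sub>R v) = r *\<^sub>R (a *\<^sub>l v)" by (simp add: lscale_mult lscale_of_real)
  show "\<exists>K. \<forall>a v. norm (a *\<^sub>l v :: 'v) \<le> norm a * norm v * K" by (auto simp: norm_lscale intro!: exI[of _ 1])
qed (simp_all add: lscale_add_left lscale_add_right)

text \<open>The integrand is a continuous function of the pair
  \<open>(polar_density \<mu> t, t)\<close>, so it factors through the separable space of such
  pairs. This justifies the \<open>THE\<close> in \<open>quat_integral\<close> and turns every
  bounded linear image of it into an ordinary integral.\<close>

lemma quat_integral_functional:
  fixes u :: "real \<Rightarrow> 'v::quaternionic_banach" and \<phi> :: "'v \<Rightarrow> 'c::{banach, second_countable_topology}"
  assumes \<mu>: "quaternionic_measure \<mu>" "exp_integrable c \<mu>" "c \<ge> 0"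
    and u: "continuous_on UNIV u" "\<And>t. norm (u t) \<le> C * exp (c * \<bar>t\<bar>)" and \<phi>: "bounded_linear \<phi>"
  shows "has_bochner_integral (total_variation \<mu>) (\<lambda>t. \<phi> (polar_density \<mu> t *\<^sub>l u t)) (\<phi> (quat_integral \<mu> u))"
proof -
  have fin: "finite_measure (total_variation \<mu>)" by (rule finite_total_variation) fact+
  note p = polar_density[OF \<mu>(1) fin]
  interpret lscale: bounded_bilinear "(*\<^sub>l) :: quat \<Rightarrow> 'v \<Rightarrow> 'v" by (rule bounded_bilinear_lscale)
  define \<Phi> where "\<Phi> q = fst q *\<^sub>l u (snd q)" for q :: "quat \<times> real"
  have "\<exists>x. has_bochner_int (total_variation \<mu>) (\<lambda>t. \<Phi> (polar_density \<mu> t, t)) x"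
  proof (rule ex_has_bochner_int[OF fin])
    have "(\<lambda>t. (polar_density \<mu> t, t)) \<in> borel_measurable borel" using p(1) by (intro borel_measurable_Pair) auto
    then show "(\<lambda>t. (polar_density \<mu> t, t)) \<in> borel_measurable (total_variation \<mu>)"
      by (simp cong: measurable_cong_sets)
    show "continuous_on UNIV \<Phi>" unfolding \<Phi>_def
      by (intro lscale.continuous_on continuous_intros continuous_on_compose2[OF u(1)]) auto
    have "(\<integral>\<^sup>+ t. ennreal (norm (\<Phi> (polar_density \<mu> t, t))) \<partial>total_variation \<mu>) \<le>
        (\<integral>\<^sup>+ t. ennreal C * ennreal (exp (c * \<bar>t\<bar>)) \<partial>total_variation \<mu>)"
      using p(2) u(2) by (intro nn_integral_mono) (auto simp: \<Phi>_def norm_lscale ennreal_mult''[symmetric] intro!: ennreal_leI)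
    also have "\<dots> = ennreal C * (\<integral>\<^sup>+ t. ennreal (exp (c * \<bar>t\<bar>)) \<partial>total_variation \<mu>)"
      by (intro nn_integral_cmult) measurable
    also have "\<dots> < \<infinity>" using \<mu>(2) by (simp add: exp_integrable_def ennreal_mult_less_top)
    finally show "(\<integral>\<^sup>+ t. ennreal (norm (\<Phi> (polar_density \<mu> t, t))) \<partial>total_variation \<mu>) < \<infinity>" .
  qed
  then have "\<exists>!x. has_bochner_int (total_variation \<mu>) (\<lambda>t. polar_density \<mu> t *\<^sub>l u t) x"
    unfolding \<Phi>_def using has_bochner_int_unique by auto
  from theI'[OF this] have "has_bochner_int (total_variation \<mu>) (\<lambda>t. polar_density \<mu> t *\<^sub>l u t) (quat_integral \<mu> u)"
    unfolding quat_integral_def .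
  then show ?thesis using \<phi> by (rule has_bochner_int_bounded_linear)
qed

section \<open>Cauchy's theorem for cycles\<close>

text \<open>Filled in on the diagonal, the difference quotient of a holomorphic function is jointly
  continuous and holomorphic in each variable; Dixon's argument requires both.\<close>

definition diff_quot :: "(complex \<Rightarrow> complex) \<Rightarrow> complex \<Rightarrow> complex \<Rightarrow> complex" where
  "diff_quot f z w = (if w = z then deriv f z else (f w - f z) / (w - z))"

lemma diff_quot_commute: "diff_quot f z w = diff_quot f w z"
  by (auto simp: diff_quot_def divide_simps) (simp add: algebra_simps)

lemma diff_quot_holomorphic:
  assumes "f holomorphic_on S" "open S"
  shows "diff_quot f w holomorphic_on S"
  using pole_lemma_open[OF assms, of w] by (simp add: diff_quot_def[abs_def])

text \<open>Near a diagonal point (a, a) the linear function with slope f'(a) is subtracted: the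
  derivative of the rest is small on a ball, and the mean value inequality turns this into a bound
  for the difference quotient.\<close>

lemma diff_quot_continuous:
  assumes f: "f holomorphic_on S" and S: "open S"
  shows "continuous_on (S \<times> S) (\<lambda>(z, w). diff_quot f z w)"
proof -
  have cf: "isCont f x" if "x \<in> S" for x
    using f S that by (metis continuous_on_eq_continuous_at holomorphic_on_imp_continuous_on)
  have "isCont (\<lambda>p. diff_quot f (fst p) (snd p)) (a, b)" if ab: "a \<in> S" "b \<in> S" for a b
  proof (cases "a = b")
    case False
    define N where "N = {p :: complex \<times> complex. fst p \<noteq> snd p}"
    have "open N" unfolding N_def by (intro open_Collect_neq continuous_intros)
    moreover have "(a, b) \<in> N" using False by (simp add: N_def)
    ultimately have "\<forall>\<^sub>F p in nhds (a, b). p \<in> N" by (rule eventually_nhds_in_open)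
    then have "\<forall>\<^sub>F p in nhds (a, b). diff_quot f (fst p) (snd p) = (f (snd p) - f (fst p)) / (snd p - fst p)"
      by eventually_elim (auto simp: diff_quot_def N_def)
    moreover have "isCont (\<lambda>p. (f (snd p) - f (fst p)) / (snd p - fst p)) (a, b)"
      using False ab by (intro continuous_intros isCont_o2[of _ fst f] isCont_o2[of _ snd f] cf) auto
    ultimately show ?thesis by (simp add: isCont_cong)
  next
    case True
    have cd: "isCont (deriv f) a"
      by (metis S ab(1) continuous_on_eq_continuous_at f holomorphic_deriv holomorphic_on_imp_continuous_on)
    show ?thesis unfolding continuous_at_eps_delta
    proof (intro allI impI)
      fix e :: real assume e: "e > 0"
      obtain d1 where d1: "d1 > 0" "\<And>x. dist x a < d1 \<Longrightarrow> dist (deriv f x) (deriv f a) < e / 2"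
        using cd e unfolding continuous_at_eps_delta by (meson half_gt_zero)
      obtain d2 where d2: "d2 > 0" "ball a d2 \<subseteq> S" using S ab(1) by (meson openE)
      define d where "d = min d1 d2"
      have d: "d > 0" using d1 d2 by (simp add: d_def)
      have der: "(f has_field_derivative deriv f x) (at x within ball a d)" if "x \<in> ball a d" for x
        using that d2(2) f S holomorphic_derivI[OF f S, of x] d_def by (auto intro: has_field_derivative_at_within)
      have main: "dist (diff_quot f z w) (deriv f a) < e" if zw: "z \<in> ball a d" "w \<in> ball a d" for z w
      proof (cases "w = z")
        case True
        then show ?thesis using d1(2)[of z] zw e by (simp add: diff_quot_def d_def dist_commute)
      next
        case False
        have *: "norm ((f w - deriv f a * w) - (f z - deriv f a * z)) \<le> e / 2 * norm (w - z)"
        proof (rule field_differentiable_bound[where S = "ball a d" and f' = "\<lambda>x. deriv f x - deriv f a"])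
          show "((\<lambda>w. f w - deriv f a * w) has_field_derivative deriv f x - deriv f a) (at x within ball a d)"
            if "x \<in> ball a d" for x
            using der[OF that] by (auto intro!: derivative_eq_intros)
          show "norm (deriv f x - deriv f a) \<le> e / 2" if "x \<in> ball a d" for x
            using d1(2)[of x] that by (simp add: d_def dist_norm norm_minus_commute)
        qed (use zw in auto)
        have "diff_quot f z w - deriv f a = ((f w - deriv f a * w) - (f z - deriv f a * z)) / (w - z)"
          using False by (simp add: diff_quot_def divide_simps) (simp add: algebra_simps)
        then have "norm (diff_quot f z w - deriv f a) =
            norm ((f w - deriv f a * w) - (f z - deriv f a * z)) / norm (w - z)"
          by (simp only: norm_divide)
        then have "norm (diff_quot f z w - deriv f a) \<le> e / 2"
          using * False by (simp add: pos_divide_le_eq)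
        then show ?thesis using e by (simp add: dist_norm)
      qed
      show "\<exists>d>0. \<forall>p. dist p (a, b) < d \<longrightarrow>
              dist (diff_quot f (fst p) (snd p)) (diff_quot f (fst (a, b)) (snd (a, b))) < e"
      proof (intro exI[of _ d] conjI d allI impI)
        fix p :: "complex \<times> complex" assume p: "dist p (a, b) < d"
        have "dist (fst p) a < d" "dist (snd p) a < d"
          using p True dist_fst_le[of p "(a, b)"] dist_snd_le[of p "(a, b)"] by auto
        then have "fst p \<in> ball a d" "snd p \<in> ball a d" by (auto simp: dist_commute)
        from main[OF this] show "dist (diff_quot f (fst p) (snd p)) (diff_quot f (fst (a, b)) (snd (a, b))) < e"
          using True by (simp add: diff_quot_def[of f b b])
      qed
    qed
  qed
  then show ?thesis
    by (auto simp: split_def continuous_on_eq_continuous_at open_Times S intro!: continuous_at_imp_continuous_at_within)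
qed

lemma contour_integral_param_continuous:
  assumes \<gamma>: "\<gamma> C1_differentiable_on {0..1}"
    and c: "continuous_on (U \<times> path_image \<gamma>) (\<lambda>(z, w). F z w)"
  shows "continuous_on U (\<lambda>z. contour_integral \<gamma> (F z))"
proof -
  have cd: "continuous_on {0..1} (\<lambda>t. vector_derivative \<gamma> (at t))"
    using \<gamma> by (simp add: C1_differentiable_on_eq)
  have cg: "continuous_on {0..1} \<gamma>" using \<gamma> C1_differentiable_imp_continuous_on by blast
  have "continuous_on (U \<times> cbox 0 (1::real)) (\<lambda>p. F (fst p) (\<gamma> (snd p)))"
    by (rule continuous_on_compose2[OF c, of _ "\<lambda>p. (fst p, \<gamma> (snd p))", simplified])
       (auto intro!: continuous_intros continuous_on_compose2[OF cg] simp: path_image_def)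
  moreover have "continuous_on (U \<times> cbox 0 (1::real)) (\<lambda>p. vector_derivative \<gamma> (at (snd p)))"
    by (rule continuous_on_compose2[OF cd]) (auto intro!: continuous_intros)
  ultimately have "continuous_on (U \<times> cbox 0 (1::real)) (\<lambda>(z, t). F z (\<gamma> t) * vector_derivative \<gamma> (at t))"
    by (auto simp: split_def intro!: continuous_intros)
  from integral_continuous_on_param[OF this]
  show ?thesis by (simp add: contour_integral_integral vector_derivative_at_within_ivl[symmetric] cong: )
qed

lemma C1_imp_valid_path: "\<gamma> C1_differentiable_on {0..1} \<Longrightarrow> valid_path \<gamma>"
  by (simp add: C1_differentiable_imp_piecewise valid_path_def)

lemma contour_integrable_continuous_C1:
  assumes "\<gamma> C1_differentiable_on {0..1}" "continuous_on (path_image \<gamma>) F"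
  shows "F contour_integrable_on \<gamma>"
proof -
  have "continuous_on {0..1} (\<lambda>t. vector_derivative \<gamma> (at t))" "continuous_on {0..1} \<gamma>"
    using assms(1) C1_differentiable_imp_continuous_on by (auto simp: C1_differentiable_on_eq)
  then show ?thesis using assms(2)
    by (auto simp: contour_integrable_on path_image_def
        intro!: integrable_continuous_interval continuous_intros elim!: continuous_on_compose2)
qed

text \<open>The parameter integral is continuous, and interchanging it with the integral over a
  circle shows that it satisfies Cauchy's formula on small discs. A continuous function with a
  Cauchy integral representation is differentiable.\<close>

lemma diff_quot_integral_holomorphic:
  assumes f: "f holomorphic_on S" and S: "open S"
    and \<gamma>: "\<gamma> C1_differentiable_on {0..1}" "path_image \<gamma> \<subseteq> S"
  shows "(\<lambda>z. contour_integral \<gamma> (diff_quot f z)) holomorphic_on S"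
proof -
  let ?H = "\<lambda>z. contour_integral \<gamma> (diff_quot f z)"
  have cH: "continuous_on S ?H"
    by (rule contour_integral_param_continuous[OF \<gamma>(1) continuous_on_subset[OF diff_quot_continuous[OF f S]]])
       (use \<gamma>(2) in auto)
  have "?H field_differentiable (at z0)" if z0: "z0 \<in> S" for z0
  proof -
    obtain r where r: "r > 0" "cball z0 r \<subseteq> S" using S z0 open_contains_cball by blast
    let ?C = "circlepath z0 r"
    have pC: "path_image ?C \<subseteq> S" using r by (auto simp: path_image_circlepath_nonneg)
    have C1: "?C C1_differentiable_on {0..1}" 
      unfolding C1_differentiable_on_eq
      by (auto simp: vector_derivative_circlepath intro!: continuous_intros differentiableI_vector[OF has_vector_derivative_circlepath])
    have cint: "(diff_quot f u) contour_integrable_on \<gamma>" if "u \<in> S" for u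
      by (rule contour_integrable_continuous_C1[OF \<gamma>(1)])
         (meson \<gamma>(2) continuous_on_subset diff_quot_holomorphic[OF f S] holomorphic_on_imp_continuous_on)
    have "((\<lambda>u. ?H u / (u - z)) has_contour_integral (2 * of_real pi * \<i> * ?H z)) ?C"
      if z: "z \<in> ball z0 r" for z
    proof -
      have zC: "z \<notin> path_image ?C" using z r by (auto simp: path_image_circlepath_nonneg)
      have 1: "contour_integral ?C (\<lambda>u. diff_quot f u w / (u - z)) = 2 * of_real pi * \<i> * diff_quot f z w"
        if w: "w \<in> path_image \<gamma>" for w
      proof (rule contour_integral_unique, rule Cauchy_integral_circlepath_simple)
        have "(\<lambda>u. diff_quot f u w) holomorphic_on S"
          using diff_quot_holomorphic[OF f S, of w] by (simp add: diff_quot_commute[of f _ w])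
        then show "(\<lambda>u. diff_quot f u w) holomorphic_on cball z0 r" using r(2) holomorphic_on_subset by blast
      qed (use z in \<open>auto simp: dist_norm norm_minus_commute\<close>)
      have "contour_integral ?C (\<lambda>u. ?H u / (u - z)) =
          contour_integral ?C (\<lambda>u. contour_integral \<gamma> (\<lambda>w. diff_quot f u w / (u - z)))"
        by (rule contour_integral_eq) (use pC cint contour_integral_div in auto)
      also have "\<dots> = contour_integral \<gamma> (\<lambda>w. contour_integral ?C (\<lambda>u. diff_quot f u w / (u - z)))"
      proof (rule contour_integral_swap)
        have "continuous_on (path_image ?C \<times> path_image \<gamma>) (\<lambda>p. diff_quot f (fst p) (snd p))"
          using continuous_on_subset[OF diff_quot_continuous[OF f S], of "path_image ?C \<times> path_image \<gamma>"] pC \<gamma>(2)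
          by (simp add: split_def Sigma_mono)
        then show "continuous_on (path_image ?C \<times> path_image \<gamma>) (\<lambda>(u, w). diff_quot f u w / (u - z))"
          unfolding split_def using zC by (intro continuous_intros) auto
      qed (use \<gamma>(1) C1 C1_imp_valid_path in \<open>auto simp: C1_differentiable_on_eq\<close>)
      also have "\<dots> = contour_integral \<gamma> (\<lambda>w. 2 * of_real pi * \<i> * diff_quot f z w)"
        by (rule contour_integral_eq) (use 1 in auto)
      also have "\<dots> = 2 * of_real pi * \<i> * ?H z"
        using cint[of z] z r by (simp add: contour_integral_lmul subset_iff)
      finally have "contour_integral ?C (\<lambda>u. ?H u / (u - z)) = 2 * of_real pi * \<i> * ?H z" .
      moreover have "(\<lambda>u. ?H u / (u - z)) contour_integrable_on ?C"
        using zC by (intro contour_integrable_continuous_C1[OF C1] continuous_intros continuous_on_subset[OF cH] pC) auto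
      ultimately show ?thesis using has_contour_integral_integral by metis
    qed
    then have "((\<lambda>z. 2 * of_real pi * \<i> * ?H z) has_field_derivative
        of_nat 1 * contour_integral ?C (\<lambda>u. ?H u / (u - z0)^(Suc 1))) (at z0)"
      by (intro Cauchy_next_derivative_circlepath(2)) (use r cH continuous_on_subset pC in auto)
    then have "(\<lambda>z. 1 / (2 * of_real pi * \<i>) * (2 * of_real pi * \<i> * ?H z)) field_differentiable (at z0)"
      unfolding field_differentiable_def using DERIV_cmult by blast
    then show ?thesis by (simp del: of_real_mult)
  qed
  then show ?thesis by (simp add: holomorphic_on_open S field_differentiable_def)
qed

text \<open>The kernel 1/(w - z) is the first of the powers that can be differentiated under the
  integral sign, each derivative leading to the next power.\<close>

lemma Cauchy_transform_holomorphic: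
  assumes \<gamma>: "\<gamma> C1_differentiable_on {0..1}" and f: "continuous_on (path_image \<gamma>) f"
  shows "(\<lambda>z. contour_integral \<gamma> (\<lambda>w. f w / (w - z))) holomorphic_on - path_image \<gamma>"
proof -
  have op: "open (- path_image \<gamma>)"
    using C1_imp_valid_path[OF \<gamma>] closed_valid_path_image by (auto simp: open_closed)
  obtain B where B: "\<And>t. t \<in> {0..1} \<Longrightarrow> norm (vector_derivative \<gamma> (at t)) \<le> B"
  proof -
    have "bounded ((\<lambda>t. vector_derivative \<gamma> (at t)) ` {0..1})"
      using \<gamma> by (intro compact_imp_bounded compact_continuous_image) (auto simp: C1_differentiable_on_eq)
    then show ?thesis using that unfolding bounded_iff by blast
  qed
  have "((\<lambda>z. contour_integral \<gamma> (\<lambda>w. f w / (w - z))) has_field_derivative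
      of_nat 1 * contour_integral \<gamma> (\<lambda>u. f u / (u - z)^(Suc 1))) (at z)" if "z \<in> - path_image \<gamma>" for z
  proof (rule Cauchy_next_derivative(2)[OF f B, where S = "- path_image \<gamma>"])
    show "((\<lambda>u. f u / (u - w) ^ 1) has_contour_integral contour_integral \<gamma> (\<lambda>w'. f w' / (w' - w))) \<gamma>"
      if "w \<in> - path_image \<gamma> - path_image \<gamma>" for w
      using that by (auto intro!: has_contour_integral_integral contour_integrable_continuous_C1[OF \<gamma>] continuous_intros f)
  qed (use that op C1_imp_valid_path[OF \<gamma>] in auto)
  then show ?thesis using op by (auto simp: holomorphic_on_open)
qed

lemma Cauchy_transform_tendsto_0:
  assumes \<gamma>: "\<gamma> C1_differentiable_on {0..1}" and f: "continuous_on (path_image \<gamma>) f"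
  shows "((\<lambda>z. contour_integral \<gamma> (\<lambda>w. f w / (w - z))) \<longlongrightarrow> 0) at_infinity"
proof -
  have cg: "continuous_on {0..1} \<gamma>" using \<gamma> C1_differentiable_imp_continuous_on by blast
  have "bounded ((\<lambda>t. f (\<gamma> t) * vector_derivative \<gamma> (at t)) ` {0..1})"
    using \<gamma> f cg by (intro compact_imp_bounded compact_continuous_image)
      (auto simp: C1_differentiable_on_eq path_image_def intro!: continuous_intros elim!: continuous_on_compose2)
  then obtain B where B: "\<And>t. t \<in> {0..1} \<Longrightarrow> norm (f (\<gamma> t) * vector_derivative \<gamma> (at t)) \<le> B"
    unfolding bounded_iff by blast
  have "bounded (path_image \<gamma>)"
    using \<gamma> C1_imp_valid_path bounded_valid_path_image by blast
  then obtain R where R: "\<And>w. w \<in> path_image \<gamma> \<Longrightarrow> norm w \<le> R" by (auto simp: bounded_iff)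
  have B0: "B \<ge> 0" using order_trans[OF norm_ge_zero B[of 0]] by simp
  have bd: "norm (contour_integral \<gamma> (\<lambda>w. f w / (w - z))) \<le> B / (norm z - R)" if z: "norm z > R" for z
  proof -
    have zn: "z \<notin> path_image \<gamma>" using R z by force
    have "norm (integral {0..1} (\<lambda>t. f (\<gamma> t) / (\<gamma> t - z) * vector_derivative \<gamma> (at t))) \<le> B / (norm z - R) * (1 - 0)"
    proof (rule integral_bound)
      show "continuous_on {0..1} (\<lambda>t. f (\<gamma> t) / (\<gamma> t - z) * vector_derivative \<gamma> (at t))"
        using \<gamma> f cg zn by (auto simp: C1_differentiable_on_eq path_image_def intro!: continuous_intros elim!: continuous_on_compose2)
      fix t :: real assume t: "t \<in> {0..1}"
      have "norm z - R \<le> norm (\<gamma> t - z)"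
        using norm_triangle_ineq2[of z "\<gamma> t"] R[of "\<gamma> t"] t by (auto simp: path_image_def norm_minus_commute)
      then have "norm (f (\<gamma> t) * vector_derivative \<gamma> (at t)) / norm (\<gamma> t - z) \<le> B / (norm z - R)"
        using z B[OF t] B0 by (intro frac_le) auto
      then show "norm (f (\<gamma> t) / (\<gamma> t - z) * vector_derivative \<gamma> (at t)) \<le> B / (norm z - R)"
        by (simp add: norm_mult norm_divide)
    qed simp
    then show ?thesis by (simp add: contour_integral_integral vector_derivative_at_within_ivl[symmetric])
  qed
  have "((\<lambda>z. B / (norm z - R)) \<longlongrightarrow> 0) (at_infinity :: complex filter)"
    by (intro real_tendsto_divide_at_top tendsto_const) 
       (auto intro!: filterlim_tendsto_add_at_top[where c = "-R" and F=at_infinity and f="\<lambda>_. -R" and g=norm, simplified] filterlim_norm_at_top)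
  then show ?thesis
  proof (rule Lim_null_comparison[rotated])
    show "\<forall>\<^sub>F z in at_infinity. norm (contour_integral \<gamma> (\<lambda>w. f w / (w - z))) \<le> B / (norm z - R)"
      unfolding eventually_at_infinity by (rule exI[of _ "R + 1"]) (auto intro: bd)
  qed
qed


lemma sum_list_holomorphic_on:
  "(\<And>x. x \<in> set xs \<Longrightarrow> (\<lambda>z. g x z) holomorphic_on S) \<Longrightarrow> (\<lambda>z. \<Sum>x\<leftarrow>xs. g x z) holomorphic_on S"
  by (induction xs) (auto intro!: holomorphic_intros)

lemma tendsto_sum_list_0:
  fixes g :: "'a \<Rightarrow> 'b \<Rightarrow> 'c::real_normed_vector"
  shows "(\<And>x. x \<in> set xs \<Longrightarrow> (g x \<longlongrightarrow> 0) F) \<Longrightarrow> ((\<lambda>z. \<Sum>x\<leftarrow>xs. g x z) \<longlongrightarrow> 0) F"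
  by (induction xs) (auto intro!: tendsto_add_zero)

text \<open>Dixon's argument: the sum of the integrals of the difference quotients extends, by the Cauchy
  transform, to an entire function that vanishes at infinity.\<close>

theorem Cauchy_integral_formula_cycle:
  assumes S: "open S" and f: "f holomorphic_on S"
    and \<gamma>s: "\<And>\<gamma>. \<gamma> \<in> set \<gamma>s \<Longrightarrow> \<gamma> C1_differentiable_on {0..1} \<and> path_image \<gamma> \<subseteq> S \<and> pathfinish \<gamma> = pathstart \<gamma>"
    and wn: "\<And>z. z \<notin> S \<Longrightarrow> (\<Sum>\<gamma>\<leftarrow>\<gamma>s. winding_number \<gamma> z) = 0"
    and z: "z \<in> S" "\<And>\<gamma>. \<gamma> \<in> set \<gamma>s \<Longrightarrow> z \<notin> path_image \<gamma>"
  shows "(\<Sum>\<gamma>\<leftarrow>\<gamma>s. contour_integral \<gamma> (\<lambda>w. f w / (w - z))) =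
    2 * of_real pi * \<i> * (\<Sum>\<gamma>\<leftarrow>\<gamma>s. winding_number \<gamma> z) * f z"
proof -
  define P where "P = (\<Union>\<gamma>\<in>set \<gamma>s. path_image \<gamma>)"
  define H where "H z = (\<Sum>\<gamma>\<leftarrow>\<gamma>s. contour_integral \<gamma> (diff_quot f z))" for z
  define G where "G z = (\<Sum>\<gamma>\<leftarrow>\<gamma>s. contour_integral \<gamma> (\<lambda>w. f w / (w - z)))" for z
  define n where "n z = (\<Sum>\<gamma>\<leftarrow>\<gamma>s. winding_number \<gamma> z)" for z
  have vp: "valid_path \<gamma>" "path \<gamma>" if "\<gamma> \<in> set \<gamma>s" for \<gamma>
    using \<gamma>s that C1_imp_valid_path valid_path_imp_path by blast+
  have cf: "continuous_on (path_image \<gamma>) f" if "\<gamma> \<in> set \<gamma>s" for \<gamma>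
    using f \<gamma>s[OF that] by (meson continuous_on_subset holomorphic_on_imp_continuous_on)
  have clP: "closed P" unfolding P_def using vp by (intro closed_UN) (auto simp: closed_valid_path_image)
  have HG: "H z = G z - 2 * of_real pi * \<i> * n z * f z" if z: "z \<in> S" "z \<notin> P" for z
  proof -
    have "contour_integral \<gamma> (diff_quot f z) =
        contour_integral \<gamma> (\<lambda>w. f w / (w - z)) - 2 * of_real pi * \<i> * winding_number \<gamma> z * f z"
      if \<gamma>: "\<gamma> \<in> set \<gamma>s" for \<gamma>
    proof -
      have zn: "z \<notin> path_image \<gamma>" using z \<gamma> by (auto simp: P_def)
      have "contour_integral \<gamma> (diff_quot f z) = contour_integral \<gamma> (\<lambda>w. f w / (w - z) - f z * (1 / (w - z)))"
        by (rule contour_integral_eq) (use zn in \<open>auto simp: diff_quot_def diff_divide_distrib\<close>)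
      also have "\<dots> = contour_integral \<gamma> (\<lambda>w. f w / (w - z)) - contour_integral \<gamma> (\<lambda>w. f z * (1 / (w - z)))"
        by (intro contour_integral_diff contour_integrable_continuous_C1 continuous_intros cf \<gamma>)
           (use \<gamma>s \<gamma> zn in auto)
      also have "contour_integral \<gamma> (\<lambda>w. f z * (1 / (w - z))) = f z * (2 * of_real pi * \<i> * winding_number \<gamma> z)"
        by (intro contour_integral_unique has_contour_integral_lmul)
           (use has_contour_integral_winding_number[OF vp(1)[OF \<gamma>] zn] in auto)
      finally show ?thesis by (simp add: mult_ac)
    qed
    then have "H z = (\<Sum>\<gamma>\<leftarrow>\<gamma>s. contour_integral \<gamma> (\<lambda>w. f w / (w - z)) - 2 * of_real pi * \<i> * winding_number \<gamma> z * f z)"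
      unfolding H_def by (simp cong: map_cong)
    also have "\<dots> = G z - 2 * of_real pi * \<i> * n z * f z"
      unfolding G_def n_def by (simp add: sum_list_subtractf sum_list_const_mult sum_list_mult_const)
    finally show ?thesis .
  qed
  \<comment> \<open>On this open set the correction term in \<open>HG\<close> vanishes, so
    \<open>G\<close> continues \<open>H\<close> there; the hypothesis on winding numbers says that
    \<open>V\<close> covers the complement of \<open>S\<close>.\<close>
  define V where "V = {z. z \<notin> P \<and> n z = 0}"
  have opV: "open V"
  proof -
    have "\<exists>e>0. ball z e \<subseteq> V" if z: "z \<in> V" for z
    proof -
      obtain e where e: "e > 0" "ball z e \<subseteq> - P" using clP z by (metis ComplI V_def mem_Collect_eq open_Compl openE)
      have "winding_number \<gamma> w = winding_number \<gamma> z" if "w \<in> ball z e" "\<gamma> \<in> set \<gamma>s" for w \<gamma>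
      proof -
        have "winding_number \<gamma> constant_on ball z e"
          by (rule winding_number_constant) (use that(2) e vp \<gamma>s in \<open>auto simp: P_def\<close>)
        then obtain c where "\<forall>x\<in>ball z e. winding_number \<gamma> x = c" unfolding constant_on_def by blast
        then show ?thesis using that(1) e(1) by simp
      qed
      then have nw: "n w = n z" if "w \<in> ball z e" for w
        using that unfolding n_def by (simp cong: map_cong)
      have "w \<in> V" if "w \<in> ball z e" for w
        using nw[OF that] that e(2) z unfolding V_def by auto
      then have "ball z e \<subseteq> V" by blast
      then show ?thesis using e by blast
    qed
    then show ?thesis by (auto simp: open_contains_ball)
  qed
  have PS: "P \<subseteq> S" using \<gamma>s by (auto simp: P_def)
  have "z \<in> V" if "z \<notin> S" for z using PS that wn[OF that] by (auto simp: V_def n_def)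
  then have cover: "S \<union> V = UNIV" by blast
  define h where "h z = (if z \<in> S then H z else G z)" for z
  have hS: "H holomorphic_on S" unfolding H_def
    by (intro sum_list_holomorphic_on diff_quot_integral_holomorphic f S) (use \<gamma>s in auto)
  have hV: "G holomorphic_on V" unfolding G_def
  proof (intro sum_list_holomorphic_on)
    fix \<gamma> assume \<gamma>: "\<gamma> \<in> set \<gamma>s"
    show "(\<lambda>z. contour_integral \<gamma> (\<lambda>w. f w / (w - z))) holomorphic_on V"
      by (rule holomorphic_on_subset[OF Cauchy_transform_holomorphic[OF _ cf[OF \<gamma>]]])
         (use \<gamma> \<gamma>s in \<open>auto simp: V_def P_def\<close>)
  qed
  have hUN: "h holomorphic_on UNIV"
    unfolding h_def cover[symmetric] by (intro holomorphic_on_If_Un hS hV S opV) (auto simp: HG V_def)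
  have "bounded P" unfolding P_def using vp bounded_valid_path_image by (intro bounded_UN) auto
  then obtain R where "\<And>w. w \<in> P \<Longrightarrow> norm w \<le> R" unfolding bounded_iff by blast
  then have R: "P \<subseteq> cball 0 R" by auto
  \<comment> \<open>Outside a disc that contains all curves every winding number is zero, so
    \<open>h\<close> is the Cauchy transform there and decays.\<close>
  have far: "h z = G z" if "norm z > R" for z
  proof (cases "z \<in> S")
    case True
    have "winding_number \<gamma> z = 0" if "\<gamma> \<in> set \<gamma>s" for \<gamma>
      by (rule winding_number_zero_outside[of _ "cball 0 R"]) (use that R vp(2)[OF that] \<gamma>s[OF that] \<open>norm z > R\<close> in \<open>auto simp: P_def\<close>)
    then have "n z = 0" unfolding n_def by (simp cong: map_cong)
    moreover have "z \<notin> P" using R that by auto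
    ultimately show ?thesis using HG[of z] True by (simp add: h_def)
  qed (simp add: h_def)
  have "(G \<longlongrightarrow> 0) at_infinity" unfolding G_def
    using \<gamma>s cf by (intro tendsto_sum_list_0 Cauchy_transform_tendsto_0) auto
  moreover have "\<forall>\<^sub>F z in at_infinity. G z = h z"
    unfolding eventually_at_infinity by (rule exI[of _ "R + 1"]) (use far in auto)
  ultimately have "(h \<longlongrightarrow> 0) at_infinity" by (rule Lim_transform_eventually)
  then have "h z = 0" by (rule Liouville_weak_0[OF hUN])
  moreover have "z \<notin> P" using z(2) by (auto simp: P_def)
  ultimately have "G z = 2 * of_real pi * \<i> * n z * f z" using HG[of z] z(1) by (simp add: h_def)
  then show ?thesis unfolding G_def n_def .
qed

text \<open>This is the integral formula for f(w)(w - z), which vanishes at z. A point z of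
  \<open>S\<close> off the curves exists because the union of the curves is compact and nonempty and
  so cannot equal an open subset of the plane.\<close>

corollary Cauchy_theorem_cycle:
  assumes S: "open S" and f: "f holomorphic_on S"
    and \<gamma>s: "\<And>\<gamma>. \<gamma> \<in> set \<gamma>s \<Longrightarrow> \<gamma> C1_differentiable_on {0..1} \<and> path_image \<gamma> \<subseteq> S \<and> pathfinish \<gamma> = pathstart \<gamma>"
    and wn: "\<And>z. z \<notin> S \<Longrightarrow> (\<Sum>\<gamma>\<leftarrow>\<gamma>s. winding_number \<gamma> z) = 0"
  shows "(\<Sum>\<gamma>\<leftarrow>\<gamma>s. contour_integral \<gamma> f) = 0"
proof (cases "\<gamma>s = []")
  case False
  define P where "P = (\<Union>\<gamma>\<in>set \<gamma>s. path_image \<gamma>)"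
  have "P \<subseteq> S" using \<gamma>s by (auto simp: P_def)
  moreover have "P \<noteq> {}" using False by (auto simp: P_def)
  moreover have "compact P" unfolding P_def using \<gamma>s C1_imp_valid_path compact_valid_path_image
    by (intro compact_UN) blast+
  ultimately have "P \<noteq> S" using S compact_open by blast
  then obtain z where z: "z \<in> S" "z \<notin> P" using \<open>P \<subseteq> S\<close> by blast
  have "(\<Sum>\<gamma>\<leftarrow>\<gamma>s. contour_integral \<gamma> (\<lambda>w. (f w * (w - z)) / (w - z))) =
    2 * of_real pi * \<i> * (\<Sum>\<gamma>\<leftarrow>\<gamma>s. winding_number \<gamma> z) * (f z * (z - z))"
    by (rule Cauchy_integral_formula_cycle[OF S])
       (use z \<gamma>s wn in \<open>auto simp: P_def intro!: holomorphic_intros f\<close>)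
  then have 0: "(\<Sum>\<gamma>\<leftarrow>\<gamma>s. contour_integral \<gamma> (\<lambda>w. (f w * (w - z)) / (w - z))) = 0" by (simp only: diff_self mult_zero_right)
  have eq: "contour_integral \<gamma> f = contour_integral \<gamma> (\<lambda>w. (f w * (w - z)) / (w - z))"
    if "\<gamma> \<in> set \<gamma>s" for \<gamma>
    by (rule contour_integral_eq) (use that z in \<open>auto simp: P_def\<close>)
  have "(\<Sum>\<gamma>\<leftarrow>\<gamma>s. contour_integral \<gamma> f) = (\<Sum>\<gamma>\<leftarrow>\<gamma>s. contour_integral \<gamma> (\<lambda>w. (f w * (w - z)) / (w - z)))"
    by (rule arg_cong[where f = sum_list], rule map_cong[OF refl], rule eq)
  also note 0
  finally show ?thesis .
qed simp

section \<open>Limits of trigonometric polynomials\<close>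

text \<open>All frequencies are integer multiples of one base frequency \<open>y\<close>, so the
  members are functions of the single point \<open>cis (y * t)\<close> of the circle, where
  Stone-Weierstrass can be applied.\<close>

inductive_set trig_polys :: "real \<Rightarrow> (real \<Rightarrow> complex) set" for y where
  exp: "(\<lambda>t. cis (of_int k * y * t)) \<in> trig_polys y"
| scale: "p \<in> trig_polys y \<Longrightarrow> (\<lambda>t. c * p t) \<in> trig_polys y"
| add: "p \<in> trig_polys y \<Longrightarrow> q \<in> trig_polys y \<Longrightarrow> (\<lambda>t. p t + q t) \<in> trig_polys y"

lemma trig_polys_mult:
  assumes "p \<in> trig_polys y" "q \<in> trig_polys y"
  shows "(\<lambda>t. p t * q t) \<in> trig_polys y"
  using assms
proof (induction arbitrary: q)
  case (exp k)
  from exp show ?case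
  proof induction
    case (exp l)
    then show ?case using trig_polys.exp[of "k + l" y] by (simp add: cis_mult algebra_simps)
  next
    case (scale p c)
    from trig_polys.scale[OF scale.IH, of c] show ?case by (simp add: mult_ac)
  next
    case (add p q)
    from trig_polys.add[OF add.IH] show ?case by (simp add: distrib_left)
  qed
next
  case (scale p c)
  from trig_polys.scale[OF scale.IH[OF scale.prems], of c] show ?case by (simp add: mult_ac)
next
  case (add p r)
  from trig_polys.add[OF add.IH(1)[OF add.prems] add.IH(2)[OF add.prems]] show ?case by (simp add: distrib_right)
qed

lemma trig_polys_const: "(\<lambda>t. c) \<in> trig_polys y"
  using trig_polys.scale[OF trig_polys.exp[of 0 y], of c] by simp

text \<open>Polynomials on the plane, which are what Stone-Weierstrass supplies, restrict to
  trigonometric polynomials on the circle.\<close>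

lemma trig_polys_real_polynomial_function:
  assumes "real_polynomial_function (p :: complex \<Rightarrow> real)"
  shows "(\<lambda>t. of_real (p (cis (y * t)))) \<in> trig_polys y"
  using assms
proof induction
  case (linear p)
  have e: "(\<lambda>t. cis (y * t)) \<in> trig_polys y" "(\<lambda>t. cis (- (y * t))) \<in> trig_polys y"
    using trig_polys.exp[of 1 y] trig_polys.exp[of "-1" y] by simp_all
  \<comment> \<open>A real linear functional sees \<open>cis x\<close> as cos x times its value at 1
    plus sin x times its value at \<i>; Euler's formulas do the rest.\<close>
  have eq: "complex_of_real (p (cis x)) =
      (p 1 - \<i> * p \<i>) / 2 * cis x + (p 1 + \<i> * p \<i>) / 2 * cis (- x)" for x
  proof -
    interpret bounded_linear p by fact
    have "p (cis x) = p (cos x *\<^sub>R 1 + sin x *\<^sub>R \<i>)"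
      by (rule arg_cong[of _ _ p]) (simp add: complex_eq_iff)
    then have "p (cis x) = cos x * p 1 + sin x * p \<i>" by (simp add: add scaleR)
    then show ?thesis by (simp add: complex_eq_iff field_simps)
  qed
  then show ?case
    using trig_polys.add[OF trig_polys.scale[OF e(1)] trig_polys.scale[OF e(2)]] by (simp only: eq)
next
  case (const c)
  then show ?case by (rule trig_polys_const)
next
  case (add p q)
  from trig_polys.add[OF add.IH] show ?case by simp
next
  case (mult p q)
  from trig_polys_mult[OF mult.IH] show ?case by simp
qed

lemma trig_polys_polynomial_function:
  assumes "polynomial_function (p :: complex \<Rightarrow> complex)"
  shows "(\<lambda>t. p (cis (y * t))) \<in> trig_polys y"
proof -
  have "real_polynomial_function (Re \<circ> p)" "real_polynomial_function (Im \<circ> p)"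
    using assms by (auto simp: polynomial_function_def bounded_linear_Re bounded_linear_Im)
  from this[THEN trig_polys_real_polynomial_function, of y]
  have "(\<lambda>t. complex_of_real (Re (p (cis (y * t)))) + \<i> * complex_of_real (Im (p (cis (y * t))))) \<in> trig_polys y"
    using trig_polys.add trig_polys.scale by fastforce
  then show ?thesis by (simp add: complex_eq[symmetric])
qed

lemma abs_Arg_cis_le: "\<bar>Arg (cis x)\<bar> \<le> \<bar>x\<bar>"
proof (cases "-pi < x \<and> x \<le> pi")
  case True
  then have "Arg (cis x) = x" by (intro Arg_cis) auto
  then show ?thesis by simp
next
  case False
  then have "\<bar>x\<bar> \<ge> pi" by auto
  moreover have "\<bar>Arg (cis x)\<bar> \<le> pi" using Arg_bounded[of "cis x"] by auto
  ultimately show ?thesis by linarith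
qed

text \<open>The approximants are trigonometric polynomials of large period; the growth of the periodic
  functions they are close to is controlled by \<open>|Arg (cis x)| \<le> |x|\<close>.\<close>

lemma exponential_closure:
  fixes \<G> :: "(real \<Rightarrow> complex) set" and G :: "real \<Rightarrow> complex"
  assumes add: "\<And>f g. f \<in> \<G> \<Longrightarrow> g \<in> \<G> \<Longrightarrow> (\<lambda>t. f t + g t) \<in> \<G>"
    and scale: "\<And>f c. f \<in> \<G> \<Longrightarrow> (\<lambda>t. c * f t) \<in> \<G>"
    and exp: "\<And>y. (\<lambda>t. cis (y * t)) \<in> \<G>"
    and lim: "\<And>f g C. (\<And>n::nat. f n \<in> \<G>) \<Longrightarrow> (\<And>t. (\<lambda>n. f n t) \<longlonglongrightarrow> g t) \<Longrightarrow>
      (\<And>n t. norm (f n t) \<le> C * exp (\<omega> * \<bar>t\<bar>)) \<Longrightarrow> g \<in> \<G>"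
    and \<omega>: "\<omega> \<ge> 0" and G: "continuous_on UNIV G" "\<And>t. norm (G t) \<le> C * exp (\<omega> * \<bar>t\<bar>)"
  shows "G \<in> \<G>"
proof -
  have tp: "p \<in> \<G>" if "p \<in> trig_polys y" for p y
    using that
  proof induction
    case (exp k)
    from assms(3)[of "of_int k * y"] show ?case .
  qed (auto intro: assms(1,2))
  have C0: "C \<ge> 0" using order_trans[OF norm_ge_zero G(2)[of 0]] by simp
  define N where "N n = real (Suc n)" for n
  have N: "N n > 0" for n by (simp add: N_def)
  \<comment> \<open>The part of \<open>G\<close> on [-N, N] is carried to the unit circle by t = N
    Arg z / \<pi>. Its two ends meet at -1, where \<open>Arg\<close> jumps; the first factor
    vanishes there and restores continuity. For fixed t the point on the circle tends to 1 as N
    grows, so that factor is eventually 1 and \<open>G t\<close> is recovered.\<close>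
  define g where "g n z = of_real (min 1 (N n * norm (z + 1))) * G (N n * Arg z / pi)" for n and z :: complex
  have g_bd: "norm (g n (cis (pi / N n * t))) \<le> C * exp (\<omega> * \<bar>t\<bar>)" for n t
  proof -
    have "\<bar>Arg (cis (pi / N n * t))\<bar> \<le> pi / N n * \<bar>t\<bar>"
      using abs_Arg_cis_le[of "pi / N n * t"] N[of n] by (simp add: abs_mult)
    then have "\<bar>N n * Arg (cis (pi / N n * t)) / pi\<bar> \<le> \<bar>t\<bar>"
      using N[of n] by (simp add: abs_mult field_simps)
    then have "exp (\<omega> * \<bar>N n * Arg (cis (pi / N n * t)) / pi\<bar>) \<le> exp (\<omega> * \<bar>t\<bar>)"
      by (intro iffD2[OF exp_le_cancel_iff] mult_left_mono \<omega>)
    then have "norm (G (N n * Arg (cis (pi / N n * t)) / pi)) \<le> C * exp (\<omega> * \<bar>t\<bar>)"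
      using G(2)[of "N n * Arg (cis (pi / N n * t)) / pi"] C0 by (meson mult_left_mono order_trans)
    moreover have "norm (g n z) \<le> 1 * norm (G (N n * Arg z / pi))" for z
      unfolding g_def norm_mult by (intro mult_right_mono) (use N[of n] in auto)
    ultimately show ?thesis by (metis mult_1 order_trans)
  qed
  have g_cont: "continuous_on (sphere 0 1) (g n)" for n
    unfolding continuous_on_eq_continuous_within
  proof
    fix z :: complex assume z: "z \<in> sphere 0 1"
    show "continuous (at z within sphere 0 1) (g n)"
    proof (cases "z \<in> \<real>\<^sub>\<le>\<^sub>0")
      case False
      have "isCont G x" for x using G(1) by (simp add: continuous_on_eq_continuous_at)
      then have "isCont (\<lambda>z. G (N n * Arg z / pi)) z"
        by (intro isCont_o2[of z "\<lambda>z. N n * Arg z / pi" G] continuous_intros continuous_at_Arg False) auto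
      then have "isCont (g n) z" unfolding g_def by (intro continuous_intros)
      then show ?thesis by (rule continuous_at_imp_continuous_at_within)
    next
      case True
      then have z1: "z = -1" using z by (auto elim!: nonpos_Reals_cases)
      define B where "B = C * exp (\<omega> * N n)"
      have B: "norm (g n w) \<le> (N n * norm (w + 1)) * B" for w
      proof -
        have "\<bar>N n * Arg w / pi\<bar> \<le> N n"
          using Arg_bounded[of w] N[of n] by (auto simp: abs_mult field_simps)
        then have "exp (\<omega> * \<bar>N n * Arg w / pi\<bar>) \<le> exp (\<omega> * N n)"
          by (intro iffD2[OF exp_le_cancel_iff] mult_left_mono \<omega>)
        then have "norm (G (N n * Arg w / pi)) \<le> B"
          unfolding B_def using G(2)[of "N n * Arg w / pi"] C0 by (meson mult_left_mono order_trans)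
        then show ?thesis unfolding g_def norm_mult using N[of n] by (intro mult_mono) auto
      qed
      have "((\<lambda>w. (N n * norm (w + 1)) * B) \<longlongrightarrow> (N n * norm (z + 1)) * B) (at z within sphere 0 1)"
        by (intro tendsto_intros)
      then have "((\<lambda>w. (N n * norm (w + 1)) * B) \<longlongrightarrow> 0) (at z within sphere 0 1)" by (simp add: z1)
      from Lim_null_comparison[OF _ this, of "g n"] B
      show ?thesis by (simp add: continuous_within z1 g_def)
    qed
  qed
  have "\<exists>p. polynomial_function p \<and> (\<forall>z\<in>sphere 0 1. norm (g n z - p z) < 1 / N n)" for n
    using Stone_Weierstrass_polynomial_function[OF compact_sphere g_cont, of "1 / N n" n] N[of n] by auto
  then obtain p where p: "\<And>n. polynomial_function (p n)" "\<And>n z. norm z = 1 \<Longrightarrow> norm (g n z - p n z) < 1 / N n"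
    by (metis mem_sphere_0)
  define f where "f n t = p n (cis (pi / N n * t))" for n t
  have err: "norm (g n (cis (pi / N n * t)) - f n t) < 1 / N n" for n t
    unfolding f_def by (rule p(2)) simp
  show ?thesis
  proof (rule lim[of f G "C + 1"])
    show "f n \<in> \<G>" for n
      unfolding f_def by (rule tp[OF trig_polys_polynomial_function[OF p(1)]])
    show "norm (f n t) \<le> (C + 1) * exp (\<omega> * \<bar>t\<bar>)" for n t
    proof -
      have "norm (f n t) \<le> norm (g n (cis (pi / N n * t))) + norm (g n (cis (pi / N n * t)) - f n t)"
        by (metis norm_minus_commute norm_triangle_sub)
      also have "\<dots> \<le> C * exp (\<omega> * \<bar>t\<bar>) + 1"
        using g_bd[of n t] err[of n t] by (intro add_mono) (auto simp: N_def intro: order_trans[OF less_imp_le])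
      also have "\<dots> \<le> (C + 1) * exp (\<omega> * \<bar>t\<bar>)" using \<omega> by (simp add: distrib_right)
      finally show ?thesis .
    qed
    show "(\<lambda>n. f n t) \<longlonglongrightarrow> G t" for t
    proof -
      have c1: "(\<lambda>n. 1 / N n) \<longlonglongrightarrow> 0" unfolding N_def using LIMSEQ_inverse_real_of_nat by (simp add: inverse_eq_divide)
      have c2: "(\<lambda>n. norm (cis (pi * t * (1 / N n)) + 1)) \<longlonglongrightarrow> norm (cis (pi * t * 0) + 1)"
        by (intro tendsto_intros c1)
      then have "(\<lambda>n. norm (cis (pi / N n * t) + 1)) \<longlonglongrightarrow> 2" by (simp add: mult_ac)
      then have e1: "\<forall>\<^sub>F n in sequentially. norm (cis (pi / N n * t) + 1) > 1" by (rule order_tendstoD) simp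
      have e2: "\<forall>\<^sub>F n in sequentially. N n > \<bar>t\<bar>"
        unfolding N_def using eventually_gt_at_top[of "nat \<lceil>\<bar>t\<bar>\<rceil>"] by eventually_elim linarith
      have "\<forall>\<^sub>F n in sequentially. norm (f n t - G t) \<le> 1 / N n"
        using e1 e2
      proof eventually_elim
        case (elim n)
        have "\<bar>pi / N n * t\<bar> < pi" using elim(2) N[of n] by (simp add: abs_mult field_simps)
        then have "Arg (cis (pi / N n * t)) = pi / N n * t" by (intro Arg_cis) (simp only: abs_less_iff greaterThanAtMost_iff, linarith)
        moreover have "1 \<le> N n * norm (cis (pi / N n * t) + 1)"
          using elim(1) mult_mono[of 1 "N n" 1 "norm (cis (pi / N n * t) + 1)"] by (simp add: N_def)
        ultimately have "g n (cis (pi / N n * t)) = G t" using N[of n] by (simp add: g_def)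
        then show ?case using err[of n t] by (simp add: norm_minus_commute)
      qed
      then have "(\<lambda>n. f n t - G t) \<longlonglongrightarrow> 0" by (rule Lim_null_comparison[OF _ c1])
      then show ?thesis by (simp add: LIM_zero_iff)
    qed
  qed
qed

section \<open>The Hahn-Banach theorem\<close>

text \<open>Functionals on subspaces are handled as their graphs, which are subspaces of
  \<^typ>\<open>'a \<times> real\<close>; single-valuedness follows from the norm bound.\<close>

lemma Hahn_Banach_separating:
  fixes v :: "'a::real_normed_vector"
  shows "\<exists>\<phi> :: 'a \<Rightarrow> real. bounded_linear \<phi> \<and> \<phi> v = norm v"
proof -
  define \<A> where "\<A> = {G :: ('a \<times> real) set. subspace G \<and> (v, norm v) \<in> G \<and> (\<forall>(x, r)\<in>G. r \<le> norm x)}"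
  have "span {(v, norm v)} \<in> \<A>"
  proof -
    have "r \<le> norm x" if "(x, r) \<in> span {(v, norm v)}" for x r
      using that by (auto simp: span_singleton) (metis abs_ge_self mult_right_mono norm_ge_zero)
    then show ?thesis by (auto simp: \<A>_def span_base)
  qed
  then have "\<A> \<noteq> {}" by blast
  then have "\<exists>G\<in>\<A>. \<forall>X\<in>\<A>. G \<subseteq> X \<longrightarrow> X = G"
  proof (rule subset_Zorn_nonempty)
    fix \<C> assume C: "\<C> \<noteq> {}" "subset.chain \<A> \<C>"
    have CA: "G \<in> \<A>" if "G \<in> \<C>" for G using C(2) that unfolding subset_chain_def by blast
    have CA': "subspace G" "(v, norm v) \<in> G" "(x, r) \<in> G \<Longrightarrow> r \<le> norm x" if "G \<in> \<C>" for G x r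
      using CA[OF that] by (auto simp: \<A>_def)
    have ch: "G \<subseteq> H \<or> H \<subseteq> G" if "G \<in> \<C>" "H \<in> \<C>" for G H
      using C(2) that unfolding subset_chain_def by blast
    have tot: "\<exists>H\<in>\<C>. p \<in> H \<and> q \<in> H" if "p \<in> \<Union>\<C>" "q \<in> \<Union>\<C>" for p q
    proof -
      obtain G H where "G \<in> \<C>" "H \<in> \<C>" "p \<in> G" "q \<in> H" using \<open>p \<in> \<Union>\<C>\<close> \<open>q \<in> \<Union>\<C>\<close> by blast
      moreover from this have "G \<subseteq> H \<or> H \<subseteq> G" by (intro ch)
      ultimately show ?thesis by blast
    qed
    have "subspace (\<Union>\<C>)"
      unfolding subspace_def
    proof (intro conjI ballI allI)
      show "0 \<in> \<Union>\<C>" using C(1) subspace_0[OF CA'(1)] by blast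
      show "x + y \<in> \<Union>\<C>" if "x \<in> \<Union>\<C>" "y \<in> \<Union>\<C>" for x y
        using tot[OF that] subspace_add[OF CA'(1)] by blast
      show "c *\<^sub>R x \<in> \<Union>\<C>" if "x \<in> \<Union>\<C>" for c x
        using that subspace_scale[OF CA'(1)] by blast
    qed
    then show "\<Union>\<C> \<in> \<A>" using C(1) CA' unfolding \<A>_def by blast
  qed
  then obtain G where G: "G \<in> \<A>" and max: "\<And>X. X \<in> \<A> \<Longrightarrow> G \<subseteq> X \<Longrightarrow> X = G" by blast
  have sG: "subspace G" and vG: "(v, norm v) \<in> G" and bG: "\<And>x r. (x, r) \<in> G \<Longrightarrow> r \<le> norm x"
    using G by (auto simp: \<A>_def)
  have ex: "\<exists>c. (y, c) \<in> G" for y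
  proof -
    \<comment> \<open>An extension to \<open>y\<close> by the value c stays below the norm if r - |x
      - y| \<le> c \<le> |x' + y| - r' for all (x, r) and (x', r') in the graph. The triangle
      inequality puts every lower bound below every upper bound, so the supremum of the lower bounds
      can serve as c.\<close>
    define L where "L = (\<lambda>(x, r). r - norm (x - y)) ` G"
    have le: "l \<le> norm (x' + y) - r'" if lL: "l \<in> L" and xr': "(x', r') \<in> G" for l x' r'
    proof -
      obtain x r where xr: "(x, r) \<in> G" "l = r - norm (x - y)" using lL by (auto simp: L_def)
      have "(x + x', r + r') \<in> G" using subspace_add[OF sG xr(1) xr'] by simp
      then have "r + r' \<le> norm (x + x')" by (rule bG)
      also have "\<dots> = norm ((x - y) + (x' + y))" by (simp add: algebra_simps)
      also have "\<dots> \<le> norm (x - y) + norm (x' + y)" by (rule norm_triangle_ineq)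
      finally show ?thesis using xr by simp
    qed
    have Lne: "L \<noteq> {}" using vG by (auto simp: L_def)
    have bdd: "bdd_above L" using le[OF _ vG] by (auto simp: bdd_above_def)
    define c where "c = Sup L"
    have c1: "r - norm (x - y) \<le> c" if "(x, r) \<in> G" for x r
      unfolding c_def by (rule cSup_upper[OF _ bdd]) (use that in \<open>force simp: L_def\<close>)
    have c2: "c \<le> norm (x + y) - r" if "(x, r) \<in> G" for x r
      unfolding c_def by (rule cSup_least[OF Lne]) (use le that in blast)
    define X where "X = {p + a *\<^sub>R (y, c) | p a. p \<in> G}"
    have GX: "G \<subseteq> X"
    proof
      fix p assume "p \<in> G"
      then have "p = p + 0 *\<^sub>R (y, c) \<and> p \<in> G" by (simp add: zero_prod_def)
      then show "p \<in> X" unfolding X_def by blast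
    qed
    have "subspace X"
      unfolding subspace_def
    proof (intro conjI ballI allI)
      show "0 \<in> X" using subspace_0[OF sG] GX by blast
      fix p assume "p \<in> X"
      then obtain p' a where p: "p = p' + a *\<^sub>R (y, c)" "p' \<in> G" by (auto simp: X_def)
      show "k *\<^sub>R p \<in> X" for k
        unfolding X_def mem_Collect_eq
        by (rule exI[of _ "k *\<^sub>R p'"], rule exI[of _ "k * a"])
           (use p subspace_scale[OF sG] in \<open>simp add: scaleR_add_right del: scaleR_Pair\<close>)
      fix q assume "q \<in> X"
      then obtain q' b where q: "q = q' + b *\<^sub>R (y, c)" "q' \<in> G" by (auto simp: X_def)
      show "p + q \<in> X"
        unfolding X_def mem_Collect_eq
        by (rule exI[of _ "p' + q'"], rule exI[of _ "a + b"])
           (use p q subspace_add[OF sG] in \<open>simp add: scaleR_add_left del: scaleR_Pair\<close>)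
    qed
    moreover have "r \<le> norm x" if xX: "(x, r) \<in> X" for x r
    proof -
      obtain x' r' a where *: "(x', r') \<in> G" "x = x' + a *\<^sub>R y" "r = r' + a * c"
        using xX by (auto simp: X_def)
      have sc: "(k *\<^sub>R x', k * r') \<in> G" for k using subspace_scale[OF sG *(1), of k] by simp
      \<comment> \<open>Scaling by 1/|a| reduces the bound to the coefficients 1 and -1 of
        \<open>y\<close>, which \<open>c2\<close> and \<open>c1\<close> settle.\<close>
      consider "a = 0" | "a > 0" | "a < 0" by linarith
      then show ?thesis
      proof cases
        case 1 then show ?thesis using * bG by simp
      next
        case 2
        have "a * c \<le> a * (norm (inverse a *\<^sub>R x' + y) - inverse a * r')"
          using c2[OF sc[of "inverse a"]] 2 by (intro mult_left_mono) auto
        also have "\<dots> = norm (a *\<^sub>R (inverse a *\<^sub>R x' + y)) - r'"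
          unfolding norm_scaleR right_diff_distrib using 2 by simp
        also have "a *\<^sub>R (inverse a *\<^sub>R x' + y) = x" using 2 * by (simp add: scaleR_add_right)
        finally show ?thesis using * by simp
      next
        case 3
        define b where "b = - a"
        have b: "b > 0" using 3 by (simp add: b_def)
        have "b * (inverse b * r' - norm (inverse b *\<^sub>R x' - y)) \<le> b * c"
          using c1[OF sc[of "inverse b"]] b by (intro mult_left_mono) auto
        moreover have "b * (inverse b * r' - norm (inverse b *\<^sub>R x' - y)) =
            r' - norm (b *\<^sub>R (inverse b *\<^sub>R x' - y))"
          unfolding norm_scaleR right_diff_distrib using b by simp
        moreover have "b *\<^sub>R (inverse b *\<^sub>R x' - y) = x" using b * by (simp add: scaleR_diff_right b_def)
        moreover have "r = r' - b * c" using * by (simp add: b_def)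
        ultimately show ?thesis by simp
      qed
    qed
    ultimately have "X \<in> \<A>" using vG GX by (auto simp: \<A>_def)
    then have "X = G" using GX by (rule max)
    moreover have "(y, c) = 0 + 1 *\<^sub>R (y, c) \<and> 0 \<in> G" using subspace_0[OF sG] by (simp add: zero_prod_def)
    then have "(y, c) \<in> X" unfolding X_def by blast
    ultimately show ?thesis by blast
  qed
  \<comment> \<open>Two values at one point would put (0, r - s) and (0, s - r) into the graph, and
    the norm bound makes both second components nonpositive.\<close>
  have uniq: "r = s" if "(x, r) \<in> G" "(x, s) \<in> G" for x r s
    using subspace_diff[OF sG that] subspace_diff[OF sG that(2,1)] bG[of 0 "r - s"] bG[of 0 "s - r"] by simp
  define \<phi> where "\<phi> x = (THE c. (x, c) \<in> G)" for x
  have \<phi>: "(x, \<phi> x) \<in> G" for x unfolding \<phi>_def by (rule theI') (use ex uniq in blast)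
  have eq: "\<phi> x = r" if "(x, r) \<in> G" for x r using uniq \<phi> that by blast
  have "bounded_linear \<phi>"
  proof (rule bounded_linear_intro[where K = 1])
    show "\<phi> (x + y) = \<phi> x + \<phi> y" for x y using subspace_add[OF sG \<phi> \<phi>, of x y] by (intro eq) simp
    show "\<phi> (r *\<^sub>R x) = r *\<^sub>R \<phi> x" for r x using subspace_scale[OF sG \<phi>, of r x] by (intro eq) simp
    show "norm (\<phi> x) \<le> norm x * 1" for x
      using bG[OF \<phi>[of x]] bG[OF subspace_neg[OF sG \<phi>[of x], simplified]] by auto
  qed
  then show ?thesis using eq[OF vG] by blast
qed

section \<open>Slices of the quaternions\<close>

lemma quat_sel_simps [simp]:
  "qRe (x + y) = qRe x + qRe y" "qIm1 (x + y) = qIm1 x + qIm1 y" "qIm2 (x + y) = qIm2 x + qIm2 y" "qIm3 (x + y) = qIm3 x + qIm3 y"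
  "qRe (x - y) = qRe x - qRe y" "qIm1 (x - y) = qIm1 x - qIm1 y" "qIm2 (x - y) = qIm2 x - qIm2 y" "qIm3 (x - y) = qIm3 x - qIm3 y"
  "qRe (- x) = - qRe x" "qIm1 (- x) = - qIm1 x" "qIm2 (- x) = - qIm2 x" "qIm3 (- x) = - qIm3 x"
  "qRe (r *\<^sub>R x) = r * qRe x" "qIm1 (r *\<^sub>R x) = r * qIm1 x" "qIm2 (r *\<^sub>R x) = r * qIm2 x" "qIm3 (r *\<^sub>R x) = r * qIm3 x"
  "qRe 0 = 0" "qIm1 0 = 0" "qIm2 0 = 0" "qIm3 0 = 0"
  "qRe 1 = 1" "qIm1 1 = 0" "qIm2 1 = 0" "qIm3 1 = 0"
  by (simp_all add: plus_quat_def minus_quat_def uminus_quat_def scaleR_quat_def zero_quat_def one_quat_def)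

lemma quat_sel_of_real [simp]:
  "qRe (of_real r) = r" "qIm1 (of_real r) = 0" "qIm2 (of_real r) = 0" "qIm3 (of_real r) = 0"
  by (simp_all add: of_real_def)

lemma quat_sel_mult:
  "qRe (x * y) = qRe x * qRe y - qIm1 x * qIm1 y - qIm2 x * qIm2 y - qIm3 x * qIm3 y"
  "qIm1 (x * y) = qRe x * qIm1 y + qIm1 x * qRe y + qIm2 x * qIm3 y - qIm3 x * qIm2 y"
  "qIm2 (x * y) = qRe x * qIm2 y - qIm1 x * qIm3 y + qIm2 x * qRe y + qIm3 x * qIm1 y"
  "qIm3 (x * y) = qRe x * qIm3 y + qIm1 x * qIm2 y - qIm2 x * qIm1 y + qIm3 x * qRe y"
  by (simp_all add: times_quat_def)

lemma of_real_quat_commute: "of_real r * (q :: quat) = q * of_real r"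
  by (simp add: of_real_def)

lemma norm_quat_sq: "(norm q)\<^sup>2 = (qRe q)\<^sup>2 + (qIm1 q)\<^sup>2 + (qIm2 q)\<^sup>2 + (qIm3 q)\<^sup>2"
  using power2_norm_eq_inner[of q] by (simp add: inner_quat_def power2_eq_square)

lemma imag_sphere_sq: "I \<in> imag_sphere \<Longrightarrow> (qIm1 I)\<^sup>2 + (qIm2 I)\<^sup>2 + (qIm3 I)\<^sup>2 = 1"
  using norm_quat_sq[of I] by (simp add: imag_sphere_def)

lemma imag_sphere_mult_self: "I \<in> imag_sphere \<Longrightarrow> I * I = -1"
  using imag_sphere_sq[of I]
  by (auto simp: quat_eq_iff quat_sel_mult imag_sphere_def power2_eq_square)

lemma in_slice_linear: "in_slice I (z + w) = in_slice I z + in_slice I w" "in_slice I (r *\<^sub>R z) = r *\<^sub>R in_slice I z"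
  "in_slice I (- z) = - in_slice I z" "in_slice I (z - w) = in_slice I z - in_slice I w" "in_slice I 0 = 0" "in_slice I 1 = 1"
  by (simp_all add: in_slice_def algebra_simps of_real_def)

lemma in_slice_of_real [simp]: "in_slice I (of_real x) = of_real x"
  by (simp add: in_slice_def)

lemma in_slice_ii [simp]: "in_slice I \<i> = I"
  by (simp add: in_slice_def)

lemma in_slice_mult:
  assumes "I \<in> imag_sphere"
  shows "in_slice I (z * w) = in_slice I z * in_slice I w"
proof -
  have "I * of_real a * (I * of_real b) = - of_real (a * b)" for a b
  proof -
    have "I * of_real a * (I * of_real b) = (I * I) * (of_real a * of_real b)"
      by (metis mult.assoc of_real_quat_commute)
    then show ?thesis by (simp add: imag_sphere_mult_self[OF assms])
  qed
  then show ?thesis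
    by (simp add: in_slice_def distrib_left distrib_right)
       (simp add: of_real_def algebra_simps)
qed

lemma qRe_in_slice: "I \<in> imag_sphere \<Longrightarrow> qRe (in_slice I z) = Re z"
  by (simp add: in_slice_def quat_sel_mult imag_sphere_def)

lemma qcnj_in_slice: "I \<in> imag_sphere \<Longrightarrow> qcnj (in_slice I z) = in_slice I (cnj z)"
  by (simp add: in_slice_def quat_eq_iff qcnj_def quat_sel_mult imag_sphere_def)

lemma norm_in_slice:
  assumes "I \<in> imag_sphere"
  shows "norm (in_slice I z) = norm z"
proof -
  have "(norm (in_slice I z))\<^sup>2 = (Re z)\<^sup>2 + ((qIm1 I)\<^sup>2 + (qIm2 I)\<^sup>2 + (qIm3 I)\<^sup>2) * (Im z)\<^sup>2"
    unfolding norm_quat_sq in_slice_def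
    using assms by (simp add: quat_sel_mult imag_sphere_def power2_eq_square algebra_simps)
  then have "(norm (in_slice I z))\<^sup>2 = (norm z)\<^sup>2" by (simp add: imag_sphere_sq[OF assms] cmod_power2)
  then show ?thesis by simp
qed

lemma bounded_linear_in_slice: "I \<in> imag_sphere \<Longrightarrow> bounded_linear (in_slice I)"
  by (rule bounded_linear_intro[where K = 1]) (simp_all add: in_slice_linear norm_in_slice)

lemma in_slice_eq_iff: "I \<in> imag_sphere \<Longrightarrow> in_slice I z = in_slice I w \<longleftrightarrow> z = w"
  by (metis in_slice_linear(4,5) norm_eq_zero norm_in_slice right_minus_eq)

lemma in_slice_power: "I \<in> imag_sphere \<Longrightarrow> in_slice I (z ^ n) = in_slice I z ^ n"
  by (induction n) (simp_all add: in_slice_linear in_slice_mult)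

lemma in_slice_inverse: "I \<in> imag_sphere \<Longrightarrow> in_slice I (inverse z) = inverse (in_slice I z)"
  by (metis in_slice_eq_iff in_slice_linear(5,6) in_slice_mult inverse_unique inverse_zero right_inverse)

lemma in_slice_exp:
  assumes "I \<in> imag_sphere"
  shows "in_slice I (exp z) = exp (in_slice I z)"
  unfolding exp_def
  by (subst bounded_linear.suminf[OF bounded_linear_in_slice[OF assms] summable_exp_generic])
     (simp add: in_slice_linear in_slice_power[OF assms])

lemma quat_in_slice:
  obtains I z where "I \<in> imag_sphere" "q = in_slice I z"
proof (cases "q = of_real (qRe q)")
  case True
  have "Quat 0 1 0 0 \<in> imag_sphere" by (simp add: imag_sphere_def norm_quat_def inner_quat_def)
  then show ?thesis using that[of "Quat 0 1 0 0" "of_real (qRe q)"] True by simp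
next
  case False
  define v where "v = q - of_real (qRe q)"
  have v: "v \<noteq> 0" using False by (simp add: v_def)
  have I: "v /\<^sub>R norm v \<in> imag_sphere" using v by (simp add: imag_sphere_def v_def)
  have "q = in_slice (v /\<^sub>R norm v) (Complex (qRe q) (norm v))"
    using v by (simp add: in_slice_def of_real_def v_def)
  then show ?thesis using that I by blast
qed

text \<open>Every quaternion lies in some slice, where the complex law applies.\<close>

lemma norm_exp_quat: "norm (exp (q :: quat)) = exp (qRe q)"
proof -
  obtain I z where I: "I \<in> imag_sphere" "q = in_slice I z" by (rule quat_in_slice)
  have "norm (exp q) = norm (exp z)" using I by (metis in_slice_exp norm_in_slice)
  then show ?thesis using I by (simp add: qRe_in_slice)
qed

text \<open>For purely imaginary quaternions anticommutation is orthogonality, so a normalized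
  vector orthogonal to \<open>I\<close> will do.\<close>

lemma ex_anticommuting_unit:
  assumes I: "I \<in> imag_sphere"
  obtains J where "J \<in> imag_sphere" "J * I = - (I * J)"
proof -
  have sq: "(qIm1 I)\<^sup>2 + (qIm2 I)\<^sup>2 + (qIm3 I)\<^sup>2 = 1" by (rule imag_sphere_sq[OF I])
  obtain d e f where v: "qIm1 I * d + qIm2 I * e + qIm3 I * f = 0" "(d, e, f) \<noteq> (0, 0, 0)"
  proof (cases "qIm1 I = 0 \<and> qIm2 I = 0")
    case True
    then show ?thesis using that[of 1 0 0] by simp
  next
    case False
    then show ?thesis using that[of "qIm2 I" "- qIm1 I" 0] by (auto simp: algebra_simps)
  qed
  define v where "v = Quat 0 d e f"
  have vn: "v \<noteq> 0" using v(2) by (simp add: v_def quat_eq_iff)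
  have "v * I = - (I * v)" using v(1) I
    by (simp add: v_def quat_eq_iff quat_sel_mult imag_sphere_def algebra_simps)
  then have "(v /\<^sub>R norm v) * I = - (I * (v /\<^sub>R norm v))" by simp
  moreover have "v /\<^sub>R norm v \<in> imag_sphere" using vn by (simp add: imag_sphere_def v_def)
  ultimately show ?thesis using that by blast
qed

section \<open>Splitting a quaternion into two complex components along a slice\<close>

definition slice_coord :: "quat \<Rightarrow> quat \<Rightarrow> complex" where
  "slice_coord I q = Complex (qRe q) (inner q I)"

text \<open>Since I^2 = -1, the part (q - I q I)/2 commutes with I and hence lies in \<complex>_I,
  while (q + I q I)/2 anticommutes with I and falls into \<complex>_I after multiplication by -J
  from the left. The coordinates of these two elements are the components F1, F2 in q = F1 + J
  F2.\<close>

definition slice_fst :: "quat \<Rightarrow> quat \<Rightarrow> complex" where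
  "slice_fst I q = slice_coord I ((1/2) *\<^sub>R (q - I * q * I))"

definition slice_snd :: "quat \<Rightarrow> quat \<Rightarrow> quat \<Rightarrow> complex" where
  "slice_snd I J q = slice_coord I ((1/2) *\<^sub>R (- (J * (q + I * q * I))))"

lemma slice_coord_in_slice: "I \<in> imag_sphere \<Longrightarrow> slice_coord I (in_slice I z) = z"
  using imag_sphere_sq[of I]
  by (simp add: slice_coord_def complex_eq_iff in_slice_def quat_sel_mult imag_sphere_def inner_quat_def
      power2_eq_square) (simp add: algebra_simps, metis distrib_left mult.right_neutral)

lemma in_slice_slice_coord:
  assumes I: "I \<in> imag_sphere" and c: "q * I = I * q"
  shows "in_slice I (slice_coord I q) = q"
proof -
  define a b d x y z where v: "a = qIm1 I" "b = qIm2 I" "d = qIm3 I" "x = qIm1 q" "y = qIm2 q" "z = qIm3 q"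
  have sq: "a * a + b * b + d * d = 1" using imag_sphere_sq[OF I] by (simp add: v power2_eq_square)
  have cr: "y * d = z * b" "z * a = x * d" "x * b = y * a"
    using c I by (auto simp: quat_eq_iff quat_sel_mult imag_sphere_def v algebra_simps)
  have "a * (x * a + y * b + z * d) = x" "b * (x * a + y * b + z * d) = y" "d * (x * a + y * b + z * d) = z"
    using sq cr by algebra+
  then show ?thesis using I
    by (simp add: quat_eq_iff in_slice_def slice_coord_def quat_sel_mult imag_sphere_def inner_quat_def v)
qed

lemma slice_decomposition:
  assumes I: "I \<in> imag_sphere" and J: "J \<in> imag_sphere" "J * I = - (I * J)"
  shows "q = in_slice I (slice_fst I q) + J * in_slice I (slice_snd I J q)"
proof -
  have II: "I * I = -1" and JJ: "J * J = -1" using imag_sphere_mult_self I J by auto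
  have II': "I * (I * x) = - x" and JJ': "J * (J * x) = - x" and JI': "J * (I * x) = - (I * (J * x))" for x
    using II JJ J(2) by (metis mult.assoc mult_minus1, metis mult.assoc mult_minus1, metis minus_mult_left mult.assoc)
  have "in_slice I (slice_fst I q) = (1/2) *\<^sub>R (q - I * q * I)"
    unfolding slice_fst_def by (rule in_slice_slice_coord[OF I]) (simp add: algebra_simps II' II)
  moreover have "in_slice I (slice_snd I J q) = (1/2) *\<^sub>R (- (J * (q + I * q * I)))"
    unfolding slice_snd_def by (rule in_slice_slice_coord[OF I]) (simp add: algebra_simps II' II JI')
  moreover have "J * ((1/2) *\<^sub>R (- (J * x))) = (1/2) *\<^sub>R x" for x by (simp add: JJ')
  ultimately have "in_slice I (slice_fst I q) + J * in_slice I (slice_snd I J q) =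
      (1/2) *\<^sub>R (q - I * q * I) + (1/2) *\<^sub>R (q + I * q * I)" by simp
  also have "\<dots> = q" unfolding scaleR_add_right[symmetric] by simp
  finally show ?thesis by simp
qed

lemma slice_fst_snd_unique:
  assumes I: "I \<in> imag_sphere" and J: "J \<in> imag_sphere" "J * I = - (I * J)"
  shows "slice_fst I (in_slice I z + J * in_slice I w) = z" "slice_snd I J (in_slice I z + J * in_slice I w) = w"
proof -
  have II: "I * I = -1" and JJ: "J * J = -1" using imag_sphere_mult_self I J by auto
  have zI: "in_slice I z * I = I * in_slice I z" for z
    using in_slice_mult[OF I, of z \<i>] in_slice_mult[OF I, of \<i> z] by (simp add: mult.commute)
  have 1: "I * in_slice I z * I = - in_slice I z" for z
    by (metis II mult.assoc mult_minus1 zI)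
  have 2: "I * (J * in_slice I z) * I = J * in_slice I z" for z
    by (metis "1" J(2) minus_mult_left minus_mult_right mult.assoc minus_minus)
  have "I * (in_slice I z + J * in_slice I w) * I = - in_slice I z + J * in_slice I w"
    by (simp only: distrib_left distrib_right 1 2)
  moreover have "(1/2) *\<^sub>R (x + x) = (x::quat)" for x by (simp add: scaleR_half_double)
  moreover have "- (J * (J * x)) = x" for x by (metis JJ mult.assoc mult_minus1 minus_minus)
  ultimately show "slice_fst I (in_slice I z + J * in_slice I w) = z" "slice_snd I J (in_slice I z + J * in_slice I w) = w"
    by (simp_all add: slice_fst_def slice_snd_def slice_coord_in_slice[OF I] distrib_left)
qed

lemma bounded_linear_slice_coord: "bounded_linear (slice_coord I)"
proof -
  have "bounded_linear (\<lambda>q. inner q 1 *\<^sub>R 1 + inner q I *\<^sub>R \<i>)"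
    by (intro bounded_linear_add bounded_linear_compose[OF bounded_linear_scaleR_left] bounded_linear_inner_left)
  moreover have "(\<lambda>q. inner q 1 *\<^sub>R 1 + inner q I *\<^sub>R \<i>) = slice_coord I"
    by (rule ext) (simp add: slice_coord_def complex_eq_iff inner_quat_def)
  ultimately show ?thesis by simp
qed

lemma bounded_linear_slice_fst: "bounded_linear (slice_fst I)"
  unfolding slice_fst_def[abs_def]
  by (intro bounded_linear_compose[OF bounded_linear_slice_coord] bounded_linear_intros)

lemma bounded_linear_slice_snd: "bounded_linear (slice_snd I J)"
  unfolding slice_snd_def[abs_def]
  by (intro bounded_linear_compose[OF bounded_linear_slice_coord] bounded_linear_compose[OF bounded_linear_scaleR_right]
      bounded_linear_minus bounded_linear_const_mult bounded_linear_add bounded_linear_mult_const bounded_linear_ident)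

text \<open>\<open>J\<close> stands on the left in the decomposition, so right multiplication by an
  element of the slice acts on both components as complex multiplication. This is what turns right
  regularity into holomorphy.\<close>

lemma slice_fst_snd_mult:
  assumes I: "I \<in> imag_sphere" and J: "J \<in> imag_sphere" "J * I = - (I * J)"
  shows "slice_fst I (q * in_slice I z) = slice_fst I q * z" "slice_snd I J (q * in_slice I z) = slice_snd I J q * z"
proof -
  have "q * in_slice I z = in_slice I (slice_fst I q * z) + J * in_slice I (slice_snd I J q * z)"
    by (subst slice_decomposition[OF assms, of q]) (simp add: distrib_right in_slice_mult[OF I] mult.assoc)
  then show "slice_fst I (q * in_slice I z) = slice_fst I q * z" "slice_snd I J (q * in_slice I z) = slice_snd I J q * z"
    using slice_fst_snd_unique[OF assms] by auto
qed

section \<open>Slice regular functions and the Laplace-Stieltjes transform\<close>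

text \<open>The slice Cauchy-Riemann equation reads \<open>D 1 + D I * I = 0\<close>. Multiplied by
  \<open>I\<close> from the right it says that the real derivative, restricted to the slice, is
  right linear over the slice.\<close>

lemma right_slice_regular_on_derivative:
  assumes f: "right_slice_regular_on f U" and I: "I \<in> imag_sphere" and z: "in_slice I z \<in> U"
  obtains D where "(f has_derivative D) (at (in_slice I z))" "\<And>k. D (in_slice I k) = D 1 * in_slice I k"
proof -
  obtain D where D: "(f has_derivative D) (at (in_slice I z))"
    using f z by (auto simp: right_slice_regular_on_def differentiable_def)
  interpret D: bounded_linear D using D by (rule has_derivative_bounded_linear)
  have x: "in_slice I z = of_real (Re z) + I * of_real (Im z)" by (simp add: in_slice_def)
  note D' = D[unfolded x]
  have "((\<lambda>t. f (of_real t + I * of_real (Im z))) has_derivative (\<lambda>t. D (t *\<^sub>R 1))) (at (Re z))"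
    by (rule has_derivative_compose[of "\<lambda>t. of_real t + I * of_real (Im z)" _ _ _ f, OF _ D'])
       (auto intro!: derivative_eq_intros simp: of_real_def)
  then have 1: "((\<lambda>t. f (of_real t + I * of_real (Im z))) has_vector_derivative D 1) (at (Re z))"
    by (simp add: has_vector_derivative_def D.scaleR)
  have "((\<lambda>t. f (of_real (Re z) + I * of_real t)) has_derivative (\<lambda>t. D (t *\<^sub>R I))) (at (Im z))"
    by (rule has_derivative_compose[of "\<lambda>t. of_real (Re z) + I * of_real t" _ _ _ f, OF _ D'])
       (auto intro!: derivative_eq_intros simp: of_real_def)
  then have 2: "((\<lambda>t. f (of_real (Re z) + I * of_real t)) has_vector_derivative D I) (at (Im z))"
    by (simp add: has_vector_derivative_def D.scaleR)
  have "(1/2) *\<^sub>R (vector_derivative (\<lambda>t. f (of_real t + I * of_real (Im z))) (at (Re z))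
      + vector_derivative (\<lambda>t. f (of_real (Re z) + I * of_real t)) (at (Im z)) * I) = 0"
    using f I z unfolding right_slice_regular_on_def x by blast
  then have "D 1 + D I * I = 0"
    unfolding vector_derivative_at[OF 1] vector_derivative_at[OF 2] by simp
  then have "(D 1 + D I * I) * I = 0" by simp
  then have DI: "D I = D 1 * I"
    by (simp add: distrib_right mult.assoc imag_sphere_mult_self[OF I])
  have "D (in_slice I k) = D 1 * in_slice I k" for k
  proof -
    have "in_slice I k = Re k *\<^sub>R 1 + Im k *\<^sub>R I" by (simp add: in_slice_def of_real_def)
    then show ?thesis by (simp add: D.add D.scaleR DI distrib_left)
  qed
  then show ?thesis using that D by blast
qed

lemma right_slice_regular_onI:
  assumes U: "open U"
    and D: "\<And>I z. I \<in> imag_sphere \<Longrightarrow> in_slice I z \<in> U \<Longrightarrow>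
      \<exists>D. (f has_derivative D) (at (in_slice I z)) \<and> D I = D 1 * I"
  shows "right_slice_regular_on f U"
  unfolding right_slice_regular_on_def
proof (intro conjI ballI allI impI)
  show "f differentiable at x" if x: "x \<in> U" for x
  proof -
    obtain I z where I: "I \<in> imag_sphere" "x = in_slice I z" by (rule quat_in_slice)
    then show ?thesis using D[OF I(1), of z] x by (auto simp: differentiable_def)
  qed
  fix I x0 x1 assume I: "I \<in> imag_sphere" and x': "of_real x0 + I * of_real x1 \<in> U"
  define z where "z = Complex x0 x1"
  have x: "in_slice I z = of_real x0 + I * of_real x1" by (simp add: in_slice_def z_def)
  then obtain D where D: "(f has_derivative D) (at (in_slice I z))" "D I = D 1 * I" using D[OF I, of z] x' by auto
  interpret D: bounded_linear D using D(1) by (rule has_derivative_bounded_linear)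
  note D' = D(1)[unfolded x]
  have "((\<lambda>t. f (of_real t + I * of_real x1)) has_derivative (\<lambda>t. D (t *\<^sub>R 1))) (at x0)"
    by (rule has_derivative_compose[of "\<lambda>t. of_real t + I * of_real x1" _ _ _ f, OF _ D'])
       (auto intro!: derivative_eq_intros simp: of_real_def)
  then have 1: "((\<lambda>t. f (of_real t + I * of_real x1)) has_vector_derivative D 1) (at x0)"
    by (simp add: has_vector_derivative_def D.scaleR)
  have "((\<lambda>t. f (of_real x0 + I * of_real t)) has_derivative (\<lambda>t. D (t *\<^sub>R I))) (at x1)"
    by (rule has_derivative_compose[of "\<lambda>t. of_real x0 + I * of_real t" _ _ _ f, OF _ D'])
       (auto intro!: derivative_eq_intros simp: of_real_def)
  then have 2: "((\<lambda>t. f (of_real x0 + I * of_real t)) has_vector_derivative D I) (at x1)"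
    by (simp add: has_vector_derivative_def D.scaleR)
  show "(1/2) *\<^sub>R (vector_derivative (\<lambda>t. f (of_real t + I * of_real x1)) (at x0)
      + vector_derivative (\<lambda>t. f (of_real x0 + I * of_real t)) (at x1) * I) = 0"
    unfolding vector_derivative_at[OF 1] vector_derivative_at[OF 2] D(2)
    by (simp add: mult.assoc imag_sphere_mult_self[OF I])
qed (rule U)

text \<open>Stated for an arbitrary map \<open>P\<close> that is right linear over the slice, so
  that it serves both components of the splitting.\<close>

lemma right_slice_regular_holomorphic:
  assumes f: "right_slice_regular_on f U" and I: "I \<in> imag_sphere"
    and P: "bounded_linear P" "\<And>q z. P (q * in_slice I z) = P q * z"
  shows "(\<lambda>z. P (f (in_slice I z))) holomorphic_on {z. in_slice I z \<in> U}"
  unfolding holomorphic_on_def field_differentiable_def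
proof
  fix z assume "z \<in> {z. in_slice I z \<in> U}"
  then obtain D where D: "(f has_derivative D) (at (in_slice I z))" "\<And>k. D (in_slice I k) = D 1 * in_slice I k"
    using right_slice_regular_on_derivative[OF f I] by auto
  have "(in_slice I has_derivative in_slice I) (at z)"
    by (rule bounded_linear_imp_has_derivative[OF bounded_linear_in_slice[OF I]])
  from has_derivative_compose[OF this D(1)]
  have "((\<lambda>z. P (f (in_slice I z))) has_derivative (\<lambda>k. P (D (in_slice I k)))) (at z)"
    by (rule bounded_linear.has_derivative[OF P(1)])
  also have "(\<lambda>k. P (D (in_slice I k))) = (*) (P (D 1))" by (rule ext) (simp add: D(2) P(2))
  finally have "((\<lambda>z. P (f (in_slice I z))) has_field_derivative P (D 1)) (at z)"
    by (simp add: has_field_derivative_def)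
  then show "\<exists>f'. ((\<lambda>z. P (f (in_slice I z))) has_field_derivative f') (at z within {z. in_slice I z \<in> U})"
    using has_field_derivative_at_within by blast
qed

lemma open_slice: "open U \<Longrightarrow> I \<in> imag_sphere \<Longrightarrow> open {z. in_slice I z \<in> U}"
  using continuous_open_vimage[of U "in_slice I"] linear_continuous_at[OF bounded_linear_in_slice]
  by (simp add: vimage_def)

section \<open>Duhamel's formula and the derivative of the quaternionic exponential\<close>

lemma exp_diff_integral:
  fixes q Q :: quat
  shows "((\<lambda>r. exp (r *\<^sub>R Q) * (Q - q) * exp ((1 - r) *\<^sub>R q)) has_integral (exp Q - exp q)) {0..1}"
proof -
  have "((\<lambda>r. exp (r *\<^sub>R Q) * exp ((1 - r) *\<^sub>R q)) has_vector_derivative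
      exp (r *\<^sub>R Q) * (Q - q) * exp ((1 - r) *\<^sub>R q)) (at r within {0..1})" for r
  proof -
    have "((\<lambda>r. exp ((1 - r) *\<^sub>R q)) has_vector_derivative (-1) *\<^sub>R (q * exp ((1 - r) *\<^sub>R q))) (at r within {0..1})"
      by (rule vector_diff_chain_within[where f = "\<lambda>r. 1 - r" and f' = "-1" and g = "\<lambda>r. exp (r *\<^sub>R q)", unfolded o_def])
         (auto intro!: derivative_eq_intros has_vector_derivative_at_within[OF exp_scaleR_has_vector_derivative_left])
    from has_vector_derivative_mult[OF exp_scaleR_has_vector_derivative_right this]
    show ?thesis by (simp add: algebra_simps)
  qed
  then have "((\<lambda>r. exp (r *\<^sub>R Q) * (Q - q) * exp ((1 - r) *\<^sub>R q)) has_integral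
      (exp (1 *\<^sub>R Q) * exp ((1 - 1) *\<^sub>R q) - exp (0 *\<^sub>R Q) * exp ((1 - 0) *\<^sub>R q))) {0..1}"
    by (intro fundamental_theorem_of_calculus) auto
  then show ?thesis by simp
qed

lemma abs_qRe_le_norm: "\<bar>qRe q\<bar> \<le> norm q"
  using norm_quat_sq[of q] by (intro power2_le_imp_le[of "\<bar>qRe q\<bar>"]) auto

text \<open>The exponents are interpolated between the two arguments, so the product of the
  exponentials never exceeds the common bound.\<close>

lemma exp_le_exp_kernel:
  fixes q Q :: quat
  assumes "r \<in> {0..1}" "\<bar>qRe Q\<bar> \<le> b" "\<bar>qRe q\<bar> \<le> b"
  shows "norm (exp (r *\<^sub>R Q)) * norm (exp ((1 - r) *\<^sub>R q)) \<le> exp b"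
proof -
  have "r * qRe Q + (1 - r) * qRe q \<le> r * b + (1 - r) * b"
    using assms by (intro add_mono mult_left_mono) auto
  then show ?thesis by (simp add: norm_exp_quat exp_add[symmetric] algebra_simps)
qed

lemma norm_exp_diff_le:
  fixes q Q :: quat
  assumes "\<bar>qRe Q\<bar> \<le> b" "\<bar>qRe q\<bar> \<le> b"
  shows "norm (exp Q - exp q) \<le> norm (Q - q) * exp b"
proof -
  have "norm (exp Q - exp q) \<le> norm (Q - q) * exp b * measure lborel {0..1::real}"
  proof (rule has_integral_bound_real[OF _ _ exp_diff_integral])
    fix r :: real assume r: "r \<in> {0..1} - {}"
    show "norm (exp (r *\<^sub>R Q) * (Q - q) * exp ((1 - r) *\<^sub>R q)) \<le> norm (Q - q) * exp b"
      using mult_left_mono[OF exp_le_exp_kernel[of r Q b q] norm_ge_zero[of "Q - q"]] r assms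
      by (simp add: norm_mult mult_ac)
  qed auto
  then show ?thesis by simp
qed

lemma continuous_on_exp_quat [continuous_intros]:
  fixes f :: "'a::topological_space \<Rightarrow> quat"
  assumes "continuous_on S f"
  shows "continuous_on S (\<lambda>x. exp (f x))"
proof -
  have "isCont exp q" for q :: quat
  proof -
    have "((\<lambda>Q. norm (Q - q) * exp (norm q + 1)) \<longlongrightarrow> norm (q - q) * exp (norm q + 1)) (at q)"
      by (intro tendsto_intros)
    then have "((\<lambda>Q. norm (Q - q) * exp (norm q + 1)) \<longlongrightarrow> 0) (at q)" by simp
    moreover have "\<forall>\<^sub>F Q in at q. norm (exp Q - exp q) \<le> norm (Q - q) * exp (norm q + 1)"
    proof -
      have "norm (exp Q - exp q) \<le> norm (Q - q) * exp (norm q + 1)" if "dist Q q < 1" for Q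
        using that abs_qRe_le_norm[of Q] abs_qRe_le_norm[of q] norm_triangle_sub[of Q q]
        by (intro norm_exp_diff_le) (auto simp: dist_norm)
      then show ?thesis by (auto simp: eventually_at intro!: exI[of _ 1])
    qed
    ultimately have "((\<lambda>Q. exp Q - exp q) \<longlongrightarrow> 0) (at q)" by (rule Lim_null_comparison[rotated])
    then show ?thesis by (simp add: isCont_def LIM_zero_iff)
  qed
  then have "continuous_on UNIV (exp :: quat \<Rightarrow> quat)" by (simp add: continuous_on_eq_continuous_at)
  from continuous_on_compose2[OF this assms] show ?thesis by auto
qed

text \<open>The derivative of \<open>exp\<close> at \<open>q\<close> in the direction
  \<open>k\<close>. As \<open>q\<close> and \<open>k\<close> need not commute,
  \<open>exp q * k\<close> is replaced by Duhamel's integral, which is the limit case of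
  \<open>exp_diff_integral\<close> for Q tending to q.\<close>

definition exp_kernel :: "quat \<Rightarrow> quat \<Rightarrow> quat" where
  "exp_kernel q k = integral {0..1} (\<lambda>r. exp (r *\<^sub>R q) * k * exp ((1 - r) *\<^sub>R q))"

lemma exp_kernel_integrable:
  "(\<lambda>r. exp (r *\<^sub>R q) * k * exp ((1 - r) *\<^sub>R q)) integrable_on {0..1}" for q k :: quat
  by (intro integrable_continuous_interval continuous_intros)

lemma norm_exp_kernel_le:
  assumes "\<bar>qRe q\<bar> \<le> b"
  shows "norm (exp_kernel q k) \<le> norm k * exp b"
proof -
  have "norm (exp_kernel q k) \<le> norm k * exp b * measure lborel {0..1::real}"
    unfolding exp_kernel_def
  proof (rule has_integral_bound_real[OF _ _ integrable_integral[OF exp_kernel_integrable]])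
    fix r :: real assume r: "r \<in> {0..1} - {}"
    show "norm (exp (r *\<^sub>R q) * k * exp ((1 - r) *\<^sub>R q)) \<le> norm k * exp b"
      using mult_left_mono[OF exp_le_exp_kernel[of r q b q] norm_ge_zero[of k]] r assms
      by (simp add: norm_mult mult_ac)
  qed auto
  then show ?thesis by simp
qed

text \<open>The exact increment and its linear part are Duhamel integrals that differ only in the
  exponential on the left; the increment of that exponential yields the second factor
  \<open>norm (Q - q)\<close>.\<close>

lemma exp_remainder_le:
  fixes q Q :: quat
  assumes "\<bar>qRe Q\<bar> \<le> b" "\<bar>qRe q\<bar> \<le> b"
  shows "norm (exp Q - exp q - exp_kernel q (Q - q)) \<le> (norm (Q - q))\<^sup>2 * exp b"
proof -
  have i: "((\<lambda>r. exp (r *\<^sub>R Q) * (Q - q) * exp ((1 - r) *\<^sub>R q) - exp (r *\<^sub>R q) * (Q - q) * exp ((1 - r) *\<^sub>R q))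
      has_integral (exp Q - exp q - exp_kernel q (Q - q))) {0..1}"
    unfolding exp_kernel_def
    by (intro has_integral_diff exp_diff_integral integrable_integral exp_kernel_integrable)
  have "norm (exp Q - exp q - exp_kernel q (Q - q)) \<le> (norm (Q - q))\<^sup>2 * exp b * measure lborel {0..1::real}"
  proof (rule has_integral_bound_real[OF _ _ i])
    fix r :: real assume r: "r \<in> {0..1} - {}"
    have "norm (exp (r *\<^sub>R Q) - exp (r *\<^sub>R q)) \<le> norm (r *\<^sub>R Q - r *\<^sub>R q) * exp (r * b)"
      using r assms by (intro norm_exp_diff_le) (auto simp: abs_mult mult_left_mono)
    also have "\<dots> \<le> norm (Q - q) * exp (r * b)"
      using r by (intro mult_right_mono) (auto simp: scaleR_diff_right[symmetric] mult_left_le_one_le)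
    finally have 1: "norm (exp (r *\<^sub>R Q) - exp (r *\<^sub>R q)) \<le> norm (Q - q) * exp (r * b)" .
    have "(1 - r) * qRe q \<le> (1 - r) * b" using r assms by (intro mult_left_mono) auto
    then have 2: "norm (exp ((1 - r) *\<^sub>R q)) \<le> exp ((1 - r) * b)" by (simp add: norm_exp_quat)
    have "norm ((exp (r *\<^sub>R Q) - exp (r *\<^sub>R q)) * (Q - q) * exp ((1 - r) *\<^sub>R q)) \<le>
        (norm (Q - q) * exp (r * b)) * norm (Q - q) * exp ((1 - r) * b)"
      unfolding norm_mult by (intro mult_mono 1 2) auto
    also have "\<dots> = (norm (Q - q))\<^sup>2 * (exp (r * b) * exp ((1 - r) * b))" by (simp add: power2_eq_square)
    also have "exp (r * b) * exp ((1 - r) * b) = exp b" by (simp add: exp_add[symmetric] algebra_simps)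
    finally show "norm (exp (r *\<^sub>R Q) * (Q - q) * exp ((1 - r) *\<^sub>R q) - exp (r *\<^sub>R q) * (Q - q) * exp ((1 - r) *\<^sub>R q))
        \<le> (norm (Q - q))\<^sup>2 * exp b" by (simp add: left_diff_distrib)
  qed auto
  then show ?thesis by simp
qed

lemma bounded_linear_exp_kernel: "bounded_linear (exp_kernel q)"
proof (rule bounded_linear_intro[where K = "exp (norm q)"])
  show "exp_kernel q (x + y) = exp_kernel q x + exp_kernel q y" for x y
    unfolding exp_kernel_def integral_add[OF exp_kernel_integrable exp_kernel_integrable, symmetric]
    by (simp add: algebra_simps)
  show "exp_kernel q (r *\<^sub>R x) = r *\<^sub>R exp_kernel q x" for r x
    unfolding exp_kernel_def by simp
  show "norm (exp_kernel q x) \<le> norm x * exp (norm q)" for x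
    by (rule norm_exp_kernel_le) (rule abs_qRe_le_norm)
qed

text \<open>Inside the commutative field \<complex>_I Duhamel's integrand is constant. The right
  linearity of the derivative over slices comes from here.\<close>

lemma exp_kernel_in_slice:
  assumes I: "I \<in> imag_sphere"
  shows "exp_kernel (in_slice I z) (in_slice I k) = exp (in_slice I z) * in_slice I k"
proof -
  have "exp (r *\<^sub>R in_slice I z) * in_slice I k * exp ((1 - r) *\<^sub>R in_slice I z) = exp (in_slice I z) * in_slice I k" for r
  proof -
    have "exp (r *\<^sub>R z) * exp ((1 - r) *\<^sub>R z) = exp z"
      by (simp add: exp_add[symmetric] scaleR_add_left[symmetric])
    then have "in_slice I (exp (r *\<^sub>R z) * k * exp ((1 - r) *\<^sub>R z)) = in_slice I (exp z * k)" by (simp add: mult_ac)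
    then show ?thesis by (simp add: in_slice_mult[OF I] in_slice_exp[OF I] in_slice_linear)
  qed
  then show ?thesis by (simp add: exp_kernel_def)
qed

lemma continuous_on_exp_kernel: "continuous_on UNIV (\<lambda>q. exp_kernel q k)"
proof -
  have "continuous_on (UNIV \<times> cbox 0 (1::real)) (\<lambda>(q, r). exp (r *\<^sub>R q) * k * exp ((1 - r) *\<^sub>R q))" for k :: quat
    unfolding split_def by (intro continuous_intros)
  from integral_continuous_on_param[OF this] show ?thesis by (simp add: exp_kernel_def[abs_def])
qed


section \<open>Differentiation of the Laplace-Stieltjes transform\<close>

lemma laplace_stieltjes_integral:
  assumes \<mu>: "quaternionic_measure \<mu>" "exp_integrable c \<mu>" and s: "\<bar>qRe s\<bar> \<le> c"
  shows "has_bochner_integral (total_variation \<mu>) (\<lambda>t. polar_density \<mu> t * exp (- s * of_real t)) (laplace_stieltjes \<mu> s)"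
proof -
  have n: "norm (exp (- s * of_real t)) \<le> 1 * exp (c * \<bar>t\<bar>)" for t
  proof -
    have "- (qRe s * t) \<le> \<bar>qRe s\<bar> * \<bar>t\<bar>" by (metis abs_ge_minus_self abs_mult)
    also have "\<dots> \<le> c * \<bar>t\<bar>" using s by (intro mult_right_mono) auto
    finally show ?thesis by (simp add: norm_exp_quat quat_sel_mult)
  qed
  have "continuous_on UNIV (\<lambda>t. exp (- s * of_real t))" by (intro continuous_intros)
  from quat_integral_functional[OF \<mu> _ this n bounded_linear_ident] s
  show ?thesis by (simp add: laplace_stieltjes_def lscale_quat_def)
qed

text \<open>A factor t^2 is paid for by an arbitrarily small part of the exponent.\<close>

lemma power2_le_exp: "x \<ge> 0 \<Longrightarrow> \<eta> > 0 \<Longrightarrow> x\<^sup>2 \<le> 2 / \<eta>\<^sup>2 * exp (\<eta> * x)" for x :: real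
proof -
  assume "x \<ge> 0" "\<eta> > 0"
  then have "0 \<le> \<eta> * x" by simp
  with exp_lower_Taylor_quadratic[OF this] have "(\<eta> * x)\<^sup>2 / 2 \<le> exp (\<eta> * x)" by linarith
  then show ?thesis using \<open>\<eta> > 0\<close> by (simp add: power_mult_distrib field_simps)
qed

lemma has_derivative_quadratic:
  fixes f :: "'a::real_normed_vector \<Rightarrow> 'b::real_normed_vector"
  assumes D: "bounded_linear D" and \<delta>: "\<delta> > 0"
    and rem: "\<And>w. norm (w - s) < \<delta> \<Longrightarrow> norm (f w - f s - D (w - s)) \<le> (norm (w - s))\<^sup>2 * C"
  shows "(f has_derivative D) (at s)"
  unfolding has_derivative_at_within
proof (intro conjI D)
  show "((\<lambda>w. (f w - f s - D (w - s)) /\<^sub>R norm (w - s)) \<longlongrightarrow> 0) (at s)"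
  proof (rule Lim_null_comparison[where g = "\<lambda>w. norm (w - s) * C"])
    have "norm ((f w - f s - D (w - s)) /\<^sub>R norm (w - s)) \<le> norm (w - s) * C"
      if "w \<noteq> s" "norm (w - s) < \<delta>" for w
    proof -
      have "norm ((f w - f s - D (w - s)) /\<^sub>R norm (w - s)) = norm (f w - f s - D (w - s)) / norm (w - s)"
        unfolding norm_scaleR by (simp add: divide_inverse mult.commute)
      also have "\<dots> \<le> ((norm (w - s))\<^sup>2 * C) / norm (w - s)" by (intro divide_right_mono rem that) simp
      also have "\<dots> = norm (w - s) * C" by (simp add: power2_eq_square)
      finally show ?thesis .
    qed
    then show "\<forall>\<^sub>F w in at s. norm ((f w - f s - D (w - s)) /\<^sub>R norm (w - s)) \<le> norm (w - s) * C"
      using \<delta> by (auto simp: eventually_at dist_norm intro!: exI[of _ \<delta>])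
    have "((\<lambda>w. norm (w - s) * C) \<longlongrightarrow> norm (s - s) * C) (at s)" by (intro tendsto_intros)
    then show "((\<lambda>w. norm (w - s) * C) \<longlongrightarrow> 0) (at s)" by simp
  qed
qed

text \<open>Differentiation under the integral with an explicit quadratic remainder, in all
  directions of the quaternions and not only inside a slice, because regularity asks for real
  differentiability. A real \<open>s\<close> lies in every slice; hence one derivative is shown to
  be right linear over each slice that contains \<open>s\<close>.\<close>

lemma laplace_stieltjes_has_derivative:
  assumes \<mu>: "quaternionic_measure \<mu>" "exp_integrable c \<mu>" and s: "\<bar>qRe s\<bar> < c"
  shows "\<exists>D. (laplace_stieltjes \<mu> has_derivative D) (at s) \<and>
    (\<forall>I\<in>imag_sphere. \<forall>z k. s = in_slice I z \<longrightarrow> D (in_slice I k) = D 1 * in_slice I k)"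
proof -
  define N where "N = total_variation \<mu>"
  define p where "p = polar_density \<mu>"
  have c: "c > 0" using s by linarith
  have fin: "finite_measure N" unfolding N_def using finite_total_variation[OF \<mu>] c by simp
  have sN [measurable_cong]: "sets N = sets borel" by (simp add: N_def)
  have pm [measurable]: "p \<in> borel_measurable borel" and pn: "norm (p t) = 1" for t
    using polar_density[OF \<mu>(1)] fin by (auto simp: p_def N_def)
  have ei: "integrable N (\<lambda>t. exp (c * \<bar>t\<bar>))"
    using \<mu>(2) by (intro integrableI_bounded) (auto simp: exp_integrable_def N_def)
  \<comment> \<open>Half of the gap between |Re s| and \<open>c\<close>. One \<open>\<eta>\<close>
    lets w move away from s, the other absorbs the factor t^2 of the remainder.\<close>
  define \<eta> where "\<eta> = (c - \<bar>qRe s\<bar>) / 2"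
  have \<eta>: "\<eta> > 0" "\<bar>qRe s\<bar> + 2 * \<eta> = c" using s by (simp_all add: \<eta>_def field_simps)
  define K where "K t k = p t * exp_kernel (- s * of_real t) (- k * of_real t)" for t k
  have Kn: "norm (K t k) \<le> norm k * (2 / \<eta>\<^sup>2 + 1) * exp (c * \<bar>t\<bar>)" for t k
  proof -
    have "norm (K t k) \<le> norm (- k * of_real t) * exp (\<bar>qRe s\<bar> * \<bar>t\<bar>)"
      unfolding K_def norm_mult pn mult_1
      by (subst norm_mult[symmetric], rule norm_exp_kernel_le) (simp add: quat_sel_mult abs_mult)
    also have "\<dots> = norm k * (\<bar>t\<bar> * exp (\<bar>qRe s\<bar> * \<bar>t\<bar>))" by (simp add: norm_mult)
    also have "\<dots> \<le> norm k * ((2 / \<eta>\<^sup>2 + 1) * exp (c * \<bar>t\<bar>))"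
    proof (rule mult_left_mono)
      \<comment> \<open>Passing from |t| to |t|^2 + 1 makes the estimate for the remainder
        applicable to the linear part as well.\<close>
      have "\<bar>t\<bar> \<le> \<bar>t\<bar>\<^sup>2 + 1"
      proof (cases "\<bar>t\<bar> \<le> 1")
        case False
        then show ?thesis using self_le_power[of "\<bar>t\<bar>" 2] by simp
      qed (use zero_le_power2[of "\<bar>t\<bar>"] in linarith)
      also have "\<dots> \<le> 2 / \<eta>\<^sup>2 * exp (\<eta> * \<bar>t\<bar>) + exp (\<eta> * \<bar>t\<bar>)"
        using power2_le_exp[of "\<bar>t\<bar>" \<eta>] \<eta> by (intro add_mono) auto
      finally have "\<bar>t\<bar> \<le> (2 / \<eta>\<^sup>2 + 1) * exp (\<eta> * \<bar>t\<bar>)" by (simp add: distrib_right)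
      then have "\<bar>t\<bar> * exp (\<bar>qRe s\<bar> * \<bar>t\<bar>) \<le> (2 / \<eta>\<^sup>2 + 1) * exp (\<eta> * \<bar>t\<bar>) * exp (\<bar>qRe s\<bar> * \<bar>t\<bar>)"
        by (rule mult_right_mono) simp
      also have "\<dots> = (2 / \<eta>\<^sup>2 + 1) * exp ((\<bar>qRe s\<bar> + \<eta>) * \<bar>t\<bar>)" by (simp add: exp_add[symmetric] algebra_simps)
      also have "\<dots> \<le> (2 / \<eta>\<^sup>2 + 1) * exp (c * \<bar>t\<bar>)"
        using \<eta> by (intro mult_left_mono iffD2[OF exp_le_cancel_iff] mult_right_mono) auto
      finally show "\<bar>t\<bar> * exp (\<bar>qRe s\<bar> * \<bar>t\<bar>) \<le> (2 / \<eta>\<^sup>2 + 1) * exp (c * \<bar>t\<bar>)" .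
    qed simp
    finally show ?thesis by (simp add: mult.assoc)
  qed
  have Keq: "K t k = p t * (exp_kernel (- s * of_real t) k * of_real (- t))" for t k
  proof -
    have "- k * of_real t = (- t) *\<^sub>R k" by (simp add: of_real_def)
    moreover have "exp_kernel (- s * of_real t) k * of_real (- t) = (- t) *\<^sub>R exp_kernel (- s * of_real t) k"
      by (simp add: of_real_def)
    ultimately show ?thesis unfolding K_def using bounded_linear_exp_kernel[of "- s * of_real t"]
      by (simp only: linear_simps)
  qed
  have Km [measurable]: "(\<lambda>t. K t k) \<in> borel_measurable borel" for k
  proof -
    have "continuous_on UNIV (\<lambda>t. exp_kernel (- s * of_real t) k * of_real (- t))"
      by (intro continuous_intros continuous_on_compose2[OF continuous_on_exp_kernel]) auto
    then have "(\<lambda>t. exp_kernel (- s * of_real t) k * of_real (- t)) \<in> borel_measurable borel"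
      by (rule borel_measurable_continuous_onI)
    then show ?thesis unfolding Keq[abs_def] by (rule borel_measurable_times[OF pm])
  qed
  have Ki: "integrable N (\<lambda>t. K t k)" for k
  proof (rule Bochner_Integration.integrable_bound[of N "\<lambda>t. norm k * (2 / \<eta>\<^sup>2 + 1) * exp (c * \<bar>t\<bar>)"])
    show "AE t in N. norm (K t k) \<le> norm (norm k * (2 / \<eta>\<^sup>2 + 1) * exp (c * \<bar>t\<bar>))"
      using Kn[of _ k] order_trans[OF _ abs_ge_self] by (intro always_eventually allI) fastforce
  qed (use ei in \<open>auto intro!: integrable_mult_right\<close>)
  define D where "D k = (LINT t|N. K t k)" for k
  have bl: "bounded_linear (\<lambda>k. K t k)" for t
    unfolding Keq[abs_def] by (intro bounded_linear_const_mult bounded_linear_mult_const bounded_linear_exp_kernel)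
  have DL: "bounded_linear D"
  proof (rule bounded_linear_intro)
    show "D (x + y) = D x + D y" for x y
      unfolding D_def Bochner_Integration.integral_add[OF Ki Ki, symmetric] using bl by (simp add: linear_simps)
    show "D (r *\<^sub>R x) = r *\<^sub>R D x" for r x
      unfolding D_def integral_scaleR_right[symmetric] using bl by (simp add: linear_simps)
    show "norm (D x) \<le> norm x * ((2 / \<eta>\<^sup>2 + 1) * (LINT t|N. exp (c * \<bar>t\<bar>)))" for x
    proof -
      have "norm (D x) \<le> (LINT t|N. norm (K t x))" unfolding D_def by (rule integral_norm_bound)
      also have "\<dots> \<le> (LINT t|N. norm x * (2 / \<eta>\<^sup>2 + 1) * exp (c * \<bar>t\<bar>))"
        using Ki Kn ei by (intro integral_mono) (auto intro!: integrable_mult_right)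
      finally show ?thesis by (simp add: mult.assoc)
    qed
  qed
  have E: "has_bochner_integral N (\<lambda>t. p t * exp (- w * of_real t)) (laplace_stieltjes \<mu> w)" if "\<bar>qRe w\<bar> \<le> c" for w
    unfolding N_def p_def by (rule laplace_stieltjes_integral) (use \<mu> that in auto)
  define C where "C = 2 / \<eta>\<^sup>2 * (LINT t|N. exp (c * \<bar>t\<bar>))"
  have C0: "C \<ge> 0" unfolding C_def by (intro mult_nonneg_nonneg) auto
  have rem: "norm (laplace_stieltjes \<mu> w - laplace_stieltjes \<mu> s - D (w - s)) \<le> (norm (w - s))\<^sup>2 * C"
    if w: "norm (w - s) < \<eta>" for w
  proof -
    have wr: "\<bar>qRe w\<bar> \<le> \<bar>qRe s\<bar> + \<eta>"
      using abs_qRe_le_norm[of "w - s"] w by simp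
    have pt: "norm (p t * exp (- w * of_real t) - p t * exp (- s * of_real t) - K t (w - s)) \<le>
        (norm (w - s))\<^sup>2 * (2 / \<eta>\<^sup>2 * exp (c * \<bar>t\<bar>))" for t
    proof -
      let ?b = "(\<bar>qRe s\<bar> + \<eta>) * \<bar>t\<bar>"
      have "norm (p t * exp (- w * of_real t) - p t * exp (- s * of_real t) - K t (w - s)) =
          norm (p t * (exp (- w * of_real t) - exp (- s * of_real t) - exp_kernel (- s * of_real t) (- w * of_real t - - s * of_real t)))"
        unfolding K_def by (simp add: algebra_simps)
      also have "\<dots> \<le> (norm (- w * of_real t - - s * of_real t))\<^sup>2 * exp ?b"
        unfolding norm_mult pn mult_1 using wr \<eta>
        by (intro exp_remainder_le) (auto simp: quat_sel_mult abs_mult intro!: mult_right_mono)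
      also have "- w * of_real t - - s * of_real t = - (w - s) * of_real t" by (simp add: algebra_simps)
      also have "(norm (- (w - s) * of_real t))\<^sup>2 * exp ?b = (norm (w - s))\<^sup>2 * (\<bar>t\<bar>\<^sup>2 * exp ?b)"
        unfolding norm_mult norm_minus_cancel by (simp add: power_mult_distrib)
      also have "\<dots> \<le> (norm (w - s))\<^sup>2 * (2 / \<eta>\<^sup>2 * exp (c * \<bar>t\<bar>))"
      proof (rule mult_left_mono)
        have "\<bar>t\<bar>\<^sup>2 * exp ?b \<le> 2 / \<eta>\<^sup>2 * exp (\<eta> * \<bar>t\<bar>) * exp ?b"
          using power2_le_exp[of "\<bar>t\<bar>" \<eta>] \<eta> by (intro mult_right_mono) auto
        also have "\<dots> = 2 / \<eta>\<^sup>2 * exp ((\<bar>qRe s\<bar> + 2 * \<eta>) * \<bar>t\<bar>)" by (simp add: exp_add[symmetric] algebra_simps)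
        finally show "\<bar>t\<bar>\<^sup>2 * exp ?b \<le> 2 / \<eta>\<^sup>2 * exp (c * \<bar>t\<bar>)" by (simp only: \<eta>(2))
      qed simp
      finally show ?thesis .
    qed
    have hb: "has_bochner_integral N (\<lambda>t. p t * exp (- w * of_real t) - p t * exp (- s * of_real t) - K t (w - s))
        (laplace_stieltjes \<mu> w - laplace_stieltjes \<mu> s - D (w - s))"
      unfolding D_def using wr \<eta> s by (intro has_bochner_integral_diff E has_bochner_integral_integrable Ki) auto
    have "norm (laplace_stieltjes \<mu> w - laplace_stieltjes \<mu> s - D (w - s)) \<le>
        (LINT t|N. norm (p t * exp (- w * of_real t) - p t * exp (- s * of_real t) - K t (w - s)))"
      using integral_norm_bound[of N "\<lambda>t. p t * exp (- w * of_real t) - p t * exp (- s * of_real t) - K t (w - s)"]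
      unfolding has_bochner_integral_integral_eq[OF hb] .
    also have "\<dots> \<le> (LINT t|N. (norm (w - s))\<^sup>2 * (2 / \<eta>\<^sup>2 * exp (c * \<bar>t\<bar>)))"
    proof (rule integral_mono)
      show "integrable N (\<lambda>t. norm (p t * exp (- w * of_real t) - p t * exp (- s * of_real t) - K t (w - s)))"
        by (rule integrable_norm[OF integrable.intros[OF hb]])
    qed (use pt ei in \<open>auto intro!: integrable_mult_right\<close>)
    also have "\<dots> = (norm (w - s))\<^sup>2 * C" by (simp add: C_def)
    finally show ?thesis .
  qed
  have "(laplace_stieltjes \<mu> has_derivative D) (at s)"
    by (rule has_derivative_quadratic[OF DL \<eta>(1) rem])
  moreover have "D (in_slice I k) = D 1 * in_slice I k" if I: "I \<in> imag_sphere" "s = in_slice I z" for I z k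
  proof -
    have "K t (in_slice I k) = K t 1 * in_slice I k" for t
    proof -
      have e: "exp_kernel (- s * of_real t) (in_slice I k) = exp (- s * of_real t) * in_slice I k" for k
      proof -
        have "- s * of_real t = in_slice I (- z * of_real t)" by (simp add: I in_slice_mult in_slice_linear)
        then show ?thesis using exp_kernel_in_slice[OF I(1)] by metis
      qed
      show ?thesis using e[of k] e[of 1]
        by (simp add: Keq in_slice_linear mult.assoc of_real_quat_commute)
    qed
    then show ?thesis unfolding D_def by (simp add: Ki)
  qed
  ultimately show ?thesis by blast
qed

lemma holomorphic_Taylor_remainder:
  assumes F: "F holomorphic_on ball 0 \<rho>" and \<rho>: "\<rho> > 0" and B: "\<And>z. norm z < \<rho> \<Longrightarrow> norm (F z) \<le> B"
    and z: "norm z < \<rho> / 2"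
  shows "norm (F z - F 0 - deriv F 0 * z) \<le> (norm z)\<^sup>2 * (32 * B / \<rho>\<^sup>2)"
proof -
  have "norm ((\<lambda>n. (deriv ^^ n) F) 0 z - (\<Sum>i\<le>1. (\<lambda>n. (deriv ^^ n) F) i 0 * (z - 0) ^ i / (fact i))) \<le>
      32 * B / \<rho>\<^sup>2 * norm (z - 0) ^ (Suc 1) / fact 1"
  proof (rule complex_Taylor[where S = "ball 0 (\<rho> / 2)"])
    fix i :: nat and x :: complex assume x: "x \<in> ball 0 (\<rho> / 2)"
    have xb: "x \<in> ball 0 \<rho>" using x \<rho> by auto
    show "((deriv ^^ i) F has_field_derivative (deriv ^^ Suc i) F x) (at x within ball 0 (\<rho> / 2))"
      using has_field_derivative_higher_deriv[OF F open_ball xb, of i] has_field_derivative_at_within by blast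
  next
    fix x :: complex assume x: "x \<in> ball 0 (\<rho> / 2)"
    have sub: "cball x (\<rho> / 4) \<subseteq> ball 0 \<rho>"
      using x \<rho> by (auto simp: subset_iff dist_norm) (smt (verit) norm_minus_commute norm_triangle_sub)
    \<comment> \<open>Discs of radius \<rho>/4 about points of the half ball stay inside the ball;
      2! and 4^2 together give the constant 32.\<close>
    have "norm ((deriv ^^ 2) F x) \<le> fact 2 * B / (\<rho> / 4) ^ 2"
    proof (rule Cauchy_inequality)
      show "F holomorphic_on ball x (\<rho> / 4)" using F sub holomorphic_on_subset ball_subset_cball by blast
      show "continuous_on (cball x (\<rho> / 4)) F" using F sub holomorphic_on_subset holomorphic_on_imp_continuous_on by blast
      show "norm (F w) \<le> B" if "norm (x - w) = \<rho> / 4" for w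
        using sub that by (intro B) (auto simp: dist_norm subset_iff)
    qed (use \<rho> in auto)
    then show "norm ((deriv ^^ Suc 1) F x) \<le> 32 * B / \<rho>\<^sup>2"
      by (simp add: numeral_2_eq_2 power2_eq_square)
  qed (use z \<rho> in auto)
  then show ?thesis by (simp add: algebra_simps power2_eq_square)
qed

lemma norm_slice_coord_le: "I \<in> imag_sphere \<Longrightarrow> norm (slice_coord I q) \<le> 2 * norm q"
  using cmod_le[of "slice_coord I q"] abs_qRe_le_norm[of q] Cauchy_Schwarz_ineq2[of q I]
  by (simp add: slice_coord_def imag_sphere_def)

lemma norm_slice_fst_le: "I \<in> imag_sphere \<Longrightarrow> norm (slice_fst I q) \<le> 2 * norm q"
  using norm_slice_coord_le[of I "(1/2) *\<^sub>R (q - I * q * I)"] norm_triangle_ineq4[of q "I * q * I"]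
  by (simp add: slice_fst_def norm_mult imag_sphere_def)

lemma norm_slice_snd_le: "I \<in> imag_sphere \<Longrightarrow> J \<in> imag_sphere \<Longrightarrow> norm (slice_snd I J q) \<le> 2 * norm q"
  using norm_slice_coord_le[of I "(1/2) *\<^sub>R (- (J * (q + I * q * I)))"] norm_triangle_ineq[of q "I * q * I"]
  by (simp add: slice_snd_def norm_mult imag_sphere_def)

text \<open>On each slice the singularity is removable for both components, and Taylor's formula
  gives h(s) = h(0) + c s + O(|s|^2) with a constant independent of the slice. All slices share the
  real axis, which forces one and the same c, so the expansion holds in a full neighbourhood of
  0.\<close>

lemma right_slice_regular_removable:
  assumes h: "right_slice_regular_on h (ball 0 \<rho> - {0})" and \<rho>: "\<rho> > 0" and lim: "(h \<longlongrightarrow> h 0) (at 0)"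
  shows "\<exists>c. (h has_derivative (\<lambda>k. c * k)) (at 0)"
proof -
  \<comment> \<open>The component maps at most double the norm, hence the factor 2.\<close>
  define B where "B = 2 * (norm (h 0) + 1)"
  have "\<forall>\<^sub>F s in at 0. dist (h s) (h 0) < 1" using lim by (rule tendstoD) simp
  then obtain d where d: "d > 0" "\<And>s. s \<noteq> 0 \<Longrightarrow> norm s < d \<Longrightarrow> norm (h s - h 0) < 1"
    by (auto simp: eventually_at dist_norm)
  define \<rho>' where "\<rho>' = min d \<rho>"
  have \<rho>': "\<rho>' > 0" "\<rho>' \<le> d" "\<rho>' \<le> \<rho>" using d \<rho> by (auto simp: \<rho>'_def)
  have hB: "2 * norm (h s) \<le> B" if "norm s < \<rho>'" for s
  proof (cases "s = 0")
    case False
    then show ?thesis using d(2)[of s] that \<rho>' norm_triangle_sub[of "h s" "h 0"] by (simp add: B_def)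
  qed (simp add: B_def)
  define K where "K = 64 * B / \<rho>'\<^sup>2"
  have slice: "\<exists>c. \<forall>z. norm z < \<rho>' / 2 \<longrightarrow> norm (h (in_slice I z) - h 0 - c * in_slice I z) \<le> (norm z)\<^sup>2 * K"
    if I: "I \<in> imag_sphere" for I
  proof -
    obtain J where J: "J \<in> imag_sphere" "J * I = - (I * J)" using ex_anticommuting_unit[OF I] by blast
    have T: "norm (P (h (in_slice I z)) - P (h 0) - deriv (\<lambda>z. P (h (in_slice I z))) 0 * z) \<le> (norm z)\<^sup>2 * (32 * B / \<rho>'\<^sup>2)"
      if P: "bounded_linear P" "\<And>q z. P (q * in_slice I z) = P q * z" "\<And>q. norm (P q) \<le> 2 * norm q" and z: "norm z < \<rho>' / 2"
      for P z
    proof -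
      have s0: "in_slice I z = 0 \<longleftrightarrow> z = 0" for z using in_slice_eq_iff[OF I, of z 0] by (simp add: in_slice_linear)
      have sb: "in_slice I z \<in> ball 0 \<rho> - {0}" if "z \<in> ball 0 \<rho>' - {0}" for z
        using that \<rho>'(3) s0[of z] norm_in_slice[OF I, of z] by simp
      have "(\<lambda>z. P (h (in_slice I z))) holomorphic_on {z. in_slice I z \<in> ball 0 \<rho> - {0}}"
        by (rule right_slice_regular_holomorphic[OF h I P(1)]) (rule P(2))
      then have "(\<lambda>z. P (h (in_slice I z))) holomorphic_on ball 0 \<rho>' - {0}"
        by (rule holomorphic_on_subset) (use sb in blast)
      moreover have "continuous_on (ball 0 \<rho>') (\<lambda>z. P (h (in_slice I z)))"
        unfolding continuous_on_eq_continuous_at[OF open_ball]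
      proof
        fix z :: complex assume z: "z \<in> ball 0 \<rho>'"
        have "isCont h (in_slice I z)"
        proof (cases "z = 0")
          case True
          then show ?thesis using lim by (simp add: isCont_def in_slice_linear)
        next
          case False
          then have "in_slice I z \<in> ball 0 \<rho> - {0}" using z by (intro sb) auto
          then show ?thesis using h differentiable_imp_continuous_within unfolding right_slice_regular_on_def by blast
        qed
        then have "isCont (\<lambda>z. h (in_slice I z)) z"
          using isCont_o2[of z "in_slice I" h] linear_continuous_at[OF bounded_linear_in_slice[OF I]] by blast
        then show "isCont (\<lambda>z. P (h (in_slice I z))) z" by (rule bounded_linear.isCont[OF P(1)])
      qed
      ultimately have hol: "(\<lambda>z. P (h (in_slice I z))) holomorphic_on ball 0 \<rho>'"
        using no_isolated_singularity[of "ball 0 \<rho>'" "\<lambda>z. P (h (in_slice I z))" "{0}"] by simp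
      have "norm (P (h (in_slice I z)) - P (h (in_slice I 0)) - deriv (\<lambda>z. P (h (in_slice I z))) 0 * z)
          \<le> (norm z)\<^sup>2 * (32 * B / \<rho>'\<^sup>2)"
        by (rule holomorphic_Taylor_remainder[OF hol \<rho>'(1) _ z])
           (use order_trans[OF P(3) hB] in \<open>auto simp: norm_in_slice[OF I]\<close>)
      then show ?thesis by (simp add: in_slice_linear)
    qed
    define a where "a = deriv (\<lambda>z. slice_fst I (h (in_slice I z))) 0"
    define b where "b = deriv (\<lambda>z. slice_snd I J (h (in_slice I z))) 0"
    define c where "c = in_slice I a + J * in_slice I b"
    have "norm (h (in_slice I z) - h 0 - c * in_slice I z) \<le> (norm z)\<^sup>2 * K" if z: "norm z < \<rho>' / 2" for z
    proof -
      define A A0 Bz B0 where AB: "A = slice_fst I (h (in_slice I z))" "A0 = slice_fst I (h 0)"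
        "Bz = slice_snd I J (h (in_slice I z))" "B0 = slice_snd I J (h 0)"
      define u v where uv: "u = A - A0 - a * z" "v = Bz - B0 - b * z"
      have hz: "h (in_slice I z) = in_slice I A + J * in_slice I Bz" "h 0 = in_slice I A0 + J * in_slice I B0"
        unfolding AB by (rule slice_decomposition[OF I J])+
      have "h (in_slice I z) - h 0 - c * in_slice I z = in_slice I u + J * in_slice I v"
        unfolding hz c_def uv in_slice_linear in_slice_mult[OF I] by (simp add: algebra_simps)
      then have "norm (h (in_slice I z) - h 0 - c * in_slice I z) \<le> norm (in_slice I u) + norm (J * in_slice I v)"
        by (simp add: norm_triangle_ineq)
      also have "\<dots> = norm u + norm v" using J by (simp add: norm_mult norm_in_slice[OF I] imag_sphere_def)
      also have "\<dots> \<le> (norm z)\<^sup>2 * (32 * B / \<rho>'\<^sup>2) + (norm z)\<^sup>2 * (32 * B / \<rho>'\<^sup>2)"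
        unfolding uv AB a_def b_def
        by (intro add_mono T bounded_linear_slice_fst bounded_linear_slice_snd norm_slice_fst_le norm_slice_snd_le I J
            slice_fst_snd_mult[OF I J] z)
      also have "\<dots> = (norm z)\<^sup>2 * K" by (simp add: K_def)
      finally show ?thesis .
    qed
    then show ?thesis by blast
  qed
  obtain I0 :: quat where I0: "I0 \<in> imag_sphere" by (rule quat_in_slice)
  obtain c where c: "\<And>z. norm z < \<rho>' / 2 \<Longrightarrow> norm (h (in_slice I0 z) - h 0 - c * in_slice I0 z) \<le> (norm z)\<^sup>2 * K"
    using slice[OF I0] by blast
  have "(h has_derivative (\<lambda>k. c * k)) (at 0)"
  proof (rule has_derivative_quadratic[where \<delta> = "\<rho>' / 2" and C = K])
    fix s :: quat assume s: "norm (s - 0) < \<rho>' / 2"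
    obtain I z where I: "I \<in> imag_sphere" "s = in_slice I z" by (rule quat_in_slice)
    obtain c' where c': "\<And>z. norm z < \<rho>' / 2 \<Longrightarrow> norm (h (in_slice I z) - h 0 - c' * in_slice I z) \<le> (norm z)\<^sup>2 * K"
      using slice[OF I(1)] by blast
    \<comment> \<open>The two expansions are compared at a real point x, which belongs to both
      slices; afterwards x tends to 0.\<close>
    have "norm (c' - c) \<le> 2 * K * x" if x: "x > 0" "x < \<rho>' / 2" for x :: real
    proof -
      let ?y = "of_real x :: quat"
      have 1: "norm (h ?y - h 0 - c * ?y) \<le> x\<^sup>2 * K" "norm (h ?y - h 0 - c' * ?y) \<le> x\<^sup>2 * K"
        using c[of "of_real x"] c'[of "of_real x"] x by auto
      have eq: "(c' - c) * ?y = (h ?y - h 0 - c * ?y) - (h ?y - h 0 - c' * ?y)" by (simp add: algebra_simps)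
      have "norm ((c' - c) * ?y) \<le> x\<^sup>2 * K + x\<^sup>2 * K"
        unfolding eq by (rule order_trans[OF norm_triangle_ineq4 add_mono[OF 1]])
      moreover have "norm ((c' - c) * ?y) = norm (c' - c) * x" using x by (simp only: norm_mult norm_of_real abs_of_pos)
      moreover have "x\<^sup>2 * K + x\<^sup>2 * K = (2 * K * x) * x" by (simp add: power2_eq_square)
      ultimately have "norm (c' - c) * x \<le> (2 * K * x) * x" by metis
      then show ?thesis using x mult_right_le_imp_le by blast
    qed
    moreover have "((\<lambda>x. 2 * K * x) \<longlongrightarrow> 2 * K * 0) (at_right 0)" by (intro tendsto_intros)
    ultimately have "norm (c' - c) \<le> 2 * K * 0"
      using \<rho>' by (intro tendsto_lowerbound[of "\<lambda>x. 2 * K * x" _ "at_right 0"])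
        (auto simp: eventually_at_right_field intro!: exI[of _ "\<rho>' / 2"])
    then have "c' = c" by simp
    then show "norm (h s - h 0 - c * (s - 0)) \<le> (norm (s - 0))\<^sup>2 * K"
      using c'[of z] s I by (simp add: norm_in_slice)
  qed (use \<rho>' in \<open>auto intro: bounded_linear_mult_right\<close>)
  then show ?thesis by blast
qed

section \<open>Regularity of f composed with the inverse of the Moebius map\<close>

lemma right_slice_regular_on_subset:
  "right_slice_regular_on f U \<Longrightarrow> open V \<Longrightarrow> V \<subseteq> U \<Longrightarrow> right_slice_regular_on f V"
  unfolding right_slice_regular_on_def by blast

text \<open>The preimage under s \<mapsto> 1/s + \<alpha> of a set on which f is known to be
  regular, namely a strip together with the exterior of a ball; the point 0 stands for
  infinity.\<close>

definition moebius_domain :: "real \<Rightarrow> real \<Rightarrow> real \<Rightarrow> quat set" where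
  "moebius_domain \<alpha> c r =
     {s. s = 0 \<or> \<bar>qRe (inverse s + of_real \<alpha>)\<bar> < c \<or> r < norm (inverse s + of_real \<alpha>)}"

lemma moebius_ball: "r > 0 \<Longrightarrow> s \<noteq> 0 \<Longrightarrow> norm s < 1 / (r + \<bar>\<alpha>\<bar>) \<Longrightarrow> r < norm (inverse s + of_real \<alpha> :: quat)"
proof -
  assume *: "r > 0" "s \<noteq> 0" "norm s < 1 / (r + \<bar>\<alpha>\<bar>)"
  then have "r + \<bar>\<alpha>\<bar> < inverse (norm s)" by (simp add: field_simps)
  then have "r + \<bar>\<alpha>\<bar> < norm (inverse s)" by (simp only: norm_inverse)
  then show ?thesis using norm_diff_ineq[of "inverse s" "of_real \<alpha> :: quat"] by simp
qed

lemma isCont_qRe: "isCont qRe q"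
proof -
  have "isCont (\<lambda>q :: quat. inner q 1) q" by (intro continuous_intros)
  moreover have "(\<lambda>q. inner q 1) = qRe" by (rule ext) (simp add: inner_quat_def)
  ultimately show ?thesis by simp
qed

lemma open_moebius_domain:
  assumes r: "r > 0"
  shows "open (moebius_domain \<alpha> c r - {0})" "open (moebius_domain \<alpha> c r)"
proof -
  have cq: "continuous_on S qRe" for S using isCont_qRe continuous_at_imp_continuous_on by blast
  have "open {x :: quat. \<bar>qRe x\<bar> < c}" "open {x :: quat. r < norm x}"
    by (intro open_Collect_less continuous_intros cq)+
  then have "open ((- {0}) \<inter> (\<lambda>s. inverse s + of_real \<alpha>) -` ({x :: quat. \<bar>qRe x\<bar> < c} \<union> {x. r < norm x}))"
    by (intro continuous_open_preimage continuous_intros) auto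
  moreover have "(- {0}) \<inter> (\<lambda>s. inverse s + of_real \<alpha>) -` ({x :: quat. \<bar>qRe x\<bar> < c} \<union> {x. r < norm x}) =
      moebius_domain \<alpha> c r - {0}" by (auto simp: moebius_domain_def)
  ultimately show 1: "open (moebius_domain \<alpha> c r - {0})" by simp
  have "moebius_domain \<alpha> c r = (moebius_domain \<alpha> c r - {0}) \<union> ball 0 (1 / (r + \<bar>\<alpha>\<bar>))"
    using moebius_ball[OF r, of _ \<alpha>] r by (auto simp: moebius_domain_def)
  then show "open (moebius_domain \<alpha> c r)" using 1 by (metis open_Un open_ball)
qed

text \<open>Away from 0 the chain rule suffices: s \<mapsto> 1/s + \<alpha> preserves every slice,
  and along the slice its derivative is multiplication by an element of the slice. At 0 the limit of
  f at infinity provides the continuity that makes the singularity removable.\<close>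

lemma right_slice_regular_moebius:
  assumes \<mu>: "quaternionic_measure \<mu>" "exp_integrable c \<mu>"
    and f: "\<And>s. \<bar>qRe s\<bar> < c \<Longrightarrow> f s = laplace_stieltjes \<mu> s"
    and r: "r > 0" "right_slice_regular_on f {s. norm s > r}" and l: "(f \<longlongrightarrow> l) at_infinity"
  shows "right_slice_regular_on (\<lambda>s. if s = 0 then l else f (inverse s + of_real \<alpha>)) (moebius_domain \<alpha> c r)"
proof -
  define h where "h s = (if s = 0 then l else f (inverse s + of_real \<alpha>))" for s
  have nz: "\<exists>D. (h has_derivative D) (at (in_slice I z)) \<and> D I = D 1 * I"
    if I: "I \<in> imag_sphere" and z: "in_slice I z \<in> moebius_domain \<alpha> c r - {0}" for I z
  proof -
    define s where "s = in_slice I z"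
    define w where "w = inverse z + of_real \<alpha>"
    have s0: "s \<noteq> 0" using z by (simp add: s_def)
    have x: "inverse s + of_real \<alpha> = in_slice I w"
      by (simp add: s_def w_def in_slice_linear in_slice_inverse[OF I])
    have "\<exists>D. (f has_derivative D) (at (in_slice I w)) \<and> (\<forall>k. D (in_slice I k) = D 1 * in_slice I k)"
    proof (cases "\<bar>qRe (in_slice I w)\<bar> < c")
      case True
      obtain D where D: "(laplace_stieltjes \<mu> has_derivative D) (at (in_slice I w))"
          "\<And>k. D (in_slice I k) = D 1 * in_slice I k"
        using laplace_stieltjes_has_derivative[OF \<mu> True] I by blast
      have "open {x :: quat. \<bar>qRe x\<bar> < c}"
        by (intro open_Collect_less continuous_intros continuous_at_imp_continuous_on ballI isCont_qRe)
      from has_derivative_transform_within_open[OF D(1) this, of f] f True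
      have "(f has_derivative D) (at (in_slice I w))" by auto
      then show ?thesis using D(2) by blast
    next
      case False
      have "\<bar>qRe (inverse s + of_real \<alpha>)\<bar> < c \<or> r < norm (inverse s + of_real \<alpha>)"
        using z s0 unfolding moebius_domain_def s_def by blast
      then have "in_slice I w \<in> {s. norm s > r}" using False unfolding x by simp
      then show ?thesis by (rule right_slice_regular_on_derivative[OF r(2) I]) blast
    qed
    then obtain D where D: "(f has_derivative D) (at (inverse s + of_real \<alpha>))" "\<And>k. D (in_slice I k) = D 1 * in_slice I k"
      unfolding x by blast
    have "((\<lambda>s. inverse s + of_real \<alpha>) has_derivative (\<lambda>k. - (inverse s * k * inverse s))) (at s)"
      using s0 by (auto intro!: derivative_eq_intros)
    from has_derivative_compose[OF this D(1)]
    have "((\<lambda>s. f (inverse s + of_real \<alpha>)) has_derivative (\<lambda>k. D (- (inverse s * k * inverse s)))) (at s)" .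
    then have "(h has_derivative (\<lambda>k. D (- (inverse s * k * inverse s)))) (at s)"
      by (rule has_derivative_transform_within_open[where s = "- {0}"]) (use s0 in \<open>auto simp: h_def\<close>)
    moreover have "D (- (inverse s * I * inverse s)) = D (- (inverse s * 1 * inverse s)) * I"
    proof -
      have "- (inverse s * I * inverse s) = in_slice I (- (inverse z * \<i> * inverse z))"
        "- (inverse s * 1 * inverse s) = in_slice I (- (inverse z * inverse z))"
        by (simp_all add: s_def in_slice_linear in_slice_mult[OF I] in_slice_inverse[OF I] in_slice_ii)
      moreover have "in_slice I (- (inverse z * \<i> * inverse z)) = in_slice I (- (inverse z * inverse z)) * I"
        using in_slice_mult[OF I, of "- (inverse z * inverse z)" \<i>] by (simp add: mult_ac)
      ultimately show ?thesis using D(2) by (metis mult.assoc)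
    qed
    ultimately show ?thesis unfolding s_def by blast
  qed
  have "right_slice_regular_on h (moebius_domain \<alpha> c r - {0})"
    by (rule right_slice_regular_onI[OF open_moebius_domain(1)[OF r(1)]]) (use nz in auto)
  then have hb: "right_slice_regular_on h (ball 0 (1 / (r + \<bar>\<alpha>\<bar>)) - {0})"
    by (rule right_slice_regular_on_subset)
       (use moebius_ball[OF r(1), of _ \<alpha>] r(1) in \<open>auto simp: moebius_domain_def intro: open_delete\<close>)
  have "(h \<longlongrightarrow> h 0) (at 0)"
  proof -
    have inv: "filterlim (\<lambda>s. inverse s + of_real \<alpha>) at_infinity (at (0 :: quat))"
      by (rule tendsto_add_filterlim_at_infinity'[OF filterlim_inverse_at_infinity tendsto_const])
    from filterlim_compose[OF l inv] have "((\<lambda>s. f (inverse s + of_real \<alpha>)) \<longlongrightarrow> l) (at 0)" .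
    moreover have "\<forall>\<^sub>F s in at 0. f (inverse s + of_real \<alpha>) = h s"
      by (auto simp: h_def eventually_at_filter)
    ultimately have "(h \<longlongrightarrow> l) (at 0)" by (rule Lim_transform_eventually)
    then show ?thesis by (simp add: h_def)
  qed
  moreover have "1 / (r + \<bar>\<alpha>\<bar>) > 0" using r(1) by simp
  ultimately obtain c0 where c0: "(h has_derivative (\<lambda>k. c0 * k)) (at 0)"
    using right_slice_regular_removable[OF hb] by blast
  have "right_slice_regular_on h (moebius_domain \<alpha> c r)"
  proof (rule right_slice_regular_onI[OF open_moebius_domain(2)[OF r(1)]])
    fix I z assume I: "I \<in> imag_sphere" "in_slice I z \<in> moebius_domain \<alpha> c r"
    show "\<exists>D. (h has_derivative D) (at (in_slice I z)) \<and> D I = D 1 * I"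
      using nz[OF I(1), of z] I(2) c0 by (cases "in_slice I z = 0") auto
  qed
  then show ?thesis unfolding h_def[abs_def] .
qed

section \<open>Generators of strongly continuous groups\<close>

lemma is_bounded_inverse_unique:
  assumes "is_bounded_inverse D R B" "is_bounded_inverse D R B'"
  shows "B = B'"
proof (rule blinfun_eqI)
  fix w
  have "B' w \<in> D" "R (B' w) = w" using assms(2) by (auto simp: is_bounded_inverse_def)
  then show "B w = B' w" using assms(1) unfolding is_bounded_inverse_def by metis
qed

lemma bounded_inverse_eq: "is_bounded_inverse D R B \<Longrightarrow> bounded_inverse D R = B"
  unfolding bounded_inverse_def using is_bounded_inverse_unique by blast

lemma bounded_linear_rscale: "bounded_linear (\<lambda>v :: 'v::quaternionic_banach. v *\<^sub>r a)"
proof (rule bounded_linear_intro[where K = "norm a"])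
  fix v w :: 'v and r :: real
  show "(v + w) *\<^sub>r a = v *\<^sub>r a + w *\<^sub>r a" by (rule rscale_add_left)
  have "r *\<^sub>R (v *\<^sub>r a) = v *\<^sub>r (a * of_real r)" by (simp add: rscale_mult rscale_of_real)
  also have "a * of_real r = of_real r * a" by (simp add: of_real_quat_commute)
  finally show "(r *\<^sub>R v) *\<^sub>r a = r *\<^sub>R (v *\<^sub>r a)" by (simp add: rscale_mult rscale_of_real)
  show "norm (v *\<^sub>r a) \<le> norm v * norm a" by (simp add: norm_rscale)
qed

lemma rscale_diff_scaleR:
  fixes v w :: "'v::quaternionic_banach"
  shows "(v - w) *\<^sub>r a = v *\<^sub>r a - w *\<^sub>r a" "(r *\<^sub>R v) *\<^sub>r a = r *\<^sub>R (v *\<^sub>r a)"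
proof -
  interpret bounded_linear "\<lambda>v :: 'v. v *\<^sub>r a" by (rule bounded_linear_rscale)
  show "(v - w) *\<^sub>r a = v *\<^sub>r a - w *\<^sub>r a" "(r *\<^sub>R v) *\<^sub>r a = r *\<^sub>R (v *\<^sub>r a)" by (rule diff scaleR)+
qed

locale group_generator =
  fixes Z :: "real \<Rightarrow> 'v::quaternionic_banach \<Rightarrow>\<^sub>L 'v" and M \<omega> :: real
  assumes Z: "strongly_continuous_group Z" and M: "M > 0" and \<omega>: "\<omega> \<ge> 0"
    and bound: "norm (Z t) \<le> M * exp (\<omega> * \<bar>t\<bar>)"
begin

abbreviation D where "D \<equiv> generator_domain Z"
abbreviation T where "T \<equiv> generator Z"

lemma Z_rlin: "Z t (v *\<^sub>r a) = Z t v *\<^sub>r a"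
  and Z_0: "Z 0 v = v" and Z_add: "Z (s + t) v = Z s (Z t v)"
  and Z_cont: "continuous_on UNIV (\<lambda>t. Z t v)"
  using Z by (auto simp: strongly_continuous_group_def right_linear_ops_def)

lemma generator_tendsto: "v \<in> D \<Longrightarrow> ((\<lambda>h. (1 / h) *\<^sub>R (Z h v - v)) \<longlongrightarrow> T v) (at_right 0)"
proof -
  assume "v \<in> D"
  then obtain l where l: "((\<lambda>h. (1 / h) *\<^sub>R (Z h v - v)) \<longlongrightarrow> l) (at_right 0)"
    by (auto simp: generator_domain_def)
  with tendsto_Lim[OF trivial_limit_at_right_real l] show ?thesis by (simp add: generator_def)
qed

lemma generatorI:
  assumes "((\<lambda>h. (1 / h) *\<^sub>R (Z h v - v)) \<longlongrightarrow> l) (at_right 0)"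
  shows "v \<in> D" "T v = l"
  using assms tendsto_Lim[OF trivial_limit_at_right_real assms]
  by (auto simp: generator_domain_def generator_def)

lemma generator_add:
  assumes "v \<in> D" "w \<in> D"
  shows "v + w \<in> D" "T (v + w) = T v + T w"
proof -
  have "((\<lambda>h. (1 / h) *\<^sub>R (Z h (v + w) - (v + w))) \<longlongrightarrow> T v + T w) (at_right 0)"
    using tendsto_add[OF generator_tendsto[OF assms(1)] generator_tendsto[OF assms(2)]]
    by (simp add: blinfun.add_right algebra_simps)
  from generatorI[OF this] show "v + w \<in> D" "T (v + w) = T v + T w" .
qed

lemma generator_scaleR:
  assumes "v \<in> D"
  shows "r *\<^sub>R v \<in> D" "T (r *\<^sub>R v) = r *\<^sub>R T v"
proof -
  have "((\<lambda>h. (1 / h) *\<^sub>R (Z h (r *\<^sub>R v) - r *\<^sub>R v)) \<longlongrightarrow> r *\<^sub>R T v) (at_right 0)"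
    using tendsto_scaleR[OF tendsto_const generator_tendsto[OF assms], of r]
    by (simp add: blinfun.scaleR_right scaleR_diff_right mult.commute)
  from generatorI[OF this] show "r *\<^sub>R v \<in> D" "T (r *\<^sub>R v) = r *\<^sub>R T v" .
qed

lemma generator_rscale:
  assumes "v \<in> D"
  shows "v *\<^sub>r a \<in> D" "T (v *\<^sub>r a) = T v *\<^sub>r a"
proof -
  interpret bounded_linear "\<lambda>v :: 'v. v *\<^sub>r a" by (rule bounded_linear_rscale)
  have "((\<lambda>h. (1 / h) *\<^sub>R (Z h (v *\<^sub>r a) - v *\<^sub>r a)) \<longlongrightarrow> T v *\<^sub>r a) (at_right 0)"
    using tendsto[OF generator_tendsto[OF assms]] by (simp add: Z_rlin scaleR diff)
  from generatorI[OF this] show "v *\<^sub>r a \<in> D" "T (v *\<^sub>r a) = T v *\<^sub>r a" .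
qed

lemma generator_diff:
  assumes "v \<in> D" "w \<in> D"
  shows "v - w \<in> D" "T (v - w) = T v - T w"
  using generator_add[OF assms(1) generator_scaleR(1)[OF assms(2), of "-1"]] generator_scaleR[OF assms(2), of "-1"]
  by simp_all

lemma generator_0: "0 \<in> D" "T 0 = 0"
  using generatorI[of 0 0] by (auto simp: blinfun.zero_right)

lemma norm_Z_apply: "norm (Z t v) \<le> M * exp (\<omega> * \<bar>t\<bar>) * norm v"
  by (rule order_trans[OF norm_blinfun mult_right_mono[OF bound]]) simp

text \<open>The generator is defined by a limit from the right only. For a group, the quotient at -h
  is \<open>Z (- h)\<close> applied to the quotient at h, so the limit from the left exists and
  agrees, by strong continuity and the norm bound for \<open>Z (- h)\<close>.\<close>

lemma has_vector_derivative_Z: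
  assumes v: "v \<in> D"
  shows "((\<lambda>t. Z t v) has_vector_derivative Z t (T v)) (at t)"
proof -
  define g where "g h = (1 / h) *\<^sub>R (Z h v - v)" for h
  have right: "(g \<longlongrightarrow> T v) (at_right 0)" unfolding g_def by (rule generator_tendsto[OF v])
  have right': "((\<lambda>h. Z (- h) (g h)) \<longlongrightarrow> T v) (at_right 0)"
  proof -
    have "((\<lambda>h. Z (- h) (T v)) \<longlongrightarrow> Z (- 0) (T v)) (at_right 0)"
    proof -
      have "isCont (\<lambda>t. Z t (T v)) (- 0)" using Z_cont by (simp add: continuous_on_eq_continuous_at)
      moreover have "((\<lambda>h::real. - h) \<longlongrightarrow> - 0) (at_right 0)" by (intro tendsto_intros)
      ultimately show ?thesis by (rule isCont_tendsto_compose)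
    qed
    moreover have "((\<lambda>h. Z (- h) (g h - T v)) \<longlongrightarrow> 0) (at_right 0)"
    proof (rule Lim_null_comparison[where g = "\<lambda>h. M * exp (\<omega> * \<bar>- h\<bar>) * norm (g h - T v)"])
      have "((\<lambda>h. M * exp (\<omega> * \<bar>- h\<bar>) * norm (g h - T v)) \<longlongrightarrow> M * exp (\<omega> * \<bar>- 0\<bar>) * norm (T v - T v)) (at_right 0)"
        by (intro tendsto_intros right)
      then show "((\<lambda>h. M * exp (\<omega> * \<bar>- h\<bar>) * norm (g h - T v)) \<longlongrightarrow> 0) (at_right 0)" by simp
    qed (use norm_Z_apply in \<open>intro always_eventually allI\<close>)
    ultimately have "((\<lambda>h. Z (- h) (g h - T v) + Z (- h) (T v)) \<longlongrightarrow> 0 + Z (- 0) (T v)) (at_right 0)"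
      by (intro tendsto_add)
    then show ?thesis by (simp add: blinfun.diff_right Z_0)
  qed
  have "g (- h) = Z (- h) (g h)" for h
  proof -
    have "Z (- h) (Z h v) = v" using Z_add[of "- h" h v] by (simp add: Z_0)
    then have "Z (- h) (g h) = (1 / h) *\<^sub>R (v - Z (- h) v)"
      by (simp add: g_def blinfun.scaleR_right blinfun.diff_right)
    then show ?thesis by (simp add: g_def algebra_simps)
  qed
  then have left: "(g \<longlongrightarrow> T v) (at_left 0)"
    using right' filterlim_at_left_to_right[of g "nhds (T v)" 0] by simp
  have g0: "(g \<longlongrightarrow> T v) (at 0)" by (rule filterlim_split_at[OF left right])
  have "((\<lambda>h. (Z (t + h) v - Z t v) /\<^sub>R h) \<longlongrightarrow> Z t (T v)) (at 0)"
  proof -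
    have "((\<lambda>h. Z t (g h)) \<longlongrightarrow> Z t (T v)) (at 0)" by (intro tendsto_intros g0)
    then show ?thesis
      by (simp add: g_def blinfun.scaleR_right blinfun.diff_right Z_add divide_inverse)
  qed
  from tendsto_norm[OF tendsto_diff[OF this tendsto_const[of "Z t (T v)"]]]
  have "((\<lambda>h. norm ((Z (t + h) v - Z t v) /\<^sub>R h - Z t (T v))) \<longlongrightarrow> 0) (at 0)" by simp
  moreover have "\<forall>\<^sub>F h in at 0. norm ((Z (t + h) v - Z t v) /\<^sub>R h - Z t (T v)) =
      norm (Z (t + h) v - Z t v - h *\<^sub>R Z t (T v)) / norm h"
  proof -
    have "norm ((Z (t + h) v - Z t v) /\<^sub>R h - Z t (T v)) = norm (Z (t + h) v - Z t v - h *\<^sub>R Z t (T v)) / norm h"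
      if "h \<noteq> 0" for h
    proof -
      have "(Z (t + h) v - Z t v) /\<^sub>R h - Z t (T v) = inverse h *\<^sub>R (Z (t + h) v - Z t v - h *\<^sub>R Z t (T v))"
        using that by (simp add: scaleR_diff_right)
      then show ?thesis by (simp add: divide_inverse mult.commute)
    qed
    then show ?thesis by (auto simp: eventually_at_filter)
  qed
  ultimately have "((\<lambda>h. norm (Z (t + h) v - Z t v - h *\<^sub>R Z t (T v)) / norm h) \<longlongrightarrow> 0) (at 0)"
    by (rule Lim_transform_eventually)
  then show ?thesis
    unfolding has_vector_derivative_def has_derivative_at by (simp add: bounded_linear_scaleR_left)
qed

text \<open>A Landau inequality: it replaces the closed graph theorem when bounding \<open>T B\<close> for the
  inverse \<open>B\<close> of a quadratic polynomial in \<open>T\<close>.\<close>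

lemma landau:
  fixes \<alpha> :: real
  defines "S \<equiv> \<lambda>x. T x - \<alpha> *\<^sub>R x"
  assumes x: "x \<in> D" "S x \<in> D" and \<tau>: "0 < \<tau>" "\<tau> \<le> 1"
  shows "norm (S x) \<le> (M * exp (\<omega> + \<bar>\<alpha>\<bar>) + 1) / \<tau> * norm x + \<tau> * (M * exp (\<omega> + \<bar>\<alpha>\<bar>)) * norm (S (S x))"
proof -
  define C where "C = M * exp (\<omega> + \<bar>\<alpha>\<bar>)"
  have C0: "C > 0" using M by (simp add: C_def)
  have ZC: "norm (exp (- \<alpha> * u) *\<^sub>R Z u v) \<le> C * norm v" if u: "0 \<le> u" "u \<le> 1" for u v
  proof -
    have "norm (exp (- \<alpha> * u) *\<^sub>R Z u v) \<le> exp (- \<alpha> * u) * (M * exp (\<omega> * \<bar>u\<bar>) * norm v)"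
      using norm_Z_apply[of u v] by simp
    also have "\<dots> = M * exp (\<omega> * u - \<alpha> * u) * norm v" using u by (simp add: exp_add[symmetric] exp_diff exp_minus field_simps)
    also have "\<dots> \<le> M * exp (\<omega> + \<bar>\<alpha>\<bar>) * norm v"
    proof -
      have "\<omega> * u \<le> \<omega>" using u \<omega> by (simp add: mult_left_le)
      moreover have "- \<alpha> * u \<le> \<bar>\<alpha>\<bar> * 1" using u by (intro mult_mono) auto
      ultimately show ?thesis using M by (intro mult_right_mono mult_left_mono iffD2[OF exp_le_cancel_iff]) auto
    qed
    finally show ?thesis by (simp add: C_def)
  qed
  \<comment> \<open>Taylor's formula of second order for the rescaled group exp(-\<alpha> u) Z(u),
    whose generator is \<open>S\<close>: \<open>g 0\<close> is x + \<tau> S x,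
    \<open>g \<tau>\<close> is the rescaled orbit at \<tau>, and the derivative of \<open>g\<close>
    is the integrand of the remainder.\<close>
  define g where "g u = exp (- \<alpha> * u) *\<^sub>R ((\<tau> - u) *\<^sub>R Z u (S x) + Z u x)" for u
  have der: "(g has_vector_derivative (\<tau> - u) *\<^sub>R (exp (- \<alpha> * u) *\<^sub>R Z u (S (S x)))) (at u within {0..\<tau>})" for u
  proof -
    have 1: "((\<lambda>u. Z u (S x)) has_vector_derivative Z u (T (S x))) (at u within {0..\<tau>})"
      "((\<lambda>u. Z u x) has_vector_derivative Z u (T x)) (at u within {0..\<tau>})"
      using x by (auto intro: has_vector_derivative_at_within has_vector_derivative_Z)
    have "(g has_vector_derivative
        exp (- \<alpha> * u) *\<^sub>R (((\<tau> - u) *\<^sub>R Z u (T (S x)) + (- 1) *\<^sub>R Z u (S x)) + Z u (T x)) +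
        (- \<alpha> * exp (- \<alpha> * u)) *\<^sub>R ((\<tau> - u) *\<^sub>R Z u (S x) + Z u x)) (at u within {0..\<tau>})"
      unfolding g_def
      by (intro has_vector_derivative_scaleR has_vector_derivative_add 1) (auto intro!: derivative_eq_intros)
    moreover have "T x = S x + \<alpha> *\<^sub>R x" "T (S x) = S (S x) + \<alpha> *\<^sub>R S x" by (simp_all add: S_def)
    ultimately show ?thesis
      by (simp add: blinfun.add_right blinfun.scaleR_right algebra_simps)
  qed
  have "norm (g \<tau> - g 0) \<le> (\<tau> * (C * norm (S (S x)))) * measure lborel {0..\<tau>}"
  proof (rule has_integral_bound_real)
    show "((\<lambda>u. (\<tau> - u) *\<^sub>R (exp (- \<alpha> * u) *\<^sub>R Z u (S (S x)))) has_integral (g \<tau> - g 0)) {0..\<tau>}"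
      using \<tau> by (intro fundamental_theorem_of_calculus der) auto
    fix u assume u: "u \<in> {0..\<tau>} - {}"
    have "norm ((\<tau> - u) *\<^sub>R (exp (- \<alpha> * u) *\<^sub>R Z u (S (S x)))) = (\<tau> - u) * norm (exp (- \<alpha> * u) *\<^sub>R Z u (S (S x)))"
      using u by simp
    also have "\<dots> \<le> \<tau> * (C * norm (S (S x)))" using u \<tau> C0 by (intro mult_mono ZC) auto
    finally show "norm ((\<tau> - u) *\<^sub>R (exp (- \<alpha> * u) *\<^sub>R Z u (S (S x)))) \<le> \<tau> * (C * norm (S (S x)))" .
  qed (use \<tau> C0 in auto)
  then have n: "norm (g \<tau> - g 0) \<le> \<tau> * (\<tau> * C * norm (S (S x)))" using \<tau> by (simp add: mult_ac)
  have g: "g \<tau> = exp (- \<alpha> * \<tau>) *\<^sub>R Z \<tau> x" "g 0 = \<tau> *\<^sub>R S x + x" by (simp_all add: g_def Z_0)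
  have "\<tau> * norm (S x) = norm (g \<tau> - x - (g \<tau> - g 0))" using \<tau> by (simp add: g(2))
  also have "\<dots> \<le> norm (g \<tau>) + norm x + norm (g \<tau> - g 0)"
    using norm_triangle_ineq4[of "g \<tau> - x" "g \<tau> - g 0"] norm_triangle_ineq4[of "g \<tau>" x] by linarith
  also have "\<dots> \<le> C * norm x + norm x + \<tau> * (\<tau> * C * norm (S (S x)))"
    using n ZC[of \<tau> x] \<tau> by (simp add: g(1))
  finally have "norm (S x) \<le> (C * norm x + norm x + \<tau> * (\<tau> * C * norm (S (S x)))) / \<tau>"
    using \<tau> by (simp add: pos_le_divide_eq mult.commute)
  also have "\<dots> = (C + 1) / \<tau> * norm x + \<tau> * C * norm (S (S x))" using \<tau> by (simp add: field_simps)
  finally show ?thesis by (simp add: C_def)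
qed

section \<open>The shifted generator and its inverse\<close>

lemma generator_shift_linear:
  assumes "v \<in> D" "w \<in> D"
  shows "T (v + w) - \<alpha> *\<^sub>R (v + w) = (T v - \<alpha> *\<^sub>R v) + (T w - \<alpha> *\<^sub>R w)"
    "T (r *\<^sub>R v) - \<alpha> *\<^sub>R (r *\<^sub>R v) = r *\<^sub>R (T v - \<alpha> *\<^sub>R v)"
    "T (v *\<^sub>r a) - \<alpha> *\<^sub>R (v *\<^sub>r a) = (T v - \<alpha> *\<^sub>R v) *\<^sub>r a"
proof -
  interpret r: bounded_linear "\<lambda>v :: 'v. v *\<^sub>r a" by (rule bounded_linear_rscale)
  show "T (v *\<^sub>r a) - \<alpha> *\<^sub>R (v *\<^sub>r a) = (T v - \<alpha> *\<^sub>R v) *\<^sub>r a"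
    using assms by (simp add: generator_rscale r.diff r.scaleR)
qed (use assms in \<open>simp_all add: generator_add generator_scaleR algebra_simps\<close>)

lemma dom_sq_shift:
  "x \<in> dom_sq D T \<longleftrightarrow> x \<in> D \<and> T x - \<alpha> *\<^sub>R x \<in> D"
proof -
  have "T x \<in> D \<longleftrightarrow> T x - \<alpha> *\<^sub>R x \<in> D" if x: "x \<in> D"
    using generator_diff(1)[OF _ generator_scaleR(1)[OF x, of \<alpha>], of "T x"]
      generator_add(1)[OF _ generator_scaleR(1)[OF x, of \<alpha>], of "T x - \<alpha> *\<^sub>R x"] by auto
  then show ?thesis by (auto simp: dom_sq_def)
qed

text \<open>For real \<alpha> the quadratic polynomial of T at s is that of S = T - \<alpha> at s -
  \<alpha>. This is the form in which S can be replaced by its inverse.\<close>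

lemma R_op_shift:
  assumes "x \<in> dom_sq D T"
  shows "R_op s T x = (T (T x - \<alpha> *\<^sub>R x) - \<alpha> *\<^sub>R (T x - \<alpha> *\<^sub>R x)) - (2 * (qRe s - \<alpha>)) *\<^sub>R (T x - \<alpha> *\<^sub>R x)
    + ((norm (s - of_real \<alpha>))\<^sup>2) *\<^sub>R x"
proof -
  have x: "x \<in> D" "T x \<in> D" using assms by (auto simp: dom_sq_def)
  have "(norm (s - of_real \<alpha>))\<^sup>2 = (norm s)\<^sup>2 - 2 * \<alpha> * qRe s + \<alpha>\<^sup>2"
    unfolding norm_quat_sq by (simp add: power2_eq_square algebra_simps)
  moreover have two: "(a * 2) *\<^sub>R y = a *\<^sub>R y + a *\<^sub>R y" "(a * (b * 2)) *\<^sub>R y = (a * b) *\<^sub>R y + (a * b) *\<^sub>R y"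
    for a b and y :: 'v
    by (metis mult_2_right scaleR_left_distrib, metis mult.assoc mult_2_right scaleR_left_distrib)
  ultimately show ?thesis
    using x by (simp add: R_op_def generator_diff generator_scaleR power2_eq_square scaleR_diff_right scaleR_add_right
        scaleR_diff_left scaleR_add_left left_diff_distrib right_diff_distrib mult_ac two)
qed

text \<open>The resolvent equation expresses S^2 B by the identity, S B and B. Inserted into the
  inequality of \<open>landau\<close>, the term with S B carries the factor \<tau> and is absorbed
  on the left when \<tau> is small.\<close>

lemma shift_resolvent_bounded:
  fixes \<alpha> :: real
  defines "S \<equiv> \<lambda>x. T x - \<alpha> *\<^sub>R x"
  assumes B: "is_bounded_inverse (dom_sq D T) (R_op s T) B"
  shows "\<exists>SB. SB \<in> right_linear_ops \<and> (\<forall>w. SB w = S (B w))"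
proof -
  define C where "C = M * exp (\<omega> + \<bar>\<alpha>\<bar>)"
  have C0: "C > 0" using M by (simp add: C_def)
  have Bd: "B w \<in> D" "S (B w) \<in> D" "R_op s T (B w) = w" "B w \<in> dom_sq D T" for w
    using B dom_sq_shift[of "B w" \<alpha>] by (auto simp: is_bounded_inverse_def S_def)
  define \<beta> \<gamma> where bg: "\<beta> = qRe s - \<alpha>" "\<gamma> = (norm (s - of_real \<alpha>))\<^sup>2"
  have SS: "S (S (B w)) = w + (2 * \<beta>) *\<^sub>R S (B w) - \<gamma> *\<^sub>R B w" for w
    using R_op_shift[OF Bd(4), of s w \<alpha>] Bd(3)[of w] by (simp add: S_def bg algebra_simps)
  \<comment> \<open>Chosen so that the coefficient of \<open>norm (S (B w))\<close> becomes at most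
    1/2; the 1 added to |\<beta>| avoids a division by zero.\<close>
  define \<tau> where "\<tau> = min 1 (1 / (4 * C * (\<bar>\<beta>\<bar> + 1)))"
  have \<tau>: "0 < \<tau>" "\<tau> \<le> 1" using C0 by (auto simp: \<tau>_def)
  have "\<tau> * C * (2 * \<bar>\<beta>\<bar>) \<le> 1 / 2"
  proof -
    have "\<tau> * (C * (2 * \<bar>\<beta>\<bar>)) \<le> 1 / (4 * C * (\<bar>\<beta>\<bar> + 1)) * (C * (2 * \<bar>\<beta>\<bar>))"
      using C0 by (intro mult_right_mono) (auto simp: \<tau>_def)
    also have "\<dots> \<le> 1 / 2"
    proof -
      have p: "4 * C * (\<bar>\<beta>\<bar> + 1) > 0" using C0 by simp
      have "C * (2 * \<bar>\<beta>\<bar>) \<le> 1 / 2 * (4 * C * (\<bar>\<beta>\<bar> + 1))" using C0 by (simp add: distrib_left)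
      then have "(C * (2 * \<bar>\<beta>\<bar>)) / (4 * C * (\<bar>\<beta>\<bar> + 1)) \<le> 1 / 2" using pos_divide_le_eq[OF p] by blast
      then show ?thesis by simp
    qed
    finally show ?thesis by (simp add: mult_ac)
  qed
  note \<tau>\<beta> = this
  define E where "E = 2 * ((C + 1) / \<tau> * norm B + \<tau> * C * (1 + \<gamma> * norm B))"
  have bd: "norm (S (B w)) \<le> norm w * E" for w
  proof -
    have "norm (S (B w)) \<le> (C + 1) / \<tau> * norm (B w) + \<tau> * C * norm (S (S (B w)))"
      unfolding C_def S_def using Bd \<tau> by (intro landau) (auto simp: S_def)
    also have "norm (S (S (B w))) \<le> norm w + 2 * \<bar>\<beta>\<bar> * norm (S (B w)) + \<gamma> * norm (B w)"
      unfolding SS using norm_triangle_ineq4[of "w + (2 * \<beta>) *\<^sub>R S (B w)" "\<gamma> *\<^sub>R B w"]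
        norm_triangle_ineq[of w "(2 * \<beta>) *\<^sub>R S (B w)"] by (simp add: bg(2) abs_mult)
    finally have "norm (S (B w)) \<le> (C + 1) / \<tau> * norm (B w) +
        \<tau> * C * (norm w + 2 * \<bar>\<beta>\<bar> * norm (S (B w)) + \<gamma> * norm (B w))"
      using \<tau> C0 by (simp add: mult_left_mono)
    also have "\<dots> = (C + 1) / \<tau> * norm (B w) + \<tau> * C * (norm w + \<gamma> * norm (B w)) +
        (\<tau> * C * (2 * \<bar>\<beta>\<bar>)) * norm (S (B w))" by (simp add: algebra_simps)
    also have "\<dots> \<le> (C + 1) / \<tau> * norm (B w) + \<tau> * C * (norm w + \<gamma> * norm (B w)) + 1 / 2 * norm (S (B w))"
      using \<tau>\<beta> by (intro add_left_mono mult_right_mono) auto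
    finally have "norm (S (B w)) \<le> 2 * ((C + 1) / \<tau> * norm (B w) + \<tau> * C * (norm w + \<gamma> * norm (B w)))" by simp
    also have "\<dots> \<le> 2 * ((C + 1) / \<tau> * (norm B * norm w) + \<tau> * C * (norm w + \<gamma> * (norm B * norm w)))"
      using \<tau> C0 by (intro mult_left_mono add_mono norm_blinfun) (auto simp: bg)
    finally show ?thesis by (simp add: E_def algebra_simps)
  qed
  have bl: "bounded_linear (\<lambda>w. S (B w))"
  proof (rule bounded_linear_intro[where K = E])
    show "S (B (v + w)) = S (B v) + S (B w)" for v w
      unfolding S_def blinfun.add_right by (rule generator_shift_linear(1)[OF Bd(1) Bd(1)])
    show "S (B (r *\<^sub>R v)) = r *\<^sub>R S (B v)" for r v
      unfolding S_def blinfun.scaleR_right by (rule generator_shift_linear(2)[OF Bd(1) Bd(1)])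
  qed (rule bd)
  have "B (v *\<^sub>r a) = B v *\<^sub>r a" for v a using B by (auto simp: is_bounded_inverse_def right_linear_ops_def)
  then have "Blinfun (\<lambda>w. S (B w)) \<in> right_linear_ops"
    unfolding right_linear_ops_def mem_Collect_eq bounded_linear_Blinfun_apply[OF bl]
    using generator_shift_linear(3)[OF Bd(1) Bd(1)] by (simp add: S_def)
  then show ?thesis
    by (intro exI[of _ "Blinfun (\<lambda>w. S (B w))"] conjI allI) (simp_all only: bounded_linear_Blinfun_apply[OF bl])
qed

text \<open>At a real \<alpha> the quadratic operator is the square of S, so S composed with its
  inverse is a right inverse of S. It is also a left inverse: A S v - v lies in the kernel of S,
  hence of S^2, and that kernel is trivial by the injectivity in the definition of the resolvent
  set.\<close>

lemma ex_shift_inverse: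
  assumes \<alpha>: "of_real \<alpha> \<in> S_resolvent_set D T"
  shows "\<exists>A. is_bounded_inverse D (\<lambda>v. T v - \<alpha> *\<^sub>R v) A"
proof -
  define S where "S x = T x - \<alpha> *\<^sub>R x" for x
  obtain B where B: "is_bounded_inverse (dom_sq D T) (R_op (of_real \<alpha>) T) B" and inj: "inj_on (R_op (of_real \<alpha>) T) (dom_sq D T)"
    using \<alpha> by (auto simp: S_resolvent_set_def)
  have R: "R_op (of_real \<alpha>) T x = S (S x)" if "x \<in> dom_sq D T" for x
    using R_op_shift[OF that, of "of_real \<alpha>" \<alpha>] by (simp add: S_def)
  obtain A where A: "A \<in> right_linear_ops" "\<And>w. A w = S (B w)"
    using shift_resolvent_bounded[OF B, of \<alpha>] unfolding S_def by blast
  have Bw: "B w \<in> dom_sq D T" "S (S (B w)) = w" for w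
    using B R[of "B w"] by (auto simp: is_bounded_inverse_def)
  have Aw: "A w \<in> D" "S (A w) = w" for w
    using Bw[of w] dom_sq_shift[of "B w" \<alpha>] by (auto simp: A(2) S_def)
  have "A (S v) = v" if v: "v \<in> D" for v
  proof -
    have d: "A (S v) - v \<in> D" using Aw v by (intro generator_diff)
    have "S (A (S v) - v) = S (A (S v)) - S v"
      using generator_diff(2)[OF Aw(1)[of "S v"] v] by (simp add: S_def scaleR_diff_right)
    then have 0: "S (A (S v) - v) = 0" by (simp add: Aw)
    then have dd: "A (S v) - v \<in> dom_sq D T"
      using d generator_0 dom_sq_shift[of "A (S v) - v" \<alpha>] by (simp add: S_def)
    moreover have "R_op (of_real \<alpha>) T (A (S v) - v) = R_op (of_real \<alpha>) T 0"
      using R[OF dd] 0 generator_0 by (simp add: R_op_def S_def)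
    moreover have "0 \<in> dom_sq D T" using generator_0 by (simp add: dom_sq_def)
    ultimately have "A (S v) - v = 0" using inj_onD[OF inj] by blast
    then show ?thesis by simp
  qed
  then show ?thesis using A(1) Aw unfolding is_bounded_inverse_def S_def by blast
qed

text \<open>With S = T - \<alpha> and q = (s - \<alpha>)^-1, the quadratic operator of A at q equals
  \<gamma>^-1 R_s(T) A^2. Its inverse is \<gamma> S^2 R_s(T)^-1, and this is bounded because the
  resolvent equation writes it in terms of the bounded operators \<open>SB\<close> and
  \<open>B\<close>.\<close>

lemma resolvent_set_moebius:
  assumes A: "is_bounded_inverse D (\<lambda>v. T v - \<alpha> *\<^sub>R v) A"
    and s: "s \<in> S_resolvent_set D T" "s \<noteq> of_real \<alpha>"
  shows "inverse (s - of_real \<alpha>) \<in> S_resolvent_set UNIV A"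
proof -
  define S where "S x = T x - \<alpha> *\<^sub>R x" for x
  obtain B where B: "is_bounded_inverse (dom_sq D T) (R_op s T) B"
    using s by (auto simp: S_resolvent_set_def)
  obtain SB where SB: "SB \<in> right_linear_ops" "\<And>w. SB w = S (B w)"
    using shift_resolvent_bounded[OF B, of \<alpha>] unfolding S_def by blast
  define \<beta> \<gamma> where bg: "\<beta> = qRe s - \<alpha>" "\<gamma> = (norm (s - of_real \<alpha>))\<^sup>2"
  have g0: "\<gamma> \<noteq> 0" using s by (simp add: bg)
  have ASv: "A (S v) = v" if "v \<in> D" for v using A that by (auto simp: is_bounded_inverse_def S_def)
  have SA: "A v \<in> D" "S (A v) = v" for v using A by (auto simp: is_bounded_inverse_def S_def)
  have Bd: "B w \<in> D" "S (B w) \<in> D" "R_op s T (B w) = w" "B w \<in> dom_sq D T" for w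
    using B dom_sq_shift[of "B w" \<alpha>] by (auto simp: is_bounded_inverse_def S_def)
  have BR: "B (R_op s T x) = x" if "x \<in> dom_sq D T" for x using B that by (auto simp: is_bounded_inverse_def)
  have Rs: "R_op s T x = S (S x) - (2 * \<beta>) *\<^sub>R S x + \<gamma> *\<^sub>R x" if "x \<in> dom_sq D T" for x
    using R_op_shift[OF that, of s \<alpha>] by (simp add: S_def bg)
  have inv: "inverse (s - of_real \<alpha>) = (1 / \<gamma>) *\<^sub>R qcnj (s - of_real \<alpha>)"
    by (simp add: inverse_quat_def bg divide_inverse)
  have re: "qRe (inverse (s - of_real \<alpha>)) = \<beta> / \<gamma>" by (simp add: inv qcnj_def bg)
  have nm: "(norm (inverse (s - of_real \<alpha>)))\<^sup>2 = 1 / \<gamma>" by (simp add: norm_inverse bg power_inverse divide_inverse)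
  have RA: "R_op (inverse (s - of_real \<alpha>)) A v = (1 / \<gamma>) *\<^sub>R R_op s T (A (A v))" and AAd: "A (A v) \<in> dom_sq D T" for v
  proof -
    show d: "A (A v) \<in> dom_sq D T" using SA dom_sq_shift[of "A (A v)" \<alpha>] by (simp add: S_def[symmetric])
    show "R_op (inverse (s - of_real \<alpha>)) A v = (1 / \<gamma>) *\<^sub>R R_op s T (A (A v))"
      unfolding Rs[OF d] SA R_op_def[of _ A] re nm using g0
      by (simp add: scaleR_add_right scaleR_diff_right)
  qed
  define C where "C = \<gamma> *\<^sub>R (id_blinfun + (2 * \<beta>) *\<^sub>R SB - \<gamma> *\<^sub>R B)"
  have Cw: "C w = \<gamma> *\<^sub>R S (S (B w))" for w
  proof -
    have "S (S (B w)) = w + (2 * \<beta>) *\<^sub>R S (B w) - \<gamma> *\<^sub>R B w"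
      using Rs[OF Bd(4), of w] Bd(3)[of w] by (simp add: algebra_simps)
    then show ?thesis by (simp add: C_def blinfun.add_left blinfun.diff_left blinfun.scaleR_left SB)
  qed
  have "B (v *\<^sub>r a) = B v *\<^sub>r a" "SB (v *\<^sub>r a) = SB v *\<^sub>r a" for v a
    using B SB by (auto simp: is_bounded_inverse_def right_linear_ops_def)
  then have Cr: "C \<in> right_linear_ops"
    by (simp add: right_linear_ops_def C_def blinfun.add_left blinfun.diff_left blinfun.scaleR_left
        rscale_add_left rscale_diff_scaleR)
  have 1: "C (R_op (inverse (s - of_real \<alpha>)) A v) = v" for v
  proof -
    have "B (R_op (inverse (s - of_real \<alpha>)) A v) = (1 / \<gamma>) *\<^sub>R A (A v)"
      by (simp add: RA blinfun.scaleR_right BR AAd)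
    moreover have "S ((1 / \<gamma>) *\<^sub>R x) = (1 / \<gamma>) *\<^sub>R S x" if "x \<in> D" for x
      unfolding S_def by (rule generator_shift_linear(2)[OF that that])
    ultimately show ?thesis using g0 by (simp add: Cw SA)
  qed
  have 2: "R_op (inverse (s - of_real \<alpha>)) A (C w) = w" for w
  proof -
    have "A (A (C w)) = \<gamma> *\<^sub>R B w" by (simp add: Cw blinfun.scaleR_right ASv Bd)
    moreover have "R_op s T (\<gamma> *\<^sub>R B w) = \<gamma> *\<^sub>R R_op s T (B w)"
    proof -
      have "T (B w) \<in> D" using Bd(4)[of w] by (simp add: dom_sq_def)
      then show ?thesis using Bd(1)[of w]
        by (simp add: R_op_def generator_scaleR scaleR_add_right scaleR_diff_right mult.commute)
    qed
    ultimately show ?thesis using g0 by (simp add: RA Bd)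
  qed
  have "is_bounded_inverse (dom_sq UNIV A) (R_op (inverse (s - of_real \<alpha>)) A) C"
    using Cr 1 2 by (simp add: is_bounded_inverse_def dom_sq_def)
  moreover have "inj (R_op (inverse (s - of_real \<alpha>)) A)" using 1 by (rule inj_on_inverseI)
  moreover have "surj (R_op (inverse (s - of_real \<alpha>)) A)" using 2 by (metis surjI)
  ultimately show ?thesis by (auto simp: S_resolvent_set_def dom_sq_def)
qed

end

section \<open>The S-resolvent of a bounded operator\<close>

text \<open>The inverse of 1 - X is obtained by solving v = w + X v with Banach's fixed point
  theorem; linearity follows from uniqueness and the norm bound from the equation itself.\<close>

lemma blinfun_neumann:
  fixes X :: "'v::banach \<Rightarrow>\<^sub>L 'v"
  assumes X: "norm X < 1"
  shows "\<exists>C :: 'v \<Rightarrow>\<^sub>L 'v. (\<forall>v. blinfun_apply C (v - X v) = v) \<and> (\<forall>w. blinfun_apply C w - X (blinfun_apply C w) = w) \<and> norm C \<le> 1 / (1 - norm X)"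
proof -
  have "\<exists>!v. v \<in> UNIV \<and> w + X v = v" for w
  proof (rule Banach_fix[where c = "norm X"])
    show "dist (w + X x) (w + X y) \<le> norm X * dist x y" for x y
      by (simp add: dist_norm blinfun.diff_right[symmetric] norm_blinfun)
  qed (use X in \<open>auto simp: complete_UNIV\<close>)
  then have ex1: "\<exists>!v. w + X v = v" for w by simp
  define c where "c w = (THE v. w + X v = v)" for w
  have c: "w + X (c w) = c w" for w unfolding c_def by (rule theI'[OF ex1])
  have uniq: "c w = v" if "w + X v = v" for v w using ex1[of w] c[of w] that by blast
  have bd: "norm (c w) \<le> norm w * (1 / (1 - norm X))" for w
  proof -
    have "norm (c w) \<le> norm w + norm (X (c w))" using norm_triangle_ineq[of w "X (c w)"] c[of w] by simp
    also have "norm (X (c w)) \<le> norm X * norm (c w)" by (rule norm_blinfun)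
    finally have "norm (c w) * (1 - norm X) \<le> norm w" by (simp add: algebra_simps)
    then show ?thesis using X by (simp add: pos_le_divide_eq)
  qed
  have bl: "bounded_linear c"
  proof (rule bounded_linear_intro[OF _ _ bd])
    show "c (x + y) = c x + c y" for x y
    proof (rule uniq)
      have "x + y + X (c x + c y) = (x + X (c x)) + (y + X (c y))" by (simp add: blinfun.add_right algebra_simps)
      then show "x + y + X (c x + c y) = c x + c y" by (simp only: c)
    qed
    show "c (r *\<^sub>R x) = r *\<^sub>R c x" for r x
    proof (rule uniq)
      have "r *\<^sub>R x + X (r *\<^sub>R c x) = r *\<^sub>R (x + X (c x))" by (simp add: blinfun.scaleR_right scaleR_add_right)
      then show "r *\<^sub>R x + X (r *\<^sub>R c x) = r *\<^sub>R c x" by (simp only: c)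
    qed
  qed
  have ap: "blinfun_apply (Blinfun c) = c" by (rule bounded_linear_Blinfun_apply[OF bl])
  have "norm (Blinfun c) \<le> 1 / (1 - norm X)"
    by (rule norm_blinfun_bound) (use X bd in \<open>auto simp: ap mult.commute\<close>)
  moreover have "c (v - X v) = v" for v by (rule uniq) simp
  moreover have "c w - X (c w) = w" for w using c[of w] by (metis add_diff_cancel_right')
  ultimately show ?thesis by (intro exI[of _ "Blinfun c"]) (simp add: ap)
qed

text \<open>Q' = Q (1 - X) with X = B (Q - Q'), so the new inverse is (1 - X)^-1 B. The bound 1/2
  for X limits the first factor to norm 2.\<close>

lemma blinfun_inverse_perturb:
  fixes Q Q' B :: "'v::banach \<Rightarrow>\<^sub>L 'v"
  assumes B: "\<And>v. B (Q v) = v" "\<And>w. Q (B w) = w" and small: "norm B * norm (Q - Q') \<le> 1 / 2"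
  shows "\<exists>B' :: 'v \<Rightarrow>\<^sub>L 'v. (\<forall>v. blinfun_apply B' (Q' v) = v) \<and> (\<forall>w. Q' (blinfun_apply B' w) = w) \<and> norm B' \<le> 2 * norm B"
proof -
  define X where "X = B o\<^sub>L (Q - Q')"
  have nX: "norm X \<le> 1 / 2" unfolding X_def by (rule order_trans[OF norm_blinfun_compose small])
  have Xa: "v - X v = B (Q' v)" for v by (simp add: X_def blinfun.diff_left blinfun.diff_right B)
  have Q': "Q' v = Q (v - X v)" for v by (simp add: Xa B)
  obtain C :: "'v \<Rightarrow>\<^sub>L 'v" where C: "\<And>v. blinfun_apply C (v - X v) = v" "\<And>w. blinfun_apply C w - X (blinfun_apply C w) = w" "norm C \<le> 1 / (1 - norm X)"
    using blinfun_neumann[of X] nX by auto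
  have "norm C \<le> 2" using C(3) nX by (simp add: order_trans[OF C(3)] divide_le_eq)
  then have "norm (C o\<^sub>L B) \<le> 2 * norm B"
    by (intro order_trans[OF norm_blinfun_compose] mult_right_mono) auto
  moreover have "(C o\<^sub>L B) (Q' v) = v" for v using C(1)[of v] by (simp add: Xa)
  moreover have "Q' ((C o\<^sub>L B) w) = w" for w
    unfolding blinfun_apply_blinfun_compose by (subst Q') (simp only: C(2) B(2))
  ultimately show ?thesis by blast
qed

locale bounded_op =
  fixes A :: "'v::quaternionic_banach \<Rightarrow>\<^sub>L 'v" and I :: quat
  assumes A: "A \<in> right_linear_ops" and I: "I \<in> imag_sphere"
begin

definition quad :: "complex \<Rightarrow> 'v \<Rightarrow>\<^sub>L 'v" where
  "quad z = (A o\<^sub>L A) - (2 * Re z) *\<^sub>R A + (norm z)\<^sup>2 *\<^sub>R id_blinfun"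

definition rho :: "complex set" where
  "rho = {z. in_slice I z \<in> S_resolvent_set UNIV A}"

definition rinv :: "complex \<Rightarrow> 'v \<Rightarrow>\<^sub>L 'v" where
  "rinv z = bounded_inverse UNIV (R_op (in_slice I z) A)"

lemma quad_apply: "quad z v = A (A v) - (2 * Re z) *\<^sub>R A v + (norm z)\<^sup>2 *\<^sub>R v"
  by (simp add: quad_def blinfun.add_left blinfun.diff_left blinfun.scaleR_left)

lemma quad_apply': "quad z v = A (A v) - (2 * Re z) *\<^sub>R A v + (Re z * Re z + Im z * Im z) *\<^sub>R v"
proof -
  have "(norm z)\<^sup>2 = Re z * Re z + Im z * Im z" using cmod_power2[of z] by (simp add: power2_eq_square[of "Re z"] power2_eq_square[of "Im z"])
  then show ?thesis by (simp only: quad_apply)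
qed

lemma R_op_in_slice: "R_op (in_slice I z) A = quad z"
  by (rule ext) (simp add: R_op_def quad_apply qRe_in_slice[OF I] norm_in_slice[OF I])

lemma A_rscale: "A (v *\<^sub>r a) = A v *\<^sub>r a"
  using A by (simp add: right_linear_ops_def)

lemma inverse_in_right_linear_ops:
  fixes B :: "'v \<Rightarrow>\<^sub>L 'v"
  assumes "\<And>v. B (quad z v) = v" "\<And>w. quad z (B w) = w"
  shows "B \<in> right_linear_ops"
proof -
  have qr: "quad z (v *\<^sub>r a) = quad z v *\<^sub>r a" for v a
    by (simp add: quad_apply A_rscale rscale_add_left rscale_diff_scaleR)
  have "B (v *\<^sub>r a) = B v *\<^sub>r a" for v a
    using assms(1)[of "B v *\<^sub>r a"] by (simp add: qr assms(2))
  then show ?thesis by (simp add: right_linear_ops_def)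
qed

lemma rhoI:
  fixes B :: "'v \<Rightarrow>\<^sub>L 'v"
  assumes B: "\<And>v. B (quad z v) = v" "\<And>w. quad z (B w) = w"
  shows "z \<in> rho" "rinv z = B"
proof -
  have ib: "is_bounded_inverse UNIV (R_op (in_slice I z) A) B"
    using B inverse_in_right_linear_ops[OF B] by (simp add: is_bounded_inverse_def R_op_in_slice)
  then show "rinv z = B" unfolding rinv_def by (rule bounded_inverse_eq)
  have "inj (quad z)" using B(1) by (rule inj_on_inverseI)
  moreover have "surj (quad z)" using B(2) by (metis surjI)
  ultimately show "z \<in> rho" using ib by (auto simp: rho_def S_resolvent_set_def dom_sq_def R_op_in_slice)
qed

lemma rinv:
  assumes "z \<in> rho"
  shows "rinv z (quad z v) = v" "quad z (rinv z w) = w"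
proof -
  obtain B where B: "is_bounded_inverse UNIV (R_op (in_slice I z) A) B"
    using assms by (auto simp: rho_def S_resolvent_set_def dom_sq_def)
  moreover have "rinv z = B" unfolding rinv_def using B by (rule bounded_inverse_eq)
  ultimately show "rinv z (quad z v) = v" "quad z (rinv z w) = w"
    by (auto simp: is_bounded_inverse_def R_op_in_slice)
qed

lemma tendsto_quad: "(quad \<longlongrightarrow> quad z) (at z)"
  unfolding quad_def[abs_def] by (intro tendsto_intros)

text \<open>The local bound for the inverses yields openness of \<open>rho\<close> and, through the
  resolvent identity, continuity of \<open>rinv\<close>.\<close>

lemma rho_nhd:
  assumes z: "z \<in> rho"
  shows "\<forall>\<^sub>F w in nhds z. w \<in> rho \<and> norm (rinv w) \<le> 2 * norm (rinv z)"
proof -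
  have "((\<lambda>w. norm (rinv z) * norm (quad z - quad w)) \<longlongrightarrow> norm (rinv z) * norm (quad z - quad z)) (at z)"
    by (intro tendsto_intros tendsto_quad)
  then have "((\<lambda>w. norm (rinv z) * norm (quad z - quad w)) \<longlongrightarrow> norm (rinv z) * norm (quad z - quad z)) (nhds z)"
    by (rule tendsto_at_iff_tendsto_nhds[THEN iffD1])
  from order_tendstoD(2)[OF this, of "1/2"]
  have "\<forall>\<^sub>F w in nhds z. norm (rinv z) * norm (quad z - quad w) < 1 / 2" by simp
  then show ?thesis
  proof eventually_elim
    case (elim w)
    then obtain B' :: "'v \<Rightarrow>\<^sub>L 'v" where "\<And>v. blinfun_apply B' (quad w v) = v" "\<And>v. quad w (blinfun_apply B' v) = v" "norm B' \<le> 2 * norm (rinv z)"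
      using blinfun_inverse_perturb[OF rinv[OF z], of "quad w"] by auto
    then show ?case using rhoI[of B' w] by simp
  qed
qed

lemma open_rho: "open rho"
proof -
  have "\<exists>S. open S \<and> z \<in> S \<and> S \<subseteq> rho" if "z \<in> rho" for z
    using rho_nhd[OF that] unfolding eventually_nhds by blast
  then show ?thesis using open_subopen by blast
qed

lemma isCont_rinv:
  assumes z: "z \<in> rho"
  shows "isCont rinv z"
proof -
  have "((\<lambda>w. 2 * norm (rinv z) * norm (quad z - quad w) * norm (rinv z)) \<longlongrightarrow>
      2 * norm (rinv z) * norm (quad z - quad z) * norm (rinv z)) (at z)"
    by (intro tendsto_intros tendsto_quad)
  then have "((\<lambda>w. 2 * norm (rinv z) * norm (quad z - quad w) * norm (rinv z)) \<longlongrightarrow> 0) (at z)" by simp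
  moreover have "\<forall>\<^sub>F w in at z. norm (rinv w - rinv z) \<le> 2 * norm (rinv z) * norm (quad z - quad w) * norm (rinv z)"
  proof -
    have "\<forall>\<^sub>F w in at z. w \<in> rho \<and> norm (rinv w) \<le> 2 * norm (rinv z)"
      using rho_nhd[OF z] by (simp add: eventually_at_filter eventually_mono)
    then show ?thesis
    proof eventually_elim
      case (elim w)
      have "rinv w - rinv z = rinv w o\<^sub>L (quad z - quad w) o\<^sub>L rinv z"
        using elim z by (intro blinfun_eqI) (simp add: blinfun.diff_left blinfun.diff_right rinv)
      then have "norm (rinv w - rinv z) \<le> norm (rinv w) * norm (quad z - quad w) * norm (rinv z)"
        using norm_blinfun_compose[of "rinv w o\<^sub>L (quad z - quad w)" "rinv z"]
          norm_blinfun_compose[of "rinv w" "quad z - quad w"]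
        by (metis (no_types, opaque_lifting) mult_right_mono norm_ge_zero order_trans)
      also have "\<dots> \<le> 2 * norm (rinv z) * norm (quad z - quad w) * norm (rinv z)"
        using elim by (intro mult_right_mono) auto
      finally show ?case .
    qed
  qed
  ultimately have "((\<lambda>w. rinv w - rinv z) \<longlongrightarrow> 0) (at z)" by (rule Lim_null_comparison[rotated])
  then show ?thesis by (simp add: isCont_def LIM_zero_iff)
qed

text \<open>On the complexification of \<open>'v\<close>, the resolvent \<open>(z - A)\<^sup>-\<^sup>1\<close> is \<open>res_re z + \<i> res_im z\<close>.\<close>

definition res_re :: "complex \<Rightarrow> 'v \<Rightarrow>\<^sub>L 'v" where
  "res_re z = (Re z *\<^sub>R id_blinfun - A) o\<^sub>L rinv z"

definition res_im :: "complex \<Rightarrow> 'v \<Rightarrow>\<^sub>L 'v" where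
  "res_im z = (- Im z) *\<^sub>R rinv z"

lemma res_apply: "res_re z v = Re z *\<^sub>R rinv z v - A (rinv z v)" "res_im z v = (- Im z) *\<^sub>R rinv z v"
  by (simp_all add: res_re_def res_im_def blinfun.diff_left blinfun.scaleR_left blinfun.minus_left)

lemma isCont_res:
  assumes "z \<in> rho"
  shows "isCont res_re z" "isCont res_im z"
  unfolding res_re_def[abs_def] res_im_def[abs_def]
  by (intro continuous_scaleR continuous_minus continuous_diff continuous_const isCont_rinv[OF assms]
      bounded_bilinear.isCont[OF bounded_bilinear_blinfun_compose]
      linear_continuous_at[OF bounded_linear_Re] linear_continuous_at[OF bounded_linear_Im])+

text \<open>On \<complex>_I the S-resolvent is the complexified resolvent with I in the place of the
  imaginary unit. I acts by left multiplication, with which a right linear A need not commute, so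
  real and imaginary part are kept as separate operators and I stays in front.\<close>

lemma right_S_resolvent_in_slice:
  assumes "z \<in> rho"
  shows "right_S_resolvent (in_slice I z) UNIV A = res_re z + Blinfun (\<lambda>v. I *\<^sub>l res_im z v)"
proof -
  interpret l: bounded_bilinear "(*\<^sub>l) :: quat \<Rightarrow> 'v \<Rightarrow> 'v" by (rule bounded_bilinear_lscale)
  have bl: "bounded_linear (\<lambda>v. I *\<^sub>l res_im z v)"
    by (intro bounded_linear_compose[OF l.bounded_linear_right] blinfun.bounded_linear_right)
  have "(\<lambda>v. let w = rinv z v in - (A w - qcnj (in_slice I z) *\<^sub>l w)) = (\<lambda>v. (res_re z + Blinfun (\<lambda>v. I *\<^sub>l res_im z v)) v)"
  proof
    fix v
    have "qcnj (in_slice I z) *\<^sub>l w = Re z *\<^sub>R w + I *\<^sub>l ((- Im z) *\<^sub>R w)" for w :: 'v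
    proof -
      have "qcnj (in_slice I z) = of_real (Re z) + I * of_real (- Im z)"
        unfolding qcnj_in_slice[OF I] by (simp add: in_slice_def)
      then show ?thesis by (simp only: lscale_add_left lscale_mult lscale_of_real)
    qed
    then show "(let w = rinv z v in - (A w - qcnj (in_slice I z) *\<^sub>l w)) = (res_re z + Blinfun (\<lambda>v. I *\<^sub>l res_im z v)) v"
      unfolding Let_def blinfun.add_left bounded_linear_Blinfun_apply[OF bl] unfolding res_apply by simp
  qed
  moreover have "dom_sq UNIV A = UNIV" by (simp add: dom_sq_def)
  ultimately show ?thesis
    unfolding right_S_resolvent_def rinv_def[symmetric] by (simp add: rinv_def[symmetric] blinfun_apply_inverse)
qed

text \<open>Real and imaginary part of (z - A)(p + \<i> q) = v in the complexification.\<close>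

lemma res_equations:
  fixes v :: 'v
  assumes z: "z \<in> rho"
  defines "p \<equiv> res_re z v" and "q \<equiv> res_im z v"
  shows "Re z *\<^sub>R p - Im z *\<^sub>R q - A p = v" "Re z *\<^sub>R q + Im z *\<^sub>R p - A q = 0"
proof -
  define u where "u = rinv z v"
  have pq: "p = Re z *\<^sub>R u - A u" "q = (- Im z) *\<^sub>R u" by (simp_all add: p_def q_def u_def res_apply)
  have "quad z u = v" unfolding u_def by (rule rinv(2)[OF z])
  moreover have "Re z *\<^sub>R p - Im z *\<^sub>R q - A p = quad z u"
    by (simp add: pq quad_apply' blinfun.diff_right blinfun.scaleR_right
        scaleR_diff_right scaleR_add_left scaleR_2[symmetric] mult.commute[of 2])
       (simp add: algebra_simps scaleR_2[symmetric])
  ultimately show "Re z *\<^sub>R p - Im z *\<^sub>R q - A p = v" by simp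
  show "Re z *\<^sub>R q + Im z *\<^sub>R p - A q = 0"
    by (simp add: pq blinfun.scaleR_right blinfun.minus_right scaleR_diff_right mult.commute)
qed

text \<open>Real and imaginary part of (z - A)^-1 (z - A)(a + \<i> b) = a + \<i> b; the reason is
  that A commutes with \<open>rinv z\<close>.\<close>

lemma res_left_inverse:
  fixes a b :: 'v
  assumes z: "z \<in> rho"
  defines "a' \<equiv> Re z *\<^sub>R a - Im z *\<^sub>R b - A a" and "b' \<equiv> Re z *\<^sub>R b + Im z *\<^sub>R a - A b"
  shows "res_re z a' - res_im z b' = a" "res_re z b' + res_im z a' = b"
proof -
  have comm: "A (rinv z w) = rinv z (A w)" for w
  proof -
    have "A (quad z u) = quad z (A u)" for u
      by (simp add: quad_apply blinfun.add_right blinfun.diff_right blinfun.scaleR_right)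
    then have "A w = quad z (A (rinv z w))" by (metis rinv(2)[OF z])
    then show ?thesis by (simp add: rinv(1)[OF z])
  qed
  have "res_re z a' - res_im z b' = rinv z (quad z a)"
  proof -
    have "res_re z a' - res_im z b' = rinv z (Re z *\<^sub>R a' - A a' + Im z *\<^sub>R b')"
      by (simp add: res_apply comm blinfun.add_right blinfun.diff_right blinfun.scaleR_right)
    also have "Re z *\<^sub>R a' - A a' + Im z *\<^sub>R b' = quad z a"
      by (simp add: a'_def b'_def quad_apply' blinfun.diff_right blinfun.scaleR_right)
         (simp add: algebra_simps scaleR_2[symmetric])
    finally show ?thesis .
  qed
  then show "res_re z a' - res_im z b' = a" by (simp add: rinv(1)[OF z])
  have "res_re z b' + res_im z a' = rinv z (quad z b)"
  proof -
    have "res_re z b' + res_im z a' = rinv z (Re z *\<^sub>R b' - A b' - Im z *\<^sub>R a')"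
      by (simp add: res_apply comm blinfun.add_right blinfun.diff_right blinfun.scaleR_right)
    also have "Re z *\<^sub>R b' - A b' - Im z *\<^sub>R a' = quad z b"
      by (simp add: a'_def b'_def quad_apply' blinfun.diff_right blinfun.add_right blinfun.scaleR_right)
         (simp add: algebra_simps scaleR_2[symmetric])
    finally show ?thesis .
  qed
  then show "res_re z b' + res_im z a' = b" by (simp add: rinv(1)[OF z])
qed

end

section \<open>Laplace integrals over a half line\<close>

lemma integrable_exp_half_line:
  fixes \<beta> C :: real
  assumes \<beta>: "\<beta> > 0"
  shows "integrable lborel (\<lambda>t. indicator {0<..} t *\<^sub>R (C * exp (- \<beta> * t)))"
    "(LINT t|lborel. indicator {0<..} t *\<^sub>R (C * exp (- \<beta> * t))) = C / \<beta>"
proof -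
  have "((\<lambda>t. exp (- \<beta> * t)) has_integral exp (- \<beta> * 0) / \<beta>) {0..}"
    by (rule has_integral_exp_minus_to_infinity[OF \<beta>])
  then have "((\<lambda>t. if t \<in> {0..} then exp (- \<beta> * t) else 0) has_integral (1 / \<beta>)) UNIV"
    by (subst has_integral_restrict_UNIV) simp
  moreover have "(\<lambda>t. if t \<in> {0..} then exp (- \<beta> * t) else 0) = (\<lambda>t. indicator {0..} t * exp (- \<beta> * t))"
    by (auto simp: indicator_def)
  ultimately have "((\<lambda>t. indicator {0..} t * exp (- \<beta> * t)) has_integral (1 / \<beta>)) UNIV" by simp
  then have "(\<integral>\<^sup>+ t. ennreal (indicator {0..} t * exp (- \<beta> * t)) \<partial>lborel) = ennreal (1 / \<beta>)"
    by (intro nn_integral_has_integral_lborel) auto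
  also have "(\<integral>\<^sup>+ t. ennreal (indicator {0..} t * exp (- \<beta> * t)) \<partial>lborel) =
      (\<integral>\<^sup>+ t. ennreal (indicator {0<..} t * exp (- \<beta> * t)) \<partial>lborel)"
    by (rule nn_integral_cong_AE) (use AE_lborel_singleton[of 0] in eventually_elim, auto simp: indicator_def)
  finally have "has_bochner_integral lborel (\<lambda>t. indicator {0<..} t * exp (- \<beta> * t)) (1 / \<beta>)"
    using \<beta> by (intro has_bochner_integral_nn_integral) auto
  from has_bochner_integral_mult_right[OF this, of C]
  have "has_bochner_integral lborel (\<lambda>t. indicator {0<..} t *\<^sub>R (C * exp (- \<beta> * t))) (C / \<beta>)"
    by (simp add: mult_ac)
  then show "integrable lborel (\<lambda>t. indicator {0<..} t *\<^sub>R (C * exp (- \<beta> * t)))"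
    "(LINT t|lborel. indicator {0<..} t *\<^sub>R (C * exp (- \<beta> * t))) = C / \<beta>"
    by (auto intro: integrable.intros has_bochner_integral_integral_eq)
qed

lemma half_line_integrable:
  fixes g :: "real \<Rightarrow> complex"
  assumes \<beta>: "\<beta> > 0" and g: "g \<in> borel_measurable borel" "\<And>t. t > 0 \<Longrightarrow> norm (g t) \<le> C * exp (- \<beta> * t)"
  shows "integrable lborel (\<lambda>t. indicator {0<..} t *\<^sub>R g t)"
  by (rule Bochner_Integration.integrable_bound[OF integrable_exp_half_line(1)[OF \<beta>, of C]])
     (use g in \<open>auto simp: indicator_def intro!: AE_I2 order_trans[OF _ abs_ge_self]\<close>)

lemma half_line_FTC:
  fixes k g :: "real \<Rightarrow> complex"
  assumes \<beta>: "\<beta> > 0" and g: "continuous_on UNIV g" "\<And>t. t > 0 \<Longrightarrow> norm (g t) \<le> C * exp (- \<beta> * t)"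
    and k: "\<And>t. (k has_vector_derivative g t) (at t)" "\<And>t. t > 0 \<Longrightarrow> norm (k t) \<le> C' * exp (- \<beta> * t)"
  shows "(LINT t|lborel. indicator {0<..} t *\<^sub>R g t) = - k 0"
proof -
  have "(LBINT t=0..\<infinity>. g t) = 0 - k 0"
  proof (rule interval_integral_FTC_integrable)
    show "isCont g x" for x using g(1) by (simp add: continuous_on_eq_continuous_at)
    have e: "einterval 0 \<infinity> = {0<..}" by (auto simp: einterval_def)
    show "set_integrable lborel (einterval 0 \<infinity>) g"
      unfolding set_integrable_def e using g(2)
      by (intro half_line_integrable[OF \<beta> borel_measurable_continuous_onI[OF g(1)]]) auto
    have "isCont k 0" using k(1) has_vector_derivative_continuous by blast
    then have "(k \<longlongrightarrow> k 0) (at_right 0)" by (simp add: isCont_def filterlim_at_split)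
    then show "((k \<circ> real_of_ereal) \<longlongrightarrow> k 0) (at_right 0)" by (simp add: zero_ereal_def ereal_tendsto_simps)
    have "((\<lambda>t. exp (- (\<beta> * t))) \<longlongrightarrow> 0) at_top"
      using \<beta> by (intro filterlim_compose[OF exp_at_bot] filterlim_uminus_at_bot_at_top[THEN filterlim_compose]
          filterlim_tendsto_pos_mult_at_top[OF tendsto_const _ filterlim_ident])
    then have "((\<lambda>t. C' * exp (- \<beta> * t)) \<longlongrightarrow> 0) at_top" by (auto intro: tendsto_mult_right_zero)
    moreover have "\<forall>\<^sub>F t in at_top. norm (k t) \<le> C' * exp (- \<beta> * t)"
      using eventually_gt_at_top[of 0] by eventually_elim (rule k(2))
    ultimately have "(k \<longlongrightarrow> 0) at_top" by (rule Lim_null_comparison[rotated])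
    then show "((k \<circ> real_of_ereal) \<longlongrightarrow> 0) (at_left \<infinity>)" by (simp add: ereal_tendsto_simps)
  qed (use k(1) in auto)
  then show ?thesis by (simp add: interval_integral_Ioi set_lebesgue_integral_def zero_ereal_def)
qed

text \<open>With this sign convention both branches give the resolvent: for \<open>H t = Z t v\<close> the value at \<open>z\<close>
  represents \<open>(z - T)\<^sup>-\<^sup>1 v\<close> on either side of the strip \<open>\<bar>Re z\<bar> \<le> \<omega>\<close>.\<close>

definition lap :: "(real \<Rightarrow> complex) \<Rightarrow> complex \<Rightarrow> complex" where
  "lap H z = (if Re z > 0 then (LINT t|lborel. indicator {0<..} t *\<^sub>R (exp (- z * of_real t) * H t))
     else - (LINT t|lborel. indicator {0<..} t *\<^sub>R (exp (z * of_real t) * H (- t))))"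

locale slice_functional = bounded_op A I for A :: "'v::quaternionic_banach \<Rightarrow>\<^sub>L 'v" and I :: quat +
  fixes l :: "'v \<Rightarrow> complex"
  assumes l: "bounded_linear l" and l_I: "l (I *\<^sub>l v) = \<i> * l v"
begin

text \<open>The functional \<open>l\<close>, extended complex linearly to the complexification,
  evaluated at (z - A)^-1 v.\<close>

definition resf :: "'v \<Rightarrow> complex \<Rightarrow> complex" where
  "resf v z = l (res_re z v) + \<i> * l (res_im z v)"

lemma l_add: "l (v + w) = l v + l w" and l_diff: "l (v - w) = l v - l w" and l_minus: "l (- v) = - l v"
  and l_scaleR: "l (r *\<^sub>R v) = of_real r * l v" and l_0: "l 0 = 0"
  using l by (simp_all add: linear_simps scaleR_conv_of_real)

lemma l_right_S_resolvent:
  assumes "z \<in> rho"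
  shows "l (right_S_resolvent (in_slice I z) UNIV A v) = resf v z"
proof -
  interpret b: bounded_bilinear "(*\<^sub>l) :: quat \<Rightarrow> 'v \<Rightarrow> 'v" by (rule bounded_bilinear_lscale)
  have bl: "bounded_linear (\<lambda>v. I *\<^sub>l res_im z v)"
    by (intro bounded_linear_compose[OF b.bounded_linear_right] blinfun.bounded_linear_right)
  show ?thesis
    unfolding right_S_resolvent_in_slice[OF assms] blinfun.add_left bounded_linear_Blinfun_apply[OF bl]
    by (simp add: l_add l_I resf_def)
qed

text \<open>The resolvent identity in the complexification: resf v z - resf v w = (w - z) \<Psi>(z),
  where \<Psi>(z) is the functional of (w - A)^-1 (z - A)^-1 v. Continuity of \<Psi> at w gives the
  derivative -\<Psi>(w).\<close>

lemma resf_holomorphic: "resf v holomorphic_on rho"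
proof -
  have "\<exists>d. (resf v has_field_derivative d) (at w)" if w: "w \<in> rho" for w
  proof -
    define \<Psi> where "\<Psi> z = l (res_re w (res_re z v)) - l (res_im w (res_im z v))
      + \<i> * (l (res_re w (res_im z v)) + l (res_im w (res_re z v)))" for z
    have id: "resf v z - resf v w = (w - z) * \<Psi> z" if z: "z \<in> rho" for z
    proof -
      define p q where pq: "p = res_re z v" "q = res_im z v"
      define c d where cd: "c = Re w - Re z" "d = Im w - Im z"
      define a' where "a' = Re w *\<^sub>R p - Im w *\<^sub>R q - A p"
      define b' where "b' = Re w *\<^sub>R q + Im w *\<^sub>R p - A q"
      have "a' = v + c *\<^sub>R p - d *\<^sub>R q" "b' = c *\<^sub>R q + d *\<^sub>R p"
        using res_equations[OF z, of v] by (simp_all add: a'_def b'_def pq cd algebra_simps)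
      then have lin: "l (B a') = l (B v) + of_real c * l (B p) - of_real d * l (B q)"
          "l (B b') = of_real c * l (B q) + of_real d * l (B p)" for B :: "'v \<Rightarrow>\<^sub>L 'v"
        by (simp_all add: blinfun.add_right blinfun.diff_right blinfun.scaleR_right l_add l_diff l_scaleR)
      have "res_re w a' - res_im w b' = p" "res_re w b' + res_im w a' = q"
        unfolding a'_def b'_def by (rule res_left_inverse[OF w])+
      then have "l p = l (res_re w a') - l (res_im w b')" "l q = l (res_re w b') + l (res_im w a')"
        using l_diff[of "res_re w a'" "res_im w b'"] l_add[of "res_re w b'" "res_im w a'"] by simp_all
      then have lp: "l p = (l (res_re w v) + of_real c * l (res_re w p) - of_real d * l (res_re w q)) -
            (of_real c * l (res_im w q) + of_real d * l (res_im w p))"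
        and lq: "l q = (of_real c * l (res_re w q) + of_real d * l (res_re w p)) +
            (l (res_im w v) + of_real c * l (res_im w p) - of_real d * l (res_im w q))"
        by (simp_all only: lin)
      have wz: "w - z = of_real c + \<i> * of_real d" by (simp add: cd complex_eq_iff)
      have ii: "\<i> * (\<i> * x) = - x" for x by (simp add: mult.assoc[symmetric])
      show ?thesis
        unfolding resf_def \<Psi>_def pq[symmetric] lp lq wz by (simp add: algebra_simps ii)
    qed
    have cl: "isCont l x" for x by (rule linear_continuous_at[OF l])
    have "isCont \<Psi> w" unfolding \<Psi>_def
      by (intro continuous_intros isCont_o2[of w _ l, OF _ cl] blinfun.isCont isCont_res[OF w])
    then have "(\<Psi> \<longlongrightarrow> \<Psi> w) (at w)" by (simp add: isCont_def)
    then have "((\<lambda>z. - \<Psi> z) \<longlongrightarrow> - \<Psi> w) (at w)" by (rule tendsto_minus)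
    moreover have "\<forall>\<^sub>F z in at w. - \<Psi> z = (resf v z - resf v w) / (z - w)"
    proof -
      have "\<forall>\<^sub>F z in at w. z \<in> rho" using open_rho w by (rule eventually_at_in_open')
      moreover have "\<forall>\<^sub>F z in at w. z \<noteq> w" by (simp add: eventually_at_filter)
      ultimately show ?thesis
      proof eventually_elim
        case (elim z)
        have "(w - z) / (z - w) = -1" using elim by (simp add: field_simps)
        then show ?case using id[OF elim(1)] by (metis mult.commute mult_minus1 times_divide_eq_left)
      qed
    qed
    ultimately have "((\<lambda>z. (resf v z - resf v w) / (z - w)) \<longlongrightarrow> - \<Psi> w) (at w)"
      by (rule Lim_transform_eventually)
    then show ?thesis by (auto simp: has_field_derivative_iff)
  qed
  then show ?thesis by (simp add: holomorphic_on_open open_rho)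
qed

text \<open>Perturbation of |z|^2 times the identity: with |A| \<le> |z|/8 the remaining terms have
  norm at most |z|^2 (2/8 + 1/64), which is below the admissible half.\<close>

lemma large_in_rho:
  assumes z: "z \<noteq> 0" "norm z \<ge> 8 * norm A"
  shows "z \<in> rho"
proof -
  define B where "B = inverse ((norm z)\<^sup>2) *\<^sub>R (id_blinfun :: 'v \<Rightarrow>\<^sub>L 'v)"
  have nz: "norm z > 0" using z by simp
  have nB: "norm B \<le> inverse ((norm z)\<^sup>2)"
    unfolding B_def norm_scaleR using mult_left_mono[OF norm_blinfun_id_le, of "inverse ((norm z)\<^sup>2)"] by simp
  have "norm ((norm z)\<^sup>2 *\<^sub>R id_blinfun - quad z) = norm ((2 * Re z) *\<^sub>R A - (A o\<^sub>L A))"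
    by (simp add: quad_def)
  also have "\<dots> \<le> norm ((2 * Re z) *\<^sub>R A) + norm (A o\<^sub>L A)" by (rule norm_triangle_ineq4)
  also have "\<dots> \<le> 2 * norm z * norm A + norm A * norm A"
    using abs_Re_le_cmod[of z] by (intro add_mono norm_blinfun_compose) (auto simp: abs_mult mult_right_mono)
  also have "\<dots> \<le> 2 * norm z * (norm z / 8) + (norm z / 8) * (norm z / 8)"
    using z by (intro add_mono mult_mono) auto
  also have "\<dots> \<le> 1 / 2 * (norm z)\<^sup>2" by (simp add: power2_eq_square)
  finally have "norm B * norm ((norm z)\<^sup>2 *\<^sub>R id_blinfun - quad z) \<le> inverse ((norm z)\<^sup>2) * (1 / 2 * (norm z)\<^sup>2)"
    by (intro mult_mono nB) auto
  also have "\<dots> = 1 / 2" using nz by simp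
  finally obtain B' :: "'v \<Rightarrow>\<^sub>L 'v" where "\<And>v. blinfun_apply B' (quad z v) = v" "\<And>w. quad z (blinfun_apply B' w) = w"
    using blinfun_inverse_perturb[of B "(norm z)\<^sup>2 *\<^sub>R id_blinfun" "quad z"] nz
    by (auto simp: B_def blinfun.scaleR_left)
  then show ?thesis by (rule rhoI(1))
qed

text \<open>The equation z (p + \<i> q) = v + A (p + \<i> q) shows that the resolvent is of order
  1/|z|, and that the error after l v / z is the functional of A (p + \<i> q) divided by z.\<close>

lemma resf_asymptotic:
  "\<exists>K. \<forall>z\<in>rho. z \<noteq> 0 \<and> norm z \<ge> 4 * norm A \<longrightarrow> norm (resf v z - l v / z) \<le> K / (norm z)\<^sup>2"
proof -
  obtain L where L: "L > 0" "\<And>w. norm (l w) \<le> norm w * L" using bounded_linear.pos_bounded[OF l] by blast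
  have "norm (resf v z - l v / z) \<le> 4 * L * norm A * norm v / (norm z)\<^sup>2"
    if z: "z \<in> rho" "z \<noteq> 0" "norm z \<ge> 4 * norm A" for z
  proof -
    define p q where pq: "p = res_re z v" "q = res_im z v"
    define a b where ab: "a = v + A p" "b = A q"
    have nz: "norm z > 0" using z by simp
    have e: "Re z *\<^sub>R p - Im z *\<^sub>R q = a" "Re z *\<^sub>R q + Im z *\<^sub>R p = b"
      using res_equations[OF z(1), of v] by (simp_all add: pq ab algebra_simps)
    define m where "m = norm p + norm q"
    have n2: "(norm z)\<^sup>2 = Re z * Re z + Im z * Im z"
      using cmod_power2[of z] by (simp add: power2_eq_square[of "Re z"] power2_eq_square[of "Im z"])
    have "(norm z)\<^sup>2 *\<^sub>R p = Re z *\<^sub>R a + Im z *\<^sub>R b" "(norm z)\<^sup>2 *\<^sub>R q = Re z *\<^sub>R b - Im z *\<^sub>R a"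
      unfolding e[symmetric] n2 by (simp_all add: algebra_simps)
    then have "(norm z)\<^sup>2 * norm p = norm (Re z *\<^sub>R a + Im z *\<^sub>R b)" "(norm z)\<^sup>2 * norm q = norm (Re z *\<^sub>R b - Im z *\<^sub>R a)"
      by (metis abs_of_nonneg norm_scaleR zero_le_power2)+
    moreover have "norm (Re z *\<^sub>R a + Im z *\<^sub>R b) \<le> norm z * (norm a + norm b)"
      "norm (Re z *\<^sub>R b - Im z *\<^sub>R a) \<le> norm z * (norm a + norm b)"
    proof -
      have *: "norm (Re z *\<^sub>R x) \<le> norm z * norm x" "norm (Im z *\<^sub>R x) \<le> norm z * norm x" for x :: 'v
        using abs_Re_le_cmod[of z] abs_Im_le_cmod[of z] by (auto intro: mult_right_mono)
      show "norm (Re z *\<^sub>R a + Im z *\<^sub>R b) \<le> norm z * (norm a + norm b)"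
        using norm_triangle_ineq[of "Re z *\<^sub>R a" "Im z *\<^sub>R b"] *(1)[of a] *(2)[of b] by (simp add: distrib_left)
      show "norm (Re z *\<^sub>R b - Im z *\<^sub>R a) \<le> norm z * (norm a + norm b)"
        using norm_triangle_ineq4[of "Re z *\<^sub>R b" "Im z *\<^sub>R a"] *(1)[of b] *(2)[of a] by (simp add: distrib_left)
    qed
    ultimately have "(norm z)\<^sup>2 * m \<le> norm z * (2 * (norm a + norm b))" by (simp add: m_def distrib_left)
    then have "norm z * m \<le> 2 * (norm a + norm b)" using nz by (simp add: power2_eq_square mult.assoc)
    also have "norm a + norm b \<le> norm v + norm A * m"
      using norm_triangle_ineq[of v "A p"] norm_blinfun[of A p] norm_blinfun[of A q] by (simp add: ab m_def distrib_left)
    \<comment> \<open>With the factor 2 in front this is half of |z| m, which is absorbed on the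
      left.\<close>
    also have "norm A * m \<le> norm z / 4 * m" using z by (intro mult_right_mono) (auto simp: m_def)
    finally have "norm z * m \<le> 4 * norm v" by (simp add: algebra_simps)
    then have m: "m \<le> 4 * norm v / norm z" using nz by (simp add: pos_le_divide_eq mult.commute)
    have "l a = of_real (Re z) * l p - of_real (Im z) * l q" "l b = of_real (Re z) * l q + of_real (Im z) * l p"
      unfolding e[symmetric] by (simp_all add: l_add l_diff l_scaleR)
    then have "(of_real (Re z) + \<i> * of_real (Im z)) * resf v z = l a + \<i> * l b"
      by (simp add: resf_def pq[symmetric] algebra_simps)
    then have "z * resf v z = l v + (l (A p) + \<i> * l (A q))"
      by (simp add: complex_eq[symmetric] ab l_add)
    then have "resf v z - l v / z = (l (A p) + \<i> * l (A q)) / z" using z(2) by (simp add: field_simps)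
    then have "norm (resf v z - l v / z) = norm (l (A p) + \<i> * l (A q)) / norm z" by (simp only: norm_divide)
    also have "\<dots> \<le> (L * norm A * m) / norm z"
    proof (rule divide_right_mono)
      have "norm (l (A w)) \<le> (norm A * norm w) * L" for w
        by (rule order_trans[OF L(2) mult_right_mono[OF norm_blinfun]]) (use L in auto)
      then have "norm (l (A w)) \<le> L * norm A * norm w" for w by (simp only: mult_ac)
      from add_mono[OF this[of p] this[of q]] show "norm (l (A p) + \<i> * l (A q)) \<le> L * norm A * m"
        using norm_triangle_ineq[of "l (A p)" "\<i> * l (A q)"] by (simp add: m_def norm_mult distrib_left)
    qed simp
    also have "\<dots> \<le> (L * norm A * (4 * norm v / norm z)) / norm z"
      using m L by (intro divide_right_mono mult_left_mono) auto
    also have "\<dots> = 4 * L * norm A * norm v / (norm z)\<^sup>2" by (simp add: power2_eq_square mult_ac)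
    finally show ?thesis .
  qed
  then show ?thesis by blast
qed

end

context group_generator
begin

text \<open>For z = 1/\<zeta> + \<alpha> the formal identity is (\<zeta> - A)^-1 = 1/\<zeta> - (z -
  T)^-1 / \<zeta>^2. The vector a + \<i> b = -\<zeta> A (\<zeta> - A)^-1 v plays the part of (z -
  T)^-1 v: its components lie in the domain of T and (z - T)(a + \<i> b) = v. So exp(-z t) times its
  orbit is, up to sign, an antiderivative of the Laplace integrand.\<close>

lemma resf_laplace:
  assumes Ainv: "is_bounded_inverse D (\<lambda>v. T v - \<alpha> *\<^sub>R v) A" and sf: "slice_functional A I l"
    and \<zeta>: "\<zeta> \<in> bounded_op.rho A I" "\<zeta> \<noteq> 0" "\<bar>Re (inverse \<zeta> + of_real \<alpha>)\<bar> > \<omega>"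
  shows "slice_functional.resf A I l v \<zeta> = l v / \<zeta> - lap (\<lambda>t. l (Z t v)) (inverse \<zeta> + of_real \<alpha>) / \<zeta>\<^sup>2"
proof -
  interpret slice_functional A I l by fact
  define z where "z = inverse \<zeta> + of_real \<alpha>"
  define p q where pq: "p = res_re \<zeta> v" "q = res_im \<zeta> v"
  define x y where xy: "x = Re \<zeta>" "y = Im \<zeta>"
  have \<zeta>e: "\<zeta> = of_real x + \<i> * of_real y" by (simp add: xy complex_eq_iff)
  have ii: "\<i> * (\<i> * u) = - u" for u by (simp add: mult.assoc[symmetric])
  define a where "a = - (x *\<^sub>R A p - y *\<^sub>R A q)"
  define b where "b = - (y *\<^sub>R A p + x *\<^sub>R A q)"
  have e: "x *\<^sub>R p - y *\<^sub>R q - A p = v" "x *\<^sub>R q + y *\<^sub>R p - A q = 0"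
    unfolding pq xy by (rule res_equations[OF \<zeta>(1)])+
  have AD: "A w \<in> D" "T (A w) = w + \<alpha> *\<^sub>R A w" for w
    using Ainv by (auto simp: is_bounded_inverse_def algebra_simps)
  have lin: "- (r *\<^sub>R A u + s *\<^sub>R A w) \<in> D" "T (- (r *\<^sub>R A u + s *\<^sub>R A w)) =
      - (r *\<^sub>R (u + \<alpha> *\<^sub>R A u) + s *\<^sub>R (w + \<alpha> *\<^sub>R A w))" for r s u w
  proof -
    have d: "r *\<^sub>R A u \<in> D" "s *\<^sub>R A w \<in> D" by (intro generator_scaleR(1) AD)+
    then have s: "r *\<^sub>R A u + s *\<^sub>R A w \<in> D" by (rule generator_add)
    show "- (r *\<^sub>R A u + s *\<^sub>R A w) \<in> D" using generator_scaleR(1)[OF s, of "-1"] by simp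
    show "T (- (r *\<^sub>R A u + s *\<^sub>R A w)) = - (r *\<^sub>R (u + \<alpha> *\<^sub>R A u) + s *\<^sub>R (w + \<alpha> *\<^sub>R A w))"
      using generator_scaleR(2)[OF s, of "-1"] generator_add(2)[OF d] generator_scaleR(2)[OF AD(1)] AD(2) by simp
  qed
  have a: "a \<in> D" "T a = - (x *\<^sub>R p - y *\<^sub>R q) + \<alpha> *\<^sub>R a"
    using lin[of x p "- y" q] by (simp_all add: a_def algebra_simps)
  have b: "b \<in> D" "T b = - (y *\<^sub>R p + x *\<^sub>R q) + \<alpha> *\<^sub>R b"
    using lin[of y p x q] by (simp_all add: b_def algebra_simps)
  have Ap: "A p = x *\<^sub>R p - y *\<^sub>R q - v" "A q = x *\<^sub>R q + y *\<^sub>R p"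
    using e by (simp_all add: algebra_simps)
  define \<Lambda> where "\<Lambda> B = l (B a) + \<i> * l (B b)" for B :: "'v \<Rightarrow>\<^sub>L 'v"
  have lAp: "l (B (A p)) + \<i> * l (B (A q)) = \<zeta> * (l (B p) + \<i> * l (B q)) - l (B v)" for B :: "'v \<Rightarrow>\<^sub>L 'v"
    unfolding Ap by (simp add: blinfun.add_right blinfun.diff_right blinfun.scaleR_right l_add l_diff l_scaleR \<zeta>e algebra_simps ii)
  have \<Lambda>A: "\<Lambda> B = - \<zeta> * (l (B (A p)) + \<i> * l (B (A q)))" for B :: "'v \<Rightarrow>\<^sub>L 'v"
    unfolding \<Lambda>_def a_def b_def
    by (simp add: blinfun.add_right blinfun.diff_right blinfun.minus_right blinfun.scaleR_right l_add l_diff l_minus l_scaleR \<zeta>e algebra_simps ii)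
  have \<Lambda>T: "l (B (T a)) + \<i> * l (B (T b)) = z * \<Lambda> B - l (B v)" for B :: "'v \<Rightarrow>\<^sub>L 'v"
  proof -
    have gen: "x1 = - x2 + x3 \<Longrightarrow> x4 = x5 - x2 \<Longrightarrow> x1 = x4 + x3 - x5" for x1 x2 x3 x4 x5 :: complex by simp
    have "l (B (T a)) + \<i> * l (B (T b)) = - (\<zeta> * (l (B p) + \<i> * l (B q))) + of_real \<alpha> * \<Lambda> B"
      unfolding a(2) b(2) \<Lambda>_def
      by (simp add: blinfun.add_right blinfun.diff_right blinfun.minus_right blinfun.scaleR_right l_add l_diff l_minus l_scaleR \<zeta>e algebra_simps ii)
    moreover have "inverse \<zeta> * \<Lambda> B = l (B v) - \<zeta> * (l (B p) + \<i> * l (B q))"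
      using \<zeta>(2) unfolding \<Lambda>A lAp by (simp only: mult_minus_left mult_minus_right mult.assoc[symmetric] left_inverse mult_1 minus_diff_eq not_False_eq_True)
    ultimately show ?thesis unfolding z_def distrib_right by (rule gen)
  qed
  define H where "H t = l (Z t v)" for t
  have clx: "continuous_on UNIV (\<lambda>t. l (Z t x))" for x
    by (rule continuous_on_compose2[OF linear_continuous_on[OF l, of UNIV] Z_cont]) simp
  define k where "k t = exp (- z * of_real t) * \<Lambda> (Z t)" for t :: real
  have kder: "(k has_vector_derivative - (exp (- z * of_real t) * H t)) (at t)" for t
  proof -
    have lz: "((\<lambda>t. l (Z t x)) has_vector_derivative l (Z t (T x))) (at t)" if "x \<in> D" for x
      by (rule bounded_linear.has_vector_derivative[OF l has_vector_derivative_Z[OF that]])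
    have "((\<lambda>t. \<Lambda> (Z t)) has_vector_derivative l (Z t (T a)) + \<i> * l (Z t (T b))) (at t)"
      unfolding \<Lambda>_def by (intro has_vector_derivative_add lz a b has_vector_derivative_mult_right)
    then have d1: "((\<lambda>t. \<Lambda> (Z t)) has_vector_derivative z * \<Lambda> (Z t) - H t) (at t)"
      by (simp only: \<Lambda>T H_def)
    have d2: "((\<lambda>t. exp (- z * of_real t)) has_vector_derivative - z * exp (- z * of_real t)) (at t)"
      by (rule has_vector_derivative_real_field) (auto intro!: derivative_eq_intros)
    from has_vector_derivative_mult[OF d2 d1] show ?thesis unfolding k_def by (simp add: algebra_simps)
  qed
  obtain L where L: "L > 0" "\<And>w. norm (l w) \<le> norm w * L" using bounded_linear.pos_bounded[OF l] by blast
  have lZ: "norm (l (Z t x)) \<le> L * M * norm x * exp (\<omega> * \<bar>t\<bar>)" for t x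
  proof -
    have "norm (l (Z t x)) \<le> (M * exp (\<omega> * \<bar>t\<bar>) * norm x) * L"
      by (rule order_trans[OF L(2) mult_right_mono[OF norm_Z_apply]]) (use L in auto)
    then show ?thesis by (simp add: mult_ac)
  qed
  have \<Lambda>Z: "norm (\<Lambda> (Z t)) \<le> L * M * (norm a + norm b) * exp (\<omega> * \<bar>t\<bar>)" for t
    using add_mono[OF lZ[of t a] lZ[of t b]] norm_triangle_ineq[of "l (Z t a)" "\<i> * l (Z t b)"]
    by (simp add: \<Lambda>_def norm_mult algebra_simps)
  have "lap H z = \<Lambda> id_blinfun"
  proof (cases "Re z > 0")
    case True
    define \<beta> where "\<beta> = Re z - \<omega>"
    have \<beta>: "\<beta> > 0" using \<zeta>(3) True \<omega> by (simp add: \<beta>_def z_def[symmetric])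
    have ez: "norm (exp (- z * of_real t)) * (C * exp (\<omega> * \<bar>t\<bar>)) = C * exp (- \<beta> * t)" if "t > 0" for t C
    proof -
      have "norm (exp (- z * of_real t)) = exp (- Re z * t)" by (simp add: norm_exp_eq_Re)
      moreover have "exp (- Re z * t) * exp (\<omega> * t) = exp (- \<beta> * t)" by (simp add: mult_exp_exp \<beta>_def algebra_simps)
      moreover have "\<bar>t\<bar> = t" using that by simp
      ultimately show ?thesis by (simp only: mult.left_commute[of _ C])
    qed
    have "(LINT t|lborel. indicator {0<..} t *\<^sub>R (- (exp (- z * of_real t) * H t))) = - k 0"
    proof (rule half_line_FTC[OF \<beta> _ _ kder])
      show "continuous_on UNIV (\<lambda>t. - (exp (- z * of_real t) * H t))"
        unfolding H_def by (intro continuous_intros clx)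
      show "norm (- (exp (- z * of_real t) * H t)) \<le> L * M * norm v * exp (- \<beta> * t)" if "t > 0" for t
        unfolding norm_mult norm_minus_cancel H_def
        by (rule order_trans[OF mult_left_mono[OF lZ norm_ge_zero] eq_refl[OF ez[OF that]]])
      show "norm (k t) \<le> L * M * (norm a + norm b) * exp (- \<beta> * t)" if "t > 0" for t
        unfolding k_def norm_mult
        by (rule order_trans[OF mult_left_mono[OF \<Lambda>Z norm_ge_zero] eq_refl[OF ez[OF that]]])
    qed
    then have "(LINT t|lborel. indicator {0<..} t *\<^sub>R (exp (- z * of_real t) * H t)) = k 0" by simp
    then show ?thesis using True by (simp add: lap_def k_def \<Lambda>_def Z_0)
  next
    case False
    \<comment> \<open>To the left of the strip time is reversed, and \<open>k (- t)\<close> takes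
      the place of \<open>k t\<close>.\<close>
    define \<beta> where "\<beta> = - Re z - \<omega>"
    have \<beta>: "\<beta> > 0" using \<zeta>(3) False by (simp add: \<beta>_def z_def[symmetric])
    have ez: "norm (exp (z * of_real t)) * (C * exp (\<omega> * \<bar>- t\<bar>)) = C * exp (- \<beta> * t)" if "t > 0" for t C
    proof -
      have "norm (exp (z * of_real t)) = exp (Re z * t)" by (simp add: norm_exp_eq_Re)
      moreover have "exp (Re z * t) * exp (\<omega> * t) = exp (- \<beta> * t)" by (simp add: mult_exp_exp \<beta>_def algebra_simps)
      moreover have "\<bar>- t\<bar> = t" using that by simp
      ultimately show ?thesis by (simp only: mult.left_commute[of _ C])
    qed
    have "(LINT t|lborel. indicator {0<..} t *\<^sub>R (exp (z * of_real t) * H (- t))) = - (\<lambda>t. k (- t)) 0"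
    proof (rule half_line_FTC[OF \<beta>])
      have "continuous_on UNIV (\<lambda>t. H (- t))"
        by (rule continuous_on_compose2[OF clx[of v, folded H_def]]) (auto intro!: continuous_intros)
      then show "continuous_on UNIV (\<lambda>t. exp (z * of_real t) * H (- t))" by (intro continuous_intros)
      show "norm (exp (z * of_real t) * H (- t)) \<le> L * M * norm v * exp (- \<beta> * t)" if "t > 0" for t
        unfolding norm_mult norm_minus_cancel H_def
        by (rule order_trans[OF mult_left_mono[OF lZ norm_ge_zero] eq_refl[OF ez[OF that]]])
      show "norm (k (- t)) \<le> L * M * (norm a + norm b) * exp (- \<beta> * t)" if "t > 0" for t
        unfolding k_def norm_mult of_real_minus mult_minus_right mult_minus_left minus_minus
        by (rule order_trans[OF mult_left_mono[OF \<Lambda>Z norm_ge_zero] eq_refl[OF ez[OF that, unfolded mult_minus_left]]])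
      have "((\<lambda>t. k (- t)) has_vector_derivative (-1) *\<^sub>R (- (exp (- z * of_real (- t)) * H (- t)))) (at t)" for t
        using vector_diff_chain_at[OF has_vector_derivative_minus[OF has_vector_derivative_id] kder[of "- t"]]
        by (simp only: o_def)
      then show "((\<lambda>t. k (- t)) has_vector_derivative exp (z * of_real t) * H (- t)) (at t)" for t by simp
    qed
    then show ?thesis using False by (simp add: lap_def k_def \<Lambda>_def Z_0)
  qed
  also have "\<Lambda> id_blinfun = - \<zeta> * (\<zeta> * resf v \<zeta> - l v)"
    using \<Lambda>A[of id_blinfun] lAp[of id_blinfun] by (simp add: resf_def pq)
  finally have "lap H z = - \<zeta> * (\<zeta> * resf v \<zeta> - l v)" .
  then have "resf v \<zeta> = l v / \<zeta> - lap H z / \<zeta>\<^sup>2" using \<zeta>(2) by (simp add: field_simps power2_eq_square)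
  then show ?thesis by (simp only: z_def H_def[abs_def])
qed

end

section \<open>Circular domains\<close>

text \<open>For \<open>a < b\<close> this is negative exactly inside the ball having the real segment from \<open>a\<close> to \<open>b\<close>
  as a diameter.\<close>

definition disc_form :: "real \<Rightarrow> real \<Rightarrow> quat \<Rightarrow> real" where
  "disc_form a b q = (norm q)\<^sup>2 - (a + b) * qRe q + a * b"

lemma norm_diff_of_real_quat: "(norm (q - of_real c))\<^sup>2 = (norm q)\<^sup>2 - 2 * c * qRe q + c\<^sup>2"
  unfolding norm_quat_sq by (simp add: power2_eq_square algebra_simps)

lemma disc_form_ball:
  assumes "a < b"
  shows "q \<in> ball (of_real ((a + b) / 2)) ((b - a) / 2) \<longleftrightarrow> disc_form a b q < 0"
    "q \<in> cball (of_real ((a + b) / 2)) ((b - a) / 2) \<longleftrightarrow> disc_form a b q \<le> 0"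
proof -
  define n where "n = norm (q - of_real ((a + b) / 2))"
  define r where "r = (b - a) / 2"
  have e: "n\<^sup>2 - r\<^sup>2 = disc_form a b q"
    unfolding n_def r_def norm_diff_of_real_quat disc_form_def by (simp add: power2_eq_square field_simps)
  have nr: "0 \<le> n" "0 \<le> r" using assms by (simp_all add: n_def r_def)
  have "n \<le> r \<longleftrightarrow> n\<^sup>2 \<le> r\<^sup>2" "r \<le> n \<longleftrightarrow> r\<^sup>2 \<le> n\<^sup>2" using nr by simp_all
  then have "n < r \<longleftrightarrow> disc_form a b q < 0" "n \<le> r \<longleftrightarrow> disc_form a b q \<le> 0" using e by linarith+
  then show "q \<in> ball (of_real ((a + b) / 2)) ((b - a) / 2) \<longleftrightarrow> disc_form a b q < 0"
    "q \<in> cball (of_real ((a + b) / 2)) ((b - a) / 2) \<longleftrightarrow> disc_form a b q \<le> 0"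
    by (simp_all only: mem_ball mem_cball dist_norm norm_minus_commute[of _ q] n_def r_def)
qed

lemma continuous_on_disc_form [continuous_intros]: "continuous_on UNIV (disc_form a b)"
proof -
  have "continuous_on UNIV qRe" using isCont_qRe by (simp add: continuous_on_eq_continuous_at)
  then show ?thesis unfolding disc_form_def[abs_def] by (intro continuous_intros)
qed

text \<open>The map q \<mapsto> 1/q + \<alpha> carries balls with a real diameter to such balls or
  to their complements. The factor (u - \<alpha>)(v - \<alpha>) records which: it is negative
  exactly when \<alpha> lies between u and v, and then inside and outside are exchanged.\<close>

lemma disc_form_inverse:
  assumes q: "q \<noteq> 0" and uv: "u \<noteq> \<alpha>" "v \<noteq> \<alpha>"
  shows "disc_form u v (inverse q + of_real \<alpha>) * (norm q)\<^sup>2 =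
    (u - \<alpha>) * (v - \<alpha>) * disc_form (1 / (u - \<alpha>)) (1 / (v - \<alpha>)) q"
proof -
  define N where "N = (norm q)\<^sup>2"
  have N: "N > 0" using q by (simp add: N_def)
  have re: "qRe (inverse q) = qRe q / N" by (simp add: inverse_quat_def qcnj_def N_def field_simps)
  have "(norm (inverse q))\<^sup>2 = 1 / N" by (simp add: N_def norm_inverse power_inverse divide_inverse)
  then have n2: "(norm (inverse q + of_real \<alpha>))\<^sup>2 = 1 / N + 2 * \<alpha> * (qRe q / N) + \<alpha>\<^sup>2"
    using norm_diff_of_real_quat[of "inverse q" "- \<alpha>"] re by simp
  have "disc_form u v (inverse q + of_real \<alpha>) * N = 1 - ((u - \<alpha>) + (v - \<alpha>)) * qRe q + (u - \<alpha>) * (v - \<alpha>) * N"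
    unfolding disc_form_def n2 quat_sel_simps quat_sel_of_real re
    using N by (simp add: field_simps power2_eq_square)
  also have "\<dots> = (u - \<alpha>) * (v - \<alpha>) * disc_form (1 / (u - \<alpha>)) (1 / (v - \<alpha>)) q"
  proof -
    have "1 - (m + n) * x + m * n * N = m * n * (N - (1 / m + 1 / n) * x + 1 / m * (1 / n))"
      if "m \<noteq> 0" "n \<noteq> 0" for m n x :: real using that by (simp add: field_simps)
    note h = this
    show ?thesis unfolding disc_form_def N_def[symmetric] by (rule h) (use uv in simp_all)
  qed
  finally show ?thesis by (simp only: N_def)
qed

lemma disc_form_qRe:
  assumes "disc_form u v z \<le> 0" "u < v"
  shows "u \<le> qRe z" "qRe z \<le> v"
proof -
  have "(qRe z)\<^sup>2 \<le> (norm z)\<^sup>2" by (simp add: norm_quat_sq)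
  then have s: "(qRe z - u) * (qRe z - v) \<le> 0"
    using assms(1) by (simp add: disc_form_def power2_eq_square algebra_simps)
  show "u \<le> qRe z" using s assms(2) mult_neg_neg[of "qRe z - u" "qRe z - v"] by linarith
  show "qRe z \<le> v" using s assms(2) mult_pos_pos[of "qRe z - u" "qRe z - v"] by linarith
qed

lemma inverse_disc_qRe:
  assumes s: "(u - \<alpha>) * (v - \<alpha>) \<noteq> 0" "(u - \<alpha>) * (v - \<alpha>) * disc_form (1 / (u - \<alpha>)) (1 / (v - \<alpha>)) q \<le> 0" and uv: "u < v"
  shows "q \<noteq> 0 \<and> u \<le> qRe (inverse q + of_real \<alpha>) \<and> qRe (inverse q + of_real \<alpha>) \<le> v"
proof -
  have q: "q \<noteq> 0"
  proof
    assume "q = 0"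
    then show False using s by (simp add: disc_form_def)
  qed
  have ne: "u \<noteq> \<alpha>" "v \<noteq> \<alpha>" using s(1) by auto
  have "disc_form u v (inverse q + of_real \<alpha>) * (norm q)\<^sup>2 \<le> 0"
    unfolding disc_form_inverse[OF q ne] by (rule s(2))
  then have "disc_form u v (inverse q + of_real \<alpha>) \<le> 0" using q by (simp add: mult_le_0_iff)
  from disc_form_qRe[OF this uv] show ?thesis using q by blast
qed

text \<open>If the image z of q avoids the open balls over [p, p + \<rho>] and [-p - \<rho>, -p],
  then |z|^2 \<ge> (2p + \<rho>)|Re z| - p(p + \<rho>). For |Re z| \<ge> c the right side exceeds
  r^2 by the choice of \<rho>, so z is in the strip or outside the ball of radius r.\<close>

lemma in_moebius_domain:
  assumes p: "0 \<le> p" "p \<le> c" and \<rho>: "r\<^sup>2 < \<rho> * (c - p)" "\<rho> \<ge> 0" "r > 0"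
    and ne: "p \<noteq> \<alpha>" "p + \<rho> \<noteq> \<alpha>" "- p \<noteq> \<alpha>" "- p - \<rho> \<noteq> \<alpha>"
    and d: "0 \<le> (p - \<alpha>) * (p + \<rho> - \<alpha>) * disc_form (1 / (p - \<alpha>)) (1 / (p + \<rho> - \<alpha>)) q"
      "0 \<le> (- p - \<rho> - \<alpha>) * (- p - \<alpha>) * disc_form (1 / (- p - \<rho> - \<alpha>)) (1 / (- p - \<alpha>)) q"
  shows "q \<in> moebius_domain \<alpha> c r"
proof (cases "q = 0")
  case True
  then show ?thesis by (simp add: moebius_domain_def)
next
  case False
  define z where "z = inverse q + of_real \<alpha>"
  have "0 \<le> disc_form p (p + \<rho>) z * (norm q)\<^sup>2" "0 \<le> disc_form (- p - \<rho>) (- p) z * (norm q)\<^sup>2"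
    unfolding z_def disc_form_inverse[OF False ne(1,2)] disc_form_inverse[OF False ne(4,3)] by (rule d)+
  then have "0 \<le> disc_form p (p + \<rho>) z" "0 \<le> disc_form (- p - \<rho>) (- p) z"
    using False by (simp_all add: zero_le_mult_iff)
  then have n: "(2 * p + \<rho>) * x - p * (p + \<rho>) \<le> (norm z)\<^sup>2" if "x = \<bar>qRe z\<bar>" for x
    using that by (cases "qRe z \<ge> 0") (simp_all add: disc_form_def algebra_simps)
  have "r < norm z" if x: "\<bar>qRe z\<bar> \<ge> c"
  proof -
    have "r\<^sup>2 < \<rho> * (c - p) + p * (c + (c - p))" using \<rho>(1) mult_nonneg_nonneg[of p "c + (c - p)"] p by linarith
    also have "\<dots> = (2 * p + \<rho>) * c - p * (p + \<rho>)" by (simp add: algebra_simps)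
    also have "\<dots> \<le> (2 * p + \<rho>) * \<bar>qRe z\<bar> - p * (p + \<rho>)"
      using mult_left_mono[OF x, of "2 * p + \<rho>"] p \<rho> by simp
    also have "\<dots> \<le> (norm z)\<^sup>2" by (rule n) simp
    finally show ?thesis by (rule power2_less_imp_less) simp
  qed
  then show ?thesis unfolding moebius_domain_def mem_Collect_eq z_def[symmetric] by (metis not_le)
qed

section \<open>Domains bounded by three circles with real centres\<close>

definition circular_domain :: "real \<Rightarrow> real \<Rightarrow> real \<Rightarrow> real \<Rightarrow> real \<Rightarrow> real \<Rightarrow> quat set" where
  "circular_domain a0 b0 a1 b1 a2 b2 =
     {q. disc_form a0 b0 q < 0 \<and> 0 < disc_form a1 b1 q \<and> 0 < disc_form a2 b2 q}"

definition real_circle :: "real \<Rightarrow> real \<Rightarrow> real \<Rightarrow> complex" where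
  "real_circle a b = circlepath (of_real ((a + b) / 2)) ((b - a) / 2)"

definition boundary_circles :: "real \<Rightarrow> real \<Rightarrow> real \<Rightarrow> real \<Rightarrow> real \<Rightarrow> real \<Rightarrow> (real \<Rightarrow> complex) list" where
  "boundary_circles a0 b0 a1 b1 a2 b2 =
     [real_circle a0 b0, reversepath (real_circle a1 b1), reversepath (real_circle a2 b2)]"

lemma in_slice_ball:
  assumes I: "I \<in> imag_sphere"
  shows "in_slice I z \<in> ball (of_real c) r \<longleftrightarrow> z \<in> ball (of_real c) r"
    "in_slice I z \<in> cball (of_real c) r \<longleftrightarrow> z \<in> cball (of_real c) r"
proof -
  have "dist (of_real c) (in_slice I z) = dist (of_real c) z"
    unfolding dist_norm norm_in_slice[OF I, symmetric] by (simp add: in_slice_linear)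
  then show "in_slice I z \<in> ball (of_real c) r \<longleftrightarrow> z \<in> ball (of_real c) r"
    "in_slice I z \<in> cball (of_real c) r \<longleftrightarrow> z \<in> cball (of_real c) r" by simp_all
qed

lemma disc_form_slice:
  assumes I: "I \<in> imag_sphere" and "a < b"
  shows "disc_form a b (in_slice I z) < 0 \<longleftrightarrow> z \<in> ball (of_real ((a + b) / 2)) ((b - a) / 2)"
    "disc_form a b (in_slice I z) \<le> 0 \<longleftrightarrow> z \<in> cball (of_real ((a + b) / 2)) ((b - a) / 2)"
  using disc_form_ball[OF assms(2), of "in_slice I z"] in_slice_ball[OF I] by blast+

lemma C1_circlepath: "circlepath c r C1_differentiable_on S"
proof -
  have "(circlepath c r has_vector_derivative 2 * pi * \<i> * r * exp (2 * of_real pi * \<i> * x)) (at x)" for x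
    by (rule has_vector_derivative_circlepath)
  note d = this
  show ?thesis unfolding C1_differentiable_on_def
  proof (intro exI conjI ballI)
    show "(circlepath c r has_vector_derivative 2 * pi * \<i> * r * exp (2 * of_real pi * \<i> * x)) (at x)" for x
      by (rule d)
  qed (intro continuous_intros)
qed

lemma C1_reversepath:
  assumes "g C1_differentiable_on {0..1}"
  shows "reversepath g C1_differentiable_on {0..1}"
proof -
  obtain g' where g: "\<And>x. x \<in> {0..1} \<Longrightarrow> (g has_vector_derivative g' x) (at x)" "continuous_on {0..1} g'"
    using assms unfolding C1_differentiable_on_def by blast
  have d: "(reversepath g has_vector_derivative - g' (1 - x)) (at x)" if "x \<in> {0..1}" for x
  proof -
    have "((\<lambda>x::real. 1 - x) has_vector_derivative (0 - 1)) (at x)"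
      by (intro has_vector_derivative_diff has_vector_derivative_const has_vector_derivative_id)
    from vector_diff_chain_at[OF this g(1)[of "1 - x"]] show ?thesis using that by (simp add: reversepath_def o_def)
  qed
  show ?thesis unfolding C1_differentiable_on_def
  proof (intro exI conjI ballI)
    show "(reversepath g has_vector_derivative - g' (1 - x)) (at x)" if "x \<in> {0..1}" for x by (rule d[OF that])
    show "continuous_on {0..1} (\<lambda>x. - g' (1 - x))"
      by (intro continuous_intros continuous_on_compose2[OF g(2)]) auto
  qed
qed

lemma C1_reversepath_circlepath: "reversepath (circlepath c r) C1_differentiable_on {0..1}"
  by (rule C1_reversepath[OF C1_circlepath])

lemma winding_number_real_circle:
  assumes "a < b"
  shows "z \<in> ball (of_real ((a + b) / 2)) ((b - a) / 2) \<Longrightarrow> winding_number (real_circle a b) z = 1"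
    "z \<notin> cball (of_real ((a + b) / 2)) ((b - a) / 2) \<Longrightarrow> winding_number (real_circle a b) z = 0"
    "z \<notin> sphere (of_real ((a + b) / 2)) ((b - a) / 2) \<Longrightarrow>
      winding_number (reversepath (real_circle a b)) z = - winding_number (real_circle a b) z"
    "path_image (real_circle a b) = sphere (of_real ((a + b) / 2)) ((b - a) / 2)"
proof -
  show pi: "path_image (real_circle a b) = sphere (of_real ((a + b) / 2)) ((b - a) / 2)"
    unfolding real_circle_def using assms by (intro path_image_circlepath_nonneg) simp
  show "z \<in> ball (of_real ((a + b) / 2)) ((b - a) / 2) \<Longrightarrow> winding_number (real_circle a b) z = 1"
    unfolding real_circle_def by (intro winding_number_circlepath) (simp only: mem_ball dist_norm norm_minus_commute)
  show "z \<notin> cball (of_real ((a + b) / 2)) ((b - a) / 2) \<Longrightarrow> winding_number (real_circle a b) z = 0"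
    by (rule winding_number_zero_outside[where s = "cball (of_real ((a + b) / 2)) ((b - a) / 2)"])
      (use pi in \<open>simp_all add: real_circle_def sphere_cball\<close>)
  show "z \<notin> sphere (of_real ((a + b) / 2)) ((b - a) / 2) \<Longrightarrow>
      winding_number (reversepath (real_circle a b)) z = - winding_number (real_circle a b) z"
    by (rule winding_number_reversepath) (simp add: real_circle_def, simp only: pi not_False_eq_True)
qed

lemma real_discs_nested:
  assumes "a0 < a1" "a1 < b1" "b1 < b0"
  shows "cball (of_real ((a1 + b1) / 2) :: complex) ((b1 - a1) / 2) \<subseteq> ball (of_real ((a0 + b0) / 2)) ((b0 - a0) / 2)"
proof
  fix z :: complex assume z: "z \<in> cball (of_real ((a1 + b1) / 2)) ((b1 - a1) / 2)"
  have "dist (complex_of_real ((a0 + b0) / 2)) (of_real ((a1 + b1) / 2)) = \<bar>(a0 + b0) / 2 - (a1 + b1) / 2\<bar>"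
    by (simp only: dist_norm of_real_diff[symmetric] norm_of_real)
  also have "\<dots> < (b0 - a0) / 2 - (b1 - a1) / 2" using assms by (simp add: abs_less_iff field_simps)
  finally show "z \<in> ball (of_real ((a0 + b0) / 2)) ((b0 - a0) / 2)"
    using z dist_triangle[of "complex_of_real ((a0 + b0) / 2)" z "of_real ((a1 + b1) / 2)"]
    unfolding mem_ball mem_cball by linarith
qed

lemma real_discs_disjoint:
  assumes "a1 < b1" "b1 < a2" "a2 < b2"
  shows "cball (of_real ((a1 + b1) / 2) :: complex) ((b1 - a1) / 2) \<inter> cball (of_real ((a2 + b2) / 2)) ((b2 - a2) / 2) = {}"
proof -
  have False if z: "z \<in> cball (of_real ((a1 + b1) / 2)) ((b1 - a1) / 2)" "z \<in> cball (of_real ((a2 + b2) / 2)) ((b2 - a2) / 2)" for z :: complex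
  proof -
    have "dist (complex_of_real ((a1 + b1) / 2)) (of_real ((a2 + b2) / 2)) = \<bar>(a1 + b1) / 2 - (a2 + b2) / 2\<bar>"
      by (simp only: dist_norm of_real_diff[symmetric] norm_of_real)
    moreover have "(b1 - a1) / 2 + (b2 - a2) / 2 < - ((a1 + b1) / 2 - (a2 + b2) / 2)"
      using assms by (simp add: field_simps)
    then have "(b1 - a1) / 2 + (b2 - a2) / 2 < \<bar>(a1 + b1) / 2 - (a2 + b2) / 2\<bar>"
      by (rule less_le_trans[OF _ abs_ge_minus_self])
    ultimately show False
      using z dist_triangle2[of "complex_of_real ((a1 + b1) / 2)" "of_real ((a2 + b2) / 2)" z]
      unfolding mem_cball by linarith
  qed
  then show ?thesis by blast
qed

context
  fixes a0 b0 a1 b1 a2 b2 :: real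
  assumes chain: "a0 < a1" "a1 < b1" "b1 < a2" "a2 < b2" "b2 < b0"
begin

lemma slice_circular_domain:
  assumes "I \<in> imag_sphere"
  shows "slice I (circular_domain a0 b0 a1 b1 a2 b2) = ball (of_real ((a0 + b0) / 2)) ((b0 - a0) / 2)
    - cball (of_real ((a1 + b1) / 2)) ((b1 - a1) / 2) - cball (of_real ((a2 + b2) / 2)) ((b2 - a2) / 2)"
proof -
  have "a0 < b0" using chain by linarith
  show ?thesis
  proof (rule set_eqI)
    fix z
    show "z \<in> slice I (circular_domain a0 b0 a1 b1 a2 b2) \<longleftrightarrow> z \<in> ball (of_real ((a0 + b0) / 2)) ((b0 - a0) / 2)
      - cball (of_real ((a1 + b1) / 2)) ((b1 - a1) / 2) - cball (of_real ((a2 + b2) / 2)) ((b2 - a2) / 2)"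
      unfolding slice_def circular_domain_def mem_Collect_eq Diff_iff disc_form_slice(1)[OF assms \<open>a0 < b0\<close>]
        disc_form_slice(2)[OF assms chain(2), symmetric] disc_form_slice(2)[OF assms chain(4), symmetric] not_le conj_assoc ..
  qed
qed

text \<open>The inner circles are reversed, so the winding numbers add up to 1 in the domain, to 1 -
  1 in a hole and to 0 outside.\<close>

lemma boundary_circles_oriented:
  assumes I: "I \<in> imag_sphere"
  shows "is_oriented_boundary (boundary_circles a0 b0 a1 b1 a2 b2) (slice I (circular_domain a0 b0 a1 b1 a2 b2))"
proof -
  define c where "c a b = complex_of_real ((a + b) / 2)" for a b
  define r where "r a b = (b - a) / 2" for a b :: real
  define G where "G = ball (c a0 b0) (r a0 b0) - cball (c a1 b1) (r a1 b1) - cball (c a2 b2) (r a2 b2)"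
  have ab0: "a0 < b0" using chain by linarith
  have rpos: "r a0 b0 > 0" "r a1 b1 > 0" "r a2 b2 > 0" using chain ab0 by (simp_all add: r_def)
  have n1: "cball (c a1 b1) (r a1 b1) \<subseteq> ball (c a0 b0) (r a0 b0)" unfolding c_def r_def
    by (rule real_discs_nested) (use chain in linarith)+
  have n2: "cball (c a2 b2) (r a2 b2) \<subseteq> ball (c a0 b0) (r a0 b0)" unfolding c_def r_def
    by (rule real_discs_nested) (use chain in linarith)+
  have dj: "cball (c a1 b1) (r a1 b1) \<inter> cball (c a2 b2) (r a2 b2) = {}" unfolding c_def r_def
    by (rule real_discs_disjoint) (use chain in linarith)+
  note w = winding_number_real_circle[folded c_def r_def]
  have rev0: "winding_number (reversepath (real_circle a b)) z = 0" if "a < b" "z \<notin> cball (c a b) (r a b)" for a b z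
  proof -
    have "z \<notin> sphere (c a b) (r a b)" using that by auto
    then show ?thesis using w(3)[OF that(1)] w(2)[OF that] by simp
  qed
  have rev1: "winding_number (reversepath (real_circle a b)) z = - 1" if "a < b" "z \<in> ball (c a b) (r a b)" for a b z
  proof -
    have "z \<notin> sphere (c a b) (r a b)" using that by auto
    then show ?thesis using w(3)[OF that(1)] w(1)[OF that] by simp
  qed
  have openG: "open G" unfolding G_def by (intro open_Diff open_ball closed_cball)
  have clG: "closure G = cball (c a0 b0) (r a0 b0) - ball (c a1 b1) (r a1 b1) - ball (c a2 b2) (r a2 b2)"
  proof
    show "closure G \<subseteq> cball (c a0 b0) (r a0 b0) - ball (c a1 b1) (r a1 b1) - ball (c a2 b2) (r a2 b2)"
      unfolding G_def by (intro closure_minimal closed_Diff closed_cball open_ball) auto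
    have cc: "closure (- cball x e) = - ball x e" for x :: complex and e
      by (simp add: closure_complement)
    \<comment> \<open>Each boundary circle lies in an open set that avoids the other two circles,
      and on that open set membership in \<open>G\<close> is decided by a single disc; this puts the
      circle into the closure.\<close>
    have h0: "ball (c a0 b0) (r a0 b0) \<inter> (- cball (c a2 b2) (r a2 b2)) \<inter> closure (- cball (c a1 b1) (r a1 b1)) \<subseteq> closure G"
      by (rule order_trans[OF open_Int_closure_subset]) (auto simp: G_def intro!: open_Int closure_mono)
    have h1: "ball (c a0 b0) (r a0 b0) \<inter> (- cball (c a1 b1) (r a1 b1)) \<inter> closure (- cball (c a2 b2) (r a2 b2)) \<subseteq> closure G"
      by (rule order_trans[OF open_Int_closure_subset]) (auto simp: G_def intro!: open_Int closure_mono)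
    have h2: "(- cball (c a1 b1) (r a1 b1)) \<inter> (- cball (c a2 b2) (r a2 b2)) \<inter> closure (ball (c a0 b0) (r a0 b0)) \<subseteq> closure G"
      by (rule order_trans[OF open_Int_closure_subset]) (auto simp: G_def intro!: open_Int closure_mono)
    have cb: "closure (ball (c a0 b0) (r a0 b0)) = cball (c a0 b0) (r a0 b0)" using rpos by simp
    show "cball (c a0 b0) (r a0 b0) - ball (c a1 b1) (r a1 b1) - ball (c a2 b2) (r a2 b2) \<subseteq> closure G"
      using h0 h1 h2 n1 n2 dj unfolding cc cb by blast
  qed
  have bsc: "ball x e \<subseteq> cball x e" for x :: complex and e by auto
  have sph: "sphere x e = cball x e - ball x e" for x :: complex and e by auto
  have sl: "slice I (circular_domain a0 b0 a1 b1 a2 b2) = G"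
    unfolding G_def c_def r_def by (rule slice_circular_domain[OF I])
  have pr: "path_image (reversepath g) = path_image g" for g :: "real \<Rightarrow> complex" by simp
  show ?thesis unfolding sl is_oriented_boundary_def boundary_circles_def
  proof (intro conjI ballI allI impI)
    fix \<gamma> assume "\<gamma> \<in> set [real_circle a0 b0, reversepath (real_circle a1 b1), reversepath (real_circle a2 b2)]"
    then have \<gamma>: "\<gamma> = real_circle a0 b0 \<or> \<gamma> = reversepath (real_circle a1 b1) \<or> \<gamma> = reversepath (real_circle a2 b2)" by simp
    then show "\<gamma> C1_differentiable_on {0..1}"
      unfolding real_circle_def using C1_circlepath C1_reversepath_circlepath by blast
    show "pathfinish \<gamma> = pathstart \<gamma>" using \<gamma> by (auto simp: real_circle_def)
    have "simple_path (real_circle a b)" if "a < b" for a b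
      using that by (simp add: real_circle_def simple_path_circlepath)
    then show "simple_path \<gamma>" using \<gamma> simple_path_reversepath ab0 chain by blast
  next
    show "(\<Union>\<gamma>\<in>set [real_circle a0 b0, reversepath (real_circle a1 b1), reversepath (real_circle a2 b2)]. path_image \<gamma>) = frontier G"
      unfolding frontier_def clG interior_open[OF openG]
      unfolding G_def list.set image_insert image_empty Union_insert Union_empty pr w(4)[OF ab0] w(4)[OF chain(2)] w(4)[OF chain(4)] sph
      using n1 n2 dj bsc by blast
  next
    fix z assume z: "z \<in> G"
    then have "z \<in> ball (c a0 b0) (r a0 b0)" "z \<notin> cball (c a1 b1) (r a1 b1)" "z \<notin> cball (c a2 b2) (r a2 b2)" by (simp_all add: G_def)
    from w(1)[OF ab0 this(1)] rev0[OF chain(2) this(2)] rev0[OF chain(4) this(3)]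
    show "(\<Sum>\<gamma>\<leftarrow>[real_circle a0 b0, reversepath (real_circle a1 b1), reversepath (real_circle a2 b2)]. winding_number \<gamma> z) = 1"
      by simp
  next
    fix z assume z: "z \<notin> closure G"
    then consider "z \<notin> cball (c a0 b0) (r a0 b0)" "z \<notin> cball (c a1 b1) (r a1 b1)" "z \<notin> cball (c a2 b2) (r a2 b2)"
      | "z \<in> ball (c a0 b0) (r a0 b0)" "z \<in> ball (c a1 b1) (r a1 b1)" "z \<notin> cball (c a2 b2) (r a2 b2)"
      | "z \<in> ball (c a0 b0) (r a0 b0)" "z \<notin> cball (c a1 b1) (r a1 b1)" "z \<in> ball (c a2 b2) (r a2 b2)"
      unfolding clG using n1 n2 dj bsc by blast
    then show "(\<Sum>\<gamma>\<leftarrow>[real_circle a0 b0, reversepath (real_circle a1 b1), reversepath (real_circle a2 b2)]. winding_number \<gamma> z) = 0"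
    proof cases
      case 1
      from w(2)[OF ab0 1(1)] rev0[OF chain(2) 1(2)] rev0[OF chain(4) 1(3)] show ?thesis by simp
    next
      case 2
      from w(1)[OF ab0 2(1)] rev1[OF chain(2) 2(2)] rev0[OF chain(4) 2(3)] show ?thesis by simp
    next
      case 3
      from w(1)[OF ab0 3(1)] rev0[OF chain(2) 3(2)] rev1[OF chain(4) 3(3)] show ?thesis by simp
    qed
  qed
qed

text \<open>Each slice is connected by Janiszewski's theorem, applied to the disjoint closed sets
  that are left out. The quaternionic domain is the union of its slices, which all contain the real
  point halfway between \<open>b2\<close> and \<open>b0\<close>.\<close>

lemma circular_domain_axially_symmetric:
  "axially_symmetric_slice_domain (circular_domain a0 b0 a1 b1 a2 b2)"
proof -
  let ?U = "circular_domain a0 b0 a1 b1 a2 b2"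
  define p where "p = (b2 + b0) / 2"
  have df: "disc_form a b (of_real p) = (p - a) * (p - b)" for a b
    by (simp add: disc_form_def power2_eq_square algebra_simps)
  have pU: "of_real p \<in> ?U" unfolding circular_domain_def mem_Collect_eq df
    using chain by (intro conjI mult_pos_neg mult_pos_pos) (auto simp: p_def)
  have oU: "open ?U" unfolding circular_domain_def
    by (intro open_Collect_conj open_Collect_less continuous_on_disc_form continuous_on_const)
  have osl: "open (slice I ?U)" "connected (slice I ?U)" if I: "I \<in> imag_sphere" for I
  proof -
    define c where "c a b = complex_of_real ((a + b) / 2)" for a b
    define r where "r a b = (b - a) / 2" for a b :: real
    have n1: "cball (c a1 b1) (r a1 b1) \<subseteq> ball (c a0 b0) (r a0 b0)" unfolding c_def r_def
      by (rule real_discs_nested) (use chain in linarith)+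
    have n2: "cball (c a2 b2) (r a2 b2) \<subseteq> ball (c a0 b0) (r a0 b0)" unfolding c_def r_def
      by (rule real_discs_nested) (use chain in linarith)+
    have dj: "cball (c a1 b1) (r a1 b1) \<inter> cball (c a2 b2) (r a2 b2) = {}" unfolding c_def r_def
      by (rule real_discs_disjoint) (use chain in linarith)+
    have e: "slice I ?U = - (cball (c a2 b2) (r a2 b2) \<union> (cball (c a1 b1) (r a1 b1) \<union> - ball (c a0 b0) (r a0 b0)))"
      unfolding slice_circular_domain[OF I] c_def r_def by blast
    have cc: "connected (- cball x e)" for x :: complex and e
      by (rule connected_complement_bounded_convex) auto
    have "connected (- (cball (c a1 b1) (r a1 b1) \<union> - ball (c a0 b0) (r a0 b0)))"
    proof (rule Janiszewski_connected)
      have "cball (c a1 b1) (r a1 b1) \<inter> - ball (c a0 b0) (r a0 b0) = {}" using n1 by blast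
      then show "connected (cball (c a1 b1) (r a1 b1) \<inter> - ball (c a0 b0) (r a0 b0))" by simp
    qed (simp_all add: cc closed_Compl)
    then show "connected (slice I ?U)" unfolding e
    proof (rule Janiszewski_connected[rotated 4])
      have "cball (c a2 b2) (r a2 b2) \<inter> (cball (c a1 b1) (r a1 b1) \<union> - ball (c a0 b0) (r a0 b0)) = {}" using n2 dj by blast
      then show "connected (cball (c a2 b2) (r a2 b2) \<inter> (cball (c a1 b1) (r a1 b1) \<union> - ball (c a0 b0) (r a0 b0)))" by simp
    qed (simp_all add: cc closed_Un closed_Compl)
    show "open (slice I ?U)" unfolding e by (intro open_Compl closed_Un closed_cball closed_Compl open_ball)
  qed
  have pS: "of_real p \<in> slice I ?U" for I using pU by (simp add: slice_def)
  have "connected ?U"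
  proof -
    have "?U = (\<Union>I\<in>imag_sphere. in_slice I ` slice I ?U)"
    proof
      show "?U \<subseteq> (\<Union>I\<in>imag_sphere. in_slice I ` slice I ?U)"
      proof
        fix q assume q: "q \<in> ?U"
        obtain I z where "I \<in> imag_sphere" "q = in_slice I z" by (rule quat_in_slice)
        then show "q \<in> (\<Union>I\<in>imag_sphere. in_slice I ` slice I ?U)" using q by (auto simp: slice_def)
      qed
    qed (auto simp: slice_def)
    moreover have "connected (\<Union>I\<in>imag_sphere. in_slice I ` slice I ?U)"
    proof (rule connected_Union)
      show "connected S" if "S \<in> (\<lambda>I. in_slice I ` slice I ?U) ` imag_sphere" for S
        using that osl(2) bounded_linear_in_slice
        by (auto intro!: connected_continuous_image linear_continuous_on)
      have "of_real p \<in> \<Inter> ((\<lambda>I. in_slice I ` slice I ?U) ` imag_sphere)"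
        using pS by (auto intro!: image_eqI[of _ _ "of_real p"])
      then show "\<Inter> ((\<lambda>I. in_slice I ` slice I ?U) ` imag_sphere) \<noteq> {}" by blast
    qed
    ultimately show ?thesis by metis
  qed
  moreover have "of_real x0 + J * of_real x1 \<in> ?U"
    if "I \<in> imag_sphere" "J \<in> imag_sphere" "of_real x0 + I * of_real x1 \<in> ?U" for I J x0 x1
  proof -
    have e: "of_real x0 + K * of_real x1 = in_slice K (Complex x0 x1)" for K by (simp add: in_slice_def)
    show ?thesis using that(3) unfolding e circular_domain_def disc_form_def mem_Collect_eq
      by (simp only: norm_in_slice qRe_in_slice that(1,2))
  qed
  ultimately show ?thesis unfolding axially_symmetric_slice_domain_def
    using oU pU pS osl by blast
qed

lemma bounded_circular_domain: "bounded (circular_domain a0 b0 a1 b1 a2 b2)"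
proof (rule bounded_subset[OF bounded_ball])
  have "a0 < b0" using chain by linarith
  from disc_form_ball(1)[OF this]
  show "circular_domain a0 b0 a1 b1 a2 b2 \<subseteq> ball (of_real ((a0 + b0) / 2)) ((b0 - a0) / 2)"
    unfolding circular_domain_def by blast
qed

lemma closure_circular_domain:
  "closure (circular_domain a0 b0 a1 b1 a2 b2) \<subseteq> {q. disc_form a0 b0 q \<le> 0 \<and> 0 \<le> disc_form a1 b1 q \<and> 0 \<le> disc_form a2 b2 q}"
proof (rule closure_minimal)
  show "closed {q. disc_form a0 b0 q \<le> 0 \<and> 0 \<le> disc_form a1 b1 q \<and> 0 \<le> disc_form a2 b2 q}"
    by (intro closed_Collect_conj closed_Collect_le continuous_on_disc_form continuous_on_const)
qed (auto simp: circular_domain_def)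

end

text \<open>In terms of z = 1/q + \<alpha>, the complement of the balls over [p, p + \<rho>] and
  [-p - \<rho>, -p], with p slightly larger than \<omega>, lies where f is regular. If |\<alpha>|
  \<le> \<omega>, both balls miss \<alpha> and become the two inner discs; the outer circle is then
  a large one about 0 of radius at least \<open>N\<close>. If |\<alpha>| > \<omega>, one ball
  contains \<alpha> and becomes the exterior of the outer circle. An additional dummy ball between
  the strip and that ball is removed then, so that all cases have the same shape.\<close>

lemma ex_circles:
  fixes \<alpha> \<omega> \<epsilon> r N :: real
  assumes \<omega>: "\<omega> \<ge> 0" and \<epsilon>: "\<epsilon> > 0" and r: "r > 0"
  shows "\<exists>a0 b0 a1 b1 a2 b2 \<kappa>. a0 < a1 \<and> a1 < b1 \<and> b1 < a2 \<and> a2 < b2 \<and> b2 < b0 \<and> \<kappa> > 0 \<and>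
    (\<forall>q. disc_form a1 b1 q \<le> 0 \<or> disc_form a2 b2 q \<le> 0 \<longrightarrow> q \<noteq> 0 \<and> \<omega> + \<kappa> \<le> \<bar>qRe (inverse q + of_real \<alpha>)\<bar>) \<and>
    ((\<bar>\<alpha>\<bar> \<le> \<omega> \<and> a0 = - b0 \<and> N \<le> b0 \<and>
       (\<forall>q. 0 \<le> disc_form a1 b1 q \<and> 0 \<le> disc_form a2 b2 q \<longrightarrow> q \<in> moebius_domain \<alpha> (\<omega> + \<epsilon>) r)) \<or>
     (\<alpha> \<noteq> 0 \<and> (\<forall>q. 0 \<le> disc_form a0 b0 q \<longrightarrow> q \<noteq> 0 \<and> \<omega> + \<kappa> \<le> \<bar>qRe (inverse q + of_real \<alpha>)\<bar>) \<and>
       (\<forall>q. disc_form a0 b0 q \<le> 0 \<and> 0 \<le> disc_form a1 b1 q \<and> 0 \<le> disc_form a2 b2 q \<longrightarrow>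
          q \<in> moebius_domain \<alpha> (\<omega> + \<epsilon>) r)))"
proof -
  \<comment> \<open>For \<alpha> outside the strip \<delta> is at most half of its distance from the
    strip, so that p = \<omega> + \<delta> stays closer to 0 than \<alpha> does and one ball
    contains \<alpha>.\<close>
  define \<delta> where "\<delta> = (if \<bar>\<alpha>\<bar> \<le> \<omega> then \<epsilon> / 2 else min (\<epsilon> / 2) ((\<bar>\<alpha>\<bar> - \<omega>) / 2))"
  define p where "p = \<omega> + \<delta>"
  \<comment> \<open>Large enough for \<open>in_moebius_domain\<close>, where \<omega> + \<epsilon> -
    p is at least \<epsilon>/2, and for the balls to reach beyond |\<alpha>|.\<close>
  define \<rho> where "\<rho> = 2 * r\<^sup>2 / \<epsilon> + 1 + \<bar>\<alpha>\<bar>"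
  have \<delta>: "\<delta> > 0" "\<delta> \<le> \<epsilon> / 2" using \<epsilon> by (auto simp: \<delta>_def)
  have p: "0 \<le> p" "p \<le> \<omega> + \<epsilon>" using \<omega> \<epsilon> \<delta> by (auto simp: p_def)
  have \<rho>a: "\<rho> > \<bar>\<alpha>\<bar>" using \<epsilon> by (simp add: \<rho>_def add_pos_nonneg add_nonneg_pos)
  have "r\<^sup>2 < \<rho> * (\<epsilon> / 2)"
  proof -
    have "\<rho> * (\<epsilon> / 2) = r\<^sup>2 + (1 + \<bar>\<alpha>\<bar>) * (\<epsilon> / 2)" using \<epsilon> by (simp add: \<rho>_def field_simps)
    moreover have "(1 + \<bar>\<alpha>\<bar>) * (\<epsilon> / 2) > 0" using \<epsilon> by (intro mult_pos_pos) auto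
    ultimately show ?thesis by linarith
  qed
  also have "\<dots> \<le> \<rho> * (\<omega> + \<epsilon> - p)" using \<rho>a \<delta> by (intro mult_left_mono) (auto simp: p_def)
  finally have \<rho>: "r\<^sup>2 < \<rho> * (\<omega> + \<epsilon> - p)" "\<rho> \<ge> 0" using \<rho>a by auto
  have rp: "1 / y < 1 / x" if "0 < x" "x < y" for x y :: real using that by (simp add: frac_less2)
  have rn: "1 / y < 1 / x" if "x < y" "y < 0" for x y :: real
    using that less_imp_inverse_less_neg[of x y] by (simp add: inverse_eq_divide)
  have far: "q \<noteq> 0 \<and> \<omega> + \<delta> / 4 \<le> \<bar>qRe (inverse q + of_real \<alpha>)\<bar>"
    if "(u - \<alpha>) * (v - \<alpha>) \<noteq> 0" "(u - \<alpha>) * (v - \<alpha>) * disc_form (1 / (u - \<alpha>)) (1 / (v - \<alpha>)) q \<le> 0" "u < v"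
      "\<omega> + \<delta> / 4 \<le> u \<or> v \<le> - \<omega> - \<delta> / 4" for u v q
    using inverse_disc_qRe[OF that(1-3)] that(4) by linarith
  have sym: "disc_form a b q = disc_form b a q" for a b q by (simp add: disc_form_def algebra_simps)
  note moeb = in_moebius_domain[OF p \<rho> r]
  have pos: "0 < x * y \<longleftrightarrow> 0 < y" if "x > 0" for x y :: real using that by (simp add: zero_less_mult_iff)
  consider (mid) "\<bar>\<alpha>\<bar> \<le> \<omega>" | (right) "\<alpha> > \<omega>" | (left) "\<alpha> < - \<omega>" by linarith
  then show ?thesis
  proof cases
    case mid
    have s: "p - \<alpha> > 0" "p + \<rho> - \<alpha> > 0" "- p - \<rho> - \<alpha> < 0" "- p - \<alpha> < 0"
      using mid \<delta> \<rho>a by (auto simp: p_def)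
    \<comment> \<open>Beyond both inner discs, whose outermost real points are 1/(p - \<alpha>) and
      -1/(p + \<alpha>).\<close>
    define b0 where "b0 = max N (max (1 / (p - \<alpha>)) (1 / (p + \<alpha>)) + 1)"
    have s12: "(p - \<alpha>) * (p + \<rho> - \<alpha>) > 0" "(- p - \<rho> - \<alpha>) * (- p - \<alpha>) > 0"
      by (rule mult_pos_pos[OF s(1,2)] mult_neg_neg[OF s(3,4)])+
    have \<rho>0: "\<rho> > 0" using \<rho>a by linarith
    have ch: "- b0 < 1 / (- p - \<alpha>)" "1 / (- p - \<alpha>) < 1 / (- p - \<rho> - \<alpha>)" "1 / (- p - \<rho> - \<alpha>) < 1 / (p + \<rho> - \<alpha>)"
      "1 / (p + \<rho> - \<alpha>) < 1 / (p - \<alpha>)" "1 / (p - \<alpha>) < b0"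
    proof -
      have "1 / (- p - \<alpha>) = - (1 / (p + \<alpha>))" by (metis add.commute divide_minus_right minus_add_distrib uminus_add_conv_diff diff_conv_add_uminus)
      then show "- b0 < 1 / (- p - \<alpha>)" unfolding b0_def by linarith
      show "1 / (- p - \<alpha>) < 1 / (- p - \<rho> - \<alpha>)" using s \<rho>0 by (intro rn) auto
      have "1 / (- p - \<rho> - \<alpha>) < 0" "0 < 1 / (p + \<rho> - \<alpha>)" using s by simp_all
      then show "1 / (- p - \<rho> - \<alpha>) < 1 / (p + \<rho> - \<alpha>)" by linarith
      show "1 / (p + \<rho> - \<alpha>) < 1 / (p - \<alpha>)" using s \<rho>0 by (intro rp) auto
      show "1 / (p - \<alpha>) < b0" unfolding b0_def by linarith
    qed
    show ?thesis
    proof (intro exI conjI)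
      show "- b0 < 1 / (- p - \<alpha>)" "1 / (- p - \<alpha>) < 1 / (- p - \<rho> - \<alpha>)" "1 / (- p - \<rho> - \<alpha>) < 1 / (p + \<rho> - \<alpha>)"
        "1 / (p + \<rho> - \<alpha>) < 1 / (p - \<alpha>)" "1 / (p - \<alpha>) < b0" by (rule ch)+
      show "\<delta> / 4 > 0" using \<delta> by simp
      show "\<forall>q. disc_form (1 / (- p - \<alpha>)) (1 / (- p - \<rho> - \<alpha>)) q \<le> 0 \<or> disc_form (1 / (p + \<rho> - \<alpha>)) (1 / (p - \<alpha>)) q \<le> 0
          \<longrightarrow> q \<noteq> 0 \<and> \<omega> + \<delta> / 4 \<le> \<bar>qRe (inverse q + of_real \<alpha>)\<bar>"
      proof (intro allI impI, elim disjE)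
        fix q assume d: "disc_form (1 / (- p - \<alpha>)) (1 / (- p - \<rho> - \<alpha>)) q \<le> 0"
        show "q \<noteq> 0 \<and> \<omega> + \<delta> / 4 \<le> \<bar>qRe (inverse q + of_real \<alpha>)\<bar>"
          by (rule far[of "- p - \<rho>" "- p"]) (use s12 d sym \<rho>0 \<delta> in \<open>auto simp: p_def mult_le_0_iff[of "(_ - _) * (_ - _)"]\<close>)
      next
        fix q assume d: "disc_form (1 / (p + \<rho> - \<alpha>)) (1 / (p - \<alpha>)) q \<le> 0"
        show "q \<noteq> 0 \<and> \<omega> + \<delta> / 4 \<le> \<bar>qRe (inverse q + of_real \<alpha>)\<bar>"
          by (rule far[of "p" "p + \<rho>"]) (use s12 d sym \<rho>0 \<delta> in \<open>auto simp: p_def mult_le_0_iff[of "(_ - _) * (_ - _)"]\<close>)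
      qed
      show "(\<bar>\<alpha>\<bar> \<le> \<omega> \<and> - b0 = - b0 \<and> N \<le> b0 \<and>
       (\<forall>q. 0 \<le> disc_form (1 / (- p - \<alpha>)) (1 / (- p - \<rho> - \<alpha>)) q \<and> 0 \<le> disc_form (1 / (p + \<rho> - \<alpha>)) (1 / (p - \<alpha>)) q \<longrightarrow> q \<in> moebius_domain \<alpha> (\<omega> + \<epsilon>) r)) \<or>
     (\<alpha> \<noteq> 0 \<and> (\<forall>q. 0 \<le> disc_form (- b0) b0 q \<longrightarrow> q \<noteq> 0 \<and> \<omega> + \<delta> / 4 \<le> \<bar>qRe (inverse q + of_real \<alpha>)\<bar>) \<and>
       (\<forall>q. disc_form (- b0) b0 q \<le> 0 \<and> 0 \<le> disc_form (1 / (- p - \<alpha>)) (1 / (- p - \<rho> - \<alpha>)) q \<and> 0 \<le> disc_form (1 / (p + \<rho> - \<alpha>)) (1 / (p - \<alpha>)) q \<longrightarrow>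
          q \<in> moebius_domain \<alpha> (\<omega> + \<epsilon>) r))"
      proof (intro disjI1 conjI allI impI)
        show "N \<le> b0" by (simp add: b0_def)
        fix q assume d: "0 \<le> disc_form (1 / (- p - \<alpha>)) (1 / (- p - \<rho> - \<alpha>)) q \<and> 0 \<le> disc_form (1 / (p + \<rho> - \<alpha>)) (1 / (p - \<alpha>)) q"
        show "q \<in> moebius_domain \<alpha> (\<omega> + \<epsilon>) r"
        proof (rule moeb)
          show "0 \<le> (p - \<alpha>) * (p + \<rho> - \<alpha>) * disc_form (1 / (p - \<alpha>)) (1 / (p + \<rho> - \<alpha>)) q"
            using mult_nonneg_nonneg[OF less_imp_le[OF s12(1)]] d sym by metis
          show "0 \<le> (- p - \<rho> - \<alpha>) * (- p - \<alpha>) * disc_form (1 / (- p - \<rho> - \<alpha>)) (1 / (- p - \<alpha>)) q"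
            using mult_nonneg_nonneg[OF less_imp_le[OF s12(2)]] d sym by metis
        qed (use s in auto)
      qed (rule mid refl)+
    qed
  next
    case right
    have "\<delta> = min (\<epsilon> / 2) ((\<alpha> - \<omega>) / 2)" using right \<omega> by (simp add: \<delta>_def)
    then have \<delta>2: "\<delta> \<le> (\<alpha> - \<omega>) / 2" by linarith
    have s: "p - \<alpha> < 0" "p + \<rho> - \<alpha> > 0" "- p - \<rho> - \<alpha> < 0" "- p - \<alpha> < 0"
      "\<omega> + 3 * \<delta> / 4 - \<alpha> < 0" "\<omega> + \<delta> / 4 - \<alpha> < 0"
      using right \<delta> \<delta>2 \<rho>a \<omega> by (auto simp: p_def)
    have s12: "(p - \<alpha>) * (p + \<rho> - \<alpha>) < 0" "(- p - \<rho> - \<alpha>) * (- p - \<alpha>) > 0" "(\<omega> + \<delta> / 4 - \<alpha>) * (\<omega> + 3 * \<delta> / 4 - \<alpha>) > 0"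
      by (rule mult_neg_pos[OF s(1,2)] mult_neg_neg[OF s(3,4)] mult_neg_neg[OF s(6,5)])+
    have \<rho>0: "\<rho> > 0" using \<rho>a by linarith
    show ?thesis
    proof (intro exI conjI)
      show "1 / (p - \<alpha>) < 1 / (\<omega> + 3 * \<delta> / 4 - \<alpha>)" by (rule rn) (use s \<delta> in \<open>auto simp: p_def\<close>)
      show "1 / (\<omega> + 3 * \<delta> / 4 - \<alpha>) < 1 / (\<omega> + \<delta> / 4 - \<alpha>)" by (rule rn) (use s \<delta> in \<open>auto simp: p_def\<close>)
      show "1 / (\<omega> + \<delta> / 4 - \<alpha>) < 1 / (- p - \<alpha>)" by (rule rn) (use s \<delta> \<omega> in \<open>auto simp: p_def\<close>)
      show "1 / (- p - \<alpha>) < 1 / (- p - \<rho> - \<alpha>)" by (rule rn) (use s \<rho>0 in auto)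
      have "1 / (- p - \<rho> - \<alpha>) < 0" "0 < 1 / (p + \<rho> - \<alpha>)" using s by simp_all
      then show "1 / (- p - \<rho> - \<alpha>) < 1 / (p + \<rho> - \<alpha>)" by linarith
      show "\<delta> / 4 > 0" using \<delta> by simp
      show "\<forall>q. disc_form (1 / (\<omega> + 3 * \<delta> / 4 - \<alpha>)) (1 / (\<omega> + \<delta> / 4 - \<alpha>)) q \<le> 0 \<or> disc_form (1 / (- p - \<alpha>)) (1 / (- p - \<rho> - \<alpha>)) q \<le> 0
          \<longrightarrow> q \<noteq> 0 \<and> \<omega> + \<delta> / 4 \<le> \<bar>qRe (inverse q + of_real \<alpha>)\<bar>"
      proof (intro allI impI, elim disjE)
        fix q assume d: "disc_form (1 / (\<omega> + 3 * \<delta> / 4 - \<alpha>)) (1 / (\<omega> + \<delta> / 4 - \<alpha>)) q \<le> 0"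
        show "q \<noteq> 0 \<and> \<omega> + \<delta> / 4 \<le> \<bar>qRe (inverse q + of_real \<alpha>)\<bar>"
          by (rule far[of "\<omega> + \<delta> / 4" "\<omega> + 3 * \<delta> / 4"])
            (use s12 d sym \<rho>0 \<delta> in \<open>auto simp: p_def mult_le_0_iff[of "(_ - _) * (_ - _)"]\<close>)
      next
        fix q assume d: "disc_form (1 / (- p - \<alpha>)) (1 / (- p - \<rho> - \<alpha>)) q \<le> 0"
        show "q \<noteq> 0 \<and> \<omega> + \<delta> / 4 \<le> \<bar>qRe (inverse q + of_real \<alpha>)\<bar>"
          by (rule far[of "- p - \<rho>" "- p"]) (use s12 d sym \<rho>0 \<delta> in \<open>auto simp: p_def mult_le_0_iff[of "(_ - _) * (_ - _)"]\<close>)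
      qed
      show "(\<bar>\<alpha>\<bar> \<le> \<omega> \<and> 1 / (p - \<alpha>) = - (1 / (p + \<rho> - \<alpha>)) \<and> N \<le> 1 / (p + \<rho> - \<alpha>) \<and>
       (\<forall>q. 0 \<le> disc_form (1 / (\<omega> + 3 * \<delta> / 4 - \<alpha>)) (1 / (\<omega> + \<delta> / 4 - \<alpha>)) q \<and> 0 \<le> disc_form (1 / (- p - \<alpha>)) (1 / (- p - \<rho> - \<alpha>)) q \<longrightarrow> q \<in> moebius_domain \<alpha> (\<omega> + \<epsilon>) r)) \<or>
     (\<alpha> \<noteq> 0 \<and> (\<forall>q. 0 \<le> disc_form (1 / (p - \<alpha>)) (1 / (p + \<rho> - \<alpha>)) q \<longrightarrow> q \<noteq> 0 \<and> \<omega> + \<delta> / 4 \<le> \<bar>qRe (inverse q + of_real \<alpha>)\<bar>) \<and>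
       (\<forall>q. disc_form (1 / (p - \<alpha>)) (1 / (p + \<rho> - \<alpha>)) q \<le> 0 \<and> 0 \<le> disc_form (1 / (\<omega> + 3 * \<delta> / 4 - \<alpha>)) (1 / (\<omega> + \<delta> / 4 - \<alpha>)) q \<and> 0 \<le> disc_form (1 / (- p - \<alpha>)) (1 / (- p - \<rho> - \<alpha>)) q \<longrightarrow>
          q \<in> moebius_domain \<alpha> (\<omega> + \<epsilon>) r))"
      proof (intro disjI2 conjI allI impI)
        show "\<alpha> \<noteq> 0" using right \<omega> by linarith
        fix q
        show "q \<in> moebius_domain \<alpha> (\<omega> + \<epsilon>) r"
          if d: "disc_form (1 / (p - \<alpha>)) (1 / (p + \<rho> - \<alpha>)) q \<le> 0 \<and> 0 \<le> disc_form (1 / (\<omega> + 3 * \<delta> / 4 - \<alpha>)) (1 / (\<omega> + \<delta> / 4 - \<alpha>)) q \<and> 0 \<le> disc_form (1 / (- p - \<alpha>)) (1 / (- p - \<rho> - \<alpha>)) q"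
        proof (rule moeb)
          show "0 \<le> (p - \<alpha>) * (p + \<rho> - \<alpha>) * disc_form (1 / (p - \<alpha>)) (1 / (p + \<rho> - \<alpha>)) q"
            using mult_nonpos_nonpos[OF less_imp_le[OF s12(1)]] d by blast
          show "0 \<le> (- p - \<rho> - \<alpha>) * (- p - \<alpha>) * disc_form (1 / (- p - \<rho> - \<alpha>)) (1 / (- p - \<alpha>)) q"
            using mult_nonneg_nonneg[OF less_imp_le[OF s12(2)]] d sym by metis
        qed (use s in auto)
        assume d: "0 \<le> disc_form (1 / (p - \<alpha>)) (1 / (p + \<rho> - \<alpha>)) q"
        have "q \<noteq> 0 \<and> \<omega> + \<delta> / 4 \<le> \<bar>qRe (inverse q + of_real \<alpha>)\<bar>"
          by (rule far[of p "p + \<rho>"]) (use s12 mult_nonpos_nonneg[OF less_imp_le[OF s12(1)] d] \<rho>0 \<delta> in \<open>auto simp: p_def\<close>)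
        then show "q \<noteq> 0" "\<omega> + \<delta> / 4 \<le> \<bar>qRe (inverse q + of_real \<alpha>)\<bar>" by blast+
      qed
    qed
  next
    case left
    have "\<delta> = min (\<epsilon> / 2) ((- \<alpha> - \<omega>) / 2)" using left \<omega> by (simp add: \<delta>_def)
    then have \<delta>2: "\<delta> \<le> (- \<alpha> - \<omega>) / 2" by linarith
    have s: "p - \<alpha> > 0" "p + \<rho> - \<alpha> > 0" "- p - \<rho> - \<alpha> < 0" "- p - \<alpha> > 0"
      "- \<omega> - 3 * \<delta> / 4 - \<alpha> > 0" "- \<omega> - \<delta> / 4 - \<alpha> > 0"
      using left \<delta> \<delta>2 \<rho>a \<omega> by (auto simp: p_def)
    have s12: "(p - \<alpha>) * (p + \<rho> - \<alpha>) > 0" "(- p - \<rho> - \<alpha>) * (- p - \<alpha>) < 0" "(- \<omega> - 3 * \<delta> / 4 - \<alpha>) * (- \<omega> - \<delta> / 4 - \<alpha>) > 0"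
      by (rule mult_neg_pos[OF s(3,4)] mult_pos_pos[OF s(1,2)] mult_pos_pos[OF s(5,6)])+
    have \<rho>0: "\<rho> > 0" using \<rho>a by linarith
    show ?thesis
    proof (intro exI conjI)
      have "1 / (- p - \<rho> - \<alpha>) < 0" "0 < 1 / (p + \<rho> - \<alpha>)" using s by simp_all
      then show "1 / (- p - \<rho> - \<alpha>) < 1 / (p + \<rho> - \<alpha>)" by linarith
      show "1 / (p + \<rho> - \<alpha>) < 1 / (p - \<alpha>)" by (rule rp) (use s \<rho>0 in auto)
      show "1 / (p - \<alpha>) < 1 / (- \<omega> - \<delta> / 4 - \<alpha>)" by (rule rp) (use s \<delta> \<omega> in \<open>auto simp: p_def\<close>)
      show "1 / (- \<omega> - \<delta> / 4 - \<alpha>) < 1 / (- \<omega> - 3 * \<delta> / 4 - \<alpha>)" by (rule rp) (use s \<delta> in \<open>auto simp: p_def\<close>)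
      show "1 / (- \<omega> - 3 * \<delta> / 4 - \<alpha>) < 1 / (- p - \<alpha>)" by (rule rp) (use s \<delta> in \<open>auto simp: p_def\<close>)
      show "\<delta> / 4 > 0" using \<delta> by simp
      show "\<forall>q. disc_form (1 / (p + \<rho> - \<alpha>)) (1 / (p - \<alpha>)) q \<le> 0 \<or> disc_form (1 / (- \<omega> - \<delta> / 4 - \<alpha>)) (1 / (- \<omega> - 3 * \<delta> / 4 - \<alpha>)) q \<le> 0
          \<longrightarrow> q \<noteq> 0 \<and> \<omega> + \<delta> / 4 \<le> \<bar>qRe (inverse q + of_real \<alpha>)\<bar>"
      proof (intro allI impI, elim disjE)
        fix q assume d: "disc_form (1 / (- \<omega> - \<delta> / 4 - \<alpha>)) (1 / (- \<omega> - 3 * \<delta> / 4 - \<alpha>)) q \<le> 0"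
        show "q \<noteq> 0 \<and> \<omega> + \<delta> / 4 \<le> \<bar>qRe (inverse q + of_real \<alpha>)\<bar>"
          by (rule far[of "- \<omega> - 3 * \<delta> / 4" "- \<omega> - \<delta> / 4"])
            (use s12 d sym \<rho>0 \<delta> in \<open>auto simp: p_def mult_le_0_iff[of "(_ - _) * (_ - _)"]\<close>)
      next
        fix q assume d: "disc_form (1 / (p + \<rho> - \<alpha>)) (1 / (p - \<alpha>)) q \<le> 0"
        show "q \<noteq> 0 \<and> \<omega> + \<delta> / 4 \<le> \<bar>qRe (inverse q + of_real \<alpha>)\<bar>"
          by (rule far[of p "p + \<rho>"]) (use s12 d sym \<rho>0 \<delta> in \<open>auto simp: p_def mult_le_0_iff[of "(_ - _) * (_ - _)"]\<close>)
      qed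
      show "(\<bar>\<alpha>\<bar> \<le> \<omega> \<and> 1 / (- p - \<rho> - \<alpha>) = - (1 / (- p - \<alpha>)) \<and> N \<le> 1 / (- p - \<alpha>) \<and>
       (\<forall>q. 0 \<le> disc_form (1 / (p + \<rho> - \<alpha>)) (1 / (p - \<alpha>)) q \<and> 0 \<le> disc_form (1 / (- \<omega> - \<delta> / 4 - \<alpha>)) (1 / (- \<omega> - 3 * \<delta> / 4 - \<alpha>)) q \<longrightarrow> q \<in> moebius_domain \<alpha> (\<omega> + \<epsilon>) r)) \<or>
     (\<alpha> \<noteq> 0 \<and> (\<forall>q. 0 \<le> disc_form (1 / (- p - \<rho> - \<alpha>)) (1 / (- p - \<alpha>)) q \<longrightarrow> q \<noteq> 0 \<and> \<omega> + \<delta> / 4 \<le> \<bar>qRe (inverse q + of_real \<alpha>)\<bar>) \<and>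
       (\<forall>q. disc_form (1 / (- p - \<rho> - \<alpha>)) (1 / (- p - \<alpha>)) q \<le> 0 \<and> 0 \<le> disc_form (1 / (p + \<rho> - \<alpha>)) (1 / (p - \<alpha>)) q \<and> 0 \<le> disc_form (1 / (- \<omega> - \<delta> / 4 - \<alpha>)) (1 / (- \<omega> - 3 * \<delta> / 4 - \<alpha>)) q \<longrightarrow>
          q \<in> moebius_domain \<alpha> (\<omega> + \<epsilon>) r))"
      proof (intro disjI2 conjI allI impI)
        show "\<alpha> \<noteq> 0" using left \<omega> by linarith
        fix q
        show "q \<in> moebius_domain \<alpha> (\<omega> + \<epsilon>) r"
          if d: "disc_form (1 / (- p - \<rho> - \<alpha>)) (1 / (- p - \<alpha>)) q \<le> 0 \<and> 0 \<le> disc_form (1 / (p + \<rho> - \<alpha>)) (1 / (p - \<alpha>)) q \<and> 0 \<le> disc_form (1 / (- \<omega> - \<delta> / 4 - \<alpha>)) (1 / (- \<omega> - 3 * \<delta> / 4 - \<alpha>)) q"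
        proof (rule moeb)
          show "0 \<le> (- p - \<rho> - \<alpha>) * (- p - \<alpha>) * disc_form (1 / (- p - \<rho> - \<alpha>)) (1 / (- p - \<alpha>)) q"
            using mult_nonpos_nonpos[OF less_imp_le[OF s12(2)]] d by blast
          show "0 \<le> (p - \<alpha>) * (p + \<rho> - \<alpha>) * disc_form (1 / (p - \<alpha>)) (1 / (p + \<rho> - \<alpha>)) q"
            using mult_nonneg_nonneg[OF less_imp_le[OF s12(1)]] d sym by metis
        qed (use s in auto)
        assume d: "0 \<le> disc_form (1 / (- p - \<rho> - \<alpha>)) (1 / (- p - \<alpha>)) q"
        have "q \<noteq> 0 \<and> \<omega> + \<delta> / 4 \<le> \<bar>qRe (inverse q + of_real \<alpha>)\<bar>"
          by (rule far[of "- p - \<rho>" "- p"]) (use s12 mult_nonpos_nonneg[OF less_imp_le[OF s12(2)] d] \<rho>0 \<delta> in \<open>auto simp: p_def\<close>)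
        then show "q \<noteq> 0" "\<omega> + \<delta> / 4 \<le> \<bar>qRe (inverse q + of_real \<alpha>)\<bar>" by blast+
      qed
    qed
  qed
qed

section \<open>Contour integrals of Laplace transforms\<close>

definition exp_bounded :: "real \<Rightarrow> (real \<Rightarrow> complex) \<Rightarrow> bool" where
  "exp_bounded \<omega> H \<longleftrightarrow> H \<in> borel_measurable borel \<and> (\<exists>C. \<forall>t. norm (H t) \<le> C * exp (\<omega> * \<bar>t\<bar>))"

text \<open>One integrand on the positive half line for both signs of Re z, so that the estimates on
  the two sides of the strip have the same form.\<close>

definition lap_kernel :: "(real \<Rightarrow> complex) \<Rightarrow> complex \<Rightarrow> real \<Rightarrow> complex" where
  "lap_kernel H z t = (if Re z > 0 then exp (- z * of_real t) * H t else - (exp (z * of_real t) * H (- t)))"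

lemma lap_eq_kernel: "lap H z = (LINT t|lborel. indicator {0<..} t *\<^sub>R lap_kernel H z t)"
  by (simp add: lap_def lap_kernel_def)

lemma exp_bound_nonneg:
  fixes C :: real
  assumes "\<And>t. norm (H t) \<le> C * exp (\<omega> * \<bar>t\<bar>)"
  shows "0 \<le> C"
  using order_trans[OF norm_ge_zero assms[of 0]] by simp

lemma norm_lap_kernel:
  fixes \<omega> \<kappa> :: real
  assumes z: "\<omega> + \<kappa> \<le> \<bar>Re z\<bar>" and H: "\<And>t. norm (H t) \<le> C * exp (\<omega> * \<bar>t\<bar>)" and t: "t > 0"
  shows "norm (lap_kernel H z t) \<le> C * exp (- \<kappa> * t)"
proof -
  have C: "0 \<le> C" using H by (rule exp_bound_nonneg)
  have e: "exp (- \<bar>Re z\<bar> * t) * (C * exp (\<omega> * t)) \<le> C * exp (- \<kappa> * t)"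
  proof -
    have "- \<bar>Re z\<bar> * t + \<omega> * t = (\<omega> - \<bar>Re z\<bar>) * t" by (simp add: algebra_simps)
    also have "\<dots> \<le> (- \<kappa>) * t" using z t by (intro mult_right_mono) auto
    finally have "exp (- \<bar>Re z\<bar> * t) * exp (\<omega> * t) \<le> exp (- \<kappa> * t)" by (simp only: mult_exp_exp exp_le_cancel_iff)
    from mult_left_mono[OF this C] show ?thesis by (simp only: mult.left_commute[of C])
  qed
  have "norm (lap_kernel H z t) \<le> exp (- \<bar>Re z\<bar> * t) * (C * exp (\<omega> * t))"
  proof (cases "Re z > 0")
    case True
    have "norm (lap_kernel H z t) = exp (- \<bar>Re z\<bar> * t) * norm (H t)"
      using True by (simp add: lap_kernel_def norm_mult norm_exp_eq_Re)
    then show ?thesis using H[of t] t by (simp add: mult_left_mono)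
  next
    case False
    have "norm (lap_kernel H z t) = exp (- \<bar>Re z\<bar> * t) * norm (H (- t))"
      using False by (simp add: lap_kernel_def norm_mult norm_exp_eq_Re)
    then show ?thesis using H[of "- t"] t by (simp add: mult_left_mono)
  qed
  with e show ?thesis by (rule order_trans[rotated])
qed

lemma lap_kernel_measurable:
  assumes [measurable]: "H \<in> borel_measurable borel"
  shows "lap_kernel H z \<in> borel_measurable borel"
proof -
  have [measurable]: "(\<lambda>t. exp (w * complex_of_real t)) \<in> borel_measurable borel" for w
    by (intro borel_measurable_continuous_onI continuous_intros)
  have "(\<lambda>t. exp (- z * of_real t) * H t) \<in> borel_measurable borel" "(\<lambda>t. - (exp (z * of_real t) * H (- t))) \<in> borel_measurable borel"
    by measurable
  then show ?thesis unfolding lap_kernel_def[abs_def] by (cases "Re z > 0") simp_all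
qed

lemma lap_kernel_integrable:
  assumes "exp_bounded \<omega> H" "\<omega> < \<bar>Re z\<bar>"
  shows "integrable lborel (\<lambda>t. indicator {0<..} t *\<^sub>R lap_kernel H z t)"
proof -
  obtain C where C: "\<And>t. norm (H t) \<le> C * exp (\<omega> * \<bar>t\<bar>)" and H: "H \<in> borel_measurable borel"
    using assms by (auto simp: exp_bounded_def)
  have k: "\<bar>Re z\<bar> - \<omega> > 0" using assms(2) by simp
  show ?thesis
    by (rule half_line_integrable[OF k lap_kernel_measurable[OF H] norm_lap_kernel[OF _ C]]) auto
qed

lemma lap_add:
  assumes "exp_bounded \<omega> F" "exp_bounded \<omega> G" "\<omega> < \<bar>Re z\<bar>"
  shows "lap (\<lambda>t. F t + G t) z = lap F z + lap G z"
proof -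
  have k: "lap_kernel (\<lambda>t. F t + G t) z t = lap_kernel F z t + lap_kernel G z t" for t
    by (simp add: lap_kernel_def distrib_left)
  show ?thesis unfolding lap_eq_kernel k scaleR_add_right
    by (rule Bochner_Integration.integral_add[OF lap_kernel_integrable[OF assms(1,3)] lap_kernel_integrable[OF assms(2,3)]])
qed

lemma lap_cmult: "lap (\<lambda>t. c * F t) z = c * lap F z"
proof -
  have k: "lap_kernel (\<lambda>t. c * F t) z t = c * lap_kernel F z t" for t
    by (simp add: lap_kernel_def)
  show ?thesis unfolding lap_eq_kernel k mult_scaleR_right[symmetric] by (rule integral_mult_right_zero)
qed

lemma norm_lap_le:
  fixes \<omega> \<kappa> :: real
  assumes z: "\<omega> + \<kappa> \<le> \<bar>Re z\<bar>" "\<kappa> > 0" "\<omega> \<ge> 0" and H: "H \<in> borel_measurable borel" "\<And>t. norm (H t) \<le> C * exp (\<omega> * \<bar>t\<bar>)"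
  shows "norm (lap H z) \<le> C / \<kappa>"
proof -
  have "norm (lap H z) \<le> (LINT t|lborel. indicator {0<..} t *\<^sub>R (C * exp (- \<kappa> * t)))"
    unfolding lap_eq_kernel
  proof (rule Bochner_Integration.integral_norm_bound_integral)
    show "integrable lborel (\<lambda>t. indicator {0<..} t *\<^sub>R lap_kernel H z t)"
      by (rule lap_kernel_integrable[of \<omega>]) (use H z in \<open>auto simp: exp_bounded_def\<close>)
    show "integrable lborel (\<lambda>t. indicator {0<..} t *\<^sub>R (C * exp (- \<kappa> * t)))"
      by (rule integrable_exp_half_line(1)[OF z(2)])
    show "norm (indicator {0<..} t *\<^sub>R lap_kernel H z t) \<le> indicator {0<..} t *\<^sub>R (C * exp (- \<kappa> * t))" for t
      using norm_lap_kernel[OF z(1) H(2), of t] by (auto simp: indicator_def)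
  qed
  also have "\<dots> = C / \<kappa>" by (rule integrable_exp_half_line(2)[OF z(2)])
  finally show ?thesis .
qed

text \<open>Argument and function may vary together: a constant \<open>Hs\<close> gives continuity
  in z, a constant \<open>zs\<close> gives continuity under dominated limits.\<close>

lemma lap_limit:
  fixes \<omega> \<kappa> :: real
  assumes zs: "\<And>n. \<omega> + \<kappa> \<le> \<bar>Re (zs n)\<bar>" "\<kappa> > 0" "\<omega> \<ge> 0" "\<omega> + \<kappa> \<le> \<bar>Re z\<bar>" "zs \<longlonglongrightarrow> z"
    and H: "\<And>n. Hs n \<in> borel_measurable borel" "\<And>n t. norm (Hs n t) \<le> C * exp (\<omega> * \<bar>t\<bar>)"
      "\<And>t. (\<lambda>n. Hs n t) \<longlonglongrightarrow> H t"
  shows "(\<lambda>n. lap (Hs n) (zs n)) \<longlonglongrightarrow> lap H z"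
  unfolding lap_eq_kernel
proof (rule integral_dominated_convergence)
  have Hm: "H \<in> borel_measurable borel" by (rule borel_measurable_LIMSEQ_metric[OF H(1) H(3)])
  show "(\<lambda>t. indicator {0<..} t *\<^sub>R lap_kernel H z t) \<in> borel_measurable lborel"
    using lap_kernel_measurable[OF Hm] by measurable
  show "(\<lambda>t. indicator {0<..} t *\<^sub>R lap_kernel (Hs n) (zs n) t) \<in> borel_measurable lborel" for n
    using lap_kernel_measurable[OF H(1)] by measurable
  show "integrable lborel (\<lambda>t. indicator {0<..} t *\<^sub>R (C * exp (- \<kappa> * t)))"
    by (rule integrable_exp_half_line(1)[OF zs(2)])
  show "AE t in lborel. norm (indicator {0<..} t *\<^sub>R lap_kernel (Hs n) (zs n) t) \<le> indicator {0<..} t *\<^sub>R (C * exp (- \<kappa> * t))" for n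
    using norm_lap_kernel[OF zs(1) H(2)] by (auto simp: indicator_def)
  have "(\<lambda>n. lap_kernel (Hs n) (zs n) t) \<longlonglongrightarrow> lap_kernel H z t" for t
  proof (cases "Re z > 0")
    case True
    have "\<forall>\<^sub>F n in sequentially. Re (zs n) > 0"
      using order_tendstoD(1)[OF tendsto_Re[OF zs(5)] True] .
    then have "\<forall>\<^sub>F n in sequentially. exp (- zs n * of_real t) * Hs n t = lap_kernel (Hs n) (zs n) t"
      by eventually_elim (simp add: lap_kernel_def)
    moreover have "(\<lambda>n. exp (- zs n * of_real t) * Hs n t) \<longlonglongrightarrow> exp (- z * of_real t) * H t"
      by (intro tendsto_intros zs H)
    ultimately show ?thesis using True by (simp add: lap_kernel_def[of H] Lim_transform_eventually)
  next
    case False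
    then have Rz: "Re z < 0" using zs(2,3,4) by linarith
    have "\<forall>\<^sub>F n in sequentially. Re (zs n) < 0"
      using order_tendstoD(2)[OF tendsto_Re[OF zs(5)] Rz] .
    then have "\<forall>\<^sub>F n in sequentially. - (exp (zs n * of_real t) * Hs n (- t)) = lap_kernel (Hs n) (zs n) t"
      by eventually_elim (simp add: lap_kernel_def)
    moreover have "(\<lambda>n. - (exp (zs n * of_real t) * Hs n (- t))) \<longlonglongrightarrow> - (exp (z * of_real t) * H (- t))"
      by (intro tendsto_intros zs H)
    ultimately show ?thesis using False by (simp add: lap_kernel_def[of H] Lim_transform_eventually)
  qed
  then show "AE t in lborel. (\<lambda>n. indicator {0<..} t *\<^sub>R lap_kernel (Hs n) (zs n) t) \<longlonglongrightarrow> indicator {0<..} t *\<^sub>R lap_kernel H z t"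
    by (intro AE_I2 tendsto_scaleR tendsto_const)
qed

text \<open>The resolvent of the scalar generator \<i> y; the minus sign in the second branch of
  \<open>lap\<close> makes the two half planes agree.\<close>

lemma laplace_cis:
  assumes "Re z \<noteq> 0"
  shows "lap (\<lambda>t. cis (y * t)) z = 1 / (z - \<i> * of_real y)"
proof -
  have L: "(LINT t|lborel. indicator {0<..} t *\<^sub>R exp (- s * of_real t)) = 1 / s" if s: "Re s > 0" for s
  proof -
    have s0: "s \<noteq> 0" using s by auto
    have "(LINT t|lborel. indicator {0<..} t *\<^sub>R exp (- s * of_real t)) = - (- exp (- s * of_real 0) / s)"
    proof (rule half_line_FTC[OF s])
      show "continuous_on UNIV (\<lambda>t. exp (- s * complex_of_real t))" by (intro continuous_intros)
      show "norm (exp (- s * of_real t)) \<le> 1 * exp (- Re s * t)" for t by (simp add: norm_exp_eq_Re)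
      show "norm (- exp (- s * of_real t) / s) \<le> (1 / norm s) * exp (- Re s * t)" for t
        by (simp add: norm_exp_eq_Re norm_divide)
      show "((\<lambda>t. - exp (- s * of_real t) / s) has_vector_derivative exp (- s * of_real t)) (at t)" for t
        by (rule has_vector_derivative_real_field) (use s0 in \<open>auto intro!: derivative_eq_intros\<close>)
    qed
    then show ?thesis by simp
  qed
  show ?thesis
  proof (cases "Re z > 0")
    case True
    have "exp (- z * of_real t) * cis (y * t) = exp (- (z - \<i> * of_real y) * of_real t)" for t
      by (simp add: cis_conv_exp mult_exp_exp algebra_simps)
    then show ?thesis using True L[of "z - \<i> * of_real y"] by (simp only: lap_def if_True) simp
  next
    case False
    have "exp (z * of_real t) * cis (y * - t) = exp (- (\<i> * of_real y - z) * of_real t)" for t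
      by (simp add: cis_conv_exp mult_exp_exp algebra_simps)
    moreover have "Re z < 0" using False assms by simp
    ultimately have "lap (\<lambda>t. cis (y * t)) z = - (1 / (\<i> * of_real y - z))"
      using False L[of "\<i> * of_real y - z"] by (simp only: lap_def if_False) simp
    then show ?thesis by (metis minus_diff_eq minus_divide_right)
  qed
qed

text \<open>The scalar counterpart of the resolvent of \<open>(T - \<alpha>)\<^sup>-\<^sup>1\<close>, with \<open>H\<close> in the place of
  \<open>t \<mapsto> Z(t) v\<close>.\<close>

definition lap_res :: "real \<Rightarrow> (real \<Rightarrow> complex) \<Rightarrow> complex \<Rightarrow> complex" where
  "lap_res \<alpha> H \<zeta> = H 0 / \<zeta> - lap H (inverse \<zeta> + of_real \<alpha>) / \<zeta>\<^sup>2"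

text \<open>For the one-dimensional group \<open>cis (y * t)\<close> the resolvent is a Cauchy
  kernel whose pole is the image of \<i> y, which opens the way to Cauchy's integral
  formula.\<close>

lemma lap_res_cis:
  assumes \<zeta>: "\<zeta> \<noteq> 0" "Re (inverse \<zeta> + of_real \<alpha>) \<noteq> 0" and w: "\<i> * of_real y \<noteq> of_real \<alpha>"
  shows "lap_res \<alpha> (\<lambda>t. cis (y * t)) \<zeta> = 1 / (\<zeta> - 1 / (\<i> * of_real y - of_real \<alpha>))"
proof -
  define b where "b = \<i> * of_real y - of_real \<alpha>"
  have b: "b \<noteq> 0" using w by (simp add: b_def)
  have e: "inverse \<zeta> + of_real \<alpha> - \<i> * of_real y = (1 - b * \<zeta>) / \<zeta>" using \<zeta>(1) by (simp add: b_def field_simps)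
  have ne: "1 - b * \<zeta> \<noteq> 0"
  proof
    assume "1 - b * \<zeta> = 0"
    then have "inverse \<zeta> + of_real \<alpha> = \<i> * of_real y" using e by simp
    then show False using \<zeta>(2) by simp
  qed
  then have ne': "b * \<zeta> - 1 \<noteq> 0" by simp
  have "lap_res \<alpha> (\<lambda>t. cis (y * t)) \<zeta> = 1 / \<zeta> - 1 / ((1 - b * \<zeta>) / \<zeta>) / \<zeta>\<^sup>2"
    unfolding lap_res_def laplace_cis[OF \<zeta>(2)] e by simp
  also have "\<dots> = 1 / \<zeta> - 1 / ((1 - b * \<zeta>) * \<zeta>)" using \<zeta>(1) by (simp add: power2_eq_square)
  also have "\<dots> = (1 - b * \<zeta> - 1) / ((1 - b * \<zeta>) * \<zeta>)" using \<zeta>(1) ne by (simp add: field_simps)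
  also have "\<dots> = - b / (1 - b * \<zeta>)" using \<zeta>(1) by simp
  also have "\<dots> = - b / - (b * \<zeta> - 1)" by simp
  also have "\<dots> = b / (b * \<zeta> - 1)" by (rule minus_divide_divide)
  also have "\<dots> = 1 / (\<zeta> - 1 / b)" using b ne' by (simp add: field_simps)
  finally show ?thesis by (simp only: b_def)
qed

section \<open>Functionals determined by their values on exponentials\<close>

lemma compact_bound:
  fixes f :: "'a::topological_space \<Rightarrow> 'b::real_normed_vector"
  assumes "compact K" "continuous_on K f"
  obtains B where "B \<ge> 0" "\<And>x. x \<in> K \<Longrightarrow> norm (f x) \<le> B"
proof -
  have "bounded (f ` K)" by (rule compact_imp_bounded[OF compact_continuous_image[OF assms(2,1)]])
  then obtain B where "\<And>x. x \<in> K \<Longrightarrow> norm (f x) \<le> B" by (auto simp: bounded_iff)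
  then have "\<And>x. x \<in> K \<Longrightarrow> norm (f x) \<le> max 0 B" by fastforce
  then show ?thesis by (intro that[of "max 0 B"]) auto
qed

text \<open>The properties that carry an identity from exponentials to general functions by way of
  \<open>exponential_closure\<close>: linearity, and continuity under pointwise limits with a common
  exponential bound.\<close>

definition admissible :: "real \<Rightarrow> ((real \<Rightarrow> complex) \<Rightarrow> complex) \<Rightarrow> bool" where
  "admissible \<omega> \<Lambda> \<longleftrightarrow>
     (\<forall>F G. exp_bounded \<omega> F \<longrightarrow> exp_bounded \<omega> G \<longrightarrow> \<Lambda> (\<lambda>t. F t + G t) = \<Lambda> F + \<Lambda> G) \<and>
     (\<forall>F c. exp_bounded \<omega> F \<longrightarrow> \<Lambda> (\<lambda>t. c * F t) = c * \<Lambda> F) \<and>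
     (\<forall>F G C. (\<forall>n. F n \<in> borel_measurable borel) \<longrightarrow> (\<forall>n t. norm (F n t) \<le> C * exp (\<omega> * \<bar>t\<bar>)) \<longrightarrow>
        (\<forall>t. (\<lambda>n::nat. F n t) \<longlonglongrightarrow> G t) \<longrightarrow> (\<lambda>n. \<Lambda> (F n)) \<longlonglongrightarrow> \<Lambda> G)"

lemma admissibleI:
  assumes "\<And>F G. exp_bounded \<omega> F \<Longrightarrow> exp_bounded \<omega> G \<Longrightarrow> \<Lambda> (\<lambda>t. F t + G t) = \<Lambda> F + \<Lambda> G"
    and "\<And>F c. exp_bounded \<omega> F \<Longrightarrow> \<Lambda> (\<lambda>t. c * F t) = c * \<Lambda> F"
    and "\<And>F G C. (\<And>n. F n \<in> borel_measurable borel) \<Longrightarrow> (\<And>n t. norm (F n t) \<le> C * exp (\<omega> * \<bar>t\<bar>)) \<Longrightarrow>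
        (\<And>t. (\<lambda>n::nat. F n t) \<longlonglongrightarrow> G t) \<Longrightarrow> (\<lambda>n. \<Lambda> (F n)) \<longlonglongrightarrow> \<Lambda> G"
  shows "admissible \<omega> \<Lambda>"
  unfolding admissible_def by (intro conjI allI impI assms; (assumption | elim allE)+)

lemma admissibleD:
  assumes "admissible \<omega> \<Lambda>"
  shows "exp_bounded \<omega> F \<Longrightarrow> exp_bounded \<omega> G \<Longrightarrow> \<Lambda> (\<lambda>t. F t + G t) = \<Lambda> F + \<Lambda> G"
    "exp_bounded \<omega> F \<Longrightarrow> \<Lambda> (\<lambda>t. c * F t) = c * \<Lambda> F"
    "(\<And>n. Fs n \<in> borel_measurable borel) \<Longrightarrow> (\<And>n t. norm (Fs n t) \<le> C * exp (\<omega> * \<bar>t\<bar>)) \<Longrightarrow>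
        (\<And>t. (\<lambda>n::nat. Fs n t) \<longlonglongrightarrow> G t) \<Longrightarrow> (\<lambda>n. \<Lambda> (Fs n)) \<longlonglongrightarrow> \<Lambda> G"
proof -
  from assms show "exp_bounded \<omega> F \<Longrightarrow> exp_bounded \<omega> G \<Longrightarrow> \<Lambda> (\<lambda>t. F t + G t) = \<Lambda> F + \<Lambda> G"
    "exp_bounded \<omega> F \<Longrightarrow> \<Lambda> (\<lambda>t. c * F t) = c * \<Lambda> F"
    unfolding admissible_def by blast+
  from assms have "\<forall>F G C. (\<forall>n. F n \<in> borel_measurable borel) \<longrightarrow> (\<forall>n t. norm (F n t) \<le> C * exp (\<omega> * \<bar>t\<bar>)) \<longrightarrow>
        (\<forall>t. (\<lambda>n::nat. F n t) \<longlonglongrightarrow> G t) \<longrightarrow> (\<lambda>n. \<Lambda> (F n)) \<longlonglongrightarrow> \<Lambda> G"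
    unfolding admissible_def by (elim conjE)
  from this[rule_format, of Fs C G] show "(\<And>n. Fs n \<in> borel_measurable borel) \<Longrightarrow> (\<And>n t. norm (Fs n t) \<le> C * exp (\<omega> * \<bar>t\<bar>)) \<Longrightarrow>
        (\<And>t. (\<lambda>n::nat. Fs n t) \<longlonglongrightarrow> G t) \<Longrightarrow> (\<lambda>n. \<Lambda> (Fs n)) \<longlonglongrightarrow> \<Lambda> G" .
qed

lemma admissible_add: "admissible \<omega> \<Lambda> \<Longrightarrow> admissible \<omega> \<Lambda>' \<Longrightarrow> admissible \<omega> (\<lambda>H. \<Lambda> H + \<Lambda>' H)"
proof (rule admissibleI)
  assume a: "admissible \<omega> \<Lambda>" "admissible \<omega> \<Lambda>'"
  fix F G c
  assume F: "exp_bounded \<omega> F"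
  show "\<Lambda> (\<lambda>t. c * F t) + \<Lambda>' (\<lambda>t. c * F t) = c * (\<Lambda> F + \<Lambda>' F)"
    unfolding admissibleD(2)[OF a(1) F] admissibleD(2)[OF a(2) F] by (simp add: distrib_left)
  assume G: "exp_bounded \<omega> G"
  show "\<Lambda> (\<lambda>t. F t + G t) + \<Lambda>' (\<lambda>t. F t + G t) = \<Lambda> F + \<Lambda>' F + (\<Lambda> G + \<Lambda>' G)"
    unfolding admissibleD(1)[OF a(1) F G] admissibleD(1)[OF a(2) F G] by simp
next
  assume a: "admissible \<omega> \<Lambda>" "admissible \<omega> \<Lambda>'"
  fix F :: "nat \<Rightarrow> real \<Rightarrow> complex" and G C
  assume F: "\<And>n. F n \<in> borel_measurable borel" "\<And>n t. norm (F n t) \<le> C * exp (\<omega> * \<bar>t\<bar>)" "\<And>t. (\<lambda>n. F n t) \<longlonglongrightarrow> G t"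
  show "(\<lambda>n. \<Lambda> (F n) + \<Lambda>' (F n)) \<longlonglongrightarrow> \<Lambda> G + \<Lambda>' G"
    by (intro tendsto_add admissibleD(3)[OF a(1) F] admissibleD(3)[OF a(2) F])
qed

text \<open>Covers an outer circle about 0 that belongs to a neighbourhood of \<alpha>: its integral
  sees the orbit only through its value at time 0.\<close>

lemma admissible_point: "admissible \<omega> (\<lambda>H. c * H 0)"
  by (rule admissibleI) (auto simp: algebra_simps intro!: tendsto_intros)

text \<open>The reflected argument \<open>- t\<close> is the one that occurs in the group
  calculus.\<close>

lemma admissible_measure:
  fixes a :: "real \<Rightarrow> complex"
  assumes N: "sets N = sets borel" and a: "a \<in> borel_measurable borel" "\<And>t. norm (a t) \<le> K"
    and int: "integrable N (\<lambda>t. exp (\<omega> * \<bar>t\<bar>))"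
  shows "admissible \<omega> (\<lambda>H. LINT t|N. a t * H (- t))"
proof (rule admissibleI)
  note [measurable] = a(1) and [measurable_cong] = N
  have K: "0 \<le> K" using order_trans[OF norm_ge_zero a(2)] .
  have bd: "norm (a t * H (- t)) \<le> K * C * exp (\<omega> * \<bar>t\<bar>)" if "\<And>t. norm (H t) \<le> C * exp (\<omega> * \<bar>t\<bar>)" for H C t
    using mult_mono[OF a(2)[of t] that[of "- t"] K] by (simp add: norm_mult mult.assoc)
  have i: "integrable N (\<lambda>t. a t * H (- t))" if eb: "exp_bounded \<omega> H" for H
  proof -
    obtain C where C: "\<And>t. norm (H t) \<le> C * exp (\<omega> * \<bar>t\<bar>)" and [measurable]: "H \<in> borel_measurable borel"
      using eb by (auto simp: exp_bounded_def)
    show ?thesis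
      by (rule Bochner_Integration.integrable_bound[OF integrable_mult_right[OF int, of "K * C"]])
        (measurable, use bd[OF C] in \<open>auto intro!: AE_I2 order_trans[OF _ abs_ge_self]\<close>)
  qed
  fix F G c
  assume F: "exp_bounded \<omega> F"
  show "(LINT t|N. a t * (c * F (- t))) = c * (LINT t|N. a t * F (- t))"
    unfolding mult.left_commute[of _ c] by (rule integral_mult_right_zero)
  assume G: "exp_bounded \<omega> G"
  show "(LINT t|N. a t * (F (- t) + G (- t))) = (LINT t|N. a t * F (- t)) + (LINT t|N. a t * G (- t))"
    unfolding distrib_left by (rule Bochner_Integration.integral_add[OF i[OF F] i[OF G]])
next
  note [measurable] = a(1) and [measurable_cong] = N
  fix F :: "nat \<Rightarrow> real \<Rightarrow> complex" and G C
  assume F[measurable]: "\<And>n. F n \<in> borel_measurable borel" and b: "\<And>n t. norm (F n t) \<le> C * exp (\<omega> * \<bar>t\<bar>)"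
    and l: "\<And>t. (\<lambda>n. F n t) \<longlonglongrightarrow> G t"
  have [measurable]: "G \<in> borel_measurable borel" by (rule borel_measurable_LIMSEQ_metric[OF F l])
  have K: "0 \<le> K" using order_trans[OF norm_ge_zero a(2)] .
  show "(\<lambda>n. LINT t|N. a t * F n (- t)) \<longlonglongrightarrow> (LINT t|N. a t * G (- t))"
  proof (rule integral_dominated_convergence)
    show "integrable N (\<lambda>t. K * C * exp (\<omega> * \<bar>t\<bar>))" by (rule integrable_mult_right[OF int])
    show "AE t in N. (\<lambda>n. a t * F n (- t)) \<longlonglongrightarrow> a t * G (- t)"
      by (intro AE_I2 tendsto_mult tendsto_const l)
    show "AE t in N. norm (a t * F n (- t)) \<le> K * C * exp (\<omega> * \<bar>t\<bar>)" for n
    proof (rule AE_I2)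
      fix t
      show "norm (a t * F n (- t)) \<le> K * C * exp (\<omega> * \<bar>t\<bar>)"
        using mult_mono[OF a(2)[of t] b[of n "- t"] K] by (simp add: norm_mult mult.assoc)
    qed
  qed measurable
qed

text \<open>Along the arc the arguments of \<open>lap\<close> keep the distance \<kappa> from the
  strip of half-width \<omega>, so all transforms in a sequence share one bound and dominated
  convergence applies twice, in time and along the arc.\<close>

lemma admissible_arc:
  fixes \<omega> \<kappa> \<alpha> :: real
  assumes \<gamma>: "\<gamma> C1_differentiable_on {0..1}" and \<kappa>: "\<kappa> > 0" "\<omega> \<ge> 0"
    and im: "\<And>\<zeta>. \<zeta> \<in> path_image \<gamma> \<Longrightarrow> \<zeta> \<noteq> 0 \<and> \<omega> + \<kappa> \<le> \<bar>Re (inverse \<zeta> + of_real \<alpha>)\<bar>"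
    and h: "continuous_on (path_image \<gamma>) h"
  shows "admissible \<omega> (\<lambda>H. contour_integral \<gamma> (\<lambda>\<zeta>. h \<zeta> * lap_res \<alpha> H \<zeta>))"
proof -
  have cont: "continuous_on (path_image \<gamma>) (lap_res \<alpha> H)" if eb: "exp_bounded \<omega> H" for H
  proof -
    obtain C where C: "\<And>t. norm (H t) \<le> C * exp (\<omega> * \<bar>t\<bar>)" and H: "H \<in> borel_measurable borel"
      using eb by (auto simp: exp_bounded_def)
    have "continuous_on (path_image \<gamma>) (\<lambda>\<zeta>. lap H (inverse \<zeta> + of_real \<alpha>))"
      unfolding continuous_on_sequentially
    proof (intro allI ballI impI, elim conjE)
      fix x \<zeta> assume \<zeta>: "\<zeta> \<in> path_image \<gamma>" and x: "\<forall>n. x n \<in> path_image \<gamma>" "x \<longlonglongrightarrow> \<zeta>"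
      have "(\<lambda>n. lap H (inverse (x n) + of_real \<alpha>)) \<longlonglongrightarrow> lap H (inverse \<zeta> + of_real \<alpha>)"
      proof (rule lap_limit[OF _ \<kappa>])
        show "(\<lambda>n. inverse (x n) + of_real \<alpha>) \<longlonglongrightarrow> inverse \<zeta> + of_real \<alpha>"
          using im[OF \<zeta>] by (intro tendsto_intros x) auto
      qed (use im x(1) \<zeta> H C in auto)
      then show "((\<lambda>\<zeta>. lap H (inverse \<zeta> + of_real \<alpha>)) \<circ> x) \<longlonglongrightarrow> lap H (inverse \<zeta> + of_real \<alpha>)"
        by (simp only: o_def)
    qed
    then show ?thesis unfolding lap_res_def[abs_def] using im by (intro continuous_intros) auto
  qed
  have i: "(\<lambda>\<zeta>. h \<zeta> * lap_res \<alpha> H \<zeta>) contour_integrable_on \<gamma>" if "exp_bounded \<omega> H" for H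
    by (intro contour_integrable_continuous_C1[OF \<gamma>] continuous_on_mult h cont that)
  show ?thesis
  proof (rule admissibleI)
    fix F G c
    assume F: "exp_bounded \<omega> F"
    have "lap_res \<alpha> (\<lambda>t. c * F t) \<zeta> = c * lap_res \<alpha> F \<zeta>" for \<zeta>
      by (simp add: lap_res_def lap_cmult algebra_simps)
    then have "h \<zeta> * lap_res \<alpha> (\<lambda>t. c * F t) \<zeta> = c * (h \<zeta> * lap_res \<alpha> F \<zeta>)" for \<zeta> by simp
    then show "contour_integral \<gamma> (\<lambda>\<zeta>. h \<zeta> * lap_res \<alpha> (\<lambda>t. c * F t) \<zeta>) = c * contour_integral \<gamma> (\<lambda>\<zeta>. h \<zeta> * lap_res \<alpha> F \<zeta>)"
      by (simp only: contour_integral_lmul[OF i[OF F]])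
    assume G: "exp_bounded \<omega> G"
    have "h \<zeta> * lap_res \<alpha> (\<lambda>t. F t + G t) \<zeta> = h \<zeta> * lap_res \<alpha> F \<zeta> + h \<zeta> * lap_res \<alpha> G \<zeta>" if "\<zeta> \<in> path_image \<gamma>" for \<zeta>
    proof -
      have "\<omega> < \<bar>Re (inverse \<zeta> + of_real \<alpha>)\<bar>" using im[OF that] \<kappa> by linarith
      from lap_add[OF F G this] show ?thesis by (simp add: lap_res_def add_divide_distrib algebra_simps)
    qed
    then have "contour_integral \<gamma> (\<lambda>\<zeta>. h \<zeta> * lap_res \<alpha> (\<lambda>t. F t + G t) \<zeta>) =
        contour_integral \<gamma> (\<lambda>\<zeta>. h \<zeta> * lap_res \<alpha> F \<zeta> + h \<zeta> * lap_res \<alpha> G \<zeta>)"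
      by (rule contour_integral_eq)
    then show "contour_integral \<gamma> (\<lambda>\<zeta>. h \<zeta> * lap_res \<alpha> (\<lambda>t. F t + G t) \<zeta>) =
        contour_integral \<gamma> (\<lambda>\<zeta>. h \<zeta> * lap_res \<alpha> F \<zeta>) + contour_integral \<gamma> (\<lambda>\<zeta>. h \<zeta> * lap_res \<alpha> G \<zeta>)"
      by (simp only: contour_integral_add[OF i[OF F] i[OF G]])
  next
    fix F :: "nat \<Rightarrow> real \<Rightarrow> complex" and G C
    assume F: "\<And>n. F n \<in> borel_measurable borel" "\<And>n t. norm (F n t) \<le> C * exp (\<omega> * \<bar>t\<bar>)" "\<And>t. (\<lambda>n. F n t) \<longlonglongrightarrow> G t"
    have C: "0 \<le> C" using F(2)[of 0] by (rule exp_bound_nonneg)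
    have cpt: "compact (path_image \<gamma>)" by (rule compact_valid_path_image[OF C1_imp_valid_path[OF \<gamma>]])
    have c\<gamma>: "continuous_on {0..1} (\<lambda>t. vector_derivative \<gamma> (at t))"
      using \<gamma> by (auto simp: C1_differentiable_on_eq)
    obtain Bh where Bh: "Bh \<ge> 0" "\<And>\<zeta>. \<zeta> \<in> path_image \<gamma> \<Longrightarrow> norm (h \<zeta>) \<le> Bh" using compact_bound[OF cpt h] by blast
    have "continuous_on (path_image \<gamma>) inverse" using im by (intro continuous_intros) auto
    then obtain B1 where B1: "B1 \<ge> 0" "\<And>\<zeta>. \<zeta> \<in> path_image \<gamma> \<Longrightarrow> norm (inverse \<zeta>) \<le> B1" using compact_bound[OF cpt] by blast
    obtain Bd where Bd: "Bd \<ge> 0" "\<And>t. t \<in> {0..1} \<Longrightarrow> norm (vector_derivative \<gamma> (at t)) \<le> Bd" using compact_bound[OF compact_Icc c\<gamma>] by blast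
    \<comment> \<open>Common majorant of the integrands: bounds for h, for the two terms of
      \<open>lap_res\<close> and for the speed of the curve.\<close>
    define W where "W = Bh * (C * B1 + C / \<kappa> * B1\<^sup>2) * Bd"
    have eb: "exp_bounded \<omega> (F n)" for n using F by (auto simp: exp_bounded_def)
    show "(\<lambda>n. contour_integral \<gamma> (\<lambda>\<zeta>. h \<zeta> * lap_res \<alpha> (F n) \<zeta>)) \<longlonglongrightarrow> contour_integral \<gamma> (\<lambda>\<zeta>. h \<zeta> * lap_res \<alpha> G \<zeta>)"
      unfolding contour_integral_integral
    proof (rule dominated_convergence(2))
      show "(\<lambda>t. h (\<gamma> t) * lap_res \<alpha> (F n) (\<gamma> t) * vector_derivative \<gamma> (at t)) integrable_on {0..1}" for n
        using i[OF eb, of n] by (simp only: contour_integrable_on)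
      show "(\<lambda>t. W) integrable_on {0..1::real}" by (rule integrable_const_ivl)
      fix t :: real assume t: "t \<in> {0..1}"
      then have \<gamma>t: "\<gamma> t \<in> path_image \<gamma>" by (simp add: path_image_def)
      show "norm (h (\<gamma> t) * lap_res \<alpha> (F n) (\<gamma> t) * vector_derivative \<gamma> (at t)) \<le> W" for n
      proof -
        have "norm (F n 0 / \<gamma> t) \<le> C * B1"
          using mult_mono[OF F(2)[of n 0] B1(2)[OF \<gamma>t]] C by (simp add: divide_inverse norm_mult)
        moreover have "norm (lap (F n) (inverse (\<gamma> t) + of_real \<alpha>) / (\<gamma> t)\<^sup>2) \<le> C / \<kappa> * B1\<^sup>2"
        proof -
          have "norm (lap (F n) (inverse (\<gamma> t) + of_real \<alpha>)) \<le> C / \<kappa>"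
            by (rule norm_lap_le[OF _ \<kappa> F(1,2)]) (use im[OF \<gamma>t] in blast)
          moreover have "(norm (inverse (\<gamma> t)))\<^sup>2 \<le> B1\<^sup>2" by (rule power_mono[OF B1(2)[OF \<gamma>t] norm_ge_zero])
          ultimately have "norm (lap (F n) (inverse (\<gamma> t) + of_real \<alpha>)) * (norm (inverse (\<gamma> t)))\<^sup>2 \<le> C / \<kappa> * B1\<^sup>2"
            using C \<kappa> by (intro mult_mono) auto
          then show ?thesis by (simp add: divide_inverse norm_mult norm_power norm_inverse power_inverse)
        qed
        ultimately have "norm (lap_res \<alpha> (F n) (\<gamma> t)) \<le> C * B1 + C / \<kappa> * B1\<^sup>2"
          unfolding lap_res_def by (rule order_trans[OF norm_triangle_ineq4 add_mono])
        then show ?thesis unfolding W_def norm_mult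
          using Bh(2)[OF \<gamma>t] Bd(2)[OF t] Bh(1) Bd(1) B1(1) C \<kappa> by (intro mult_mono) auto
      qed
      have "(\<lambda>n. lap (F n) (inverse (\<gamma> t) + of_real \<alpha>)) \<longlonglongrightarrow> lap G (inverse (\<gamma> t) + of_real \<alpha>)"
        using im[OF \<gamma>t] by (intro lap_limit[OF _ \<kappa> _ tendsto_const F]) auto
      then show "(\<lambda>n. h (\<gamma> t) * lap_res \<alpha> (F n) (\<gamma> t) * vector_derivative \<gamma> (at t)) \<longlonglongrightarrow>
          h (\<gamma> t) * lap_res \<alpha> G (\<gamma> t) * vector_derivative \<gamma> (at t)"
        unfolding lap_res_def using im[OF \<gamma>t] by (intro tendsto_intros F) auto
    qed
  qed
qed

theorem admissible_unique:
  assumes a: "admissible \<omega> \<Lambda>" "admissible \<omega> \<Lambda>'" and \<omega>: "\<omega> \<ge> 0"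
    and cis: "\<And>y. \<Lambda> (\<lambda>t. cis (y * t)) = \<Lambda>' (\<lambda>t. cis (y * t))"
    and G: "continuous_on UNIV G" "\<And>t. norm (G t) \<le> C * exp (\<omega> * \<bar>t\<bar>)"
  shows "\<Lambda> G = \<Lambda>' G"
proof -
  define \<G> where "\<G> = {F. exp_bounded \<omega> F \<and> \<Lambda> F = \<Lambda>' F}"
  have "G \<in> \<G>"
  proof (rule exponential_closure[OF _ _ _ _ \<omega> G])
    fix F F' assume F: "F \<in> \<G>" "F' \<in> \<G>"
    then have e: "exp_bounded \<omega> F" "exp_bounded \<omega> F'" "\<Lambda> F = \<Lambda>' F" "\<Lambda> F' = \<Lambda>' F'" by (simp_all add: \<G>_def)
    obtain C1 C2 where "\<And>t. norm (F t) \<le> C1 * exp (\<omega> * \<bar>t\<bar>)" "\<And>t. norm (F' t) \<le> C2 * exp (\<omega> * \<bar>t\<bar>)"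
      using e(1,2) by (auto simp: exp_bounded_def)
    then have "norm (F t + F' t) \<le> (C1 + C2) * exp (\<omega> * \<bar>t\<bar>)" for t
      unfolding distrib_right by (rule order_trans[OF norm_triangle_ineq add_mono])
    then have "exp_bounded \<omega> (\<lambda>t. F t + F' t)" using e(1,2) by (auto simp: exp_bounded_def)
    then show "(\<lambda>t. F t + F' t) \<in> \<G>"
      using admissibleD(1)[OF a(1) e(1,2)] admissibleD(1)[OF a(2) e(1,2)] e by (simp add: \<G>_def)
  next
    fix F c assume F: "F \<in> \<G>"
    then have e: "exp_bounded \<omega> F" "\<Lambda> F = \<Lambda>' F" by (simp_all add: \<G>_def)
    obtain C1 where "\<And>t. norm (F t) \<le> C1 * exp (\<omega> * \<bar>t\<bar>)"
      using e(1) by (auto simp: exp_bounded_def)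
    then have "norm (c * F t) \<le> (norm c * C1) * exp (\<omega> * \<bar>t\<bar>)" for t
      unfolding norm_mult mult.assoc by (rule mult_left_mono) simp
    then have "exp_bounded \<omega> (\<lambda>t. c * F t)" using e(1) by (auto simp: exp_bounded_def)
    then show "(\<lambda>t. c * F t) \<in> \<G>"
      using admissibleD(2)[OF a(1) e(1)] admissibleD(2)[OF a(2) e(1)] e by (simp add: \<G>_def)
  next
    fix y
    have "norm (cis (y * t)) \<le> 1 * exp (\<omega> * \<bar>t\<bar>)" for t using \<omega> by simp
    moreover have "(\<lambda>t. cis (y * t)) \<in> borel_measurable borel"
      by (intro borel_measurable_continuous_onI) (auto simp: cis_conv_exp intro!: continuous_intros)
    ultimately have "exp_bounded \<omega> (\<lambda>t. cis (y * t))" unfolding exp_bounded_def by blast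
    then show "(\<lambda>t. cis (y * t)) \<in> \<G>" using cis by (simp add: \<G>_def)
  next
    fix F :: "nat \<Rightarrow> real \<Rightarrow> complex" and F' B
    assume F: "\<And>n. F n \<in> \<G>" and l: "\<And>t. (\<lambda>n. F n t) \<longlonglongrightarrow> F' t" and b: "\<And>n t. norm (F n t) \<le> B * exp (\<omega> * \<bar>t\<bar>)"
    have m: "F n \<in> borel_measurable borel" "\<Lambda> (F n) = \<Lambda>' (F n)" for n using F[of n] by (auto simp: \<G>_def exp_bounded_def)
    have "F' \<in> borel_measurable borel" by (rule borel_measurable_LIMSEQ_metric[OF m(1) l])
    moreover have "norm (F' t) \<le> B * exp (\<omega> * \<bar>t\<bar>)" for t
      by (rule LIMSEQ_le_const2[OF tendsto_norm[OF l]]) (use b in auto)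
    ultimately have "exp_bounded \<omega> F'" unfolding exp_bounded_def by blast
    moreover have "\<Lambda> F' = \<Lambda>' F'"
      using admissibleD(3)[OF a(1) m(1) b l] admissibleD(3)[OF a(2) m(1) b l] unfolding m(2) by (rule LIMSEQ_unique)
    ultimately show "F' \<in> \<G>" by (simp add: \<G>_def)
  qed
  then show ?thesis by (simp add: \<G>_def)
qed

text \<open>The integrand is l c / \<zeta> up to an error of smaller order. By Cauchy's theorem the
  radius may be enlarged without changing the integral, so only the leading term remains.\<close>

lemma outer_circle_integral:
  assumes h: "h holomorphic_on {\<zeta>. R1 < norm \<zeta>}" "(h \<longlongrightarrow> l) at_infinity"
    and r: "r holomorphic_on {\<zeta>. R1 < norm \<zeta>}" "\<And>\<zeta>. R1 < norm \<zeta> \<Longrightarrow> norm (r \<zeta> - c / \<zeta>) \<le> K / (norm \<zeta>)\<^sup>2"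
    and R: "0 \<le> R1" "R1 < R"
  shows "contour_integral (circlepath 0 R) (\<lambda>\<zeta>. h \<zeta> * r \<zeta>) = 2 * of_real pi * \<i> * l * c"
proof -
  define I0 where "I0 = contour_integral (circlepath 0 R) (\<lambda>\<zeta>. h \<zeta> * r \<zeta>)"
  have op: "open {\<zeta>::complex. R1 < norm \<zeta>}" by (intro open_Collect_less continuous_intros)
  have G: "(\<lambda>\<zeta>. h \<zeta> * r \<zeta>) holomorphic_on {\<zeta>. R1 < norm \<zeta>}" by (intro holomorphic_intros h r)
  have pin: "path_image (circlepath 0 s) = sphere 0 s" if "s > 0" for s
    using that by (intro path_image_circlepath_nonneg) simp
  have R0: "R > 0" using R by simp
  have eq: "contour_integral (circlepath 0 R') (\<lambda>\<zeta>. h \<zeta> * r \<zeta>) = I0" if R': "R' > R" for R'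
  proof -
    have R'0: "R' > 0" using R' R0 by simp
    have s: "{\<zeta>::complex. norm \<zeta> = s} \<subseteq> {\<zeta>. R1 < norm \<zeta>}" if "s \<ge> R" for s using that R by auto
    have "(\<Sum>\<gamma>\<leftarrow>[circlepath 0 R', reversepath (circlepath 0 R)]. contour_integral \<gamma> (\<lambda>\<zeta>. h \<zeta> * r \<zeta>)) = 0"
    proof (rule Cauchy_theorem_cycle[OF op G])
      fix \<gamma> :: "real \<Rightarrow> complex"
      assume "\<gamma> \<in> set [circlepath 0 R', reversepath (circlepath 0 R)]"
      then have \<gamma>: "\<gamma> = circlepath 0 R' \<or> \<gamma> = reversepath (circlepath 0 R)" by simp
      have "path_image \<gamma> \<subseteq> {\<zeta>. R1 < norm \<zeta>}"
        using \<gamma> R R' R0 R'0 by (auto simp: pin)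
      moreover have "\<gamma> C1_differentiable_on {0..1}" using \<gamma> C1_circlepath C1_reversepath_circlepath by blast
      moreover have "pathfinish \<gamma> = pathstart \<gamma>" using \<gamma> by auto
      ultimately show "\<gamma> C1_differentiable_on {0..1} \<and> path_image \<gamma> \<subseteq> {\<zeta>. R1 < norm \<zeta>} \<and> pathfinish \<gamma> = pathstart \<gamma>" by blast
    next
      fix z :: complex assume "z \<notin> {\<zeta>. R1 < norm \<zeta>}"
      then have z: "norm (z - 0) < R" "norm (z - 0) < R'" using R R' by auto
      have "winding_number (reversepath (circlepath 0 R)) z = - winding_number (circlepath 0 R) z"
        by (rule winding_number_reversepath) (use z(1) R0 in \<open>auto simp: pin\<close>)
      then show "(\<Sum>\<gamma>\<leftarrow>[circlepath 0 R', reversepath (circlepath 0 R)]. winding_number \<gamma> z) = 0"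
        using winding_number_circlepath[OF z(1)] winding_number_circlepath[OF z(2)] by simp
    qed
    then show ?thesis by (simp add: contour_integral_reversepath I0_def)
  qed
  define X where "X = norm (I0 - 2 * of_real pi * \<i> * (l * c))"
  have K: "0 \<le> K"
  proof -
    have "0 \<le> K / (norm (of_real R :: complex))\<^sup>2"
      by (rule order_trans[OF norm_ge_zero r(2)]) (use R in auto)
    then show ?thesis using R0 by (simp add: zero_le_divide_iff)
  qed
  have main: "X \<le> 2 * pi * (norm c + 1) * e" if e: "0 < e" "e \<le> 1" for e
  proof -
    have "\<forall>\<^sub>F \<zeta> in at_infinity. norm (h \<zeta> - l) < e" using tendstoD[OF h(2) e(1)] by (simp only: dist_norm)
    then obtain B0 where B0: "\<And>\<zeta>. norm \<zeta> \<ge> B0 \<Longrightarrow> norm (h \<zeta> - l) < e" by (auto simp: eventually_at_infinity)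
    \<comment> \<open>At this radius h is e-close to its limit, and the remainder of r, multiplied
      by the length of the circle, is of order e as well.\<close>
    define R' where "R' = max (R + 1) (max B0 ((norm l + 1) * K / e))"
    have R': "R' > R" "R' \<ge> B0" "R' \<ge> (norm l + 1) * K / e" unfolding R'_def by linarith+
    then have R'0: "R' > 0" using R0 by linarith
    have Ke: "(norm l + 1) * K / R' \<le> e" using R'(3) R'0 e(1) by (simp add: field_simps)
    have hc: "((\<lambda>\<zeta>. h \<zeta> * r \<zeta>) has_contour_integral I0) (circlepath 0 R')"
    proof -
      have "continuous_on (path_image (circlepath 0 R')) (\<lambda>\<zeta>. h \<zeta> * r \<zeta>)"
        by (rule continuous_on_subset[OF holomorphic_on_imp_continuous_on[OF G]]) (use R R' R'0 in \<open>auto simp: pin\<close>)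
      from has_contour_integral_integral[OF contour_integrable_continuous_circlepath[OF this]] show ?thesis
        unfolding eq[OF R'(1)] .
    qed
    moreover have "((\<lambda>\<zeta>. (l * c) / (\<zeta> - 0)) has_contour_integral (2 * of_real pi * \<i> * (l * c))) (circlepath 0 R')"
      by (rule Cauchy_integral_circlepath_simple[of "\<lambda>_. l * c"]) (use R'0 in auto)
    ultimately have d: "((\<lambda>\<zeta>. h \<zeta> * r \<zeta> - (l * c) / (\<zeta> - 0)) has_contour_integral (I0 - 2 * of_real pi * \<i> * (l * c))) (circlepath 0 R')"
      by (rule has_contour_integral_diff)
    have "X \<le> (e + norm c * e) / R' * (2 * pi * R')"
      unfolding X_def
    proof (rule has_contour_integral_bound_circlepath[OF d _ R'0])
      show "0 \<le> (e + norm c * e) / R'" using e R'0 by (intro divide_nonneg_pos add_nonneg_nonneg mult_nonneg_nonneg) auto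
      fix \<zeta> :: complex assume "norm (\<zeta> - 0) = R'"
      then have \<zeta>: "norm \<zeta> = R'" by simp
      have hl: "norm (h \<zeta> - l) < e" using B0[of \<zeta>] \<zeta> R' by simp
      have hn: "norm (h \<zeta>) \<le> norm l + 1" using norm_triangle_ineq2[of "h \<zeta>" l] hl e(2) by linarith
      have "norm (r \<zeta> - c / \<zeta>) \<le> K / R'\<^sup>2" using r(2)[of \<zeta>] \<zeta> R R' by simp
      with hn have a1: "norm (h \<zeta>) * norm (r \<zeta> - c / \<zeta>) \<le> (norm l + 1) * (K / R'\<^sup>2)" by (intro mult_mono) auto
      have "h \<zeta> * r \<zeta> - (l * c) / (\<zeta> - 0) = h \<zeta> * (r \<zeta> - c / \<zeta>) + (h \<zeta> - l) * (c / \<zeta>)" by (simp add: algebra_simps)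
      then have "norm (h \<zeta> * r \<zeta> - (l * c) / (\<zeta> - 0)) \<le> norm (h \<zeta>) * norm (r \<zeta> - c / \<zeta>) + norm (h \<zeta> - l) * (norm c / R')"
        using norm_triangle_ineq[of "h \<zeta> * (r \<zeta> - c / \<zeta>)" "(h \<zeta> - l) * (c / \<zeta>)"] \<zeta> by (simp only: norm_mult norm_divide)
      also have "\<dots> \<le> (norm l + 1) * K / R' / R' + e * (norm c / R')"
        using a1 hl R'0 by (intro add_mono mult_right_mono) (auto simp: power2_eq_square)
      also have "\<dots> \<le> e / R' + e * (norm c / R')" using Ke R'0 by (intro add_mono divide_right_mono) auto
      also have "\<dots> = (e + norm c * e) / R'" by (simp add: add_divide_distrib mult.commute)
      finally show "norm (h \<zeta> * r \<zeta> - (l * c) / (\<zeta> - 0)) \<le> (e + norm c * e) / R'" .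
    qed
    also have "\<dots> = 2 * pi * (norm c + 1) * e" using R'0 by (simp add: field_simps)
    finally show ?thesis .
  qed
  have "X \<le> 0"
  proof (rule ccontr)
    assume "\<not> X \<le> 0"
    then have X: "X > 0" by simp
    define q where "q = 2 * pi * (norm c + 1)"
    have q: "q > 0" unfolding q_def by (intro mult_pos_pos add_nonneg_pos) auto
    define e where "e = min 1 (X / (2 * q))"
    have e: "0 < e" "e \<le> 1" "e \<le> X / (2 * q)" using X q by (auto simp: e_def)
    have "X \<le> q * e" using main[OF e(1,2)] by (simp only: q_def)
    also have "\<dots> \<le> q * (X / (2 * q))" using e q by (intro mult_left_mono) auto
    also have "\<dots> = X / 2" using q by simp
    finally show False using X by simp
  qed
  then have "I0 = 2 * of_real pi * \<i> * (l * c)" by (simp add: X_def)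
  then show ?thesis by (simp add: I0_def mult.assoc)
qed

section \<open>Comparison of contours\<close>

lemma closure_slice:
  assumes I: "I \<in> imag_sphere"
  shows "closure (slice I U) \<subseteq> slice I (closure U)"
proof (rule closure_minimal)
  show "slice I U \<subseteq> slice I (closure U)" unfolding slice_def using closure_subset by blast
  have "closed (in_slice I -` closure U)"
    by (rule continuous_closed_vimage[OF closed_closure linear_continuous_at[OF bounded_linear_in_slice[OF I]]])
  then show "closed (slice I (closure U))" by (simp add: slice_def vimage_def)
qed

text \<open>The two inclusions keep the curves where the function is regular and off any set, such
  as the spectrum, that the domain contains.\<close>

lemma oriented_boundary_path_image:
  assumes I: "I \<in> imag_sphere" and b: "is_oriented_boundary \<gamma>s (slice I U)" and \<gamma>: "\<gamma> \<in> set \<gamma>s" and U: "open U"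
  shows "path_image \<gamma> \<subseteq> slice I (closure U)" "path_image \<gamma> \<inter> slice I U = {}"
proof -
  have "path_image \<gamma> \<subseteq> (\<Union>\<gamma>\<in>set \<gamma>s. path_image \<gamma>)" using \<gamma> by blast
  also have "\<dots> = frontier (slice I U)" using b by (simp add: is_oriented_boundary_def)
  finally have f: "path_image \<gamma> \<subseteq> closure (slice I U) - interior (slice I U)" by (simp only: frontier_def)
  show "path_image \<gamma> \<subseteq> slice I (closure U)" using f closure_slice[OF I] by blast
  have "open (slice I U)" unfolding slice_def by (rule open_slice[OF U I])
  then show "path_image \<gamma> \<inter> slice I U = {}" using f interior_open by blast
qed

lemma oriented_boundaryD:
  assumes "is_oriented_boundary \<gamma>s G"
  shows "\<gamma> \<in> set \<gamma>s \<Longrightarrow> \<gamma> C1_differentiable_on {0..1}" "\<gamma> \<in> set \<gamma>s \<Longrightarrow> pathfinish \<gamma> = pathstart \<gamma>"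
    "z \<in> G \<Longrightarrow> (\<Sum>\<gamma>\<leftarrow>\<gamma>s. winding_number \<gamma> z) = 1" "z \<notin> closure G \<Longrightarrow> (\<Sum>\<gamma>\<leftarrow>\<gamma>s. winding_number \<gamma> z) = 0"
  using assms unfolding is_oriented_boundary_def by blast+

lemma Cauchy_boundary_circles:
  assumes chain: "a0 < a1" "a1 < b1" "b1 < a2" "a2 < b2" "b2 < b0"
    and I: "I \<in> imag_sphere" and W: "open W" "closure (circular_domain a0 b0 a1 b1 a2 b2) \<subseteq> W"
    and F: "F holomorphic_on slice I W" and p: "p \<in> slice I (circular_domain a0 b0 a1 b1 a2 b2)"
  shows "(\<Sum>\<gamma>\<leftarrow>boundary_circles a0 b0 a1 b1 a2 b2. contour_integral \<gamma> (\<lambda>w. F w / (w - p))) = 2 * of_real pi * \<i> * F p"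
proof -
  let ?U = "circular_domain a0 b0 a1 b1 a2 b2"
  note b = boundary_circles_oriented[OF chain I]
  have U: "open ?U" using circular_domain_axially_symmetric[OF chain] by (simp add: axially_symmetric_slice_domain_def)
  have cW: "closure (slice I ?U) \<subseteq> slice I W" using closure_slice[OF I, of ?U] W(2) unfolding slice_def by blast
  have "(\<Sum>\<gamma>\<leftarrow>boundary_circles a0 b0 a1 b1 a2 b2. contour_integral \<gamma> (\<lambda>w. F w / (w - p))) =
    2 * of_real pi * \<i> * (\<Sum>\<gamma>\<leftarrow>boundary_circles a0 b0 a1 b1 a2 b2. winding_number \<gamma> p) * F p"
  proof (rule Cauchy_integral_formula_cycle[OF _ F])
    show "open (slice I W)" unfolding slice_def by (rule open_slice[OF W(1) I])
    show "p \<in> slice I W" using p cW closure_subset by blast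
    show "\<gamma> C1_differentiable_on {0..1} \<and> path_image \<gamma> \<subseteq> slice I W \<and> pathfinish \<gamma> = pathstart \<gamma>"
      if "\<gamma> \<in> set (boundary_circles a0 b0 a1 b1 a2 b2)" for \<gamma>
      using oriented_boundaryD(1,2)[OF b that] oriented_boundary_path_image(1)[OF I b that U] W(2)
      unfolding slice_def by blast
    show "p \<notin> path_image \<gamma>" if "\<gamma> \<in> set (boundary_circles a0 b0 a1 b1 a2 b2)" for \<gamma>
      using oriented_boundary_path_image(2)[OF I b that U] p by blast
    show "(\<Sum>\<gamma>\<leftarrow>boundary_circles a0 b0 a1 b1 a2 b2. winding_number \<gamma> z) = 0" if "z \<notin> slice I W" for z
      by (rule oriented_boundaryD(4)[OF b]) (use that cW in blast)
  qed
  then show ?thesis using oriented_boundaryD(3)[OF b p] by simp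
qed

text \<open>Cauchy's theorem for the difference of the two cycles. A point outside \<open>S\<close>
  is either spectral, and then both cycles wind around it once, or it is outside \<open>W\<close>
  and \<open>W'\<close>, hence outside both closed domains, where both winding numbers are
  0.\<close>

lemma (in slice_functional) contour_sum_eq:
  assumes U: "open U" "is_oriented_boundary \<gamma>s (slice I U)" "S_spectrum UNIV A \<subseteq> U" "closure U \<subseteq> W" "open W"
    and U': "open U'" "is_oriented_boundary \<gamma>s' (slice I U')" "S_spectrum UNIV A \<subseteq> U'" "closure U' \<subseteq> W'" "open W'"
    and F: "F holomorphic_on slice I W" "F holomorphic_on slice I W'"
  shows "(\<Sum>\<gamma>\<leftarrow>\<gamma>s. contour_integral \<gamma> (\<lambda>\<zeta>. F \<zeta> * resf v \<zeta>)) = (\<Sum>\<gamma>\<leftarrow>\<gamma>s'. contour_integral \<gamma> (\<lambda>\<zeta>. F \<zeta> * resf v \<zeta>))"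
proof -
  note Is = bounded_op.I[OF bounded_op_axioms]
  define S where "S = (slice I W \<union> slice I W') \<inter> rho"
  have oW: "open (slice I W)" "open (slice I W')" unfolding slice_def by (rule open_slice[OF U(5) Is] open_slice[OF U'(5) Is])+
  have oS: "open S" unfolding S_def by (intro open_Int open_Un oW open_rho)
  have FS: "(\<lambda>\<zeta>. F \<zeta> * resf v \<zeta>) holomorphic_on S"
    by (intro holomorphic_on_mult holomorphic_on_subset[OF holomorphic_on_Un[OF F oW]] holomorphic_on_subset[OF resf_holomorphic])
      (auto simp: S_def)
  have spec: "z \<in> slice I V" if "z \<notin> rho" "S_spectrum UNIV A \<subseteq> V" for z V
    using that by (auto simp: rho_def S_spectrum_def slice_def)
  have im: "path_image \<gamma> \<subseteq> slice I V \<inter> rho" if "is_oriented_boundary gs (slice I G)" "\<gamma> \<in> set gs" "open G" "S_spectrum UNIV A \<subseteq> G" "closure G \<subseteq> V" for gs \<gamma> G V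
    using oriented_boundary_path_image[OF Is that(1,2,3)] spec[OF _ that(4)] that(5) unfolding slice_def by blast
  have imS: "path_image \<gamma> \<subseteq> S" if "\<gamma> \<in> set \<gamma>s \<or> \<gamma> \<in> set \<gamma>s'" for \<gamma>
    using that im[OF U(2) _ U(1,3,4)] im[OF U'(2) _ U'(1,3,4)] unfolding S_def by blast
  note bd = oriented_boundaryD[OF U(2)] and bd' = oriented_boundaryD[OF U'(2)]
  have vp: "valid_path \<gamma>" "path \<gamma>" if "\<gamma> \<in> set \<gamma>s'" for \<gamma>
    using C1_imp_valid_path[OF bd'(1)[OF that]] valid_path_imp_path by blast+
  have "(\<Sum>\<gamma>\<leftarrow>\<gamma>s @ map reversepath \<gamma>s'. contour_integral \<gamma> (\<lambda>\<zeta>. F \<zeta> * resf v \<zeta>)) = 0"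
  proof (rule Cauchy_theorem_cycle[OF oS FS])
    fix \<gamma> assume "\<gamma> \<in> set (\<gamma>s @ map reversepath \<gamma>s')"
    then consider "\<gamma> \<in> set \<gamma>s" | \<gamma>' where "\<gamma>' \<in> set \<gamma>s'" "\<gamma> = reversepath \<gamma>'" by auto
    then show "\<gamma> C1_differentiable_on {0..1} \<and> path_image \<gamma> \<subseteq> S \<and> pathfinish \<gamma> = pathstart \<gamma>"
    proof cases
      case 1
      then show ?thesis using bd(1,2)[OF 1] imS by blast
    next
      case 2
      show ?thesis unfolding 2(2) path_image_reversepath pathfinish_reversepath pathstart_reversepath
        using C1_reversepath[OF bd'(1)[OF 2(1)]] bd'(2)[OF 2(1)] imS 2(1) by simp
    qed
  next
    fix z assume z: "z \<notin> S"
    have "winding_number (reversepath \<gamma>) z = - winding_number \<gamma> z" if "\<gamma> \<in> set \<gamma>s'" for \<gamma>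
      by (rule winding_number_reversepath[OF vp(2)[OF that]]) (use imS that z in blast)
    then have "(\<Sum>\<gamma>\<leftarrow>map reversepath \<gamma>s'. winding_number \<gamma> z) = (\<Sum>\<gamma>\<leftarrow>\<gamma>s'. - winding_number \<gamma> z)"
      by (simp add: o_def cong: map_cong)
    also have "\<dots> = - (\<Sum>\<gamma>\<leftarrow>\<gamma>s'. winding_number \<gamma> z)" by (simp add: uminus_sum_list_map o_def)
    finally have r: "(\<Sum>\<gamma>\<leftarrow>map reversepath \<gamma>s'. winding_number \<gamma> z) = - (\<Sum>\<gamma>\<leftarrow>\<gamma>s'. winding_number \<gamma> z)" .
    have "(\<Sum>\<gamma>\<leftarrow>\<gamma>s. winding_number \<gamma> z) = (\<Sum>\<gamma>\<leftarrow>\<gamma>s'. winding_number \<gamma> z)"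
    proof (cases "z \<in> rho")
      case False
      show ?thesis using bd(3)[OF spec[OF False U(3)]] bd'(3)[OF spec[OF False U'(3)]] by simp
    next
      case True
      then have nz: "z \<notin> slice I W" "z \<notin> slice I W'" using z by (simp_all add: S_def)
      have "z \<notin> closure (slice I U)" using nz(1) closure_slice[OF Is, of U] U(4) unfolding slice_def by blast
      moreover have "z \<notin> closure (slice I U')" using nz(2) closure_slice[OF Is, of U'] U'(4) unfolding slice_def by blast
      ultimately show ?thesis using bd(4) bd'(4) by simp
    qed
    then show "(\<Sum>\<gamma>\<leftarrow>\<gamma>s @ map reversepath \<gamma>s'. winding_number \<gamma> z) = 0"
      unfolding map_append sum_list_append r by simp
  qed
  moreover have "(\<Sum>\<gamma>\<leftarrow>map reversepath \<gamma>s'. contour_integral \<gamma> (\<lambda>\<zeta>. F \<zeta> * resf v \<zeta>)) = - (\<Sum>\<gamma>\<leftarrow>\<gamma>s'. contour_integral \<gamma> (\<lambda>\<zeta>. F \<zeta> * resf v \<zeta>))"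
  proof -
    have "(\<Sum>\<gamma>\<leftarrow>map reversepath \<gamma>s'. contour_integral \<gamma> (\<lambda>\<zeta>. F \<zeta> * resf v \<zeta>)) = (\<Sum>\<gamma>\<leftarrow>\<gamma>s'. - contour_integral \<gamma> (\<lambda>\<zeta>. F \<zeta> * resf v \<zeta>))"
      using contour_integral_reversepath[OF vp(1)] by (simp add: o_def cong: map_cong)
    also have "\<dots> = - (\<Sum>\<gamma>\<leftarrow>\<gamma>s'. contour_integral \<gamma> (\<lambda>\<zeta>. F \<zeta> * resf v \<zeta>))" by (simp add: uminus_sum_list_map o_def)
    finally show ?thesis .
  qed
  ultimately show ?thesis by simp
qed

context group_generator
begin

text \<open>In the application \<open>F\<close> is one complex component of f in the coordinate
  \<zeta> = 1/(z - \<alpha>), \<open>a\<close> the same component of the polar density,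
  \<open>N\<close> the total variation and \<open>L\<close> the component of f(\<alpha>), which is
  the value of \<open>F\<close> at infinity. The alternatives in \<open>outer\<close> are those of
  \<open>ex_circles\<close>.\<close>

lemma circles_resf:
  fixes F :: "complex \<Rightarrow> complex" and a :: "real \<Rightarrow> complex" and \<alpha> \<kappa> :: real
  assumes Ainv: "is_bounded_inverse D (\<lambda>v. T v - \<alpha> *\<^sub>R v) A" and sf: "slice_functional A I l"
    and spec: "\<And>s. \<omega> \<le> \<bar>qRe s\<bar> \<Longrightarrow> s \<in> S_resolvent_set D T"
    and chain: "a0 < a1" "a1 < b1" "b1 < a2" "a2 < b2" "b2 < b0" and \<kappa>: "\<kappa> > 0"
    and inner: "\<And>q. disc_form a1 b1 q \<le> 0 \<or> disc_form a2 b2 q \<le> 0 \<Longrightarrow> q \<noteq> 0 \<and> \<omega> + \<kappa> \<le> \<bar>qRe (inverse q + of_real \<alpha>)\<bar>"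
    and outer: "(\<bar>\<alpha>\<bar> \<le> \<omega> \<and> a0 = - b0 \<and> 8 * norm A + 1 \<le> b0 \<and>
       (\<forall>q. 0 \<le> disc_form a1 b1 q \<and> 0 \<le> disc_form a2 b2 q \<longrightarrow> q \<in> W)) \<or>
     (\<alpha> \<noteq> 0 \<and> (\<forall>q. 0 \<le> disc_form a0 b0 q \<longrightarrow> q \<noteq> 0 \<and> \<omega> + \<kappa> \<le> \<bar>qRe (inverse q + of_real \<alpha>)\<bar>) \<and>
       (\<forall>q. disc_form a0 b0 q \<le> 0 \<and> 0 \<le> disc_form a1 b1 q \<and> 0 \<le> disc_form a2 b2 q \<longrightarrow> q \<in> W))"
    and W: "open W" and F: "F holomorphic_on slice I W"
    and N: "sets N = sets borel" "a \<in> borel_measurable borel" "\<And>t. norm (a t) \<le> K" "integrable N (\<lambda>t. exp (\<omega> * \<bar>t\<bar>))"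
    and Fval: "\<And>y. \<i> * of_real y \<noteq> of_real \<alpha> \<Longrightarrow> F (1 / (\<i> * of_real y - of_real \<alpha>)) = (LINT t|N. a t * cis (y * (- t)))"
    and Finf: "\<bar>\<alpha>\<bar> \<le> \<omega> \<Longrightarrow> (F \<longlongrightarrow> L) at_infinity" and L: "\<alpha> = 0 \<Longrightarrow> L = (LINT t|N. a t)"
  shows "(\<Sum>\<gamma>\<leftarrow>boundary_circles a0 b0 a1 b1 a2 b2. contour_integral \<gamma> (\<lambda>\<zeta>. F \<zeta> * slice_functional.resf A I l v \<zeta>)) =
    2 * of_real pi * \<i> * (LINT t|N. a t * l (Z (- t) v))"
proof -
  interpret s: slice_functional A I l by fact
  note Is = s.I
  define c where "c = 2 * of_real pi * \<i>"
  define H where "H t = l (Z t v)" for t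
  have Hc: "continuous_on UNIV H" unfolding H_def
    by (rule continuous_on_compose2[OF linear_continuous_on[OF s.l, of UNIV] Z_cont]) simp
  obtain B where B: "B > 0" "\<And>w. norm (l w) \<le> norm w * B" using bounded_linear.pos_bounded[OF s.l] by blast
  have Hb: "norm (H t) \<le> (M * norm v * B) * exp (\<omega> * \<bar>t\<bar>)" for t
  proof -
    have "norm (H t) \<le> (M * exp (\<omega> * \<bar>t\<bar>) * norm v) * B"
      unfolding H_def by (rule order_trans[OF B(2) mult_right_mono[OF norm_Z_apply]]) (use B in auto)
    then show ?thesis by (simp only: mult_ac)
  qed
  \<comment> \<open>Points whose image under \<zeta> \<mapsto> 1/\<zeta> + \<alpha> has distance at
    least \<kappa> from the strip; there the Laplace representation of the resolvent is
    available.\<close>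
  define far where "far \<zeta> \<longleftrightarrow> \<zeta> \<noteq> 0 \<and> \<omega> + \<kappa> \<le> \<bar>Re (inverse \<zeta> + of_real \<alpha>)\<bar>" for \<zeta>
  have inv: "inverse (in_slice I \<zeta>) + of_real \<alpha> = in_slice I (inverse \<zeta> + of_real \<alpha>)" for \<zeta>
    by (simp add: in_slice_linear in_slice_inverse[OF Is])
  have farI: "far \<zeta>" if "in_slice I \<zeta> \<noteq> 0 \<and> \<omega> + \<kappa> \<le> \<bar>qRe (inverse (in_slice I \<zeta>) + of_real \<alpha>)\<bar>" for \<zeta>
    using that unfolding inv qRe_in_slice[OF Is] far_def by (auto simp: in_slice_linear)
  have resf: "s.resf v \<zeta> = lap_res \<alpha> H \<zeta>" if "far \<zeta>" for \<zeta>
  proof -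
    define z where "z = inverse \<zeta> + of_real \<alpha>"
    have \<zeta>: "\<zeta> \<noteq> 0" "\<omega> < \<bar>Re z\<bar>" using that \<kappa> unfolding far_def z_def by auto
    have "in_slice I z \<in> S_resolvent_set D T" by (rule spec) (use \<zeta>(2) in \<open>simp add: qRe_in_slice[OF Is]\<close>)
    moreover have "in_slice I z \<noteq> of_real \<alpha>"
      using in_slice_eq_iff[OF Is, of z "of_real \<alpha>"] \<zeta>(1) by (simp add: z_def)
    ultimately have "inverse (in_slice I z - of_real \<alpha>) \<in> S_resolvent_set UNIV A" by (rule resolvent_set_moebius[OF Ainv])
    moreover have "inverse (in_slice I z - of_real \<alpha>) = in_slice I \<zeta>"
      by (simp add: z_def in_slice_linear in_slice_inverse[OF Is])
    ultimately have "\<zeta> \<in> s.rho" by (simp add: s.rho_def)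
    from resf_laplace[OF Ainv sf this \<zeta>(1) \<zeta>(2)[unfolded z_def], of v] show ?thesis
      unfolding lap_res_def H_def[abs_def] Z_0 .
  qed
  define arc where "arc \<gamma> G = contour_integral \<gamma> (\<lambda>\<zeta>. F \<zeta> * lap_res \<alpha> G \<zeta>)" for \<gamma> G
  define \<gamma>0 \<gamma>1 \<gamma>2 where \<gamma>: "\<gamma>0 = real_circle a0 b0" "\<gamma>1 = reversepath (real_circle a1 b1)" "\<gamma>2 = reversepath (real_circle a2 b2)"
  have ab0: "a0 < b0" using chain by linarith
  have U: "open (circular_domain a0 b0 a1 b1 a2 b2)" using circular_domain_axially_symmetric[OF chain] by (simp add: axially_symmetric_slice_domain_def)
  note bd = boundary_circles_oriented[OF chain Is]
  have clW: "closure (circular_domain a0 b0 a1 b1 a2 b2) \<subseteq> W"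
    using closure_circular_domain[OF chain] outer by blast
  have mem: "\<gamma>0 \<in> set (boundary_circles a0 b0 a1 b1 a2 b2)" "\<gamma>1 \<in> set (boundary_circles a0 b0 a1 b1 a2 b2)" "\<gamma>2 \<in> set (boundary_circles a0 b0 a1 b1 a2 b2)"
    by (simp_all add: boundary_circles_def \<gamma>)
  have Fc: "continuous_on (path_image g) F" if "g \<in> set (boundary_circles a0 b0 a1 b1 a2 b2)" for g
    by (rule continuous_on_subset[OF holomorphic_on_imp_continuous_on[OF F]])
      (use oriented_boundary_path_image(1)[OF Is bd that U] clW in \<open>unfold slice_def, blast\<close>)
  have arc_adm: "admissible \<omega> (arc g)" if "g \<in> set (boundary_circles a0 b0 a1 b1 a2 b2)" "\<And>\<zeta>. \<zeta> \<in> path_image g \<Longrightarrow> far \<zeta>" for g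
    unfolding arc_def by (rule admissible_arc[OF oriented_boundaryD(1)[OF bd that(1)] \<kappa> \<omega> _ Fc[OF that(1)]]) (use that(2) far_def in blast)
  have arc_H: "contour_integral g (\<lambda>\<zeta>. F \<zeta> * s.resf v \<zeta>) = arc g H" if "\<And>\<zeta>. \<zeta> \<in> path_image g \<Longrightarrow> far \<zeta>" for g
    unfolding arc_def by (rule contour_integral_eq) (simp only: resf[OF that])
  have arc_cis: "arc g (\<lambda>t. cis (y * t)) = contour_integral g (\<lambda>\<zeta>. F \<zeta> / (\<zeta> - 1 / (\<i> * of_real y - of_real \<alpha>)))"
    if g: "\<And>\<zeta>. \<zeta> \<in> path_image g \<Longrightarrow> far \<zeta>" and y: "\<i> * of_real y \<noteq> of_real \<alpha>" for g y
    unfolding arc_def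
  proof (rule contour_integral_eq)
    fix \<zeta> assume "\<zeta> \<in> path_image g"
    then have "\<zeta> \<noteq> 0" "Re (inverse \<zeta> + of_real \<alpha>) \<noteq> 0" using g[of \<zeta>] \<kappa> \<omega> unfolding far_def by auto
    from lap_res_cis[OF this y] show "F \<zeta> * lap_res \<alpha> (\<lambda>t. cis (y * t)) \<zeta> = F \<zeta> / (\<zeta> - 1 / (\<i> * of_real y - of_real \<alpha>))"
      by (simp only: times_divide_eq_right mult_1_right)
  qed
  have sph: "disc_form x y (in_slice I \<zeta>) \<le> 0" "0 \<le> disc_form x y (in_slice I \<zeta>)"
    if "x < y" "\<zeta> \<in> path_image (real_circle x y)" for x y \<zeta>
  proof -
    have *: "\<zeta> \<in> sphere (of_real ((x + y) / 2)) ((y - x) / 2)" using that(2) winding_number_real_circle(4)[OF that(1)] by blast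
    then have "\<zeta> \<in> cball (of_real ((x + y) / 2)) ((y - x) / 2)" "\<zeta> \<notin> ball (of_real ((x + y) / 2)) ((y - x) / 2)"
      by (simp_all only: mem_sphere mem_cball mem_ball order_refl less_irrefl not_False_eq_True)
    with disc_form_slice[OF Is that(1)] show "disc_form x y (in_slice I \<zeta>) \<le> 0" "0 \<le> disc_form x y (in_slice I \<zeta>)"
      unfolding not_less[symmetric, of 0] by blast+
  qed
  have far1: "far \<zeta>" if "\<zeta> \<in> path_image \<gamma>1" for \<zeta>
    using that sph(1)[OF chain(2)] unfolding \<gamma> path_image_reversepath by (intro farI inner disjI1)
  have far2: "far \<zeta>" if "\<zeta> \<in> path_image \<gamma>2" for \<zeta>
    using that sph(1)[OF chain(4)] unfolding \<gamma> path_image_reversepath by (intro farI inner disjI2)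
  \<comment> \<open>The poles 1/(\<i> y - \<alpha>) come from imaginary points, which are not far,
    so they lie outside both inner discs.\<close>
  have pdom: "0 < disc_form a1 b1 (in_slice I (1 / (\<i> * of_real y - of_real \<alpha>)))" "0 < disc_form a2 b2 (in_slice I (1 / (\<i> * of_real y - of_real \<alpha>)))"
      "qRe (inverse (in_slice I (1 / (\<i> * of_real y - of_real \<alpha>))) + of_real \<alpha>) = 0"
    if y: "\<i> * of_real y \<noteq> of_real \<alpha>" for y
  proof -
    show q: "qRe (inverse (in_slice I (1 / (\<i> * of_real y - of_real \<alpha>))) + of_real \<alpha>) = 0"
      unfolding inv qRe_in_slice[OF Is] by simp
    have "\<not> \<omega> + \<kappa> \<le> \<bar>qRe (inverse (in_slice I (1 / (\<i> * of_real y - of_real \<alpha>))) + of_real \<alpha>)\<bar>"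
      unfolding q using \<kappa> \<omega> by simp
    then show "0 < disc_form a1 b1 (in_slice I (1 / (\<i> * of_real y - of_real \<alpha>)))" "0 < disc_form a2 b2 (in_slice I (1 / (\<i> * of_real y - of_real \<alpha>)))"
      using inner not_le by blast+
  qed
  \<comment> \<open>\<Lambda> is the contribution of the outer circle: an arc like the other two if
    that circle is far, otherwise a multiple of the value at time 0. The last conjunct prepares the
    case \<alpha> = 0, in which the pole for y = 0 is at infinity.\<close>
  have "\<exists>\<Lambda>. admissible \<omega> \<Lambda> \<and> \<Lambda> H = contour_integral \<gamma>0 (\<lambda>\<zeta>. F \<zeta> * s.resf v \<zeta>) \<and>
    (\<forall>y. \<i> * of_real y \<noteq> of_real \<alpha> \<longrightarrow> \<Lambda> (\<lambda>t. cis (y * t)) + arc \<gamma>1 (\<lambda>t. cis (y * t)) + arc \<gamma>2 (\<lambda>t. cis (y * t)) = c * F (1 / (\<i> * of_real y - of_real \<alpha>))) \<and>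
    (\<alpha> = 0 \<longrightarrow> \<Lambda> (\<lambda>t. 1) = c * L)"
    using outer
  proof (elim disjE conjE)
    assume nz: "\<alpha> \<noteq> 0" and o: "\<forall>q. 0 \<le> disc_form a0 b0 q \<longrightarrow> q \<noteq> 0 \<and> \<omega> + \<kappa> \<le> \<bar>qRe (inverse q + of_real \<alpha>)\<bar>"
    have far0: "far \<zeta>" if "\<zeta> \<in> path_image \<gamma>0" for \<zeta>
      using that sph(2)[OF ab0] o unfolding \<gamma> by (intro farI) blast
    have cy: "arc \<gamma>0 (\<lambda>t. cis (y * t)) + arc \<gamma>1 (\<lambda>t. cis (y * t)) + arc \<gamma>2 (\<lambda>t. cis (y * t)) = c * F (1 / (\<i> * of_real y - of_real \<alpha>))"
      if y: "\<i> * of_real y \<noteq> of_real \<alpha>" for y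
    proof -
      have "\<not> \<omega> + \<kappa> \<le> \<bar>qRe (inverse (in_slice I (1 / (\<i> * of_real y - of_real \<alpha>))) + of_real \<alpha>)\<bar>"
        unfolding pdom(3)[OF y] using \<kappa> \<omega> by simp
      then have "disc_form a0 b0 (in_slice I (1 / (\<i> * of_real y - of_real \<alpha>))) < 0" using o not_le by blast
      then have "1 / (\<i> * of_real y - of_real \<alpha>) \<in> slice I (circular_domain a0 b0 a1 b1 a2 b2)"
        using pdom(1,2)[OF y] unfolding slice_def circular_domain_def mem_Collect_eq by blast
      from Cauchy_boundary_circles[OF chain Is W clW F this]
      have "contour_integral \<gamma>0 (\<lambda>\<zeta>. F \<zeta> / (\<zeta> - 1 / (\<i> * of_real y - of_real \<alpha>))) +
          contour_integral \<gamma>1 (\<lambda>\<zeta>. F \<zeta> / (\<zeta> - 1 / (\<i> * of_real y - of_real \<alpha>))) +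
          contour_integral \<gamma>2 (\<lambda>\<zeta>. F \<zeta> / (\<zeta> - 1 / (\<i> * of_real y - of_real \<alpha>))) = c * F (1 / (\<i> * of_real y - of_real \<alpha>))"
        by (simp add: boundary_circles_def \<gamma> c_def add.assoc)
      then show ?thesis using arc_cis[OF far0 y] arc_cis[OF far1 y] arc_cis[OF far2 y] by (simp only:)
    qed
    show ?thesis
      by (intro exI[of _ "arc \<gamma>0"] conjI allI impI arc_adm mem far0 arc_H[symmetric] cy) (use nz in auto)
  next
    assume \<alpha>: "\<bar>\<alpha>\<bar> \<le> \<omega>" and a0: "a0 = - b0" and b0: "8 * norm A + 1 \<le> b0"
      and o: "\<forall>q. 0 \<le> disc_form a1 b1 q \<and> 0 \<le> disc_form a2 b2 q \<longrightarrow> q \<in> W"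
    \<comment> \<open>Beyond this radius lie neither spectral points of \<open>A\<close> nor points
      of the inner discs, so \<open>F\<close> and the resolvent are both holomorphic there.\<close>
    define R1 where "R1 = max (8 * norm A) (max (- a1) b2)"
    have R1: "0 \<le> R1" "R1 < b0" "8 * norm A \<le> R1" "- a1 \<le> R1" "b2 \<le> R1"
      using b0 chain a0 norm_ge_zero[of A] unfolding R1_def by linarith+
    have circ: "real_circle (- R) R = circlepath 0 R" for R by (simp add: real_circle_def)
    have out: "\<zeta> \<in> slice I W" if \<zeta>: "R1 < norm \<zeta>" for \<zeta>
    proof -
      have b: "\<zeta> \<notin> ball (of_real ((- norm \<zeta> + norm \<zeta>) / 2)) ((norm \<zeta> - - norm \<zeta>) / 2)" by simp
      have "cball (of_real ((a1 + b1) / 2)) ((b1 - a1) / 2) \<subseteq> ball (complex_of_real ((- norm \<zeta> + norm \<zeta>) / 2)) ((norm \<zeta> - - norm \<zeta>) / 2)"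
        by (rule real_discs_nested) (use \<zeta> R1 chain in linarith)+
      then have 1: "\<not> disc_form a1 b1 (in_slice I \<zeta>) \<le> 0" unfolding disc_form_slice(2)[OF Is chain(2)] using b by blast
      have "cball (of_real ((a2 + b2) / 2)) ((b2 - a2) / 2) \<subseteq> ball (complex_of_real ((- norm \<zeta> + norm \<zeta>) / 2)) ((norm \<zeta> - - norm \<zeta>) / 2)"
        by (rule real_discs_nested) (use \<zeta> R1 chain in linarith)+
      then have 2: "\<not> disc_form a2 b2 (in_slice I \<zeta>) \<le> 0" unfolding disc_form_slice(2)[OF Is chain(4)] using b by blast
      show ?thesis using o 1 2 unfolding slice_def mem_Collect_eq by (meson linorder_le_cases)
    qed
    have Fout: "F holomorphic_on {\<zeta>. R < norm \<zeta>}" if "R1 \<le> R" for R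
      by (rule holomorphic_on_subset[OF F]) (use out that in auto)
    have rr: "\<zeta> \<in> s.rho \<and> \<zeta> \<noteq> 0" if "R1 < norm \<zeta>" for \<zeta>
    proof -
      have "\<zeta> \<noteq> 0" using that R1(1) by auto
      moreover have "8 * norm A \<le> norm \<zeta>" using that R1 by linarith
      ultimately show ?thesis using s.large_in_rho by blast
    qed
    obtain K1 where K1: "\<And>\<zeta>. \<zeta> \<in> s.rho \<Longrightarrow> \<zeta> \<noteq> 0 \<and> norm \<zeta> \<ge> 4 * norm A \<Longrightarrow> norm (s.resf v \<zeta> - l v / \<zeta>) \<le> K1 / (norm \<zeta>)\<^sup>2"
      using s.resf_asymptotic[of v] by blast
    have outer_H: "contour_integral \<gamma>0 (\<lambda>\<zeta>. F \<zeta> * s.resf v \<zeta>) = 2 * of_real pi * \<i> * L * l v"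
      unfolding \<gamma> a0 circ
    proof (rule outer_circle_integral[OF Fout[OF order_refl] Finf[OF \<alpha>] _ _ R1(1,2)])
      show "s.resf v holomorphic_on {\<zeta>. R1 < norm \<zeta>}"
        by (rule holomorphic_on_subset[OF s.resf_holomorphic]) (use rr in blast)
      show "norm (s.resf v \<zeta> - l v / \<zeta>) \<le> K1 / (norm \<zeta>)\<^sup>2" if "R1 < norm \<zeta>" for \<zeta>
      proof (rule K1)
        have "4 * norm A \<le> norm \<zeta>" using that R1 norm_ge_zero[of A] by linarith
        then show "\<zeta> \<in> s.rho" "\<zeta> \<noteq> 0 \<and> 4 * norm A \<le> norm \<zeta>" using rr[OF that] by blast+
      qed
    qed
    have cy: "c * L + arc \<gamma>1 (\<lambda>t. cis (y * t)) + arc \<gamma>2 (\<lambda>t. cis (y * t)) = c * F (1 / (\<i> * of_real y - of_real \<alpha>))"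
      if y: "\<i> * of_real y \<noteq> of_real \<alpha>" for y
    proof -
      define p where "p = 1 / (\<i> * of_real y - of_real \<alpha>)"
      \<comment> \<open>The pole p may lie outside the given outer circle, so Cauchy's formula is
        applied on a larger domain. The integral over its outer circle is again c L; the factor 2
        makes |w - p| at least |w|/2 beyond R2.\<close>
      define R2 where "R2 = max R1 (2 * norm p)"
      define R where "R = max b0 R2 + 1"
      have R2: "R1 \<le> R2" "2 * norm p \<le> R2" "R2 < R" "b0 < R" unfolding R2_def R_def by linarith+
      have R0: "0 < R" "norm p < R" using R1 R2 norm_ge_zero[of p] by linarith+
      have chainR: "- R < a1" "b2 < R" using R1 R2 by linarith+
      have "closure (circular_domain (- R) R a1 b1 a2 b2) \<subseteq> W"
        using closure_circular_domain[OF chainR(1) chain(2-4) chainR(2)] o by blast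
      moreover have "p \<in> slice I (circular_domain (- R) R a1 b1 a2 b2)"
      proof -
        have "p \<in> ball (of_real ((- R + R) / 2)) ((R - - R) / 2)" using R0 by simp
        moreover have "- R < R" using R0 by simp
        ultimately show ?thesis using pdom(1,2)[OF y] disc_form_slice(1)[OF Is]
          unfolding slice_def circular_domain_def mem_Collect_eq p_def[symmetric] by blast
      qed
      ultimately have sum: "contour_integral (circlepath 0 R) (\<lambda>w. F w / (w - p)) + (contour_integral \<gamma>1 (\<lambda>w. F w / (w - p)) + contour_integral \<gamma>2 (\<lambda>w. F w / (w - p))) = c * F p"
        using Cauchy_boundary_circles[OF chainR(1) chain(2-4) chainR(2) Is W _ F, of p]
        by (simp add: boundary_circles_def circ \<gamma> c_def)
      have "contour_integral (circlepath 0 R) (\<lambda>w. F w * (1 / (w - p))) = 2 * of_real pi * \<i> * L * 1"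
      proof (rule outer_circle_integral[OF Fout[OF R2(1)] Finf[OF \<alpha>] _ _ _ R2(3)])
        show "0 \<le> R2" using R1 R2 by linarith
        have np: "w - p \<noteq> 0" "w \<noteq> 0" "norm w \<le> 2 * norm (w - p)" if "R2 < norm w" for w
        proof -
          have n: "2 * norm p < norm w" using that R2 by linarith
          then show "w \<noteq> 0" using norm_ge_zero[of p] by auto
          show "w - p \<noteq> 0" using n norm_ge_zero[of p] by auto
          show "norm w \<le> 2 * norm (w - p)" using n norm_triangle_ineq2[of w p] by linarith
        qed
        show "(\<lambda>w. 1 / (w - p)) holomorphic_on {w. R2 < norm w}"
          using np(1) by (intro holomorphic_intros) auto
        show "norm (1 / (w - p) - 1 / w) \<le> 2 * norm p / (norm w)\<^sup>2" if w: "R2 < norm w" for w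
        proof -
          have "1 / (w - p) - 1 / w = p / ((w - p) * w)" using np(1,2)[OF w] by (simp add: field_simps)
          then have "norm (1 / (w - p) - 1 / w) = norm p / (norm (w - p) * norm w)" by (simp only: norm_divide norm_mult)
          also have "\<dots> \<le> norm p / (norm w / 2 * norm w)"
            using np[OF w] by (intro divide_left_mono mult_right_mono mult_pos_pos) auto
          also have "\<dots> = 2 * norm p / (norm w)\<^sup>2" by (simp add: power2_eq_square)
          finally show ?thesis .
        qed
      qed
      then have "contour_integral (circlepath 0 R) (\<lambda>w. F w / (w - p)) = c * L"
        by (simp only: times_divide_eq_right mult_1_right c_def)
      with sum show ?thesis
        using arc_cis[OF far1 y] arc_cis[OF far2 y] unfolding p_def[symmetric] by (simp only: add.assoc)
    qed
    show ?thesis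
    proof (intro exI[of _ "\<lambda>G. c * L * G 0"] conjI allI impI)
      show "admissible \<omega> (\<lambda>G. c * L * G 0)" by (rule admissible_point)
      show "c * L * H 0 = contour_integral \<gamma>0 (\<lambda>\<zeta>. F \<zeta> * s.resf v \<zeta>)"
        unfolding outer_H c_def H_def Z_0 ..
      show "c * L * cis (y * 0) + arc \<gamma>1 (\<lambda>t. cis (y * t)) + arc \<gamma>2 (\<lambda>t. cis (y * t)) = c * F (1 / (\<i> * of_real y - of_real \<alpha>))"
        if "\<i> * of_real y \<noteq> of_real \<alpha>" for y using cy[OF that] by simp
    qed simp
  qed
  then obtain \<Lambda> where \<Lambda>: "admissible \<omega> \<Lambda>" "\<Lambda> H = contour_integral \<gamma>0 (\<lambda>\<zeta>. F \<zeta> * s.resf v \<zeta>)"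
    "\<And>y. \<i> * of_real y \<noteq> of_real \<alpha> \<Longrightarrow> \<Lambda> (\<lambda>t. cis (y * t)) + arc \<gamma>1 (\<lambda>t. cis (y * t)) + arc \<gamma>2 (\<lambda>t. cis (y * t)) = c * F (1 / (\<i> * of_real y - of_real \<alpha>))"
    "\<alpha> = 0 \<Longrightarrow> \<Lambda> (\<lambda>t. 1) = c * L" by blast
  define \<Lambda>' where "\<Lambda>' G = (LINT t|N. (c * a t) * G (- t))" for G
  have \<Lambda>'e: "\<Lambda>' G = c * (LINT t|N. a t * G (- t))" for G unfolding \<Lambda>'_def mult.assoc by (rule integral_mult_right_zero)
  have adm': "admissible \<omega> \<Lambda>'" unfolding \<Lambda>'_def
  proof (rule admissible_measure[OF N(1) _ _ N(4)])
    show "(\<lambda>t. c * a t) \<in> borel_measurable borel" using N(2) by measurable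
    show "norm (c * a t) \<le> norm c * K" for t unfolding norm_mult by (rule mult_left_mono[OF N(3) norm_ge_zero])
  qed
  have "\<Lambda> H + arc \<gamma>1 H + arc \<gamma>2 H = \<Lambda>' H"
  proof (rule admissible_unique[OF _ adm' \<omega> _ Hc Hb])
    show "admissible \<omega> (\<lambda>G. \<Lambda> G + arc \<gamma>1 G + arc \<gamma>2 G)"
      by (intro admissible_add \<Lambda>(1) arc_adm mem far1 far2)
    fix y
    show "\<Lambda> (\<lambda>t. cis (y * t)) + arc \<gamma>1 (\<lambda>t. cis (y * t)) + arc \<gamma>2 (\<lambda>t. cis (y * t)) = \<Lambda>' (\<lambda>t. cis (y * t))"
    proof (cases "\<i> * of_real y = (of_real \<alpha> :: complex)")
      case False
      show ?thesis unfolding \<Lambda>(3)[OF False] Fval[OF False] \<Lambda>'e ..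
    next
      case True
      \<comment> \<open>Only the constant function is left: \<open>lap_res\<close> of 1 vanishes, so
        the inner circles contribute nothing, while the outer one gives c L, which is c times the
        total integral of \<open>a\<close>.\<close>
      then have y\<alpha>: "y = 0" "\<alpha> = 0" by (auto simp: complex_eq_iff)
      have one: "(\<lambda>t. cis (y * t)) = (\<lambda>t. 1)" unfolding y\<alpha> by simp
      have "arc g (\<lambda>t. 1) = 0" if g: "\<And>\<zeta>. \<zeta> \<in> path_image g \<Longrightarrow> far \<zeta>" for g
      proof -
        have "arc g (\<lambda>t. 1) = contour_integral g (\<lambda>\<zeta>. 0)" unfolding arc_def
        proof (rule contour_integral_eq)
          fix \<zeta> assume "\<zeta> \<in> path_image g"
          then have z: "\<zeta> \<noteq> 0" "Re (inverse \<zeta>) \<noteq> 0" using g[of \<zeta>] \<kappa> \<omega> unfolding far_def y\<alpha> by auto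
          have "lap (\<lambda>t. 1) (inverse \<zeta>) = \<zeta>" using laplace_cis[OF z(2), of 0] by (simp add: divide_inverse)
          then have "lap_res \<alpha> (\<lambda>t. 1) \<zeta> = 0" using z(1) unfolding lap_res_def y\<alpha> by (simp add: power2_eq_square)
          then show "F \<zeta> * lap_res \<alpha> (\<lambda>t. 1) \<zeta> = 0" by simp
        qed
        then show ?thesis by simp
      qed
      from this[OF far1] this[OF far2] show ?thesis
        unfolding one \<Lambda>(4)[OF y\<alpha>(2)] \<Lambda>'e L[OF y\<alpha>(2)] by simp
    qed
  qed
  then have "contour_integral \<gamma>0 (\<lambda>\<zeta>. F \<zeta> * s.resf v \<zeta>) + contour_integral \<gamma>1 (\<lambda>\<zeta>. F \<zeta> * s.resf v \<zeta>) +
      contour_integral \<gamma>2 (\<lambda>\<zeta>. F \<zeta> * s.resf v \<zeta>) = c * (LINT t|N. a t * H (- t))"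
    by (simp only: \<Lambda>(2) \<Lambda>'e arc_H[OF far1] arc_H[OF far2])
  then show ?thesis by (simp add: boundary_circles_def \<gamma> add.assoc c_def H_def)
qed

end

section \<open>Functionals and the S-functional calculus\<close>

text \<open>The usual complex linear functional with real part \<psi>, for the complex structure
  given by left multiplication with I.\<close>

definition complexify :: "quat \<Rightarrow> ('v::quaternionic_banach \<Rightarrow> real) \<Rightarrow> 'v \<Rightarrow> complex" where
  "complexify I \<psi> w = Complex (\<psi> w) (- \<psi> (I *\<^sub>l w))"

lemma in_slice_lscale: "in_slice I z *\<^sub>l w = Re z *\<^sub>R w + Im z *\<^sub>R (I *\<^sub>l w)"
  for w :: "'v::quaternionic_banach"
proof -
  have "I * of_real (Im z) = of_real (Im z) * I" by (rule of_real_quat_commute[symmetric])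
  then show ?thesis by (simp add: in_slice_def lscale_add_left lscale_of_real lscale_mult)
qed

lemma Re_complexify:
  assumes "bounded_linear \<psi>"
  shows "\<psi> (in_slice I z *\<^sub>l w) = Re (z * complexify I \<psi> w)"
  using assms by (simp add: in_slice_lscale complexify_def linear_simps)

lemma slice_functional_complexify:
  fixes A :: "'v::quaternionic_banach \<Rightarrow>\<^sub>L 'v"
  assumes A: "bounded_op A I" and \<psi>: "bounded_linear \<psi>"
  shows "slice_functional A I (complexify I \<psi>)"
proof -
  have I: "I \<in> imag_sphere" by (rule bounded_op.I[OF A])
  interpret b: bounded_bilinear "(*\<^sub>l) :: quat \<Rightarrow> 'v \<Rightarrow> 'v" by (rule bounded_bilinear_lscale)
  have "bounded_linear (\<lambda>w. of_real (\<psi> w) - \<i> * of_real (\<psi> (I *\<^sub>l w)))"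
    by (intro bounded_linear_sub bounded_linear_const_mult bounded_linear_compose[OF bounded_linear_of_real]
        bounded_linear_compose[OF \<psi>] b.bounded_linear_right bounded_linear_ident)
  moreover have "(\<lambda>w. of_real (\<psi> w) - \<i> * of_real (\<psi> (I *\<^sub>l w))) = complexify I \<psi>"
    by (auto simp: complexify_def complex_eq_iff)
  ultimately have bl: "bounded_linear (complexify I \<psi>)" by simp
  have II: "I *\<^sub>l (I *\<^sub>l v) = - v" for v :: 'v
  proof -
    have "I *\<^sub>l (I *\<^sub>l v) = of_real (- 1) *\<^sub>l v" unfolding lscale_mult[symmetric] imag_sphere_mult_self[OF I] by simp
    then show ?thesis unfolding lscale_of_real by simp
  qed
  have "complexify I \<psi> (I *\<^sub>l v) = \<i> * complexify I \<psi> v" for v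
    using \<psi> by (simp add: complexify_def II complex_eq_iff linear_simps)
  then show ?thesis using A bl by (simp add: slice_functional_def slice_functional_axioms_def)
qed

text \<open>With it the left scaling of operators becomes a composition, which is continuous in both
  factors.\<close>

definition lmul :: "quat \<Rightarrow> 'v::quaternionic_banach \<Rightarrow>\<^sub>L 'v" where
  "lmul q = Blinfun (\<lambda>v. q *\<^sub>l v)"

lemma lmul_apply: "lmul q v = q *\<^sub>l v" for v :: "'v::quaternionic_banach"
proof -
  interpret b: bounded_bilinear "(*\<^sub>l) :: quat \<Rightarrow> 'v \<Rightarrow> 'v" by (rule bounded_bilinear_lscale)
  show ?thesis unfolding lmul_def by (simp add: bounded_linear_Blinfun_apply b.bounded_linear_right)
qed

lemma bounded_linear_lmul: "bounded_linear (lmul :: quat \<Rightarrow> 'v::quaternionic_banach \<Rightarrow>\<^sub>L 'v)"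
proof (rule bounded_linear_intro[where K = 1])
  interpret b: bounded_bilinear "(*\<^sub>l) :: quat \<Rightarrow> 'v \<Rightarrow> 'v" by (rule bounded_bilinear_lscale)
  show "lmul (x + y) = (lmul x + lmul y :: 'v \<Rightarrow>\<^sub>L 'v)" for x y
    by (rule blinfun_eqI) (simp add: lmul_apply blinfun.add_left b.add_left)
  show "lmul (r *\<^sub>R x) = (r *\<^sub>R lmul x :: 'v \<Rightarrow>\<^sub>L 'v)" for r x
    by (rule blinfun_eqI) (simp add: lmul_apply blinfun.scaleR_left b.scaleR_left)
  show "norm (lmul x :: 'v \<Rightarrow>\<^sub>L 'v) \<le> norm x * 1" for x
    by (rule norm_blinfun_bound) (simp_all add: lmul_apply norm_lscale)
qed

lemma op_lscale_lmul: "op_lscale q B = lmul q o\<^sub>L B"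
proof (rule blinfun_eqI)
  fix v
  have "(\<lambda>v. q *\<^sub>l B v) = blinfun_apply (lmul q o\<^sub>L B)" by (simp add: lmul_apply fun_eq_iff)
  then show "op_lscale q B v = (lmul q o\<^sub>L B) v" unfolding op_lscale_def by (simp only: blinfun_apply_inverse)
qed

text \<open>Split h = F1 + J F2. In the first term the scalar from the slice passes through the
  complexified \<phi>. In the second term J stands in front and is absorbed into the functional w
  \<mapsto> \<phi>(J w), which is complexified in turn. The factor -\<i> comes from ds_I = -ds
  I.\<close>

lemma arc_functional:
  fixes \<phi> :: "'v::quaternionic_banach \<Rightarrow> real"
  assumes A: "bounded_op A I" and J: "J \<in> imag_sphere" "J * I = - (I * J)" and \<phi>: "bounded_linear \<phi>"
    and \<gamma>: "\<gamma> C1_differentiable_on {0..1}" "path_image \<gamma> \<subseteq> slice I W \<inter> bounded_op.rho A I"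
    and h: "continuous_on W h"
  defines "p \<equiv> in_slice I \<circ> \<gamma>"
  defines "X \<equiv> \<lambda>t. op_lscale (h (p t) * (- vector_derivative p (at t within {0..1}) * I)) (right_S_resolvent (p t) UNIV (blinfun_apply A))"
  shows "X integrable_on {0..1}"
    "\<phi> (integral {0..1} X v) =
      Re (- \<i> * contour_integral \<gamma> (\<lambda>\<zeta>. slice_fst I (h (in_slice I \<zeta>)) * slice_functional.resf A I (complexify I \<phi>) v \<zeta>)) +
      Re (- \<i> * contour_integral \<gamma> (\<lambda>\<zeta>. slice_snd I J (h (in_slice I \<zeta>)) * slice_functional.resf A I (complexify I (\<lambda>w. \<phi> (J *\<^sub>l w))) v \<zeta>))"
proof -
  interpret o: bounded_op A I by (rule A)
  interpret b: bounded_bilinear "(*\<^sub>l) :: quat \<Rightarrow> 'v \<Rightarrow> 'v" by (rule bounded_bilinear_lscale)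
  have \<phi>J: "bounded_linear (\<lambda>w. \<phi> (J *\<^sub>l w))"
    by (intro bounded_linear_compose[OF \<phi>] b.bounded_linear_right)
  interpret s1: slice_functional A I "complexify I \<phi>" by (rule slice_functional_complexify[OF A \<phi>])
  interpret s2: slice_functional A I "complexify I (\<lambda>w. \<phi> (J *\<^sub>l w))" by (rule slice_functional_complexify[OF A \<phi>J])
  define \<gamma>' where "\<gamma>' t = vector_derivative \<gamma> (at t)" for t
  have \<gamma>d: "(\<gamma> has_vector_derivative \<gamma>' t) (at t)" if "t \<in> {0..1}" for t
    using \<gamma>(1) that unfolding \<gamma>'_def C1_differentiable_on_eq by (meson vector_derivative_works)
  have c\<gamma>': "continuous_on {0..1} \<gamma>'" using \<gamma>(1) unfolding \<gamma>'_def C1_differentiable_on_eq by blast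
  have c\<gamma>: "continuous_on {0..1} \<gamma>" by (rule C1_differentiable_imp_continuous_on[OF \<gamma>(1)])
  have im: "\<gamma> t \<in> o.rho" "p t \<in> W" if "t \<in> {0..1}" for t
    using \<gamma>(2) that unfolding path_image_def slice_def p_def o_def by blast+
  have pd: "vector_derivative p (at t within {0..1}) = in_slice I (\<gamma>' t)" if "t \<in> {0..1}" for t
  proof (rule vector_derivative_within_closed_interval[OF zero_less_one that])
    show "(p has_vector_derivative in_slice I (\<gamma>' t)) (at t within {0..1})"
      unfolding p_def o_def
      by (rule bounded_linear.has_vector_derivative[OF bounded_linear_in_slice[OF o.I] has_vector_derivative_at_within[OF \<gamma>d[OF that]]])
  qed
  have q: "h (p t) * (- vector_derivative p (at t within {0..1}) * I) = h (p t) * in_slice I (- \<gamma>' t * \<i>)" if "t \<in> {0..1}" for t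
    unfolding pd[OF that] in_slice_mult[OF o.I] in_slice_ii in_slice_linear(3) ..
  have lI: "Blinfun (\<lambda>v. I *\<^sub>l o.res_im z v) = lmul I o\<^sub>L o.res_im z" for z
    using op_lscale_lmul[of I "o.res_im z"] unfolding op_lscale_def .
  have Xe: "X t = lmul (h (p t) * in_slice I (- \<gamma>' t * \<i>)) o\<^sub>L (o.res_re (\<gamma> t) + (lmul I o\<^sub>L o.res_im (\<gamma> t)))" if "t \<in> {0..1}" for t
    unfolding X_def q[OF that] op_lscale_lmul
    using o.right_S_resolvent_in_slice[OF im(1)[OF that]] by (simp only: lI p_def o_def)
  have cp: "continuous_on {0..1} p" unfolding p_def o_def
    by (rule continuous_on_compose2[OF linear_continuous_on[OF bounded_linear_in_slice[OF o.I], of UNIV] c\<gamma>]) simp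
  have chp: "continuous_on {0..1} (\<lambda>t. h (p t))"
    by (rule continuous_on_compose2[OF h cp]) (use im(2) in blast)
  have cres: "continuous_on {0..1} (\<lambda>t. o.res_re (\<gamma> t))" "continuous_on {0..1} (\<lambda>t. o.res_im (\<gamma> t))"
  proof -
    have "continuous_on o.rho o.res_re" "continuous_on o.rho o.res_im"
      using o.isCont_res by (auto intro: continuous_at_imp_continuous_on)
    then show "continuous_on {0..1} (\<lambda>t. o.res_re (\<gamma> t))" "continuous_on {0..1} (\<lambda>t. o.res_im (\<gamma> t))"
      using im(1) by (auto intro: continuous_on_compose2[OF _ c\<gamma>])
  qed
  have cX: "continuous_on {0..1} X"
  proof -
    have "continuous_on {0..1} (\<lambda>t. lmul (h (p t) * in_slice I (- \<gamma>' t * \<i>)) :: 'v \<Rightarrow>\<^sub>L 'v)"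
    proof (rule continuous_on_compose2[OF linear_continuous_on[OF bounded_linear_lmul, of UNIV]])
      show "continuous_on {0..1} (\<lambda>t. h (p t) * in_slice I (- \<gamma>' t * \<i>))"
        by (intro continuous_on_mult chp continuous_on_compose2[OF linear_continuous_on[OF bounded_linear_in_slice[OF o.I], of UNIV]]
            continuous_on_minus c\<gamma>' continuous_on_const) auto
    qed simp
    then have "continuous_on {0..1} (\<lambda>t. lmul (h (p t) * in_slice I (- \<gamma>' t * \<i>)) o\<^sub>L (o.res_re (\<gamma> t) + (lmul I o\<^sub>L o.res_im (\<gamma> t))))"
      by (intro bounded_bilinear.continuous_on[OF bounded_bilinear_blinfun_compose] continuous_on_add cres continuous_on_const)
    then show ?thesis by (rule continuous_on_eq) (simp only: Xe)
  qed
  then show int: "X integrable_on {0..1}" by (rule integrable_continuous_interval)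
  define r1 where "r1 \<zeta> = slice_fst I (h (in_slice I \<zeta>)) * s1.resf v \<zeta>" for \<zeta>
  define r2 where "r2 \<zeta> = slice_snd I J (h (in_slice I \<zeta>)) * s2.resf v \<zeta>" for \<zeta>
  have bl: "bounded_linear (\<lambda>B. \<phi> (blinfun_apply B v))"
    by (rule bounded_linear_compose[OF \<phi> blinfun.bounded_linear_left])
  have "\<phi> (integral {0..1} X v) = integral {0..1} (\<lambda>t. \<phi> (X t v))"
    using integral_linear[OF int bl] by (simp only: o_def)
  also have "\<dots> = integral {0..1} (\<lambda>t. Re (- \<i> * (r1 (\<gamma> t) * \<gamma>' t)) + Re (- \<i> * (r2 (\<gamma> t) * \<gamma>' t)))"
  proof (rule Henstock_Kurzweil_Integration.integral_cong)
    fix t :: real assume t: "t \<in> {0..1}"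
    define w where "w = right_S_resolvent (in_slice I (\<gamma> t)) UNIV (blinfun_apply A) v"
    have "X t v = (h (p t) * in_slice I (- \<gamma>' t * \<i>)) *\<^sub>l w"
      unfolding X_def q[OF t] op_lscale_lmul blinfun_apply_blinfun_compose lmul_apply unfolding w_def p_def o_def ..
    also have "h (p t) * in_slice I (- \<gamma>' t * \<i>) =
        in_slice I (slice_fst I (h (p t)) * (- \<gamma>' t * \<i>)) + J * in_slice I (slice_snd I J (h (p t)) * (- \<gamma>' t * \<i>))"
      by (subst slice_decomposition[OF o.I J, of "h (p t)"]) (simp only: distrib_right in_slice_mult[OF o.I] mult.assoc)
    finally have "\<phi> (X t v) = \<phi> (in_slice I (slice_fst I (h (p t)) * (- \<gamma>' t * \<i>)) *\<^sub>l w) + \<phi> (J *\<^sub>l (in_slice I (slice_snd I J (h (p t)) * (- \<gamma>' t * \<i>)) *\<^sub>l w))"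
      by (simp only: lscale_add_left lscale_mult linear_add[OF bounded_linear.linear[OF \<phi>]])
    also have "\<dots> = Re (slice_fst I (h (p t)) * (- \<gamma>' t * \<i>) * s1.resf v (\<gamma> t)) + Re (slice_snd I J (h (p t)) * (- \<gamma>' t * \<i>) * s2.resf v (\<gamma> t))"
      unfolding Re_complexify[OF \<phi>] Re_complexify[OF \<phi>J] w_def
        s1.l_right_S_resolvent[OF im(1)[OF t]] s2.l_right_S_resolvent[OF im(1)[OF t]] ..
    also have "slice_fst I (h (p t)) * (- \<gamma>' t * \<i>) * s1.resf v (\<gamma> t) = - \<i> * (r1 (\<gamma> t) * \<gamma>' t)"
      unfolding r1_def p_def o_def by (simp add: mult_ac)
    also have "slice_snd I J (h (p t)) * (- \<gamma>' t * \<i>) * s2.resf v (\<gamma> t) = - \<i> * (r2 (\<gamma> t) * \<gamma>' t)"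
      unfolding r2_def p_def o_def by (simp add: mult_ac)
    finally show "\<phi> (X t v) = Re (- \<i> * (r1 (\<gamma> t) * \<gamma>' t)) + Re (- \<i> * (r2 (\<gamma> t) * \<gamma>' t))" .
  qed
  also have "\<dots> = Re (- \<i> * contour_integral \<gamma> r1) + Re (- \<i> * contour_integral \<gamma> r2)"
  proof -
    have hs: "continuous_on (path_image \<gamma>) (\<lambda>\<zeta>. h (in_slice I \<zeta>))"
      by (rule continuous_on_compose2[OF h linear_continuous_on[OF bounded_linear_in_slice[OF o.I]]]) (use \<gamma>(2) in \<open>auto simp: slice_def\<close>)
    have "continuous_on (path_image \<gamma>) r1" unfolding r1_def[abs_def]
      by (intro continuous_on_mult continuous_on_compose2[OF linear_continuous_on[OF bounded_linear_slice_fst, of UNIV] hs]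
          continuous_on_subset[OF holomorphic_on_imp_continuous_on[OF s1.resf_holomorphic]]) (use \<gamma>(2) in auto)
    moreover have "continuous_on (path_image \<gamma>) r2" unfolding r2_def[abs_def]
      by (intro continuous_on_mult continuous_on_compose2[OF linear_continuous_on[OF bounded_linear_slice_snd, of UNIV] hs]
          continuous_on_subset[OF holomorphic_on_imp_continuous_on[OF s2.resf_holomorphic]]) (use \<gamma>(2) in auto)
    ultimately have ci: "r1 contour_integrable_on \<gamma>" "r2 contour_integrable_on \<gamma>"
      using contour_integrable_continuous_C1[OF \<gamma>(1)] by blast+
    have "((\<lambda>t. Re (- \<i> * (r (\<gamma> t) * \<gamma>' t))) has_integral Re (- \<i> * contour_integral \<gamma> r)) {0..1}"
      if "r contour_integrable_on \<gamma>" for r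
    proof -
      have i: "((\<lambda>t. r (\<gamma> t) * \<gamma>' t) has_integral contour_integral \<gamma> r) {0..1}"
        using has_contour_integral_integral[OF that] unfolding has_contour_integral \<gamma>'_def .
      have bl: "bounded_linear (\<lambda>z. Re (- \<i> * z))"
        by (intro bounded_linear_compose[OF bounded_linear_Re] bounded_linear_const_mult bounded_linear_ident)
      from has_integral_linear[OF i bl] show ?thesis by (simp only: o_def)
    qed
    from has_integral_add[OF this[OF ci(1)] this[OF ci(2)]] show ?thesis by (rule integral_unique)
  qed
  finally show "\<phi> (integral {0..1} X v) =
      Re (- \<i> * contour_integral \<gamma> (\<lambda>\<zeta>. slice_fst I (h (in_slice I \<zeta>)) * s1.resf v \<zeta>)) +
      Re (- \<i> * contour_integral \<gamma> (\<lambda>\<zeta>. slice_snd I J (h (in_slice I \<zeta>)) * s2.resf v \<zeta>))"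
    unfolding r1_def[abs_def] r2_def[abs_def] .
qed

lemma S_cauchy_integral_functional:
  fixes \<phi> :: "'v::quaternionic_banach \<Rightarrow> real"
  assumes A: "bounded_op A I" and J: "J \<in> imag_sphere" "J * I = - (I * J)" and \<phi>: "bounded_linear \<phi>"
    and \<gamma>: "\<And>\<gamma>. \<gamma> \<in> set \<gamma>s \<Longrightarrow> \<gamma> C1_differentiable_on {0..1} \<and> path_image \<gamma> \<subseteq> slice I W \<inter> bounded_op.rho A I"
    and h: "continuous_on W h"
  shows "\<phi> (S_cauchy_integral h A I \<gamma>s v) = 1 / (2 * pi) *
     (Re (- \<i> * (\<Sum>\<gamma>\<leftarrow>\<gamma>s. contour_integral \<gamma> (\<lambda>\<zeta>. slice_fst I (h (in_slice I \<zeta>)) * slice_functional.resf A I (complexify I \<phi>) v \<zeta>))) +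
      Re (- \<i> * (\<Sum>\<gamma>\<leftarrow>\<gamma>s. contour_integral \<gamma> (\<lambda>\<zeta>. slice_snd I J (h (in_slice I \<zeta>)) * slice_functional.resf A I (complexify I (\<lambda>w. \<phi> (J *\<^sub>l w))) v \<zeta>))))"
proof -
  define X where "X \<gamma> = (let p = in_slice I \<circ> \<gamma> in integral {0..1} (\<lambda>t.
          op_lscale (h (p t) * (- vector_derivative p (at t within {0..1}) * I)) (right_S_resolvent (p t) UNIV (blinfun_apply A))))" for \<gamma>
  define c1 where "c1 \<gamma> = contour_integral \<gamma> (\<lambda>\<zeta>. slice_fst I (h (in_slice I \<zeta>)) * slice_functional.resf A I (complexify I \<phi>) v \<zeta>)" for \<gamma>
  define c2 where "c2 \<gamma> = contour_integral \<gamma> (\<lambda>\<zeta>. slice_snd I J (h (in_slice I \<zeta>)) * slice_functional.resf A I (complexify I (\<lambda>w. \<phi> (J *\<^sub>l w))) v \<zeta>)" for \<gamma>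
  have X: "\<phi> (X \<gamma> v) = Re (- \<i> * c1 \<gamma>) + Re (- \<i> * c2 \<gamma>)" if "\<gamma> \<in> set \<gamma>s" for \<gamma>
    unfolding X_def Let_def c1_def c2_def
    using arc_functional(2)[OF A J \<phi> _ _ h, of \<gamma> v] \<gamma>[OF that] by blast
  note lin = bounded_linear.linear[OF \<phi>]
  have sum: "\<phi> ((\<Sum>\<gamma>\<leftarrow>gs. X \<gamma>) v) = Re (- \<i> * (\<Sum>\<gamma>\<leftarrow>gs. c1 \<gamma>)) + Re (- \<i> * (\<Sum>\<gamma>\<leftarrow>gs. c2 \<gamma>))"
    if "set gs \<subseteq> set \<gamma>s" for gs
    using that
  proof (induction gs)
    case Nil
    show ?case using linear_0[OF lin] by simp
  next
    case (Cons \<gamma> gs)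
    have "\<phi> ((\<Sum>\<gamma>\<leftarrow>\<gamma> # gs. X \<gamma>) v) = \<phi> (X \<gamma> v) + \<phi> ((\<Sum>\<gamma>\<leftarrow>gs. X \<gamma>) v)"
      by (simp add: blinfun.add_left linear_add[OF lin])
    also have "\<dots> = Re (- \<i> * c1 \<gamma>) + Re (- \<i> * c2 \<gamma>) + (Re (- \<i> * (\<Sum>\<gamma>\<leftarrow>gs. c1 \<gamma>)) + Re (- \<i> * (\<Sum>\<gamma>\<leftarrow>gs. c2 \<gamma>)))"
      using Cons X[of \<gamma>] by simp
    finally show ?case by (simp add: algebra_simps)
  qed
  have "S_cauchy_integral h A I \<gamma>s = (1 / (2 * pi)) *\<^sub>R (\<Sum>\<gamma>\<leftarrow>\<gamma>s. X \<gamma>)"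
    unfolding S_cauchy_integral_def X_def ..
  then have "\<phi> (S_cauchy_integral h A I \<gamma>s v) = 1 / (2 * pi) * \<phi> ((\<Sum>\<gamma>\<leftarrow>\<gamma>s. X \<gamma>) v)"
    by (simp only: blinfun.scaleR_left linear_scale[OF lin] real_scaleR_def)
  then show ?thesis unfolding sum[OF order_refl] c1_def c2_def .
qed

context group_generator
begin

lemma group_calculus_eq_S_calculus_unbounded:
  assumes sp: "S_spectrum D T \<subseteq> {s. - \<omega> < qRe s \<and> qRe s < \<omega>}"
    and \<mu>S: "\<mu> \<in> S_measures \<omega>" and lf: "is_laplace_stieltjes \<omega> \<mu> f"
    and finf: "right_slice_regular_at_infinity f" and \<alpha>: "of_real \<alpha> \<in> S_resolvent_set D T"
  shows "group_calculus \<mu> Z v = S_calculus_unbounded \<alpha> f D T v"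
proof -
  obtain A where Ainv: "is_bounded_inverse D (\<lambda>v. T v - \<alpha> *\<^sub>R v) A" using ex_shift_inverse[OF \<alpha>] by blast
  have AR: "A \<in> right_linear_ops" using Ainv by (simp add: is_bounded_inverse_def)
  have bo: "bounded_op A I" if "I \<in> imag_sphere" for I using AR that by (simp add: bounded_op_def)
  have \<mu>: "quaternionic_measure \<mu>" using \<mu>S by (simp add: S_measures_def)
  obtain \<epsilon> where \<epsilon>: "\<epsilon> > 0" "exp_integrable (\<omega> + \<epsilon>) \<mu>" and fl: "\<And>s. \<bar>qRe s\<bar> < \<omega> + \<epsilon> \<Longrightarrow> f s = laplace_stieltjes \<mu> s"
    using lf by (auto simp: is_laplace_stieltjes_def)
  obtain r k where r: "r > 0" "right_slice_regular_on f {s. norm s > r}" and k: "(f \<longlongrightarrow> k) at_infinity"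
    using finf by (auto simp: right_slice_regular_at_infinity_def)
  define c where "c = \<omega> + \<epsilon>"
  have c: "0 \<le> c" "\<omega> < c" "exp_integrable c \<mu>" using \<epsilon> \<omega> by (auto simp: c_def)
  define h where "h s = (if s = 0 then k else f (inverse s + of_real \<alpha>))" for s
  define W0 where "W0 = moebius_domain \<alpha> c r"
  have hreg: "right_slice_regular_on h W0"
    unfolding h_def[abs_def] W0_def by (rule right_slice_regular_moebius[OF \<mu> c(3) fl[folded c_def] r k])
  have W0: "open W0" unfolding W0_def by (rule open_moebius_domain(2)[OF r(1)])
  have Lim: "Lim at_infinity f = k" by (rule tendsto_Lim[OF trivial_limit_at_infinity k])
  have spec: "s \<in> S_resolvent_set D T" if "\<omega> \<le> \<bar>qRe s\<bar>" for s
    using sp that by (auto simp: S_spectrum_def)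
  obtain a0 b0 a1 b1 a2 b2 \<kappa> where chain: "a0 < a1" "a1 < b1" "b1 < a2" "a2 < b2" "b2 < b0" and \<kappa>: "\<kappa> > 0"
    and inner: "\<And>q. disc_form a1 b1 q \<le> 0 \<or> disc_form a2 b2 q \<le> 0 \<Longrightarrow> q \<noteq> 0 \<and> \<omega> + \<kappa> \<le> \<bar>qRe (inverse q + of_real \<alpha>)\<bar>"
    and outer: "(\<bar>\<alpha>\<bar> \<le> \<omega> \<and> a0 = - b0 \<and> 8 * norm A + 1 \<le> b0 \<and>
       (\<forall>q. 0 \<le> disc_form a1 b1 q \<and> 0 \<le> disc_form a2 b2 q \<longrightarrow> q \<in> W0)) \<or>
     (\<alpha> \<noteq> 0 \<and> (\<forall>q. 0 \<le> disc_form a0 b0 q \<longrightarrow> q \<noteq> 0 \<and> \<omega> + \<kappa> \<le> \<bar>qRe (inverse q + of_real \<alpha>)\<bar>) \<and>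
       (\<forall>q. disc_form a0 b0 q \<le> 0 \<and> 0 \<le> disc_form a1 b1 q \<and> 0 \<le> disc_form a2 b2 q \<longrightarrow> q \<in> W0))"
    using ex_circles[OF \<omega> \<epsilon>(1) r(1), where \<alpha> = \<alpha> and N = "8 * norm A + 1"]
    unfolding c_def[symmetric] W0_def[symmetric] by (elim exE conjE) (rule that; blast)
  define U0 where "U0 = circular_domain a0 b0 a1 b1 a2 b2"
  have axU0: "axially_symmetric_slice_domain U0" unfolding U0_def by (rule circular_domain_axially_symmetric[OF chain])
  then have oU0: "open U0" by (simp add: axially_symmetric_slice_domain_def)
  have clU0: "closure U0 \<subseteq> W0" unfolding U0_def using closure_circular_domain[OF chain] outer by blast
  have specU0: "S_spectrum UNIV A \<subseteq> U0"
  proof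
    fix q assume "q \<in> S_spectrum UNIV A"
    then have q: "q \<notin> S_resolvent_set UNIV A" by (simp add: S_spectrum_def)
    \<comment> \<open>A far point is the image of a point in the resolvent set of T, hence not
      spectral for A.\<close>
    have far: False if "q \<noteq> 0 \<and> \<omega> + \<kappa> \<le> \<bar>qRe (inverse q + of_real \<alpha>)\<bar>"
    proof -
      have "inverse q + of_real \<alpha> \<in> S_resolvent_set D T" by (rule spec) (use that \<kappa> in linarith)
      moreover have "inverse q + of_real \<alpha> \<noteq> of_real \<alpha>" using that by simp
      ultimately have "inverse (inverse q + of_real \<alpha> - of_real \<alpha>) \<in> S_resolvent_set UNIV A"
        by (rule resolvent_set_moebius[OF Ainv])
      then show False using q by simp
    qed
    have "disc_form a0 b0 q < 0"
    proof (rule ccontr)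
      assume n: "\<not> disc_form a0 b0 q < 0"
      from outer show False
      proof (elim disjE conjE)
        assume "\<forall>q. 0 \<le> disc_form a0 b0 q \<longrightarrow> q \<noteq> 0 \<and> \<omega> + \<kappa> \<le> \<bar>qRe (inverse q + of_real \<alpha>)\<bar>"
        then show False using far n by (meson not_less)
      next
        assume b: "a0 = - b0" "8 * norm A + 1 \<le> b0"
        obtain I z where I: "I \<in> imag_sphere" "q = in_slice I z" by (rule quat_in_slice)
        \<comment> \<open>The zero functional instantiates the locale that contains
          \<open>large_in_rho\<close>.\<close>
        interpret s: slice_functional A I "complexify I (\<lambda>_. 0)"
          by (rule slice_functional_complexify[OF bo[OF I(1)] bounded_linear_zero])
        have "b0\<^sup>2 \<le> (norm q)\<^sup>2" using n b(1) by (simp add: disc_form_def power2_eq_square)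
        then have "b0 \<le> norm q" by (rule power2_le_imp_le) simp
        then have zA: "8 * norm A + 1 \<le> norm z" using b(2) unfolding I(2) norm_in_slice[OF I(1)] by linarith
        then have "norm z > 0" "8 * norm A \<le> norm z" using norm_ge_zero[of A] by linarith+
        then have "z \<in> s.rho" by (intro s.large_in_rho) auto
        then show False using q by (simp add: s.rho_def I(2))
      qed
    qed
    moreover have "0 < disc_form a1 b1 q" "0 < disc_form a2 b2 q" using inner far not_le by blast+
    ultimately show "q \<in> U0" by (simp add: U0_def circular_domain_def)
  qed
  have bd0: "is_oriented_boundary (boundary_circles a0 b0 a1 b1 a2 b2) (slice I U0)" if "I \<in> imag_sphere" for I
    unfolding U0_def by (rule boundary_circles_oriented[OF chain that])
  have dom0: "S_calculus_domain h A U0"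
    unfolding S_calculus_domain_def using axU0 bounded_circular_domain[OF chain, folded U0_def] specU0 bd0 clU0 hreg by blast
  define P where "P = (\<lambda>(U, I, \<gamma>s). S_calculus_domain h A U \<and> I \<in> imag_sphere \<and> is_oriented_boundary \<gamma>s (slice I U))"
  \<comment> \<open>The triple that \<open>SOME\<close> picks inside \<open>S_calculus\<close>. The
    circular domain \<open>U0\<close> witnesses that suitable triples exist, so this one has the
    defining property.\<close>
  obtain U I \<gamma>s where e: "(SOME x. P x) = (U, I, \<gamma>s)" by (cases "SOME x. P x")
  have "P (U, I, \<gamma>s)"
  proof -
    obtain I0 z where "I0 \<in> imag_sphere" "(0 :: quat) = in_slice I0 z" by (rule quat_in_slice)
    then have "P (U0, I0, boundary_circles a0 b0 a1 b1 a2 b2)" using dom0 bd0 by (simp add: P_def)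
    then show ?thesis unfolding e[symmetric] by (rule someI)
  qed
  then have domU: "S_calculus_domain h A U" and I: "I \<in> imag_sphere" and bd: "is_oriented_boundary \<gamma>s (slice I U)"
    by (simp_all add: P_def)
  have calc: "S_calculus_unbounded \<alpha> f D T = S_cauchy_integral h A I \<gamma>s"
    unfolding S_calculus_unbounded_def bounded_inverse_eq[OF Ainv] Lim h_def[abs_def, symmetric] S_calculus_def
      P_def[symmetric] e Let_def by simp
  obtain W where U: "open U" "S_spectrum UNIV A \<subseteq> U" "closure U \<subseteq> W" and hW: "right_slice_regular_on h W"
    using domU by (auto simp: S_calculus_domain_def axially_symmetric_slice_domain_def)
  have oW: "open W" using hW by (simp add: right_slice_regular_on_def)
  have hc: "continuous_on W h"
    using hW differentiable_imp_continuous_within unfolding right_slice_regular_on_def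
    by (intro continuous_at_imp_continuous_on ballI) blast
  obtain J where J: "J \<in> imag_sphere" "J * I = - (I * J)" by (rule ex_anticommuting_unit[OF I])
  interpret lsc: bounded_bilinear "(*\<^sub>l) :: quat \<Rightarrow> 'v \<Rightarrow> 'v" by (rule bounded_bilinear_lscale)
  define N where "N = total_variation \<mu>"
  have sN: "sets N = sets borel" by (simp add: N_def)
  have fin: "finite_measure N" unfolding N_def by (rule finite_total_variation[OF \<mu> c(3,1)])
  define p where "p = polar_density \<mu>"
  have p: "p \<in> borel_measurable borel" "norm (p t) = 1" for t
    using polar_density[OF \<mu> fin[unfolded N_def]] by (simp_all add: p_def)
  have intN: "integrable N (\<lambda>t. exp (\<omega> * \<bar>t\<bar>))"
  proof (rule integrableI_nonneg)
    show "(\<lambda>t. exp (\<omega> * \<bar>t\<bar>)) \<in> borel_measurable N" unfolding measurable_cong_sets[OF sN refl] by measurable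
    have "(\<integral>\<^sup>+ t. ennreal (exp (\<omega> * \<bar>t\<bar>)) \<partial>N) \<le> (\<integral>\<^sup>+ t. ennreal (exp (c * \<bar>t\<bar>)) \<partial>N)"
      using c by (intro nn_integral_mono ennreal_leI) (auto intro: mult_right_mono)
    also have "\<dots> < \<infinity>" using c(3) by (simp add: exp_integrable_def N_def)
    finally show "(\<integral>\<^sup>+ t. ennreal (exp (\<omega> * \<bar>t\<bar>)) \<partial>N) < \<infinity>" .
  qed simp
  \<comment> \<open>Near such an \<alpha> the function f coincides with the differentiable
    transform; this yields the limit f(\<alpha>) of the composed function at infinity.\<close>
  have fcont: "isCont f (of_real \<alpha>)" if "\<bar>\<alpha>\<bar> \<le> \<omega>"
  proof -
    have "\<bar>qRe (of_real \<alpha>)\<bar> < c" using that c by simp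
    then obtain D' where D': "(laplace_stieltjes \<mu> has_derivative D') (at (of_real \<alpha>))"
      using laplace_stieltjes_has_derivative[OF \<mu> c(3)] by blast
    have "continuous_on UNIV qRe" using isCont_qRe continuous_at_imp_continuous_on by blast
    then have "open {s. \<bar>qRe s\<bar> < c}" by (intro open_Collect_less continuous_intros)
    then have "(f has_derivative D') (at (of_real \<alpha>))"
      by (rule has_derivative_transform_within_open[OF D']) (use \<open>\<bar>qRe (of_real \<alpha>)\<bar> < c\<close> fl[folded c_def] in auto)
    then show ?thesis by (rule has_derivative_continuous)
  qed
  have u: "norm (Z (- t) v) \<le> (M * norm v) * exp (\<omega> * \<bar>t\<bar>)" for t using norm_Z_apply[of "- t" v] by (simp add: mult_ac)
  have uc: "continuous_on UNIV (\<lambda>t. Z (- t) v)"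
    by (rule continuous_on_compose2[OF Z_cont]) (auto intro!: continuous_intros)
  \<comment> \<open>To be used twice: for \<open>slice_fst\<close> with \<phi>, and for
    \<open>slice_snd\<close> with the functional that has absorbed J.\<close>
  have key: "(\<Sum>\<gamma>\<leftarrow>\<gamma>s. contour_integral \<gamma> (\<lambda>\<zeta>. Q (h (in_slice I \<zeta>)) * slice_functional.resf A I (complexify I \<psi>) v \<zeta>)) =
      2 * of_real pi * \<i> * (LINT t|N. Q (p t) * complexify I \<psi> (Z (- t) v))"
    "integrable N (\<lambda>t. Q (p t) * complexify I \<psi> (Z (- t) v))"
    if Q: "bounded_linear Q" "\<And>q z. Q (q * in_slice I z) = Q q * z" and \<psi>: "bounded_linear \<psi>"
    for Q :: "quat \<Rightarrow> complex" and \<psi> :: "'v \<Rightarrow> real"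
  proof -
    have sf: "slice_functional A I (complexify I \<psi>)" by (rule slice_functional_complexify[OF bo[OF I] \<psi>])
    have bl: "bounded_linear (complexify I \<psi>)" by (rule slice_functional.l[OF sf])
    obtain K where K: "K > 0" "\<And>x. norm (Q x) \<le> norm x * K" using bounded_linear.pos_bounded[OF Q(1)] by blast
    have aK: "norm (Q (p t)) \<le> K" for t using K(2)[of "p t"] p(2)[of t] by simp
    have Qc: "continuous_on UNIV Q" by (rule linear_continuous_on[OF Q(1)])
    have am: "(\<lambda>t. Q (p t)) \<in> borel_measurable borel"
      by (rule measurable_compose[OF p(1) borel_measurable_continuous_onI[OF Qc]])
    obtain B where B: "B > 0" "\<And>x. norm (complexify I \<psi> x) \<le> norm x * B" using bounded_linear.pos_bounded[OF bl] by blast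
    show "integrable N (\<lambda>t. Q (p t) * complexify I \<psi> (Z (- t) v))"
    proof (rule Bochner_Integration.integrable_bound[OF integrable_mult_right[OF intN, of "K * (M * norm v * B)"]])
      have "(\<lambda>t. complexify I \<psi> (Z (- t) v)) \<in> borel_measurable borel"
        by (intro borel_measurable_continuous_onI continuous_on_compose2[OF linear_continuous_on[OF bl, of UNIV] uc]) simp
      with am show "(\<lambda>t. Q (p t) * complexify I \<psi> (Z (- t) v)) \<in> borel_measurable N"
        unfolding measurable_cong_sets[OF sN refl] by measurable
      show "AE t in N. norm (Q (p t) * complexify I \<psi> (Z (- t) v)) \<le> norm (K * (M * norm v * B) * exp (\<omega> * \<bar>t\<bar>))"
      proof (rule AE_I2)
        fix t
        have "norm (complexify I \<psi> (Z (- t) v)) \<le> ((M * norm v) * exp (\<omega> * \<bar>t\<bar>)) * B"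
          by (rule order_trans[OF B(2) mult_right_mono[OF u]]) (use B in simp)
        then have "norm (Q (p t)) * norm (complexify I \<psi> (Z (- t) v)) \<le> K * (((M * norm v) * exp (\<omega> * \<bar>t\<bar>)) * B)"
          using K aK by (intro mult_mono) auto
        also have "\<dots> = K * (M * norm v * B) * exp (\<omega> * \<bar>t\<bar>)" by (simp only: mult_ac)
        finally show "norm (Q (p t) * complexify I \<psi> (Z (- t) v)) \<le> norm (K * (M * norm v * B) * exp (\<omega> * \<bar>t\<bar>))"
          unfolding norm_mult[of "Q (p t)"] real_norm_def by (rule order_trans[OF _ abs_ge_self])
      qed
    qed
    define F where "F \<zeta> = Q (h (in_slice I \<zeta>))" for \<zeta>
    have Fh: "F holomorphic_on slice I V" if "right_slice_regular_on h V" for V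
      unfolding F_def[abs_def] slice_def by (rule right_slice_regular_holomorphic[OF that I Q])
    have gval: "Q (f (in_slice I z)) = (LINT t|N. Q (p t) * exp (- z * of_real t))" if z: "\<bar>Re z\<bar> < c" for z
    proof -
      have "has_bochner_integral N (\<lambda>t. p t * exp (- in_slice I z * of_real t)) (laplace_stieltjes \<mu> (in_slice I z))"
        unfolding N_def p_def by (rule laplace_stieltjes_integral[OF \<mu> c(3)]) (use z in \<open>simp add: qRe_in_slice[OF I]\<close>)
      from has_bochner_integral_bounded_linear[OF Q(1) this]
      have i: "has_bochner_integral N (\<lambda>t. Q (p t * exp (- in_slice I z * of_real t))) (Q (laplace_stieltjes \<mu> (in_slice I z)))" .
      have "exp (- in_slice I z * of_real t) = in_slice I (exp (- z * of_real t))" for t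
        unfolding in_slice_exp[OF I] in_slice_mult[OF I] in_slice_linear(3) in_slice_of_real ..
      with i have "has_bochner_integral N (\<lambda>t. Q (p t) * exp (- z * of_real t)) (Q (laplace_stieltjes \<mu> (in_slice I z)))"
        by (simp only: Q(2))
      from has_bochner_integral_integral_eq[OF this] show ?thesis
        using fl[folded c_def, of "in_slice I z"] z by (simp add: qRe_in_slice[OF I])
    qed
    have hz: "F \<zeta> = Q (f (in_slice I (inverse \<zeta> + of_real \<alpha>)))" if "\<zeta> \<noteq> 0" for \<zeta>
    proof -
      have "in_slice I \<zeta> \<noteq> 0" using in_slice_eq_iff[OF I, of \<zeta> 0] that by (simp add: in_slice_linear)
      then show ?thesis by (simp add: F_def h_def in_slice_linear in_slice_inverse[OF I])
    qed
    have "(\<Sum>\<gamma>\<leftarrow>\<gamma>s. contour_integral \<gamma> (\<lambda>\<zeta>. F \<zeta> * slice_functional.resf A I (complexify I \<psi>) v \<zeta>)) =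
        (\<Sum>\<gamma>\<leftarrow>boundary_circles a0 b0 a1 b1 a2 b2. contour_integral \<gamma> (\<lambda>\<zeta>. F \<zeta> * slice_functional.resf A I (complexify I \<psi>) v \<zeta>))"
      by (rule slice_functional.contour_sum_eq[OF sf U(1) bd U(2,3) oW oU0 bd0[OF I] specU0 clU0 W0 Fh[OF hW] Fh[OF hreg]])
    also have "\<dots> = 2 * of_real pi * \<i> * (LINT t|N. Q (p t) * complexify I \<psi> (Z (- t) v))"
    proof (rule circles_resf[where L = "Q (f (of_real \<alpha>))", OF Ainv sf spec chain \<kappa> inner outer W0 Fh[OF hreg] sN am aK intN])
      fix y assume y: "\<i> * of_real y \<noteq> (of_real \<alpha> :: complex)"
      have "F (1 / (\<i> * of_real y - of_real \<alpha>)) = Q (f (in_slice I (\<i> * of_real y)))"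
        using hz[of "1 / (\<i> * of_real y - of_real \<alpha>)"] y by simp
      also have "\<dots> = (LINT t|N. Q (p t) * exp (- (\<i> * of_real y) * of_real t))"
        by (rule gval) (use c \<omega> in simp)
      also have "\<dots> = (LINT t|N. Q (p t) * cis (y * (- t)))"
        by (simp add: cis_conv_exp mult.assoc)
      finally show "F (1 / (\<i> * of_real y - of_real \<alpha>)) = (LINT t|N. Q (p t) * cis (y * (- t)))" .
    next
      assume a: "\<bar>\<alpha>\<bar> \<le> \<omega>"
      have "((\<lambda>\<zeta>. inverse \<zeta> + of_real \<alpha>) \<longlongrightarrow> 0 + (of_real \<alpha> :: complex)) at_infinity"
        by (intro tendsto_add tendsto_inverse_0 tendsto_const)
      then have "((\<lambda>\<zeta>. in_slice I (inverse \<zeta> + of_real \<alpha>)) \<longlongrightarrow> in_slice I (0 + of_real \<alpha>)) at_infinity"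
        by (rule bounded_linear.tendsto[OF bounded_linear_in_slice[OF I]])
      then have t: "((\<lambda>\<zeta>. in_slice I (inverse \<zeta> + of_real \<alpha>)) \<longlongrightarrow> of_real \<alpha>) at_infinity" by simp
      have "((\<lambda>\<zeta>. Q (f (in_slice I (inverse \<zeta> + of_real \<alpha>)))) \<longlongrightarrow> Q (f (of_real \<alpha>))) at_infinity"
        by (rule bounded_linear.tendsto[OF Q(1) isCont_tendsto_compose[OF fcont[OF a] t]])
      moreover have "\<forall>\<^sub>F \<zeta> in at_infinity. Q (f (in_slice I (inverse \<zeta> + of_real \<alpha>))) = F \<zeta>"
        using eventually_not_equal_at_infinity[of 0] by eventually_elim (rule hz[symmetric])
      ultimately show "(F \<longlongrightarrow> Q (f (of_real \<alpha>))) at_infinity" by (rule Lim_transform_eventually)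
    next
      assume a: "\<alpha> = 0"
      show "Q (f (of_real \<alpha>)) = (LINT t|N. Q (p t))"
        using gval[of 0] c \<omega> unfolding a by (simp add: in_slice_linear)
    qed
    finally show "(\<Sum>\<gamma>\<leftarrow>\<gamma>s. contour_integral \<gamma> (\<lambda>\<zeta>. Q (h (in_slice I \<zeta>)) * slice_functional.resf A I (complexify I \<psi>) v \<zeta>)) =
      2 * of_real pi * \<i> * (LINT t|N. Q (p t) * complexify I \<psi> (Z (- t) v))" unfolding F_def .
  qed
  have im: "\<gamma> C1_differentiable_on {0..1} \<and> path_image \<gamma> \<subseteq> slice I W \<inter> bounded_op.rho A I" if \<gamma>: "\<gamma> \<in> set \<gamma>s" for \<gamma>
  proof (intro conjI Int_greatest)
    show "\<gamma> C1_differentiable_on {0..1}" by (rule oriented_boundaryD(1)[OF bd \<gamma>])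
    show "path_image \<gamma> \<subseteq> slice I W" using oriented_boundary_path_image(1)[OF I bd \<gamma> U(1)] U(3) unfolding slice_def by blast
    show "path_image \<gamma> \<subseteq> bounded_op.rho A I"
      using oriented_boundary_path_image(2)[OF I bd \<gamma> U(1)] U(2)
      unfolding slice_def bounded_op.rho_def[OF bo[OF I]] S_spectrum_def by blast
  qed
  have main: "\<phi> (S_cauchy_integral h A I \<gamma>s v) = \<phi> (group_calculus \<mu> Z v)" if \<phi>: "bounded_linear \<phi>" for \<phi> :: "'v \<Rightarrow> real"
  proof -
    have \<phi>J: "bounded_linear (\<lambda>w. \<phi> (J *\<^sub>l w))" by (intro bounded_linear_compose[OF \<phi>] lsc.bounded_linear_right)
    define x1 where "x1 t = slice_fst I (p t) * complexify I \<phi> (Z (- t) v)" for t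
    define x2 where "x2 t = slice_snd I J (p t) * complexify I (\<lambda>w. \<phi> (J *\<^sub>l w)) (Z (- t) v)" for t
    note k1 = key[OF bounded_linear_slice_fst slice_fst_snd_mult(1)[OF I J] \<phi>, folded x1_def]
    note k2 = key[OF bounded_linear_slice_snd slice_fst_snd_mult(2)[OF I J] \<phi>J, folded x2_def]
    have "\<phi> (S_cauchy_integral h A I \<gamma>s v) = 1 / (2 * pi) *
      (Re (- \<i> * (2 * of_real pi * \<i> * (LINT t|N. x1 t))) + Re (- \<i> * (2 * of_real pi * \<i> * (LINT t|N. x2 t))))"
    proof -
      note fi = S_cauchy_integral_functional[where \<gamma>s = \<gamma>s and v = v, OF bo[OF I] J \<phi> _ hc, OF im]
      show ?thesis by (simp only: fi k1(1) k2(1))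
    qed
    \<comment> \<open>The factor -\<i> of the contour form times 2 \<pi> \<i> from Cauchy's formula
      cancels the normalizing 1/(2 \<pi>).\<close>
    also have "\<dots> = Re (LINT t|N. x1 t) + Re (LINT t|N. x2 t)"
    proof -
      have "Re (- \<i> * (2 * of_real pi * \<i> * z)) = 2 * pi * Re z" for z by simp
      then show ?thesis by (simp only: distrib_left[symmetric]) simp
    qed
    also have "\<dots> = (LINT t|N. Re (x1 t) + Re (x2 t))"
      using k1(2) k2(2) by simp
    also have "\<dots> = (LINT t|N. \<phi> (p t *\<^sub>l Z (- t) v))"
    proof (rule Bochner_Integration.integral_cong[OF refl])
      fix t
      have "p t *\<^sub>l Z (- t) v = in_slice I (slice_fst I (p t)) *\<^sub>l Z (- t) v + J *\<^sub>l (in_slice I (slice_snd I J (p t)) *\<^sub>l Z (- t) v)"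
        by (subst slice_decomposition[OF I J, of "p t"]) (simp only: lscale_add_left lscale_mult)
      then show "Re (x1 t) + Re (x2 t) = \<phi> (p t *\<^sub>l Z (- t) v)"
        unfolding x1_def x2_def using Re_complexify[OF \<phi>] Re_complexify[OF \<phi>J]
        by (simp only: linear_add[OF bounded_linear.linear[OF \<phi>]])
    qed
    also have "\<dots> = \<phi> (group_calculus \<mu> Z v)"
    proof -
      have "norm (Z (- t) v) \<le> (M * norm v) * exp (c * \<bar>t\<bar>)" for t
      proof (rule order_trans[OF u])
        show "M * norm v * exp (\<omega> * \<bar>t\<bar>) \<le> M * norm v * exp (c * \<bar>t\<bar>)"
          using M c(2) by (intro mult_left_mono) (auto intro: mult_right_mono)
      qed
      from quat_integral_functional[OF \<mu> c(3,1) uc this \<phi>] show ?thesis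
        unfolding N_def p_def group_calculus_def by (rule has_bochner_integral_integral_eq)
    qed
    finally show ?thesis .
  qed
  define d where "d = group_calculus \<mu> Z v - S_cauchy_integral h A I \<gamma>s v"
  obtain \<phi> :: "'v \<Rightarrow> real" where \<phi>: "bounded_linear \<phi>" "\<phi> d = norm d" using Hahn_Banach_separating[of d] by blast
  have "\<phi> d = 0" unfolding d_def linear_diff[OF bounded_linear.linear[OF \<phi>(1)]] main[OF \<phi>(1)] by simp
  then have "d = 0" using \<phi>(2) by simp
  then show ?thesis unfolding calc d_def by simp
qed

end

theorem theorem4p5:
  fixes Z :: "real \<Rightarrow> 'v::quaternionic_banach \<Rightarrow>\<^sub>L 'v"
    and M \<omega> :: real
    and \<mu> :: "real set \<Rightarrow> quat"
    and f :: "quat \<Rightarrow> quat"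
    and \<alpha> :: real
  defines "D \<equiv> generator_domain Z" and "T \<equiv> generator Z"
  assumes "strongly_continuous_group Z"
    and "M > 0" and "\<omega> \<ge> 0"
    and "\<And>t. norm (Z t) \<le> M * exp (\<omega> * \<bar>t\<bar>)"
    and "S_spectrum D T \<subseteq> {s. - \<omega> < qRe s \<and> qRe s < \<omega>}"
    and "\<mu> \<in> S_measures \<omega>" and "is_laplace_stieltjes \<omega> \<mu> f"
    and "right_slice_regular_at_infinity f"
    and "of_real \<alpha> \<in> S_resolvent_set D T"
  shows "group_calculus \<mu> Z = blinfun_apply (S_calculus_unbounded \<alpha> f D T)"
proof
  interpret group_generator Z M \<omega> by unfold_locales fact+
  show "group_calculus \<mu> Z v = S_calculus_unbounded \<alpha> f D T v" for v
    using assms(7-) unfolding D_def T_def by (rule group_calculus_eq_S_calculus_unbounded)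
qed

end
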